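(* Let $M$ be a closed manifold whose first Betti number is zero. If the underlying transversely Kähler flows of two Sasakian metrics $(g_{1},\alpha_{1})$ and $(g_{2},\alpha_{2})$ on $M$ are isomorphic, then $(M,g_{1},\alpha_{1})$ and $(M,g_{2},\alpha_{2})$ are isomorphic.
   Context: A transversely Kähler flow on $M$ is a triple $(\mathcal{F},J,g_\nu)$ where $\mathcal{F}$ is a $1$-dimensional foliation, $g_\nu$ is a metric and $J$ an almost complex structure on $TM/T\mathcal{F}$, both invariant under the Lie derivative along vector fields tangent to $\mathcal{F}$, $J$ is integrable (its Nijenhuis tensor vanishes on transverse vector fields, i.e. projections of local fields $X$ with $[Y,X]$ tangent to $\mathcal{F}$ for all $Y$ tangent to $\mathcal{F}$), and $\omega(X,Y)=g_\nu(X,JY)$ is antisymmetric and closed as a $2$-form on $M$ (transverse Kähler form). Two transversely Kähler flows on $M$ are isomorphic if a diffeomorphism of $M$ carries one to the other (foliation, transverse complex structure and transverse metric). A Sasakian metric on $M$ is a pair $(g,\alpha)$ of a Riemannian metric and a contact form such that $r^{2}g+dr\otimes dr$ on $M\times\mathbb{R}_{>0}$ is a Kähler metric with Kähler form $d(r^{2}\alpha)$. Its Reeb flow is the orbit foliation $\mathcal{F}$ of the Reeb field $\xi$ ($\alpha(\xi)=1$, $\iota_\xi d\alpha=0$); its underlying transversely Kähler flow is $(\mathcal{F},J,g_\nu)$ where $g_\nu$ is induced by $g$ on $TM/T\mathcal{F}\cong\ker\alpha$ and $d\alpha(X,Y)=g_\nu(X,JY)$. $(M,g_1,\alpha_1)$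 and $(M,g_2,\alpha_2)$ are isomorphic if there is a diffeomorphism $f$ of $M$ with $f^{*}g_2=g_1$ and $f^{*}\alpha_2=\alpha_1$. *)

theory Defs
  imports "HOL-Analysis.Analysis" "HOL-Homology.Homology" "HOL-Library.Extended_Nat"
    "HOL-Combinatorics.Permutations"
begin

section \<open>Smooth manifolds\<close>

primrec Ck_on :: "nat \<Rightarrow> 'e::euclidean_space set \<Rightarrow> ('e \<Rightarrow> 'f::real_normed_vector) \<Rightarrow> bool" where
  "Ck_on 0 S f \<longleftrightarrow> continuous_on S f"
| "Ck_on (Suc k) S f \<longleftrightarrow> (\<forall>x\<in>S. f differentiable (at x)) \<and>
     (\<forall>v. Ck_on k S (\<lambda>x. frechet_derivative f (at x) v))"

text \<open>Only used for open sets \<open>S\<close>.\<close>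
definition smooth_on :: "'e::euclidean_space set \<Rightarrow> ('e \<Rightarrow> 'f::real_normed_vector) \<Rightarrow> bool" where
  "smooth_on S f \<longleftrightarrow> (\<forall>k. Ck_on k S f)"

text \<open>A topological space with an indexed (not necessarily maximal) atlas
  modelled on the Euclidean space \<open>'e\<close>.\<close>
record ('a, 'i, 'e) atlas_space =
  mspace :: "'a topology"
  index_set :: "'i set"
  cdom :: "'i \<Rightarrow> 'a set"
  chart :: "'i \<Rightarrow> 'a \<Rightarrow> 'e"

definition cimg :: "('a, 'i, 'e) atlas_space \<Rightarrow> 'i \<Rightarrow> 'e set" where
  "cimg M i = chart M i ` cdom M i"

definition local_rep ::
  "('a, 'i, 'e) atlas_space \<Rightarrow> ('a \<Rightarrow> 'a) \<Rightarrow> 'i \<Rightarrow> 'i \<Rightarrow> 'e \<Rightarrow> 'e" where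
  "local_rep M f i j = chart M j \<circ> f \<circ> inv_into (cdom M i) (chart M i)"

definition smooth_manifold :: "('a, 'i, 'e::euclidean_space) atlas_space \<Rightarrow> bool" where
  "smooth_manifold M \<longleftrightarrow>
     Hausdorff_space (mspace M) \<and> second_countable (mspace M) \<and>
     (\<Union>i\<in>index_set M. cdom M i) = topspace (mspace M) \<and>
     (\<forall>i\<in>index_set M. openin (mspace M) (cdom M i) \<and> open (cimg M i) \<and>
        homeomorphic_map (subtopology (mspace M) (cdom M i)) (top_of_set (cimg M i)) (chart M i)) \<and>
     (\<forall>i\<in>index_set M. \<forall>j\<in>index_set M.
        smooth_on (chart M i ` (cdom M i \<inter> cdom M j)) (local_rep M id i j))"

definition closed_manifold :: "('a, 'i, 'e::euclidean_space) atlas_space \<Rightarrow> bool" where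
  "closed_manifold M \<longleftrightarrow> smooth_manifold M \<and> compact_space (mspace M)"

definition smooth_self_map :: "('a, 'i, 'e::euclidean_space) atlas_space \<Rightarrow> ('a \<Rightarrow> 'a) \<Rightarrow> bool" where
  "smooth_self_map M f \<longleftrightarrow> continuous_map (mspace M) (mspace M) f \<and>
     (\<forall>i\<in>index_set M. \<forall>j\<in>index_set M.
        smooth_on (chart M i ` {p \<in> cdom M i. f p \<in> cdom M j}) (local_rep M f i j))"

definition diffeomorphism :: "('a, 'i, 'e::euclidean_space) atlas_space \<Rightarrow> ('a \<Rightarrow> 'a) \<Rightarrow> bool" where
  "diffeomorphism M f \<longleftrightarrow> smooth_self_map M f \<and>
     (\<exists>h. smooth_self_map M h \<and> (\<forall>p\<in>topspace (mspace M). h (f p) = p \<and> f (h p) = p))"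

definition in_charts ::
  "('a, 'i, 'e) atlas_space \<Rightarrow> ('a \<Rightarrow> 'a) \<Rightarrow> 'i \<Rightarrow> 'i \<Rightarrow> 'a \<Rightarrow> bool" where
  "in_charts M f i j p \<longleftrightarrow>
     i \<in> index_set M \<and> j \<in> index_set M \<and> p \<in> cdom M i \<and> f p \<in> cdom M j"

definition tangent_map ::
  "('a, 'i, 'e::euclidean_space) atlas_space \<Rightarrow> ('a \<Rightarrow> 'a) \<Rightarrow> 'i \<Rightarrow> 'i \<Rightarrow> 'a \<Rightarrow> 'e \<Rightarrow> 'e" where
  "tangent_map M f i j p = frechet_derivative (local_rep M f i j) (at (chart M i p))"

section \<open>First Betti number\<close>

definition int_independent :: "('g, 'b) monoid_scheme \<Rightarrow> 'g set \<Rightarrow> bool" where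
  "int_independent G B \<longleftrightarrow> B \<subseteq> carrier G \<and>
     (\<forall>c :: 'g \<Rightarrow> int. finprod G (\<lambda>b. b [^]\<^bsub>G\<^esub> c b) B = \<one>\<^bsub>G\<^esub> \<longrightarrow> (\<forall>b\<in>B. c b = 0))"

definition abelian_rank :: "('g, 'b) monoid_scheme \<Rightarrow> enat" where
  "abelian_rank G = (SUP B \<in> {B. finite B \<and> int_independent G B}. enat (card B))"

text \<open>The rank of singular homology with integer coefficients.\<close>
definition betti_number :: "int \<Rightarrow> 'a topology \<Rightarrow> enat" where
  "betti_number p X = abelian_rank (homology_group p X)"

section \<open>Tensor fields\<close>

text \<open>A tensor field is given by its components in every chart: \<open>\<alpha> i x v\<close> is the value at the point
  with coordinates \<open>x \<in> cimg M i\<close> on the vector with coordinates \<open>v\<close>. The transformation rule under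
  change of charts is invariance under pullback by the identity map. Only values on
  \<open>cimg M i\<close> for \<open>i \<in> index_set M\<close> are meaningful.\<close>

type_synonym ('i, 'e) one_form = "'i \<Rightarrow> 'e \<Rightarrow> 'e \<Rightarrow> real"
type_synonym ('i, 'e) bilinear_field = "'i \<Rightarrow> 'e \<Rightarrow> 'e \<Rightarrow> 'e \<Rightarrow> real"
type_synonym ('i, 'e) endo_field = "'i \<Rightarrow> 'e \<Rightarrow> 'e \<Rightarrow> 'e"

text \<open>\<open>pulls_back_form M f \<beta> \<alpha>\<close> says \<open>f\<^sup>* \<beta> = \<alpha>\<close>.\<close>
definition pulls_back_form :: "('a, 'i, 'e::euclidean_space) atlas_space \<Rightarrow> ('a \<Rightarrow> 'a) \<Rightarrow>
    ('i, 'e) one_form \<Rightarrow> ('i, 'e) one_form \<Rightarrow> bool" where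
  "pulls_back_form M f \<beta> \<alpha> \<longleftrightarrow> (\<forall>i j p. in_charts M f i j p \<longrightarrow>
     (\<forall>v. \<beta> j (chart M j (f p)) (tangent_map M f i j p v) = \<alpha> i (chart M i p) v))"

definition pulls_back_bilinear :: "('a, 'i, 'e::euclidean_space) atlas_space \<Rightarrow> ('a \<Rightarrow> 'a) \<Rightarrow>
    ('i, 'e) bilinear_field \<Rightarrow> ('i, 'e) bilinear_field \<Rightarrow> bool" where
  "pulls_back_bilinear M f h g \<longleftrightarrow> (\<forall>i j p. in_charts M f i j p \<longrightarrow>
     (\<forall>v w. h j (chart M j (f p)) (tangent_map M f i j p v) (tangent_map M f i j p w)
        = g i (chart M i p) v w))"

definition smooth_one_form ::
  "('a, 'i, 'e::euclidean_space) atlas_space \<Rightarrow> ('i, 'e) one_form \<Rightarrow> bool" where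
  "smooth_one_form M \<alpha> \<longleftrightarrow>
     (\<forall>i\<in>index_set M. (\<forall>x\<in>cimg M i. linear (\<alpha> i x)) \<and>
        (\<forall>v. smooth_on (cimg M i) (\<lambda>x. \<alpha> i x v))) \<and>
     pulls_back_form M id \<alpha> \<alpha>"

definition smooth_bilinear_field ::
  "('a, 'i, 'e::euclidean_space) atlas_space \<Rightarrow> ('i, 'e) bilinear_field \<Rightarrow> bool" where
  "smooth_bilinear_field M g \<longleftrightarrow>
     (\<forall>i\<in>index_set M. (\<forall>x\<in>cimg M i. bilinear (g i x)) \<and>
        (\<forall>v w. smooth_on (cimg M i) (\<lambda>x. g i x v w))) \<and>
     pulls_back_bilinear M id g g"

definition smooth_endo_field ::
  "('a, 'i, 'e::euclidean_space) atlas_space \<Rightarrow> ('i, 'e) endo_field \<Rightarrow> bool" where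
  "smooth_endo_field M J \<longleftrightarrow>
     (\<forall>i\<in>index_set M. (\<forall>x\<in>cimg M i. linear (J i x)) \<and>
        (\<forall>v. smooth_on (cimg M i) (\<lambda>x. J i x v))) \<and>
     (\<forall>i j p. in_charts M id i j p \<longrightarrow>
        (\<forall>v. tangent_map M id i j p (J i (chart M i p) v)
           = J j (chart M j p) (tangent_map M id i j p v)))"

definition riemannian_metric ::
  "('a, 'i, 'e::euclidean_space) atlas_space \<Rightarrow> ('i, 'e) bilinear_field \<Rightarrow> bool" where
  "riemannian_metric M g \<longleftrightarrow> smooth_bilinear_field M g \<and>
     (\<forall>i\<in>index_set M. \<forall>x\<in>cimg M i.
        (\<forall>v w. g i x v w = g i x w v) \<and> (\<forall>v. v \<noteq> 0 \<longrightarrow> g i x v v > 0))"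

text \<open>The exterior derivative of a 1-form, normalised by
  \<open>2 d\<alpha>(X, Y) = X(\<alpha>(Y)) - Y(\<alpha>(X)) - \<alpha>([X, Y])\<close> (evaluated on constant coordinate fields).
  With the factor \<open>1/2\<close>, \<open>d(r\<^sup>2 \<alpha>)\<close> is the Kaehler form of a cone metric whose Reeb field
  has unit length; this is the usual convention behind \<open>d\<alpha>(X, Y) = g(X, J Y)\<close>.
  Without the factor one obtains the same pairs \<open>(g, \<alpha>)\<close> with \<open>\<alpha>\<close> divided by 2.\<close>
definition ext_d :: "('i, 'e::euclidean_space) one_form \<Rightarrow> ('i, 'e) bilinear_field" where
  "ext_d \<alpha> i x v w = (frechet_derivative (\<lambda>y. \<alpha> i y w) (at x) v
                      - frechet_derivative (\<lambda>y. \<alpha> i y v) (at x) w) / 2"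

definition closed_two_form ::
  "('a, 'i, 'e::euclidean_space) atlas_space \<Rightarrow> ('i, 'e) bilinear_field \<Rightarrow> bool" where
  "closed_two_form M \<omega> \<longleftrightarrow> (\<forall>i\<in>index_set M. \<forall>x\<in>cimg M i. \<forall>u v w.
     frechet_derivative (\<lambda>y. \<omega> i y v w) (at x) u
     + frechet_derivative (\<lambda>y. \<omega> i y w u) (at x) v
     + frechet_derivative (\<lambda>y. \<omega> i y u v) (at x) w = 0)"

definition lie_bracket :: "('e::euclidean_space \<Rightarrow> 'e) \<Rightarrow> ('e \<Rightarrow> 'e) \<Rightarrow> 'e \<Rightarrow> 'e" where
  "lie_bracket X Y x = frechet_derivative Y (at x) (X x) - frechet_derivative X (at x) (Y x)"

section \<open>Contact forms and Kaehler metrics\<close>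

text \<open>The top-degree form \<open>\<alpha> \<and> (d\<alpha>)\<^sup>n\<close> evaluated on \<open>v 0, \<dots>, v (2 n)\<close>, up to a positive constant.\<close>
definition contact_volume ::
  "nat \<Rightarrow> ('i, 'e::euclidean_space) one_form \<Rightarrow> 'i \<Rightarrow> 'e \<Rightarrow> (nat \<Rightarrow> 'e) \<Rightarrow> real" where
  "contact_volume n \<alpha> i x v = (\<Sum>\<sigma> | \<sigma> permutes {..<2 * n + 1}.
     of_int (sign \<sigma>) * \<alpha> i x (v (\<sigma> 0)) *
     (\<Prod>k<n. ext_d \<alpha> i x (v (\<sigma> (2 * k + 1))) (v (\<sigma> (2 * k + 2)))))"

definition contact_form ::
  "('a, 'i, 'e::euclidean_space) atlas_space \<Rightarrow> ('i, 'e) one_form \<Rightarrow> bool" where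
  "contact_form M \<alpha> \<longleftrightarrow> smooth_one_form M \<alpha> \<and>
     (\<exists>n. DIM('e) = 2 * n + 1 \<and>
        (\<forall>i\<in>index_set M. \<forall>x\<in>cimg M i. \<exists>v. contact_volume n \<alpha> i x v \<noteq> 0))"

definition integrable_complex_structure ::
  "('a, 'i, 'e::euclidean_space) atlas_space \<Rightarrow> ('i, 'e) endo_field \<Rightarrow> bool" where
  "integrable_complex_structure M J \<longleftrightarrow> smooth_endo_field M J \<and>
     (\<forall>i\<in>index_set M. \<forall>x\<in>cimg M i. \<forall>v. J i x (J i x v) = - v) \<and>
     (\<forall>i\<in>index_set M. \<forall>W X Y. open W \<and> W \<subseteq> cimg M i \<and> smooth_on W X \<and> smooth_on W Y \<longrightarrow>
        (\<forall>x\<in>W. lie_bracket (\<lambda>y. J i y (X y)) (\<lambda>y. J i y (Y y)) x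
           - J i x (lie_bracket (\<lambda>y. J i y (X y)) Y x)
           - J i x (lie_bracket X (\<lambda>y. J i y (Y y)) x)
           - lie_bracket X Y x = 0))"

definition kaehler_metric_with_form :: "('a, 'i, 'e::euclidean_space) atlas_space \<Rightarrow>
    ('i, 'e) bilinear_field \<Rightarrow> ('i, 'e) bilinear_field \<Rightarrow> bool" where
  "kaehler_metric_with_form M G \<omega> \<longleftrightarrow> riemannian_metric M G \<and> closed_two_form M \<omega> \<and>
     (\<exists>J. integrable_complex_structure M J \<and>
        (\<forall>i\<in>index_set M. \<forall>x\<in>cimg M i. \<forall>v w.
           G i x (J i x v) (J i x w) = G i x v w \<and> \<omega> i x v w = G i x v (J i x w)))"

section \<open>Sasakian metrics\<close>

definition cone :: "('a, 'i, 'e) atlas_space \<Rightarrow> ('a \<times> real, 'i, 'e \<times> real) atlas_space" where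
  "cone M = \<lparr> mspace = prod_topology (mspace M) (top_of_set {0<..}),
              index_set = index_set M,
              cdom = (\<lambda>i. cdom M i \<times> {0<..}),
              chart = (\<lambda>i (p, r). (chart M i p, r)) \<rparr>"

definition cone_metric :: "('i, 'e) bilinear_field \<Rightarrow> ('i, 'e \<times> real) bilinear_field" where
  "cone_metric g i = (\<lambda>(x, r) (v, s) (w, t). r\<^sup>2 * g i x v w + s * t)"

definition cone_form :: "('i, 'e) one_form \<Rightarrow> ('i, 'e \<times> real) one_form" where
  "cone_form \<alpha> i = (\<lambda>(x, r) (v, s). r\<^sup>2 * \<alpha> i x v)"

definition sasakian_metric :: "('a, 'i, 'e::euclidean_space) atlas_space \<Rightarrow>
    ('i, 'e) bilinear_field \<Rightarrow> ('i, 'e) one_form \<Rightarrow> bool" where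
  "sasakian_metric M g \<alpha> \<longleftrightarrow> riemannian_metric M g \<and> contact_form M \<alpha> \<and>
     kaehler_metric_with_form (cone M) (cone_metric g) (ext_d (cone_form \<alpha>))"

definition sasakian_isomorphic :: "('a, 'i, 'e::euclidean_space) atlas_space \<Rightarrow>
    ('i, 'e) bilinear_field \<Rightarrow> ('i, 'e) one_form \<Rightarrow>
    ('i, 'e) bilinear_field \<Rightarrow> ('i, 'e) one_form \<Rightarrow> bool" where
  "sasakian_isomorphic M g\<^sub>1 \<alpha>\<^sub>1 g\<^sub>2 \<alpha>\<^sub>2 \<longleftrightarrow> (\<exists>f. diffeomorphism M f \<and>
     pulls_back_bilinear M f g\<^sub>2 g\<^sub>1 \<and> pulls_back_form M f \<alpha>\<^sub>2 \<alpha>\<^sub>1)"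

section \<open>Transversely Kaehler flows\<close>

text \<open>A 1-dimensional foliation \<open>\<F>\<close> is given by its tangent line field \<open>T\<F>\<close>, which is automatically
  involutive. Elements of \<open>TM/T\<F>\<close> are cosets of \<open>T\<F>\<close>, that is, sets of coordinate vectors.\<close>
record ('i, 'e) transverse_flow =
  tangent_line :: "'i \<Rightarrow> 'e \<Rightarrow> 'e set"
  trans_J :: "'i \<Rightarrow> 'e \<Rightarrow> 'e set \<Rightarrow> 'e set"
  trans_metric :: "'i \<Rightarrow> 'e \<Rightarrow> 'e set \<Rightarrow> 'e set \<Rightarrow> real"

definition coset_of :: "'e::euclidean_space set \<Rightarrow> 'e \<Rightarrow> 'e set" where
  "coset_of L v = (\<lambda>w. v + w) ` L"

abbreviation tcoset :: "('i, 'e::euclidean_space) transverse_flow \<Rightarrow> 'i \<Rightarrow> 'e \<Rightarrow> 'e \<Rightarrow> 'e set" where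
  "tcoset T i x v \<equiv> coset_of (tangent_line T i x) v"

definition normal_space :: "('i, 'e::euclidean_space) transverse_flow \<Rightarrow> 'i \<Rightarrow> 'e \<Rightarrow> 'e set set" where
  "normal_space T i x = range (tcoset T i x)"

text \<open>\<open>f\<close> carries the flow \<open>T\<^sub>1\<close> to \<open>T\<^sub>2\<close>; the map induced by \<open>df\<close> on normal spaces is the image of
  cosets.\<close>
definition carries_flow :: "('a, 'i, 'e::euclidean_space) atlas_space \<Rightarrow> ('a \<Rightarrow> 'a) \<Rightarrow>
    ('i, 'e) transverse_flow \<Rightarrow> ('i, 'e) transverse_flow \<Rightarrow> bool" where
  "carries_flow M f T\<^sub>1 T\<^sub>2 \<longleftrightarrow> (\<forall>i j p. in_charts M f i j p \<longrightarrow>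
     (let x = chart M i p; y = chart M j (f p); D = tangent_map M f i j p in
        D ` tangent_line T\<^sub>1 i x = tangent_line T\<^sub>2 j y \<and>
        (\<forall>Q\<in>normal_space T\<^sub>1 i x. trans_J T\<^sub>2 j y (D ` Q) = D ` trans_J T\<^sub>1 i x Q) \<and>
        (\<forall>Q\<in>normal_space T\<^sub>1 i x. \<forall>R\<in>normal_space T\<^sub>1 i x.
           trans_metric T\<^sub>2 j y (D ` Q) (D ` R) = trans_metric T\<^sub>1 i x Q R)))"

definition tangent_field :: "('a, 'i, 'e::euclidean_space) atlas_space \<Rightarrow>
    ('i, 'e) transverse_flow \<Rightarrow> 'i \<Rightarrow> 'e set \<Rightarrow> ('e \<Rightarrow> 'e) \<Rightarrow> bool" where
  "tangent_field M T i W Y \<longleftrightarrow>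
     open W \<and> W \<subseteq> cimg M i \<and> smooth_on W Y \<and> (\<forall>x\<in>W. Y x \<in> tangent_line T i x)"

text \<open>Local fields whose bracket with every tangent field is tangent, i.e. whose classes in
  \<open>TM/T\<F>\<close> are transverse vector fields.\<close>
definition foliate_field :: "('a, 'i, 'e::euclidean_space) atlas_space \<Rightarrow>
    ('i, 'e) transverse_flow \<Rightarrow> 'i \<Rightarrow> 'e set \<Rightarrow> ('e \<Rightarrow> 'e) \<Rightarrow> bool" where
  "foliate_field M T i W X \<longleftrightarrow> open W \<and> W \<subseteq> cimg M i \<and> smooth_on W X \<and>
     (\<forall>V Y. V \<subseteq> W \<and> tangent_field M T i V Y \<longrightarrow>
        (\<forall>x\<in>V. lie_bracket Y X x \<in> tangent_line T i x))"

definition line_field ::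
  "('a, 'i, 'e::euclidean_space) atlas_space \<Rightarrow> ('i, 'e) transverse_flow \<Rightarrow> bool" where
  "line_field M T \<longleftrightarrow> (\<forall>i\<in>index_set M. \<forall>x\<in>cimg M i. \<exists>W Y. x \<in> W \<and> tangent_field M T i W Y \<and>
     (\<forall>y\<in>W. Y y \<noteq> 0 \<and> tangent_line T i y = span {Y y}))"

definition normal_metric ::
  "('a, 'i, 'e::euclidean_space) atlas_space \<Rightarrow> ('i, 'e) transverse_flow \<Rightarrow> bool" where
  "normal_metric M T \<longleftrightarrow> (\<forall>i\<in>index_set M.
     (\<forall>v w. smooth_on (cimg M i) (\<lambda>x. trans_metric T i x (tcoset T i x v) (tcoset T i x w))) \<and>
     (\<forall>x\<in>cimg M i. let h = (\<lambda>v w. trans_metric T i x (tcoset T i x v) (tcoset T i x w)) in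
        bilinear h \<and> (\<forall>v w. h v w = h w v) \<and> (\<forall>v. v \<notin> tangent_line T i x \<longrightarrow> h v v > 0)))"

definition normal_almost_complex ::
  "('a, 'i, 'e::euclidean_space) atlas_space \<Rightarrow> ('i, 'e) transverse_flow \<Rightarrow> bool" where
  "normal_almost_complex M T \<longleftrightarrow> (\<forall>i\<in>index_set M.
     (\<forall>x\<in>cimg M i.
        (\<forall>Q\<in>normal_space T i x. trans_J T i x Q \<in> normal_space T i x \<and>
           trans_J T i x (trans_J T i x Q) = uminus ` Q) \<and>
        (\<forall>v w v' w' a b. trans_J T i x (tcoset T i x v) = tcoset T i x v' \<and>
           trans_J T i x (tcoset T i x w) = tcoset T i x w' \<longrightarrow>
           trans_J T i x (tcoset T i x (a *\<^sub>R v + b *\<^sub>R w)) = tcoset T i x (a *\<^sub>R v' + b *\<^sub>R w'))) \<and>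
     (\<forall>v w. smooth_on (cimg M i)
        (\<lambda>x. trans_metric T i x (tcoset T i x v) (trans_J T i x (tcoset T i x w)))))"

text \<open>A field \<open>X'\<close> representing \<open>J\<close> applied to the class of \<open>X\<close>.\<close>
definition lifts_J :: "('i, 'e::euclidean_space) transverse_flow \<Rightarrow> 'i \<Rightarrow> 'e set \<Rightarrow>
    ('e \<Rightarrow> 'e) \<Rightarrow> ('e \<Rightarrow> 'e) \<Rightarrow> bool" where
  "lifts_J T i W X X' \<longleftrightarrow> smooth_on W X' \<and>
     (\<forall>x\<in>W. trans_J T i x (tcoset T i x (X x)) = tcoset T i x (X' x))"

text \<open>Vanishing of \<open>L\<^sub>Y g\<close> and \<open>L\<^sub>Y J\<close>, where \<open>L\<^sub>Y\<close> of the class of \<open>X\<close> is the class of \<open>[Y, X]\<close>.\<close>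
definition holonomy_invariant ::
  "('a, 'i, 'e::euclidean_space) atlas_space \<Rightarrow> ('i, 'e) transverse_flow \<Rightarrow> bool" where
  "holonomy_invariant M T \<longleftrightarrow> (\<forall>i\<in>index_set M. \<forall>W Y X. tangent_field M T i W Y \<and> smooth_on W X \<longrightarrow>
     (\<forall>Z. smooth_on W Z \<longrightarrow> (\<forall>x\<in>W.
        let h = (\<lambda>y v w. trans_metric T i y (tcoset T i y v) (tcoset T i y w)) in
        frechet_derivative (\<lambda>y. h y (X y) (Z y)) (at x) (Y x)
          = h x (lie_bracket Y X x) (Z x) + h x (X x) (lie_bracket Y Z x))) \<and>
     (\<forall>X'. lifts_J T i W X X' \<longrightarrow> (\<forall>x\<in>W.
        trans_J T i x (tcoset T i x (lie_bracket Y X x)) = tcoset T i x (lie_bracket Y X' x))))"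

text \<open>Vanishing of the Nijenhuis tensor,
  \<open>[J X, J Z] - J ([J X, Z] + [X, J Z]) - [X, Z] = 0\<close>, on transverse vector fields.\<close>
definition transversely_integrable ::
  "('a, 'i, 'e::euclidean_space) atlas_space \<Rightarrow> ('i, 'e) transverse_flow \<Rightarrow> bool" where
  "transversely_integrable M T \<longleftrightarrow> (\<forall>i\<in>index_set M. \<forall>W X Z X' Z'.
     foliate_field M T i W X \<and> foliate_field M T i W Z \<and> lifts_J T i W X X' \<and> lifts_J T i W Z Z' \<longrightarrow>
     (\<forall>x\<in>W. trans_J T i x (tcoset T i x (lie_bracket X' Z x + lie_bracket X Z' x))
        = tcoset T i x (lie_bracket X' Z' x - lie_bracket X Z x)))"

definition transverse_kaehler_form ::
  "('i, 'e::euclidean_space) transverse_flow \<Rightarrow> ('i, 'e) bilinear_field" where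
  "transverse_kaehler_form T i x v w =
     trans_metric T i x (tcoset T i x v) (trans_J T i x (tcoset T i x w))"

definition transversely_kaehler_flow ::
  "('a, 'i, 'e::euclidean_space) atlas_space \<Rightarrow> ('i, 'e) transverse_flow \<Rightarrow> bool" where
  "transversely_kaehler_flow M T \<longleftrightarrow>
     line_field M T \<and> normal_metric M T \<and> normal_almost_complex M T \<and> carries_flow M id T T \<and>
     holonomy_invariant M T \<and> transversely_integrable M T \<and>
     (\<forall>i\<in>index_set M. \<forall>x\<in>cimg M i. \<forall>v w.
        transverse_kaehler_form T i x v w = - transverse_kaehler_form T i x w v) \<and>
     closed_two_form M (transverse_kaehler_form T)"

definition flow_isomorphic :: "('a, 'i, 'e::euclidean_space) atlas_space \<Rightarrow>
    ('i, 'e) transverse_flow \<Rightarrow> ('i, 'e) transverse_flow \<Rightarrow> bool" where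
  "flow_isomorphic M T\<^sub>1 T\<^sub>2 \<longleftrightarrow> (\<exists>f. diffeomorphism M f \<and> carries_flow M f T\<^sub>1 T\<^sub>2)"

section \<open>The underlying flow of a Sasakian metric\<close>

definition reeb_field :: "('i, 'e::euclidean_space) one_form \<Rightarrow> 'i \<Rightarrow> 'e \<Rightarrow> 'e" where
  "reeb_field \<alpha> i x = (THE \<xi>. \<alpha> i x \<xi> = 1 \<and> (\<forall>v. ext_d \<alpha> i x \<xi> v = 0))"

text \<open>The line field of the Reeb orbits.\<close>
definition reeb_line :: "('i, 'e::euclidean_space) one_form \<Rightarrow> 'i \<Rightarrow> 'e \<Rightarrow> 'e set" where
  "reeb_line \<alpha> i x = span {reeb_field \<alpha> i x}"

text \<open>The isomorphism from \<open>TM/T\<F>\<close> to \<open>ker \<alpha>\<close>.\<close>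
definition horizontal_lift :: "('i, 'e) one_form \<Rightarrow> 'i \<Rightarrow> 'e \<Rightarrow> 'e set \<Rightarrow> 'e" where
  "horizontal_lift \<alpha> i x Q = (THE v. v \<in> Q \<and> \<alpha> i x v = 0)"

definition induced_metric :: "('i, 'e) bilinear_field \<Rightarrow> ('i, 'e) one_form \<Rightarrow>
    'i \<Rightarrow> 'e \<Rightarrow> 'e set \<Rightarrow> 'e set \<Rightarrow> real" where
  "induced_metric g \<alpha> i x Q R = g i x (horizontal_lift \<alpha> i x Q) (horizontal_lift \<alpha> i x R)"

text \<open>\<open>J\<close> is determined by \<open>d\<alpha>(X, Y) = g\<^sub>\<nu>(X, J Y)\<close>. The conditions defining a transversely
  Kaehler flow need not be imposed: they hold for every Sasakian metric.\<close>
definition underlying_flow :: "('i, 'e::euclidean_space) bilinear_field \<Rightarrow> ('i, 'e) one_form \<Rightarrow>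
    ('i, 'e) transverse_flow" where
  "underlying_flow g \<alpha> =
     \<lparr> tangent_line = reeb_line \<alpha>,
       trans_J = (\<lambda>i x Q. THE R. R \<in> range (coset_of (reeb_line \<alpha> i x)) \<and>
          (\<forall>v. \<forall>w\<in>Q. ext_d \<alpha> i x v w
             = induced_metric g \<alpha> i x (coset_of (reeb_line \<alpha> i x) v) R)),
       trans_metric = induced_metric g \<alpha> \<rparr>"

end

(* A Sasakian metric is determined by its transverse tensor nu = g - alpha * alpha and alpha.  The
   complex structure of the cone gives g(xi, v) = alpha(v) and, through its Nijenhuis tensor on the
   Euler field, that the Reeb field xi preserves alpha and nu.

   Let F carry the first flow to the second.  Then F^* nu_2 = nu_1 and F^* d alpha_2 = d alpha_1, so
   F^* alpha_2 - alpha_1 is closed, hence equal to dh, as the first Betti number is zero.  Moving points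
   along the second Reeb flow Phi_2 by a time s adds ds to pullbacks of alpha_2 and does not change
   pullbacks of nu_2.  Therefore f(p) = Phi_2(-h(p), F p) satisfies f^* alpha_2 = alpha_1 and
   f^* nu_2 = nu_1, that is f^* g_2 = g_1.  The inverse of f is q |-> Phi_1(h(F^-1 q), F^-1 q):
   along a leaf, the times measured by alpha_1 and by F^* alpha_2 differ by the increment of h. *)
theory Submission
  imports Defs
begin

section \<open>Calculus of \<open>C\<^sup>k\<close> maps\<close>

text \<open>The Reeb flow must run for times up to sup |h|, while a flow box lasts only for a short
  time. Compactness of M supplies one duration \<epsilon> for all points, and the longer flow is the
  n-fold iterate of the step t/n; each step contributes the n-th part of the change -dh. Vanishing
  of the first Betti number concerns singular homology with integer coefficients: a nonzero multiple
  of every 1-cycle bounds, which kills real periods. As singular simplices are merely continuous,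
  periods of the closed form are defined by continuing its local primitives, not by integrating it.
  The equality of F^* d\<alpha>2 and d\<alpha>1 uses the transverse metric and complex structure
  together, since d\<alpha>(v, w) = \<nu>(v, T w). Pulling g2 back to g1 makes f only a local
  diffeomorphism; F preserves leaves but not their time, so the inverse is obtained by comparing two
  parametrisations of one leaf.\<close>

lemma Ck_on_subset: "Ck_on k S f \<Longrightarrow> T \<subseteq> S \<Longrightarrow> Ck_on k T f"
  by (induction k arbitrary: f) (auto intro: continuous_on_subset)

text \<open>\<open>frechet_derivative\<close> chooses among the maps satisfying
  \<open>has_derivative\<close>, and this predicate is local; hence the two choices
  coincide.\<close>

lemma frechet_derivative_cong_open:
  assumes "open S" "x \<in> S" "\<And>y. y \<in> S \<Longrightarrow> f y = g y"
  shows "frechet_derivative f (at x) = frechet_derivative g (at x)"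
proof -
  have "(f has_derivative D) (at x) = (g has_derivative D) (at x)" for D
    using assms by (metis has_derivative_transform_within_open)
  then show ?thesis by (simp add: frechet_derivative_def)
qed

lemma differentiable_cong_open:
  assumes "open S" "x \<in> S" "\<And>y. y \<in> S \<Longrightarrow> f y = g y" "f differentiable at x"
  shows "g differentiable at x"
  using assms unfolding differentiable_def by (metis has_derivative_transform_within_open)

lemma Ck_on_cong:
  assumes "open S" "\<And>x. x \<in> S \<Longrightarrow> f x = g x" "Ck_on k S f"
  shows "Ck_on k S g"
  using assms(2,3)
proof (induction k arbitrary: f g)
  case 0
  then show ?case by (simp cong: continuous_on_cong)
next
  case (Suc k)
  have "Ck_on k S (\<lambda>x. frechet_derivative g (at x) v)" for v
  proof (rule Suc.IH[where f = "\<lambda>x. frechet_derivative f (at x) v"])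
    show "frechet_derivative f (at x) v = frechet_derivative g (at x) v" if "x \<in> S" for x
      using frechet_derivative_cong_open[OF assms(1) that Suc.prems(1)] by simp
  qed (use Suc.prems in auto)
  then show ?case
    using Suc.prems differentiable_cong_open[OF assms(1)] by auto blast
qed

text \<open>An explicit formula f' replaces the chosen \<open>frechet_derivative\<close>, so that
  the sum, product and chain rules feed inductions on k directly.\<close>

lemma Ck_on_SucI:
  assumes "open S" "\<And>x. x \<in> S \<Longrightarrow> (f has_derivative f' x) (at x)"
    "\<And>v. Ck_on k S (\<lambda>x. f' x v)"
  shows "Ck_on (Suc k) S f"
proof -
  have "Ck_on k S (\<lambda>x. frechet_derivative f (at x) v)" for v
    by (rule Ck_on_cong[OF assms(1) _ assms(3)[of v]]) (metis assms(2) frechet_derivative_at)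
  then show ?thesis using assms(2) by (auto simp: differentiable_def)
qed

lemma Ck_on_SucD:
  assumes "Ck_on (Suc k) S f"
  shows "\<And>x. x \<in> S \<Longrightarrow> (f has_derivative frechet_derivative f (at x)) (at x)"
    "\<And>v. Ck_on k S (\<lambda>x. frechet_derivative f (at x) v)"
  using assms by (auto simp: frechet_derivative_works)

lemma Ck_on_Suc_imp: "Ck_on (Suc k) S f \<Longrightarrow> Ck_on k S f"
proof (induction k arbitrary: f)
  case 0
  then show ?case
    by (auto intro!: differentiable_imp_continuous_on simp: differentiable_on_def differentiable_at_withinI)
next
  case (Suc k)
  then show ?case by (metis Ck_on.simps(2))
qed

lemma Ck_on_le: "Ck_on n S f \<Longrightarrow> k \<le> n \<Longrightarrow> Ck_on k S f"
  by (induction n) (auto simp: le_Suc_eq dest: Ck_on_Suc_imp simp del: Ck_on.simps)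

lemma Ck_on_imp_continuous_on: "Ck_on k S f \<Longrightarrow> continuous_on S f"
  using Ck_on_le[of k S f 0] by simp

lemma Ck_on_const: "Ck_on k S (\<lambda>x. c)"
proof (induction k arbitrary: c)
  case (Suc k)
  then show ?case by simp
qed simp

lemma Ck_on_bounded_linear:
  assumes "bounded_linear L" shows "Ck_on k S L"
proof (cases k)
  case (Suc n)
  have "frechet_derivative L (at x) = L" for x
    using assms by (metis bounded_linear_imp_has_derivative frechet_derivative_at)
  then show ?thesis
    using Suc assms by (auto simp: Ck_on_const bounded_linear_imp_differentiable)
qed (use assms in \<open>auto intro: linear_continuous_on\<close>)

lemma Ck_on_add:
  assumes "open S" shows "Ck_on k S f \<Longrightarrow> Ck_on k S g \<Longrightarrow> Ck_on k S (\<lambda>x. f x + g x)"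
proof (induction k arbitrary: f g)
  case (Suc k)
  show ?case
    by (rule Ck_on_SucI[OF assms has_derivative_add[OF Ck_on_SucD(1) Ck_on_SucD(1)]])
      (use Suc in \<open>auto\<close>)
qed (auto intro: continuous_intros)

text \<open>One Leibniz induction serves products, scalar multiples and inner products: the
  derivative is a sum of two terms of the same bilinear shape.\<close>

lemma Ck_on_bilinear:
  assumes "open S" "bounded_bilinear B"
  shows "Ck_on k S f \<Longrightarrow> Ck_on k S g \<Longrightarrow> Ck_on k S (\<lambda>x. B (f x) (g x))"
proof (induction k arbitrary: f g)
  case 0
  then show ?case using assms(2) by (auto intro: bounded_bilinear.continuous_on)
next
  case (Suc k)
  show ?case
  proof (rule Ck_on_SucI[OF assms(1)])
    show "((\<lambda>x. B (f x) (g x)) has_derivative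
        (\<lambda>h. B (f x) (frechet_derivative g (at x) h) + B (frechet_derivative f (at x) h) (g x))) (at x)"
      if "x \<in> S" for x
      using bounded_bilinear.FDERIV[OF assms(2) Ck_on_SucD(1)[OF Suc.prems(1) that]
          Ck_on_SucD(1)[OF Suc.prems(2) that]] .
    show "Ck_on k S (\<lambda>x. B (f x) (frechet_derivative g (at x) v) + B (frechet_derivative f (at x) v) (g x))" for v
      by (intro Ck_on_add[OF assms(1)] Suc.IH)
        (use Suc.prems Ck_on_Suc_imp Ck_on_SucD(2) in blast)+
  qed
qed

lemma Ck_on_scaleR: "open S \<Longrightarrow> Ck_on k S f \<Longrightarrow> Ck_on k S g \<Longrightarrow> Ck_on k S (\<lambda>x. f x *\<^sub>R g x)"
  by (rule Ck_on_bilinear[OF _ bounded_bilinear_scaleR])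

lemma Ck_on_mult:
  fixes f g :: "_ \<Rightarrow> real"
  shows "open S \<Longrightarrow> Ck_on k S f \<Longrightarrow> Ck_on k S g \<Longrightarrow> Ck_on k S (\<lambda>x. f x * g x)"
  by (rule Ck_on_bilinear[OF _ bounded_bilinear_mult])

lemma Ck_on_sum:
  assumes "open S" "\<And>i. i \<in> I \<Longrightarrow> Ck_on k S (f i)"
  shows "Ck_on k S (\<lambda>x. \<Sum>i\<in>I. f i x)"
  using assms(2) by (induction I rule: infinite_finite_induct) (auto intro: Ck_on_const Ck_on_add assms(1))

text \<open>Expanding V in the standard basis reduces everything to the coefficients A x b for fixed
  b. Tensor fields in charts are smooth in exactly this sense.\<close>

lemma Ck_on_linear_family:
  assumes "open S" "\<And>x. x \<in> S \<Longrightarrow> linear (A x)" "\<And>v. Ck_on k S (\<lambda>x. A x v)"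
    "Ck_on k S V"
  shows "Ck_on k S (\<lambda>x. A x (V x :: 'v::euclidean_space))"
proof (rule Ck_on_cong[OF assms(1)])
  show "Ck_on k S (\<lambda>x. \<Sum>b\<in>Basis. (V x \<bullet> b) *\<^sub>R A x b)"
    by (intro Ck_on_sum Ck_on_scaleR assms Ck_on_bilinear[OF _ bounded_bilinear_inner] Ck_on_const)
  show "(\<Sum>b\<in>Basis. (V x \<bullet> b) *\<^sub>R A x b) = A x (V x)" if "x \<in> S" for x
  proof -
    have "A x (V x) = A x (\<Sum>b\<in>Basis. (V x \<bullet> b) *\<^sub>R b)" by (simp add: euclidean_representation)
    also have "\<dots> = (\<Sum>b\<in>Basis. (V x \<bullet> b) *\<^sub>R A x b)"
      using assms(2)[OF that] by (simp add: linear_sum linear_scale)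
    finally show ?thesis by simp
  qed
qed

lemma linear_frechet_derivative_Ck: "Ck_on (Suc k) S f \<Longrightarrow> x \<in> S \<Longrightarrow> linear (frechet_derivative f (at x))"
  using Ck_on_SucD(1) has_derivative_linear by blast

text \<open>The chain rule presents the derivative of the composite as the linear family Dg(f x)
  applied to Df(x) v; the family is C^k by the induction hypothesis for the directional derivatives
  of g.\<close>

lemma Ck_on_compose:
  assumes "open S" "open T"
  shows "Ck_on k T g \<Longrightarrow> Ck_on k S f \<Longrightarrow> f ` S \<subseteq> T \<Longrightarrow> Ck_on k S (\<lambda>x. g (f x))"
proof (induction k arbitrary: g)
  case 0
  then show ?case by (auto intro: continuous_on_compose2)
next
  case (Suc k)
  have fT: "f x \<in> T" if "x \<in> S" for x using Suc.prems(3) that by auto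
  show ?case
  proof (rule Ck_on_SucI[OF assms(1)])
    show "((\<lambda>x. g (f x)) has_derivative
        (\<lambda>h. frechet_derivative g (at (f x)) (frechet_derivative f (at x) h))) (at x)" if "x \<in> S" for x
      using has_derivative_compose[OF Ck_on_SucD(1)[OF Suc.prems(2) that] Ck_on_SucD(1)[OF Suc.prems(1) fT[OF that]]] .
    show "Ck_on k S (\<lambda>x. frechet_derivative g (at (f x)) (frechet_derivative f (at x) v))" for v
    proof (rule Ck_on_linear_family[OF assms(1)])
      show "linear (frechet_derivative g (at (f x)))" if "x \<in> S" for x
        using linear_frechet_derivative_Ck[OF Suc.prems(1) fT[OF that]] .
      show "Ck_on k S (\<lambda>x. frechet_derivative g (at (f x)) w)" for w
        by (rule Suc.IH[OF Ck_on_SucD(2)[OF Suc.prems(1)] Ck_on_Suc_imp[OF Suc.prems(2)] Suc.prems(3)])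
    qed (rule Ck_on_SucD(2)[OF Suc.prems(2)])
  qed
qed

lemma Ck_on_linear_compose:
  "bounded_linear L \<Longrightarrow> open S \<Longrightarrow> Ck_on k S f \<Longrightarrow> Ck_on k S (\<lambda>x. L (f x))"
proof (induction k arbitrary: f)
  case 0
  then show ?case by (auto intro: bounded_linear.continuous_on)
next
  case (Suc k)
  show ?case
    by (rule Ck_on_SucI[OF Suc.prems(2) bounded_linear.has_derivative[OF Suc.prems(1) Ck_on_SucD(1)]])
      (use Suc in \<open>auto\<close>)
qed

lemma Ck_on_Pair:
  assumes "open S" shows "Ck_on k S f \<Longrightarrow> Ck_on k S g \<Longrightarrow> Ck_on k S (\<lambda>x. (f x, g x))"
proof (induction k arbitrary: f g)
  case (Suc k)
  show ?case
    by (rule Ck_on_SucI[OF assms has_derivative_Pair[OF Ck_on_SucD(1) Ck_on_SucD(1)]])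
      (use Suc in \<open>auto\<close>)
qed (auto intro: continuous_intros)

lemma Ck_on_local:
  assumes "\<And>x. x \<in> S \<Longrightarrow> \<exists>T. open T \<and> x \<in> T \<and> Ck_on k T f"
  shows "Ck_on k S f"
  using assms
proof (induction k arbitrary: f)
  case 0
  then show ?case
    by (simp add: continuous_on_eq_continuous_within)
      (meson at_within_open continuous_at_imp_continuous_at_within continuous_on_eq_continuous_at
        Ck_on.simps(1) continuous_on_eq_continuous_within)
next
  case (Suc k)
  show ?case
  proof (simp, intro conjI ballI allI)
    show "f differentiable at x" if "x \<in> S" for x using Suc.prems[OF that] by auto
    show "Ck_on k S (\<lambda>x. frechet_derivative f (at x) v)" for v
      by (rule Suc.IH) (use Suc.prems in fastforce)
  qed
qed

section \<open>Smooth maps\<close>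

lemma smooth_on_imp_Ck_on: "smooth_on S f \<Longrightarrow> Ck_on k S f"
  by (simp add: smooth_on_def)

lemma smooth_on_subset: "smooth_on S f \<Longrightarrow> T \<subseteq> S \<Longrightarrow> smooth_on T f"
  unfolding smooth_on_def using Ck_on_subset by blast

lemma smooth_on_cong:
  "open S \<Longrightarrow> (\<And>x. x \<in> S \<Longrightarrow> f x = g x) \<Longrightarrow> smooth_on S f \<Longrightarrow> smooth_on S g"
  unfolding smooth_on_def using Ck_on_cong by metis

lemma smooth_on_local:
  "(\<And>x. x \<in> S \<Longrightarrow> \<exists>T. open T \<and> x \<in> T \<and> smooth_on T f) \<Longrightarrow> smooth_on S f"
  unfolding smooth_on_def using Ck_on_local by metis

lemma smooth_on_const: "smooth_on S (\<lambda>x. c)"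
  by (simp add: smooth_on_def Ck_on_const)

lemma smooth_on_bounded_linear: "bounded_linear L \<Longrightarrow> smooth_on S L"
  by (simp add: smooth_on_def Ck_on_bounded_linear)

lemma smooth_on_ident: "smooth_on S (\<lambda>x. x)"
  by (simp add: smooth_on_bounded_linear bounded_linear_ident)

lemma smooth_on_add:
  "open S \<Longrightarrow> smooth_on S f \<Longrightarrow> smooth_on S g \<Longrightarrow> smooth_on S (\<lambda>x. f x + g x)"
  by (simp add: smooth_on_def Ck_on_add)

lemma smooth_on_scaleR:
  "open S \<Longrightarrow> smooth_on S f \<Longrightarrow> smooth_on S g \<Longrightarrow> smooth_on S (\<lambda>x. f x *\<^sub>R g x)"
  by (simp add: smooth_on_def Ck_on_scaleR)

lemma smooth_on_mult:
  fixes f g :: "_ \<Rightarrow> real"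
  shows "open S \<Longrightarrow> smooth_on S f \<Longrightarrow> smooth_on S g \<Longrightarrow> smooth_on S (\<lambda>x. f x * g x)"
  by (simp add: smooth_on_def Ck_on_mult)

lemma smooth_on_linear_compose:
  "bounded_linear L \<Longrightarrow> open S \<Longrightarrow> smooth_on S f \<Longrightarrow> smooth_on S (\<lambda>x. L (f x))"
  by (simp add: smooth_on_def Ck_on_linear_compose)

lemma smooth_on_minus: "open S \<Longrightarrow> smooth_on S f \<Longrightarrow> smooth_on S (\<lambda>x. - f x)"
  by (rule smooth_on_linear_compose[OF bounded_linear_minus[OF bounded_linear_ident]])

lemma smooth_on_diff:
  "open S \<Longrightarrow> smooth_on S f \<Longrightarrow> smooth_on S g \<Longrightarrow> smooth_on S (\<lambda>x. f x - g x)"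
  using smooth_on_add[OF _ _ smooth_on_minus] by fastforce

lemma smooth_on_Pair:
  "open S \<Longrightarrow> smooth_on S f \<Longrightarrow> smooth_on S g \<Longrightarrow> smooth_on S (\<lambda>x. (f x, g x))"
  by (simp add: smooth_on_def Ck_on_Pair)

lemma smooth_on_compose:
  "open S \<Longrightarrow> open T \<Longrightarrow> smooth_on T g \<Longrightarrow> smooth_on S f \<Longrightarrow> f ` S \<subseteq> T
    \<Longrightarrow> smooth_on S (\<lambda>x. g (f x))"
  unfolding smooth_on_def using Ck_on_compose by blast

lemma smooth_on_linear_family:
  "open S \<Longrightarrow> (\<And>x. x \<in> S \<Longrightarrow> linear (A x)) \<Longrightarrow> (\<And>v. smooth_on S (\<lambda>x. A x v)) \<Longrightarrow>
    smooth_on S V \<Longrightarrow> smooth_on S (\<lambda>x. A x (V x :: 'v::euclidean_space))"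
  unfolding smooth_on_def using Ck_on_linear_family by blast

lemma smooth_on_has_derivative:
  "smooth_on S f \<Longrightarrow> x \<in> S \<Longrightarrow> (f has_derivative frechet_derivative f (at x)) (at x)"
  using Ck_on_SucD(1) smooth_on_def by blast

lemma smooth_on_linear_frechet_derivative:
  "smooth_on S f \<Longrightarrow> x \<in> S \<Longrightarrow> linear (frechet_derivative f (at x))"
  using smooth_on_has_derivative has_derivative_linear by blast

lemma smooth_on_frechet_derivative:
  "smooth_on S f \<Longrightarrow> smooth_on S (\<lambda>x. frechet_derivative f (at x) v)"
  unfolding smooth_on_def using Ck_on_SucD(2) by blast

lemma smooth_on_frechet_derivative_field:
  "open S \<Longrightarrow> smooth_on S f \<Longrightarrow> smooth_on S V \<Longrightarrow>
    smooth_on S (\<lambda>x. frechet_derivative f (at x) (V x :: 'v::euclidean_space))"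
  by (rule smooth_on_linear_family[OF _ smooth_on_linear_frechet_derivative
        smooth_on_frechet_derivative])

lemma smooth_on_imp_continuous_on: "smooth_on S f \<Longrightarrow> continuous_on S f"
  using Ck_on_imp_continuous_on smooth_on_def by blast

text \<open>Serves for primitives: a function whose differential is a smooth 1-form is itself
  smooth.\<close>

lemma smooth_onI_derivative:
  assumes "open S" "\<And>x. x \<in> S \<Longrightarrow> (f has_derivative f' x) (at x)"
    "\<And>v. smooth_on S (\<lambda>x. f' x v)"
  shows "smooth_on S f"
  unfolding smooth_on_def
proof
  fix k
  have "Ck_on (Suc k) S f"
    using Ck_on_SucI[OF assms(1,2)] assms(3) by (simp add: smooth_on_def)
  then show "Ck_on k S f" by (rule Ck_on_Suc_imp)
qed

lemma has_derivative_chain: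
  assumes "(g has_derivative g') (at y)" "f x = y" "(f has_derivative f') (at x within S)"
  shows "((\<lambda>x. g (f x)) has_derivative (\<lambda>h. g' (f' h))) (at x within S)"
  using has_derivative_compose[OF assms(3), of g g'] assms by simp

text \<open>Leibniz rule for evaluating a field of linear maps on a field of vectors. All later Lie
  derivative computations rest on it.\<close>

lemma has_derivative_linear_family:
  fixes A :: "'x::real_normed_vector \<Rightarrow> 'v::euclidean_space \<Rightarrow> 'w::real_normed_vector"
  assumes "open S" "x \<in> S" "\<And>y. y \<in> S \<Longrightarrow> linear (A y)"
    "\<And>v. ((\<lambda>y. A y v) has_derivative DA v) (at x)"
    "(V has_derivative V') (at x)"
  shows "((\<lambda>y. A y (V y)) has_derivative (\<lambda>h. DA (V x) h + A x (V' h))) (at x)"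
proof -
  have exp: "A y u = (\<Sum>b\<in>Basis. (u \<bullet> b) *\<^sub>R A y b)" if "y \<in> S" for y u
  proof -
    have "A y u = A y (\<Sum>b\<in>Basis. (u \<bullet> b) *\<^sub>R b)" by (simp add: euclidean_representation)
    then show ?thesis using assms(3)[OF that] by (simp add: linear_sum linear_scale)
  qed
  \<comment> \<open>Freezing the vector V x and differentiating its basis expansion identifies DA (V
    x) with the corresponding combination of the DA b, by uniqueness of derivatives.\<close>
  have "((\<lambda>y. \<Sum>b\<in>Basis. (V x \<bullet> b) *\<^sub>R A y b) has_derivative (\<lambda>h. \<Sum>b\<in>Basis. (V x \<bullet> b) *\<^sub>R DA b h)) (at x)"
    by (auto intro!: derivative_eq_intros assms)
  then have "((\<lambda>y. A y (V x)) has_derivative (\<lambda>h. \<Sum>b\<in>Basis. (V x \<bullet> b) *\<^sub>R DA b h)) (at x)"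
    by (rule has_derivative_transform_within_open[OF _ assms(1,2)]) (rule exp[symmetric])
  then have DA: "DA (V x) = (\<lambda>h. \<Sum>b\<in>Basis. (V x \<bullet> b) *\<^sub>R DA b h)"
    using assms(4) has_derivative_unique by blast
  have "((\<lambda>y. \<Sum>b\<in>Basis. (V y \<bullet> b) *\<^sub>R A y b) has_derivative
      (\<lambda>h. \<Sum>b\<in>Basis. (V x \<bullet> b) *\<^sub>R DA b h + (V' h \<bullet> b) *\<^sub>R A x b)) (at x)"
    by (auto intro!: derivative_eq_intros assms(4,5))
  then have "((\<lambda>y. A y (V y)) has_derivative
      (\<lambda>h. \<Sum>b\<in>Basis. (V x \<bullet> b) *\<^sub>R DA b h + (V' h \<bullet> b) *\<^sub>R A x b)) (at x)"
    by (rule has_derivative_transform_within_open[OF _ assms(1,2)]) (rule exp[symmetric])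
  moreover have "(\<lambda>h. \<Sum>b\<in>Basis. (V x \<bullet> b) *\<^sub>R DA b h + (V' h \<bullet> b) *\<^sub>R A x b)
      = (\<lambda>h. DA (V x) h + A x (V' h))"
    unfolding DA by (simp add: sum.distrib exp[OF assms(2), of "V' _", symmetric])
  ultimately show ?thesis by simp
qed

section \<open>Symmetry of second derivatives\<close>

text \<open>Two applications of the mean value theorem: in direction v to the difference of f along
  w, then in direction w to the derivative A.\<close>

lemma second_difference:
  fixes f :: "'e::euclidean_space \<Rightarrow> real"
  assumes "smooth_on S f" "0 < s"
    "\<And>\<tau> \<sigma>. 0 \<le> \<tau> \<Longrightarrow> \<tau> \<le> s \<Longrightarrow> 0 \<le> \<sigma> \<Longrightarrow> \<sigma> \<le> s \<Longrightarrow> x + \<tau> *\<^sub>R v + \<sigma> *\<^sub>R w \<in> S"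
  obtains \<tau> \<sigma> where "0 \<le> \<tau>" "\<tau> \<le> s" "0 \<le> \<sigma>" "\<sigma> \<le> s"
    "f (x + s *\<^sub>R v + s *\<^sub>R w) - f (x + s *\<^sub>R v) - f (x + s *\<^sub>R w) + f x
      = s * (s * frechet_derivative (\<lambda>y. frechet_derivative f (at y) v) (at (x + \<tau> *\<^sub>R v + \<sigma> *\<^sub>R w)) w)"
proof -
  define A where "A y = frechet_derivative f (at y) v" for y
  have A: "smooth_on S A" unfolding A_def using assms(1) by (rule smooth_on_frechet_derivative)
  have 1: "((\<lambda>\<tau>. f (x + \<tau> *\<^sub>R v + \<sigma> *\<^sub>R w)) has_real_derivative A (x + \<tau> *\<^sub>R v + \<sigma> *\<^sub>R w)) (at \<tau>)"
    if "0 \<le> \<tau>" "\<tau> \<le> s" "0 \<le> \<sigma>" "\<sigma> \<le> s" for \<tau> \<sigma>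
  proof -
    note D = smooth_on_has_derivative[OF assms(1) assms(3)[OF that]]
    have "((\<lambda>\<tau>. f (x + \<tau> *\<^sub>R v + \<sigma> *\<^sub>R w)) has_derivative
        (\<lambda>h. frechet_derivative f (at (x + \<tau> *\<^sub>R v + \<sigma> *\<^sub>R w)) (h *\<^sub>R v))) (at \<tau>)"
      by (rule has_derivative_chain[OF D]) (auto intro!: derivative_eq_intros)
    then show ?thesis
      unfolding has_field_derivative_def A_def
      by (rule has_derivative_eq_rhs) (simp add: linear_scale[OF has_derivative_linear[OF D]] fun_eq_iff)
  qed
  have 2: "((\<lambda>\<sigma>. A (x + \<tau> *\<^sub>R v + \<sigma> *\<^sub>R w)) has_real_derivative
        frechet_derivative A (at (x + \<tau> *\<^sub>R v + \<sigma> *\<^sub>R w)) w) (at \<sigma>)"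
    if "0 \<le> \<tau>" "\<tau> \<le> s" "0 \<le> \<sigma>" "\<sigma> \<le> s" for \<tau> \<sigma>
  proof -
    note D = smooth_on_has_derivative[OF A assms(3)[OF that]]
    have "((\<lambda>\<sigma>. A (x + \<tau> *\<^sub>R v + \<sigma> *\<^sub>R w)) has_derivative
        (\<lambda>h. frechet_derivative A (at (x + \<tau> *\<^sub>R v + \<sigma> *\<^sub>R w)) (h *\<^sub>R w))) (at \<sigma>)"
      by (rule has_derivative_chain[OF D]) (auto intro!: derivative_eq_intros)
    then show ?thesis
      unfolding has_field_derivative_def
      by (rule has_derivative_eq_rhs) (simp add: linear_scale[OF has_derivative_linear[OF D]] fun_eq_iff)
  qed
  have "\<exists>\<tau>>0. \<tau> < s \<and> (f (x + s *\<^sub>R v + s *\<^sub>R w) - f (x + s *\<^sub>R v + 0 *\<^sub>R w))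
      - (f (x + 0 *\<^sub>R v + s *\<^sub>R w) - f (x + 0 *\<^sub>R v + 0 *\<^sub>R w))
      = (s - 0) * (A (x + \<tau> *\<^sub>R v + s *\<^sub>R w) - A (x + \<tau> *\<^sub>R v + 0 *\<^sub>R w))"
    by (rule MVT2[OF assms(2)]) (use assms(2) in \<open>auto intro!: DERIV_diff 1 1[where \<sigma>=0, simplified]\<close>)
  then obtain \<tau> where \<tau>: "0 < \<tau>" "\<tau> < s" "f (x + s *\<^sub>R v + s *\<^sub>R w) - f (x + s *\<^sub>R v) - f (x + s *\<^sub>R w) + f x
      = s * (A (x + \<tau> *\<^sub>R v + s *\<^sub>R w) - A (x + \<tau> *\<^sub>R v))" by auto
  have "\<exists>\<sigma>>0. \<sigma> < s \<and> A (x + \<tau> *\<^sub>R v + s *\<^sub>R w) - A (x + \<tau> *\<^sub>R v + 0 *\<^sub>R w)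
      = (s - 0) * frechet_derivative A (at (x + \<tau> *\<^sub>R v + \<sigma> *\<^sub>R w)) w"
    by (rule MVT2[OF assms(2)]) (use \<tau> in \<open>auto intro!: 2\<close>)
  then obtain \<sigma> where "0 < \<sigma>" "\<sigma> < s" "A (x + \<tau> *\<^sub>R v + s *\<^sub>R w) - A (x + \<tau> *\<^sub>R v)
      = s * frechet_derivative A (at (x + \<tau> *\<^sub>R v + \<sigma> *\<^sub>R w)) w" by auto
  with \<tau> show thesis by (intro that[of \<tau> \<sigma>]) (auto simp: A_def[abs_def])
qed

text \<open>The second difference is symmetric in v and w, so it equals s^2 times either mixed
  derivative at points near x; continuity of both at x forces equality.\<close>

lemma symmetric_second_derivative_real:
  fixes f :: "'e::euclidean_space \<Rightarrow> real"
  assumes "open S" "smooth_on S f" "x \<in> S"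
  shows "frechet_derivative (\<lambda>y. frechet_derivative f (at y) v) (at x) w
       = frechet_derivative (\<lambda>y. frechet_derivative f (at y) w) (at x) v"
proof (rule ccontr)
  let ?P = "\<lambda>z. frechet_derivative (\<lambda>y. frechet_derivative f (at y) v) (at z) w"
  let ?Q = "\<lambda>z. frechet_derivative (\<lambda>y. frechet_derivative f (at y) w) (at z) v"
  assume ne: "?P x \<noteq> ?Q x"
  \<comment> \<open>Half of the gap: each mixed derivative moves by less than e, so together they
    cannot bridge 2 e.\<close>
  define e where "e = \<bar>?P x - ?Q x\<bar> / 2"
  have e: "0 < e" using ne by (simp add: e_def)
  have "continuous_on S ?P" "continuous_on S ?Q"
    using assms(2) by (auto intro!: smooth_on_imp_continuous_on smooth_on_frechet_derivative)
  then have c: "isCont ?P x" "isCont ?Q x"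
    using assms continuous_on_eq_continuous_at by blast+
  obtain d1 where d1: "d1 > 0" "\<And>z. dist z x < d1 \<Longrightarrow> dist (?P z) (?P x) < e"
    using c(1) e unfolding continuous_at_eps_delta by metis
  obtain d2 where d2: "d2 > 0" "\<And>z. dist z x < d2 \<Longrightarrow> dist (?Q z) (?Q x) < e"
    using c(2) e unfolding continuous_at_eps_delta by metis
  obtain d3 where d3: "d3 > 0" "ball x d3 \<subseteq> S" using assms open_contains_ball by blast
  define d where "d = min d1 (min d2 d3)"
  have d: "0 < d" using d1 d2 d3 by (simp add: d_def)
  \<comment> \<open>With s * N = d / 2 the whole parallelogram lies within distance d of x; the
    summand 1 keeps N positive.\<close>
  define N where "N = norm v + norm w + 1"
  define s where "s = d / (2 * N)"
  have pos: "N > 0" unfolding N_def by (smt (verit) norm_ge_zero)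
  have s: "0 < s" using d pos by (simp add: s_def)
  have near: "dist (x + \<tau> *\<^sub>R v + \<sigma> *\<^sub>R w) x < d" if "0 \<le> \<tau>" "\<tau> \<le> s" "0 \<le> \<sigma>" "\<sigma> \<le> s" for \<tau> \<sigma>
  proof -
    have "dist (x + \<tau> *\<^sub>R v + \<sigma> *\<^sub>R w) x \<le> \<tau> * norm v + \<sigma> * norm w"
      using that norm_triangle_ineq[of "\<tau> *\<^sub>R v" "\<sigma> *\<^sub>R w"] by (simp add: dist_norm)
    also have "\<dots> \<le> s * norm v + s * norm w" using that by (intro add_mono mult_right_mono) auto
    also have "\<dots> \<le> s * N" using s by (simp add: N_def algebra_simps)
    also have "\<dots> = d / 2" using pos by (simp add: s_def)
    finally show ?thesis using d by simp
  qed
  have mem: "x + \<tau> *\<^sub>R v + \<sigma> *\<^sub>R w \<in> S" if "0 \<le> \<tau>" "\<tau> \<le> s" "0 \<le> \<sigma>" "\<sigma> \<le> s" for \<tau> \<sigma>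
    using near[OF that] d3(2) by (auto simp: d_def dist_commute subset_iff)
  obtain \<tau> \<sigma> where 1: "0 \<le> \<tau>" "\<tau> \<le> s" "0 \<le> \<sigma>" "\<sigma> \<le> s"
    "f (x + s *\<^sub>R v + s *\<^sub>R w) - f (x + s *\<^sub>R v) - f (x + s *\<^sub>R w) + f x = s * (s * ?P (x + \<tau> *\<^sub>R v + \<sigma> *\<^sub>R w))"
    using second_difference[OF assms(2) s, of x v w] mem by blast
  obtain \<sigma>' \<tau>' where 2: "0 \<le> \<tau>'" "\<tau>' \<le> s" "0 \<le> \<sigma>'" "\<sigma>' \<le> s"
    "f (x + s *\<^sub>R w + s *\<^sub>R v) - f (x + s *\<^sub>R w) - f (x + s *\<^sub>R v) + f x = s * (s * ?Q (x + \<sigma>' *\<^sub>R w + \<tau>' *\<^sub>R v))"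
    using second_difference[OF assms(2) s, of x w v] mem by (smt (verit) add.commute add.left_commute)
  have "s * (s * ?P (x + \<tau> *\<^sub>R v + \<sigma> *\<^sub>R w)) = s * (s * ?Q (x + \<sigma>' *\<^sub>R w + \<tau>' *\<^sub>R v))"
    using 1(5) 2(5) by (simp add: algebra_simps)
  then have "?P (x + \<tau> *\<^sub>R v + \<sigma> *\<^sub>R w) = ?Q (x + \<tau>' *\<^sub>R v + \<sigma>' *\<^sub>R w)"
    using s by (simp add: algebra_simps)
  moreover have "dist (?P (x + \<tau> *\<^sub>R v + \<sigma> *\<^sub>R w)) (?P x) < e"
    using d1(2) near[OF 1(1-4)] by (simp add: d_def)
  moreover have "dist (?Q (x + \<tau>' *\<^sub>R v + \<sigma>' *\<^sub>R w)) (?Q x) < e"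
    using d2(2) near[OF 2(1-4)] by (simp add: d_def)
  ultimately have "\<bar>?P x - ?Q x\<bar> < 2 * e" by (simp add: dist_real_def)
  then show False by (simp add: e_def)
qed

lemma frechet_derivative_inner:
  assumes "f differentiable at x"
  shows "frechet_derivative (\<lambda>y. f y \<bullet> b) (at x) v = frechet_derivative f (at x) v \<bullet> b"
  using frechet_derivative_at[OF has_derivative_inner_left[OF assms[unfolded frechet_derivative_works]], of b]
  by metis

lemma symmetric_second_derivative:
  fixes f :: "'e::euclidean_space \<Rightarrow> 'f::euclidean_space"
  assumes "open S" "smooth_on S f" "x \<in> S"
  shows "frechet_derivative (\<lambda>y. frechet_derivative f (at y) v) (at x) w
       = frechet_derivative (\<lambda>y. frechet_derivative f (at y) w) (at x) v"
proof (rule euclidean_eqI)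
  fix b :: 'f assume "b \<in> Basis"
  have diff: "g differentiable at y" if "smooth_on S g" "y \<in> S" for g :: "'e \<Rightarrow> 'f" and y
    using smooth_on_has_derivative[OF that] by (auto simp: differentiable_def)
  have *: "frechet_derivative (\<lambda>y. frechet_derivative (\<lambda>z. f z \<bullet> b) (at y) v) (at x) w
      = frechet_derivative (\<lambda>y. frechet_derivative f (at y) v) (at x) w \<bullet> b" for v w
  proof -
    have "frechet_derivative (\<lambda>y. frechet_derivative (\<lambda>z. f z \<bullet> b) (at y) v) (at x)
      = frechet_derivative (\<lambda>y. frechet_derivative f (at y) v \<bullet> b) (at x)"
      using assms by (intro frechet_derivative_cong_open[of S]) (auto intro!: frechet_derivative_inner diff)
    then show ?thesis
      using assms by (simp add: frechet_derivative_inner diff smooth_on_frechet_derivative)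
  qed
  have "smooth_on S (\<lambda>z. f z \<bullet> b)"
    using smooth_on_linear_compose[OF bounded_linear_inner_left assms(1,2)] .
  from symmetric_second_derivative_real[OF assms(1) this assms(3)] *
  show "frechet_derivative (\<lambda>y. frechet_derivative f (at y) v) (at x) w \<bullet> b
       = frechet_derivative (\<lambda>y. frechet_derivative f (at y) w) (at x) v \<bullet> b" by metis
qed

section \<open>Poincare lemma for 1-forms on a ball\<close>

text \<open>The function h(x) is the integral of \<gamma> along the segment from c to x.
  Differentiating under the integral and using closedness turns the integrand into the t-derivative
  of t \<gamma>(c + t (x - c)) u.\<close>

lemma poincare_lemma_ball:
  fixes \<gamma> :: "'e::euclidean_space \<Rightarrow> 'e \<Rightarrow> real"
  assumes lin: "\<And>x. x \<in> ball c r \<Longrightarrow> linear (\<gamma> x)"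
    and sm: "\<And>v. smooth_on (ball c r) (\<lambda>x. \<gamma> x v)"
    and closed: "\<And>x v w. x \<in> ball c r \<Longrightarrow>
      frechet_derivative (\<lambda>y. \<gamma> y w) (at x) v = frechet_derivative (\<lambda>y. \<gamma> y v) (at x) w"
  obtains h where "\<And>x. x \<in> ball c r \<Longrightarrow> (h has_derivative \<gamma> x) (at x)"
proof -
  let ?B = "ball c r"
  define q where "q = (\<lambda>(x, t::real). c + t *\<^sub>R (x - c))"
  \<comment> \<open>S is open and contains the ball times [0, 1], so that k has two-sided
    derivatives also at t = 0 and t = 1.\<close>
  define S where "S = q -` ?B"
  define k where "k = (\<lambda>z. \<gamma> (q z) (fst z - c))"
  define h where "h x = integral (cbox 0 1) (\<lambda>t. k (x, t))" for x
  have "(h has_derivative \<gamma> x) (at x)" if x: "x \<in> ?B" for x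
  proof -
    have qc: "continuous_on UNIV q" unfolding q_def split_def by (intro continuous_intros)
    have S: "open S" unfolding S_def using open_vimage[OF open_ball qc] .
    have qB: "q (y, t) \<in> ?B" if "y \<in> ?B" "t \<in> cbox 0 1" for y t
    proof -
      have "norm (t *\<^sub>R (y - c)) \<le> 1 * norm (y - c)" using that by (simp add: mult_left_le_one_le)
      then show ?thesis using that by (simp add: q_def dist_norm norm_minus_commute)
    qed
    have q_sm: "smooth_on S q"
      unfolding q_def split_def
      by (intro smooth_on_add smooth_on_scaleR smooth_on_diff S smooth_on_const
          smooth_on_bounded_linear bounded_linear_fst bounded_linear_snd)
    have k: "smooth_on S k"
      unfolding k_def
    proof (rule smooth_on_linear_family[OF S, where A = "\<lambda>z. \<gamma> (q z)" and V = "\<lambda>z. fst z - c"])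
      show "smooth_on S (\<lambda>z. \<gamma> (q z) v)" for v
        by (rule smooth_on_compose[OF S open_ball sm q_sm]) (auto simp: S_def)
      show "smooth_on S (\<lambda>z. fst z - c)"
        by (intro smooth_on_diff S smooth_on_const smooth_on_bounded_linear[OF bounded_linear_fst])
    qed (auto simp: S_def lin)
    \<comment> \<open>\<open>leibniz_rule\<close> takes the partial derivative as a bounded linear
      map that depends continuously on (y, t).\<close>
    define K where "K y t = Blinfun (\<lambda>u. frechet_derivative k (at (y, t)) (u, 0))" for y t
    have SI: "(y, t) \<in> S" if "y \<in> ?B" "t \<in> cbox 0 1" for y t using qB[OF that] by (simp add: S_def)
    have bl: "bounded_linear (\<lambda>u. frechet_derivative k (at z) (u, 0))" if "z \<in> S" for z
      using has_derivative_bounded_linear[OF smooth_on_has_derivative[OF k that]]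
      by (rule bounded_linear_compose) (auto intro!: bounded_linear_Pair bounded_linear_ident bounded_linear_zero)
    have Kapp: "blinfun_apply (K y t) u = frechet_derivative k (at (y, t)) (u, 0)" if "y \<in> ?B" "t \<in> cbox 0 1" for y t u
      unfolding K_def using bounded_linear_Blinfun_apply[OF bl[OF SI[OF that]]] by simp
    have D1: "((\<lambda>x. k (x, t)) has_derivative blinfun_apply (K y t)) (at y within ?B)"
      if "y \<in> ?B" "t \<in> cbox 0 1" for y t
    proof -
      have "((\<lambda>x. k (x, t)) has_derivative (\<lambda>u. frechet_derivative k (at (y, t)) (u, 0))) (at y)"
        by (rule has_derivative_chain[OF smooth_on_has_derivative[OF k SI[OF that]]])
          (auto intro!: derivative_eq_intros)
      then show ?thesis using Kapp[OF that] by (metis (no_types, lifting) ext has_derivative_at_withinI)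
    qed
    have Kcont: "continuous_on (?B \<times> cbox 0 1) (\<lambda>(y, t). K y t)"
    proof (rule continuous_on_blinfun_componentwise)
      fix b :: 'e
      have "continuous_on (?B \<times> cbox 0 1) (\<lambda>z. frechet_derivative k (at z) (b, 0))"
        using smooth_on_imp_continuous_on[OF smooth_on_frechet_derivative[OF k]]
        by (rule continuous_on_subset) (auto simp: SI simp del: mem_ball)
      then show "continuous_on (?B \<times> cbox 0 1) (\<lambda>z. blinfun_apply (case z of (y, t) \<Rightarrow> K y t) b)"
        by (rule continuous_on_cong[THEN iffD1, rotated 2]) (auto simp: Kapp simp del: mem_ball mem_box)
    qed
    have kint: "(\<lambda>t. k (y, t)) integrable_on cbox 0 1" if "y \<in> ?B" for y
      by (rule integrable_continuous, rule continuous_on_compose2[OF smooth_on_imp_continuous_on[OF k]])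
        (use SI that in \<open>auto intro!: continuous_intros simp del: mem_ball\<close>)
    have hd: "(h has_derivative integral (cbox 0 1) (K x)) (at x within ?B)"
      unfolding h_def[abs_def] by (rule leibniz_rule[OF D1 kint Kcont x convex_ball])
    have "integral (cbox 0 1) (K x) u = \<gamma> x u" for u
    proof -
      have Ki: "K x integrable_on cbox 0 1"
      proof (rule integrable_continuous)
        have "continuous_on (cbox 0 1) (\<lambda>t. case (x, t) of (y, t) \<Rightarrow> K y t)"
          by (rule continuous_on_compose2[OF Kcont]) (use x in \<open>auto intro!: continuous_intros\<close>)
        then show "continuous_on (cbox 0 1) (K x)" by simp
      qed
      have "integral (cbox 0 1) (K x) u = integral (cbox 0 1) (\<lambda>t. K x t u)"
        by (rule blinfun_apply_integral[OF Ki])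
      moreover have "((\<lambda>t. K x t u) has_integral (1 *\<^sub>R \<gamma> (q (x, 1)) u - 0 *\<^sub>R \<gamma> (q (x, 0)) u)) {0..1}"
      proof (rule fundamental_theorem_of_calculus[of 0 1 "\<lambda>t. t *\<^sub>R \<gamma> (q (x, t)) u"])
        fix t :: real assume t: "t \<in> {0..1}"
        let ?y = "q (x, t)"
        have y: "?y \<in> ?B" using qB[OF x] t by auto
        have D: "((\<lambda>z. \<gamma> z w) has_derivative frechet_derivative (\<lambda>z. \<gamma> z w) (at ?y)) (at ?y)" for w
          by (rule smooth_on_has_derivative[OF sm y])
        have Dl: "linear (frechet_derivative (\<lambda>z. \<gamma> z w) (at ?y))" for w using has_derivative_linear[OF D] .
        have "((\<lambda>t. \<gamma> (q (x, t)) u) has_derivative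
            (\<lambda>s. frechet_derivative (\<lambda>z. \<gamma> z u) (at ?y) (s *\<^sub>R (x - c)))) (at t)"
          by (rule has_derivative_chain[OF D]) (auto simp: q_def intro!: derivative_eq_intros)
        then have v: "((\<lambda>t. \<gamma> (q (x, t)) u) has_vector_derivative frechet_derivative (\<lambda>z. \<gamma> z u) (at ?y) (x - c)) (at t)"
          by (simp add: has_vector_derivative_def linear_scale[OF Dl])
        have "((\<lambda>t. t *\<^sub>R \<gamma> (q (x, t)) u) has_vector_derivative
            t *\<^sub>R frechet_derivative (\<lambda>z. \<gamma> z u) (at ?y) (x - c) + 1 *\<^sub>R \<gamma> ?y u) (at t)"
          by (rule has_vector_derivative_scaleR[OF _ v]) (auto intro!: derivative_eq_intros)
        moreover have "K x t u = t *\<^sub>R frechet_derivative (\<lambda>z. \<gamma> z u) (at ?y) (x - c) + 1 *\<^sub>R \<gamma> ?y u"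
        proof -
          have "((\<lambda>y. \<gamma> (q (y, t)) w) has_derivative
            (\<lambda>s. frechet_derivative (\<lambda>z. \<gamma> z w) (at ?y) (t *\<^sub>R s))) (at x)" for w
            by (rule has_derivative_chain[OF D]) (auto simp: q_def intro!: derivative_eq_intros)
          note lf = this
          have "((\<lambda>y. \<gamma> (q (y, t)) (y - c)) has_derivative
            (\<lambda>h. frechet_derivative (\<lambda>z. \<gamma> z (x - c)) (at ?y) (t *\<^sub>R h) + \<gamma> ?y h)) (at x)"
            by (rule has_derivative_linear_family[of ?B x "\<lambda>y. \<gamma> (q (y, t))", OF open_ball x _ lf])
              (use qB t lin in \<open>auto intro!: derivative_eq_intros simp del: mem_ball\<close>)
          moreover have "((\<lambda>y. k (y, t)) has_derivative K x t) (at x)"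
            using D1[OF x, of t] t at_within_open[OF x open_ball] by simp
          ultimately have "blinfun_apply (K x t) = (\<lambda>h. frechet_derivative (\<lambda>z. \<gamma> z (x - c)) (at ?y) (t *\<^sub>R h) + \<gamma> ?y h)"
            unfolding k_def fst_conv by (rule has_derivative_unique[rotated])
          \<comment> \<open>Closedness exchanges the directions u and x - c.\<close>
          then show ?thesis using closed[OF y, of u "x - c"] linear_scale[OF Dl] by simp
        qed
        ultimately show "((\<lambda>t. t *\<^sub>R \<gamma> (q (x, t)) u) has_vector_derivative K x t u) (at t within {0..1})"
          by (metis has_vector_derivative_at_within)
      qed simp
      ultimately show ?thesis by (simp add: integral_unique q_def)
    qed
    then have "blinfun_apply (integral (cbox 0 1) (K x)) = \<gamma> x" by auto
    then show "(h has_derivative \<gamma> x) (at x)"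
      using hd at_within_open[OF x open_ball] by simp
  qed
  then show thesis by (rule that)
qed

section \<open>Ordinary differential equations\<close>

text \<open>Takes the place of Gronwall's inequality. With M the maximum of norm w, the mean value
  inequality bounds the increment by \<delta> (K M + B), and \<delta> K \<le> 1/2 lets half of M be
  absorbed on the left.\<close>

lemma short_time_estimate:
  fixes w :: "real \<Rightarrow> 'e::real_normed_vector"
  defines "S \<equiv> \<lambda>a \<delta>. {a - \<delta>..a + \<delta>}"
  assumes w: "\<And>s. s \<in> S a \<delta> \<Longrightarrow> (w has_vector_derivative w' s) (at s within S a \<delta>)"
    and w': "\<And>s. s \<in> S a \<delta> \<Longrightarrow> norm (w' s) \<le> K * norm (w s) + B"
    and pos: "0 \<le> \<delta>" "0 \<le> K" "0 \<le> B" "\<delta> * K \<le> 1/2" and t: "t \<in> S a \<delta>"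
  shows "norm (w t) \<le> 2 * (norm (w a) + \<delta> * B)"
proof -
  have "continuous_on (S a \<delta>) w"
    using w has_vector_derivative_continuous continuous_on_eq_continuous_within by blast
  then have "continuous_on (S a \<delta>) (\<lambda>s. norm (w s))" by (rule continuous_on_norm)
  then obtain s0 where s0: "s0 \<in> S a \<delta>" "\<And>s. s \<in> S a \<delta> \<Longrightarrow> norm (w s) \<le> norm (w s0)"
    using continuous_attains_sup[of "S a \<delta>" "\<lambda>s. norm (w s)"] t unfolding S_def by fastforce
  let ?M = "norm (w s0)"
  have "norm (w s0 - w a) \<le> (K * ?M + B) * norm (s0 - a)"
  proof (rule differentiable_bound[of "S a \<delta>" w "\<lambda>s h. h *\<^sub>R w' s"])
    fix s assume s: "s \<in> S a \<delta>"
    show "(w has_derivative (\<lambda>h. h *\<^sub>R w' s)) (at s within S a \<delta>)"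
      using w[OF s] by (simp add: has_vector_derivative_def)
    have "norm (w' s) \<le> K * ?M + B"
      using w'[OF s] mult_left_mono[OF s0(2)[OF s] pos(2)] by simp
    then show "onorm (\<lambda>h. h *\<^sub>R w' s) \<le> K * ?M + B"
      by (auto simp: mult.commute[of "K * _ + B"] intro!: onorm_le mult_left_mono)
  qed (use s0 pos in \<open>auto simp: S_def\<close>)
  also have "\<dots> \<le> (K * ?M + B) * \<delta>"
    using s0(1) pos by (intro mult_left_mono) (auto simp: S_def)
  also have "\<dots> = (\<delta> * K) * ?M + \<delta> * B" by (simp add: algebra_simps)
  also have "\<dots> \<le> 1/2 * ?M + \<delta> * B" using pos(4) by (intro add_right_mono mult_right_mono) auto
  finally have "?M \<le> 2 * (norm (w a) + \<delta> * B)"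
    using norm_triangle_ineq2[of "w s0" "w a"] by simp
  then show ?thesis using s0(2)[OF t] by simp
qed

text \<open>Banach's fixed point theorem for the map sending z to y0 plus the integral of F t (z t).
  The bound 1/4 on \<epsilon> K becomes the contraction constant 1/2 through the factor 2 of
  \<open>short_time_estimate\<close>.\<close>

lemma picard_short_time:
  fixes F :: "real \<Rightarrow> 'e::euclidean_space \<Rightarrow> 'e"
  assumes cont: "continuous_on ({-\<epsilon>..\<epsilon>} \<times> UNIV) (\<lambda>(t, y). F t y)"
    and lip: "\<And>t y1 y2. t \<in> {-\<epsilon>..\<epsilon>} \<Longrightarrow> norm (F t y1 - F t y2) \<le> K * norm (y1 - y2)"
    and pos: "0 \<le> \<epsilon>" "0 \<le> K" "\<epsilon> * K \<le> 1/4"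
  obtains y where "y 0 = y0"
    "\<And>t. t \<in> {-\<epsilon>..\<epsilon>} \<Longrightarrow> (y has_vector_derivative F t (y t)) (at t within {-\<epsilon>..\<epsilon>})"
proof -
  let ?S = "{-\<epsilon>..\<epsilon>}"
  \<comment> \<open>The complete space is that of bounded continuous functions on the whole line;
    clamping extends a curve from the interval by its end values.\<close>
  have "\<exists>G::real \<Rightarrow>\<^sub>C 'e. G 0 = y0 \<and> (\<forall>t\<in>?S. (G has_vector_derivative F t (z t)) (at t within ?S))
      \<and> (\<forall>t. G t = G (clamp (-\<epsilon>) \<epsilon> t))" for z :: "real \<Rightarrow>\<^sub>C 'e"
  proof -
    have "continuous_on ?S (\<lambda>t. case (t, z t) of (t, y) \<Rightarrow> F t y)"
      by (rule continuous_on_compose2[OF cont]) (auto intro!: continuous_intros)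
    then have "continuous_on ?S (\<lambda>t. F t (z t))" by simp
    then obtain g where g: "\<And>t. t \<in> ?S \<Longrightarrow> (g has_vector_derivative F t (z t)) (at t within ?S)"
      by (rule antiderivative_continuous) blast
    define h where "h t = y0 + g t - g 0" for t
    have h: "(h has_vector_derivative F t (z t)) (at t within ?S)" if "t \<in> ?S" for t
      unfolding h_def using g[OF that] by (auto intro!: derivative_eq_intros)
    then have "continuous_on (cbox (-\<epsilon>) \<epsilon>) h"
      using has_vector_derivative_continuous continuous_on_eq_continuous_within by (metis box_real(2))
    then obtain G :: "real \<Rightarrow>\<^sub>C 'e" where G: "\<And>x. x \<in> cbox (-\<epsilon>) \<epsilon> \<Longrightarrow> G x = h x"
      "\<And>x. G x = h (clamp (-\<epsilon>) \<epsilon> x)" using continuous_on_cbox_bcontfunE by blast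
    have "(G has_vector_derivative F t (z t)) (at t within ?S)" if "t \<in> ?S" for t
      by (rule has_vector_derivative_transform[OF that _ h[OF that]]) (simp add: G(1))
    moreover have "clamp (-\<epsilon>) \<epsilon> t \<in> cbox (-\<epsilon>) \<epsilon>" for t using pos(1) by (intro clamp_in_interval) auto
    ultimately show ?thesis using G pos(1) by (intro exI[of _ G]) (auto simp: h_def)
  qed
  then obtain T :: "(real \<Rightarrow>\<^sub>C 'e) \<Rightarrow> (real \<Rightarrow>\<^sub>C 'e)" where T: "\<And>z. T z 0 = y0"
    "\<And>z t. t \<in> ?S \<Longrightarrow> (T z has_vector_derivative F t (z t)) (at t within ?S)"
    "\<And>z t. T z t = T z (clamp (-\<epsilon>) \<epsilon> t)" by metis
  have "dist (T z1) (T z2) \<le> (1/2) * dist z1 z2" for z1 z2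
  proof (rule dist_bound)
    fix t0
    define t where "t = clamp (-\<epsilon>) \<epsilon> t0"
    have "t \<in> cbox (-\<epsilon>) \<epsilon>" unfolding t_def using pos(1) by (intro clamp_in_interval) auto
    then have t: "t \<in> {0 - \<epsilon>..0 + \<epsilon>}" by simp
    \<comment> \<open>The difference of the derivatives is already bounded by K * dist z1 z2, so the
      estimate is used with growth constant 0.\<close>
    have "norm (T z1 t - T z2 t) \<le> 2 * (norm (T z1 0 - T z2 0) + \<epsilon> * (K * dist z1 z2))"
    proof (rule short_time_estimate[of 0 \<epsilon> "\<lambda>t. T z1 t - T z2 t" "\<lambda>t. F t (z1 t) - F t (z2 t)" 0])
      fix s assume s: "s \<in> {0 - \<epsilon>..0 + \<epsilon>}"
      then have "norm (F s (z1 s) - F s (z2 s)) \<le> K * norm (z1 s - z2 s)" by (intro lip) auto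
      also have "\<dots> \<le> K * dist z1 z2"
        using dist_bounded[of z1 s z2] pos(2) by (intro mult_left_mono) (simp_all add: dist_norm)
      finally show "norm (F s (z1 s) - F s (z2 s)) \<le> 0 * norm (T z1 s - T z2 s) + K * dist z1 z2" by simp
    qed (use t pos in \<open>auto intro!: has_vector_derivative_diff T(2)\<close>)
    also have "\<dots> = 2 * (\<epsilon> * K) * dist z1 z2" by (simp add: T(1))
    also have "\<dots> \<le> (1/2) * dist z1 z2" using pos(3) by (intro mult_right_mono) auto
    finally show "dist (T z1 t0) (T z2 t0) \<le> (1/2) * dist z1 z2"
      using T(3)[of z1 t0] T(3)[of z2 t0] by (simp add: t_def dist_norm)
  qed
  then obtain y where "T y = y" using banach_fix_type[of "1/2" T] by auto
  then show thesis using that[of y] T(1,2) by metis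
qed

section \<open>Uniform first-order approximation along compact sets\<close>

text \<open>The radius is a Lebesgue number of a cover of C. Unlike in uniform continuity on C, one
  of the two points may lie off C.\<close>

lemma compact_uniform_continuity:
  fixes f :: "'a::metric_space \<Rightarrow> 'b::metric_space"
  assumes "compact C" "C \<subseteq> S" "open S" "continuous_on S f" "0 < \<eta>"
  obtains \<rho> where "0 < \<rho>" "\<And>c z. c \<in> C \<Longrightarrow> dist c z < \<rho> \<Longrightarrow> z \<in> S \<and> dist (f z) (f c) < \<eta>"
proof -
  have "\<exists>U. open U \<and> c \<in> U \<and> U \<subseteq> S \<and> (\<forall>z\<in>U. dist (f z) (f c) < \<eta>/2)" if "c \<in> C" for c
  proof -
    have "open (f -` ball (f c) (\<eta>/2) \<inter> S)"
      by (rule continuous_on_open_vimage[OF assms(3), THEN iffD1, rule_format, OF assms(4) open_ball])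
    then show ?thesis using assms that
      by (intro exI[of _ "f -` ball (f c) (\<eta>/2) \<inter> S"]) (auto simp: dist_commute)
  qed
  then obtain U where U: "\<And>c. c \<in> C \<Longrightarrow> open (U c) \<and> c \<in> U c \<and> U c \<subseteq> S \<and> (\<forall>z\<in>U c. dist (f z) (f c) < \<eta>/2)"
    by metis
  obtain \<rho> where \<rho>: "0 < \<rho>" "\<And>c. c \<in> C \<Longrightarrow> \<exists>G\<in>U ` C. ball c \<rho> \<subseteq> G"
    using Heine_Borel_lemma[of C "U ` C"] assms(1) U by blast
  show thesis
  proof (rule that[OF \<rho>(1)])
    fix c z assume c: "c \<in> C" "dist c z < \<rho>"
    obtain c' where c': "c' \<in> C" "ball c \<rho> \<subseteq> U c'" using \<rho>(2)[OF c(1)] by blast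
    have zc: "z \<in> U c'" "c \<in> U c'" using c' c \<rho>(1) by auto
    show "z \<in> S \<and> dist (f z) (f c) < \<eta>"
    proof
      have 1: "dist (f z) (f c') < \<eta>/2" "dist (f c) (f c') < \<eta>/2" and "U c' \<subseteq> S"
        using U[OF c'(1)] zc by blast+
      then show "z \<in> S" using zc by blast
      show "dist (f z) (f c) < \<eta>" using 1 by (rule dist_triangle_half_l)
    qed
  qed
qed

lemma Ck_on_continuous_Blinfun:
  fixes f :: "'a::euclidean_space \<Rightarrow> 'b::real_normed_vector"
  assumes "Ck_on (Suc 0) S f"
  shows "continuous_on S (\<lambda>x. Blinfun (frechet_derivative f (at x)))"
proof (rule continuous_on_blinfun_componentwise)
  fix b :: 'a
  have "blinfun_apply (Blinfun (frechet_derivative f (at x))) = frechet_derivative f (at x)" if "x \<in> S" for x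
    using has_derivative_bounded_linear[OF Ck_on_SucD(1)[OF assms that]] by (rule bounded_linear_Blinfun_apply)
  then show "continuous_on S (\<lambda>x. blinfun_apply (Blinfun (frechet_derivative f (at x))) b)"
    using assms by (simp cong: continuous_on_cong)
qed

lemma compact_derivative_bound:
  fixes f :: "'a::euclidean_space \<Rightarrow> 'b::real_normed_vector"
  assumes f: "Ck_on (Suc 0) S f" and C: "compact C" "C \<subseteq> S"
  obtains L where "0 \<le> L" "\<And>c v :: 'a. c \<in> C \<Longrightarrow> norm (frechet_derivative f (at c) v) \<le> L * norm v"
proof -
  let ?D = "\<lambda>x. Blinfun (frechet_derivative f (at x))"
  have app: "blinfun_apply (?D x) = frechet_derivative f (at x)" if "x \<in> S" for x
    using has_derivative_bounded_linear[OF Ck_on_SucD(1)[OF f that]] by (rule bounded_linear_Blinfun_apply)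
  have "compact (?D ` C)"
    using Ck_on_continuous_Blinfun[OF f] C by (meson compact_continuous_image continuous_on_subset)
  then obtain L where L: "L > 0" "\<And>c. c \<in> C \<Longrightarrow> norm (?D c) \<le> L"
    using compact_imp_bounded[of "?D ` C"] by (auto simp: bounded_pos)
  have "norm (frechet_derivative f (at c) v) \<le> L * norm v" if "c \<in> C" for c v
    using norm_blinfun[of "?D c" v] mult_right_mono[OF L(2)[OF that], of "norm v"] app[of c] that C(2) by auto
  then show thesis using L(1) by (intro that[of L]) auto
qed

text \<open>The mean value inequality for f minus its linearisation, combined with uniform
  continuity of the derivative near C. Uniformity over C is what allows its use along a whole
  integral curve.\<close>

lemma uniform_linear_approximation:
  fixes f :: "'a::euclidean_space \<Rightarrow> 'b::real_normed_vector"
  assumes f: "Ck_on (Suc 0) S f" and S: "open S" and C: "compact C" "C \<subseteq> S" and \<eta>: "0 < \<eta>"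
  obtains \<rho> where "0 < \<rho>" "\<And>c v :: 'a. c \<in> C \<Longrightarrow> norm v < \<rho> \<Longrightarrow>
    c + v \<in> S \<and> norm (f (c + v) - f c - frechet_derivative f (at c) v) \<le> \<eta> * norm v"
proof -
  let ?D = "\<lambda>x. Blinfun (frechet_derivative f (at x))"
  have bl: "bounded_linear (frechet_derivative f (at x))" if "x \<in> S" for x
    using has_derivative_bounded_linear[OF Ck_on_SucD(1)[OF f that]] .
  have app: "blinfun_apply (?D x) = frechet_derivative f (at x)" if "x \<in> S" for x
    using bl[OF that] by (rule bounded_linear_Blinfun_apply)
  obtain \<rho> where \<rho>: "0 < \<rho>" "\<And>c z. c \<in> C \<Longrightarrow> dist c z < \<rho> \<Longrightarrow> z \<in> S \<and> dist (?D z) (?D c) < \<eta>"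
    using compact_uniform_continuity[OF C S Ck_on_continuous_Blinfun[OF f] \<eta>] by blast
  show thesis
  proof (rule that[OF \<rho>(1)])
    fix c v :: 'a assume c: "c \<in> C" and v: "norm v < \<rho>"
    have "norm (f (c + v) - f c - frechet_derivative f (at c) (c + v - c)) \<le> norm (c + v - c) * \<eta>"
    proof (rule differentiable_bound_linearization[of c "c + v" "ball c \<rho>"])
      show "c + t *\<^sub>R (c + v - c) \<in> ball c \<rho>" if "t \<in> {0..1}" for t
        using that v by (simp add: dist_norm) (metis le_less_trans mult_left_le_one_le norm_ge_zero)
      fix x assume "x \<in> ball c \<rho>"
      then have x: "x \<in> S" "dist (?D x) (?D c) < \<eta>" using \<rho>(2)[OF c] by auto
      show "(f has_derivative frechet_derivative f (at x)) (at x within ball c \<rho>)"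
        using Ck_on_SucD(1)[OF f x(1)] by (rule has_derivative_at_withinI)
      have "norm (blinfun_apply (?D x - ?D c) h) \<le> \<eta> * norm h" for h
        using norm_blinfun[of "?D x - ?D c" h] x(2) mult_right_mono[of "norm (?D x - ?D c)" \<eta> "norm h"]
        by (simp add: dist_norm)
      then show "onorm (frechet_derivative f (at x) - frechet_derivative f (at c)) \<le> \<eta>"
        using \<eta> c C(2) x(1) by (intro onorm_le) (auto simp: app blinfun.diff_left subset_iff)
    qed (use \<rho>(1) in auto)
    moreover have "c + v \<in> S" using \<rho>(2)[OF c, of "c + v"] v by (simp add: dist_norm)
    ultimately show "c + v \<in> S \<and> norm (f (c + v) - f c - frechet_derivative f (at c) v) \<le> \<eta> * norm v"
      by (simp add: mult.commute)
  qed
qed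

text \<open>Converse of the mean value inequality; transfers the Lipschitz constant of a right-hand
  side to its linearisation.\<close>

lemma derivative_bound_of_lipschitz:
  fixes f :: "'a::real_normed_vector \<Rightarrow> 'b::real_normed_vector"
  assumes D: "(f has_derivative D) (at x)" and Y: "open Y" "x \<in> Y"
    and lip: "\<And>y. y \<in> Y \<Longrightarrow> norm (f y - f x) \<le> K * norm (y - x)"
  shows "norm (D v) \<le> K * norm v"
proof (cases "v = 0")
  case True
  then show ?thesis using has_derivative_bounded_linear[OF D] by (simp add: linear_simps)
next
  case False
  interpret D: bounded_linear D using has_derivative_bounded_linear[OF D] .
  have "norm (D v) / norm v \<le> K + e" if e: "0 < e" for e
  proof -
    obtain d where d: "d > 0" "\<And>y. norm (y - x) < d \<Longrightarrow> norm (f y - f x - D (y - x)) \<le> e * norm (y - x)"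
      using D[unfolded has_derivative_at_alt, THEN conjunct2, rule_format, OF e] by blast
    obtain r where r: "r > 0" "ball x r \<subseteq> Y" using Y open_contains_ball by blast
    define s where "s = min d r / (2 * norm v)"
    have s: "s > 0" using d r False by (simp add: s_def)
    define y where "y = x + s *\<^sub>R v"
    have yx: "norm (y - x) = s * norm v" using s by (simp add: y_def)
    also have "\<dots> < min d r" using d r False by (simp add: s_def min_less_iff_disj)
    finally have lt: "norm (y - x) < d" "y \<in> Y" using r(2) by (auto simp: dist_norm norm_minus_commute)
    have "s * norm (D v) = norm (D (y - x))" using s by (simp add: y_def D.scaleR)
    also have "\<dots> \<le> norm (f y - f x) + norm (f y - f x - D (y - x))"
      using norm_triangle_ineq4[of "f y - f x" "f y - f x - D (y - x)"] by simp
    also have "\<dots> \<le> K * norm (y - x) + e * norm (y - x)" using lip[OF lt(2)] d(2)[OF lt(1)] by simp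
    also have "\<dots> = s * ((K + e) * norm v)" by (simp add: yx algebra_simps)
    finally have "norm (D v) \<le> (K + e) * norm v" using s by simp
    then show ?thesis using False by (simp add: divide_le_eq)
  qed
  then have "norm (D v) / norm v \<le> K" by (rule field_le_epsilon)
  then show ?thesis using False by (simp add: divide_le_eq)
qed

section \<open>Differentiable dependence on parameters\<close>

text \<open>The initial value y (0, p) is an arbitrary function of the parameter, so dependence on
  initial points is included. The bound on \<epsilon> * K makes \<open>short_time_estimate\<close>
  applicable on every interval [-\<delta>, \<delta>] with \<delta> < \<epsilon>.\<close>

locale ode_family =
  fixes \<epsilon> K :: real and P :: "'p::euclidean_space set" and Y :: "'e::euclidean_space set"
    and F :: "real \<times> 'p \<times> 'e \<Rightarrow> 'e" and y :: "real \<times> 'p \<Rightarrow> 'e"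
  assumes pos: "0 < \<epsilon>" "0 \<le> K" "\<epsilon> * K \<le> 1/4"
    and opens: "open P" "open Y"
    and lip: "\<And>t p y1 y2. t \<in> {-\<epsilon><..<\<epsilon>} \<Longrightarrow> p \<in> P \<Longrightarrow> y1 \<in> Y \<Longrightarrow> y2 \<in> Y \<Longrightarrow>
      norm (F (t, p, y1) - F (t, p, y2)) \<le> K * norm (y1 - y2)"
    and mem: "\<And>t p. t \<in> {-\<epsilon><..<\<epsilon>} \<Longrightarrow> p \<in> P \<Longrightarrow> y (t, p) \<in> Y"
    and ode: "\<And>t p. t \<in> {-\<epsilon><..<\<epsilon>} \<Longrightarrow> p \<in> P \<Longrightarrow>
      ((\<lambda>s. y (s, p)) has_vector_derivative F (t, p, y (t, p))) (at t)"
begin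

abbreviation "I \<equiv> {-\<epsilon><..<\<epsilon>}"
abbreviation "D \<equiv> I \<times> P \<times> Y"

lemma open_D: "open D" "open (I \<times> P)"
  using opens by (auto intro!: open_Times)

lemma continuous_curve: "p \<in> P \<Longrightarrow> continuous_on I (\<lambda>t. y (t, p))"
  by (rule continuous_at_imp_continuous_on) (use has_vector_derivative_continuous[OF ode] in blast)

lemma compact_curve:
  assumes "\<delta> < \<epsilon>" "p \<in> P"
  shows "compact ((\<lambda>s. (s, p, y (s, p))) ` {-\<delta>..\<delta>})" "(\<lambda>s. (s, p, y (s, p))) ` {-\<delta>..\<delta>} \<subseteq> D"
proof -
  have sub: "{-\<delta>..\<delta>} \<subseteq> I" using assms(1) by auto
  then show "(\<lambda>s. (s, p, y (s, p))) ` {-\<delta>..\<delta>} \<subseteq> D" using assms(2) mem by blast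
  show "compact ((\<lambda>s. (s, p, y (s, p))) ` {-\<delta>..\<delta>})"
    by (intro compact_continuous_image continuous_on_Pair continuous_on_id continuous_on_const
        continuous_on_subset[OF continuous_curve sub] assms compact_Icc)
qed

text \<open>The difference of the right-hand sides splits into a Lipschitz part and the effect of
  replacing p by q at points of the p-curve; only the latter, B, is an inhomogeneity.\<close>

lemma difference_estimate:
  assumes \<delta>: "0 \<le> \<delta>" "\<delta> < \<epsilon>" and p: "p \<in> P" "q \<in> P" and B: "0 \<le> B"
    and b: "\<And>s. s \<in> {-\<delta>..\<delta>} \<Longrightarrow> norm (F (s, q, y (s, p)) - F (s, p, y (s, p))) \<le> B"
    and t: "t \<in> {-\<delta>..\<delta>}"
  shows "norm (y (t, q) - y (t, p)) \<le> 2 * (norm (y (0, q) - y (0, p)) + \<epsilon> * B)"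
proof -
  have "\<delta> * K \<le> \<epsilon> * K" using \<delta> pos by (intro mult_right_mono) auto
  then have \<delta>K: "\<delta> * K \<le> 1/2" using pos by simp
  have "norm (y (t, q) - y (t, p)) \<le> 2 * (norm (y (0, q) - y (0, p)) + \<delta> * B)"
  proof (rule short_time_estimate[of 0 \<delta> "\<lambda>t. y (t, q) - y (t, p)"
        "\<lambda>t. F (t, q, y (t, q)) - F (t, p, y (t, p))" K B t])
    fix s assume "s \<in> {0 - \<delta>..0 + \<delta>}"
    then have s: "s \<in> I" "s \<in> {-\<delta>..\<delta>}" using \<delta> by auto
    show "((\<lambda>t. y (t, q) - y (t, p)) has_vector_derivative F (s, q, y (s, q)) - F (s, p, y (s, p)))
        (at s within {0 - \<delta>..0 + \<delta>})"
      by (intro has_vector_derivative_diff has_vector_derivative_at_within[OF ode] s p)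
    have "norm (F (s, q, y (s, q)) - F (s, p, y (s, p)))
        \<le> norm (F (s, q, y (s, q)) - F (s, q, y (s, p))) + norm (F (s, q, y (s, p)) - F (s, p, y (s, p)))"
      using norm_triangle_ineq[of "F (s, q, y (s, q)) - F (s, q, y (s, p))" "F (s, q, y (s, p)) - F (s, p, y (s, p))"]
      by simp
    also have "\<dots> \<le> K * norm (y (s, q) - y (s, p)) + B"
      using s p by (intro add_mono lip mem b)
    finally show "norm (F (s, q, y (s, q)) - F (s, p, y (s, p))) \<le> K * norm (y (s, q) - y (s, p)) + B" .
  qed (use \<delta> \<delta>K t pos B in auto)
  also have "\<dots> \<le> 2 * (norm (y (0, q) - y (0, p)) + \<epsilon> * B)"
    using \<delta> B by (auto intro: mult_right_mono)
  finally show ?thesis .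
qed

text \<open>Moving p changes the right-hand side by less than B, uniformly along the compact curve
  of p0, and \<open>difference_estimate\<close> integrates this.\<close>

lemma continuous_dependence:
  assumes F: "continuous_on D F" and y0: "continuous_on P (\<lambda>p. y (0, p))"
  shows "continuous_on (I \<times> P) y"
proof (rule continuous_at_imp_continuous_on, safe)
  fix t0 p0 assume t0: "t0 \<in> I" and p0: "p0 \<in> P"
  \<comment> \<open>A radius strictly between |t0| and \<epsilon>, leaving room for t near t0 inside
    a compact interval.\<close>
  define \<delta> where "\<delta> = (\<bar>t0\<bar> + \<epsilon>) / 2"
  have \<delta>: "0 \<le> \<delta>" "\<delta> < \<epsilon>" "\<bar>t0\<bar> < \<delta>" using t0 by (auto simp: \<delta>_def)
  show "isCont y (t0, p0)"
    unfolding continuous_at_eps_delta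
  proof safe
    fix \<eta> :: real assume \<eta>: "0 < \<eta>"
    \<comment> \<open>Chosen so that 2 (\<eta>/8 + \<epsilon> B) \<le> \<eta>/2; the other half of
      \<eta> pays for moving t.\<close>
    define B where "B = \<eta> / (8 * (\<epsilon> + 1))"
    have B: "0 < B" "\<epsilon> * B \<le> \<eta> / 8" using \<eta> pos by (auto simp: B_def field_simps)
    obtain \<rho> where \<rho>: "0 < \<rho>" "\<And>c z. c \<in> (\<lambda>s. (s, p0, y (s, p0))) ` {-\<delta>..\<delta>} \<Longrightarrow> dist c z < \<rho> \<Longrightarrow>
        z \<in> D \<and> dist (F z) (F c) < B"
      using compact_uniform_continuity[OF compact_curve[OF \<delta>(2) p0] open_D(1) F B(1)] by blast
    have "isCont (\<lambda>p. y (0, p)) p0" using y0 p0 opens continuous_on_eq_continuous_at by blast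
    then obtain d1 where d1: "d1 > 0" "\<And>p. dist p p0 < d1 \<Longrightarrow> dist (y (0, p)) (y (0, p0)) < \<eta> / 8"
      unfolding continuous_at_eps_delta using \<eta> by (metis divide_pos_pos zero_less_numeral)
    have "isCont (\<lambda>t. y (t, p0)) t0"
      using has_vector_derivative_continuous[OF ode[OF t0 p0]] .
    then obtain d2 where d2: "d2 > 0" "\<And>t. dist t t0 < d2 \<Longrightarrow> dist (y (t, p0)) (y (t0, p0)) < \<eta> / 2"
      unfolding continuous_at_eps_delta using \<eta> by (metis half_gt_zero)
    define d where "d = min (min \<rho> d1) (min d2 (\<delta> - \<bar>t0\<bar>))"
    show "\<exists>d>0. \<forall>x'. dist x' (t0, p0) < d \<longrightarrow> dist (y x') (y (t0, p0)) < \<eta>"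
    proof (intro exI conjI allI impI)
      show "0 < d" using \<rho> d1 d2 \<delta> by (auto simp: d_def)
      fix z assume z: "dist z (t0, p0) < d"
      obtain t p where tp: "z = (t, p)" by (cases z)
      have dt: "dist t t0 < d" "dist p p0 < d"
        using z dist_fst_le[of z "(t0, p0)"] dist_snd_le[of z "(t0, p0)"] tp by auto
      have t: "t \<in> {-\<delta>..\<delta>}" using dt(1) by (auto simp: d_def dist_real_def)
      have near: "(s, p, y (s, p0)) \<in> D \<and> dist (F (s, p, y (s, p0))) (F (s, p0, y (s, p0))) < B"
        if "s \<in> {-\<delta>..\<delta>}" for s
        by (rule \<rho>(2)) (use that dt(2) in \<open>auto simp: d_def dist_Pair_Pair dist_commute\<close>)
      have p: "p \<in> P" using near[of 0] \<delta> by auto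
      have "norm (y (t, p) - y (t, p0)) \<le> 2 * (norm (y (0, p) - y (0, p0)) + \<epsilon> * B)"
        using near B by (intro difference_estimate[OF \<delta>(1,2) p0 p _ _ t]) (auto simp: dist_norm less_imp_le)
      also have "\<dots> < \<eta> / 2" using d1(2)[of p] dt(2) B by (auto simp: d_def dist_norm)
      finally have "dist (y (t, p)) (y (t, p0)) < \<eta> / 2" by (simp add: dist_norm)
      moreover have "dist (y (t, p0)) (y (t0, p0)) < \<eta> / 2" using d2(2) dt(1) by (auto simp: d_def)
      ultimately show "dist (y z) (y (t0, p0)) < \<eta>"
        unfolding tp using dist_triangle[of "y (t, p)" "y (t0, p0)" "y (t, p0)"] by simp
    qed
  qed
qed

text \<open>Right-hand side of the variational equation along the known curve: u is the direction in
  parameter space, z the unknown variation.\<close>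

abbreviation "G \<equiv> \<lambda>u (t, p, z). frechet_derivative F (at (t, p, y (t, p))) (0, u, z)"

text \<open>The variational equation inherits the constant K, so existence and dependence on
  parameters hold for it under the same bound on the length of the interval.\<close>

lemma G_diff:
  assumes F: "Ck_on (Suc 0) D F" and t: "t \<in> I" and p: "p \<in> P"
  shows "norm (G u (t, p, z1) - G u (t, p, z2)) \<le> K * norm (z1 - z2)"
proof -
  let ?c = "(t, p, y (t, p))"
  have c: "?c \<in> D" using t p mem by auto
  note DF = Ck_on_SucD(1)[OF F c]
  have "((\<lambda>z. F (t, p, z)) has_derivative (\<lambda>h. frechet_derivative F (at ?c) (0, 0, h))) (at (y (t, p)))"
    by (rule has_derivative_chain[OF DF])
      (auto intro!: derivative_eq_intros)
  from derivative_bound_of_lipschitz[OF this opens(2) mem[OF t p], of K "z1 - z2"] lip[OF t p _ mem[OF t p]]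
  have "norm (frechet_derivative F (at ?c) (0, 0, z1 - z2)) \<le> K * norm (z1 - z2)" by blast
  moreover have "frechet_derivative F (at ?c) (0, 0, z1 - z2)
      = frechet_derivative F (at ?c) (0, u, z1) - frechet_derivative F (at ?c) (0, u, z2)"
    using linear_diff[OF has_derivative_linear[OF DF], of "(0, u, z1)" "(0, u, z2)"] by simp
  ultimately show ?thesis by simp
qed

text \<open>The remainder r = y(q) - y(p) - z has a derivative bounded by K norm r + B, where B is
  small compared with norm h because F is approximated linearly, uniformly along the curve.\<close>

lemma parameter_derivative:
  assumes F: "Ck_on (Suc 0) D F" and y0: "Ck_on (Suc 0) P (\<lambda>p. y (0, p))"
    and \<delta>: "0 < \<delta>" "\<delta> < \<epsilon>"
    and z0: "\<And>u p. p \<in> P \<Longrightarrow> z u (0, p) = frechet_derivative (\<lambda>p. y (0, p)) (at p) u"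
    and z: "\<And>u t p. t \<in> {-\<delta>..\<delta>} \<Longrightarrow> p \<in> P \<Longrightarrow>
      ((\<lambda>s. z u (s, p)) has_vector_derivative G u (t, p, z u (t, p))) (at t within {-\<delta>..\<delta>})"
    and t: "t \<in> {-\<delta>..\<delta>}" and p: "p \<in> P"
  shows "((\<lambda>p. y (t, p)) has_derivative (\<lambda>u. z u (t, p))) (at p)"
proof -
  let ?C = "(\<lambda>s. (s, p, y (s, p))) ` {-\<delta>..\<delta>}"
  note C = compact_curve[OF \<delta>(2) p]
  have \<delta>K: "\<delta> * K \<le> 1/2" using \<delta> pos mult_right_mono[of \<delta> \<epsilon> K] by simp
  have cD: "(s, p, y (s, p)) \<in> D" if "s \<in> {-\<delta>..\<delta>}" for s
    using subsetD[OF C(2) imageI[OF that]] by simp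
  have sI: "s \<in> I" if "s \<in> {-\<delta>..\<delta>}" for s using \<delta> that by auto
  have Dlin: "linear (frechet_derivative F (at (s, p, y (s, p))))" if "s \<in> {-\<delta>..\<delta>}" for s
    using linear_frechet_derivative_Ck[OF F cD[OF that]] .
  have D0lin: "linear (frechet_derivative (\<lambda>p. y (0, p)) (at p))"
    using linear_frechet_derivative_Ck[OF y0 p] .
  \<comment> \<open>Uniqueness for the homogeneous variational equation; it yields additivity and
    homogeneity of z in u.\<close>
  have vanish: "w t = 0"
    if w0: "w 0 = 0" and w: "\<And>s. s \<in> {-\<delta>..\<delta>} \<Longrightarrow>
      (w has_vector_derivative frechet_derivative F (at (s, p, y (s, p))) (0, 0, w s)) (at s within {-\<delta>..\<delta>})"
    for w :: "real \<Rightarrow> 'e"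
  proof -
    have "norm (w t) \<le> 2 * (norm (w 0) + \<delta> * 0)"
    proof (rule short_time_estimate[of 0 \<delta> w "\<lambda>s. frechet_derivative F (at (s, p, y (s, p))) (0, 0, w s)" K 0 t])
      fix s assume "s \<in> {0 - \<delta>..0 + \<delta>}"
      then have s: "s \<in> {-\<delta>..\<delta>}" by simp
      show "norm (frechet_derivative F (at (s, p, y (s, p))) (0, 0, w s)) \<le> K * norm (w s) + 0"
        using G_diff[OF F sI[OF s] p, of 0 "w s" 0] linear_0[OF Dlin[OF s]] by (simp add: zero_prod_def)
    qed (use w t \<delta> \<delta>K pos in auto)
    then show ?thesis using w0 by simp
  qed
  have lin: "linear (\<lambda>u. z u (t, p))"
  proof (rule linearI)
    fix u v
    have "z (u + v) (t, p) - z u (t, p) - z v (t, p) = 0"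
    proof (rule vanish)
      show "z (u + v) (0, p) - z u (0, p) - z v (0, p) = 0" using p by (simp add: z0 linear_add[OF D0lin])
      fix s assume s: "s \<in> {-\<delta>..\<delta>}"
      have "frechet_derivative F (at (s, p, y (s, p))) (0, 0, z (u + v) (s, p) - z u (s, p) - z v (s, p))
        = G (u + v) (s, p, z (u + v) (s, p)) - G u (s, p, z u (s, p)) - G v (s, p, z v (s, p))"
        by (simp add: linear_diff[OF Dlin[OF s], symmetric])
      then show "((\<lambda>s. z (u + v) (s, p) - z u (s, p) - z v (s, p)) has_vector_derivative
        frechet_derivative F (at (s, p, y (s, p))) (0, 0, z (u + v) (s, p) - z u (s, p) - z v (s, p)))
        (at s within {-\<delta>..\<delta>})"
        using has_vector_derivative_diff[OF has_vector_derivative_diff[OF z[OF s p, of "u + v"] z[OF s p, of u]] z[OF s p, of v]]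
        by (simp only:)
    qed
    then show "z (u + v) (t, p) = z u (t, p) + z v (t, p)" by (simp add: algebra_simps)
  next
    fix r u
    have "z (r *\<^sub>R u) (t, p) - r *\<^sub>R z u (t, p) = 0"
    proof (rule vanish)
      show "z (r *\<^sub>R u) (0, p) - r *\<^sub>R z u (0, p) = 0" using p by (simp add: z0 linear_scale[OF D0lin])
      fix s assume s: "s \<in> {-\<delta>..\<delta>}"
      have "frechet_derivative F (at (s, p, y (s, p))) (0, 0, z (r *\<^sub>R u) (s, p) - r *\<^sub>R z u (s, p))
        = G (r *\<^sub>R u) (s, p, z (r *\<^sub>R u) (s, p)) - r *\<^sub>R G u (s, p, z u (s, p))"
        by (simp add: linear_diff[OF Dlin[OF s], symmetric] linear_scale[OF Dlin[OF s], symmetric])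
      then show "((\<lambda>s. z (r *\<^sub>R u) (s, p) - r *\<^sub>R z u (s, p)) has_vector_derivative
        frechet_derivative F (at (s, p, y (s, p))) (0, 0, z (r *\<^sub>R u) (s, p) - r *\<^sub>R z u (s, p)))
        (at s within {-\<delta>..\<delta>})"
        using has_vector_derivative_diff[OF z[OF s p, of "r *\<^sub>R u"]
          has_vector_derivative_scaleR[OF DERIV_const z[OF s p, of u], of r]] by simp
    qed
    then show "z (r *\<^sub>R u) (t, p) = r *\<^sub>R z u (t, p)" by simp
  qed
  obtain L where L: "0 \<le> L" "\<And>c v. c \<in> ?C \<Longrightarrow> norm (frechet_derivative F (at c) v) \<le> L * norm v"
    using compact_derivative_bound[OF F C] by blast
  have cp: "compact {p}" "{p} \<subseteq> P" "p \<in> {p}" using p by auto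
  obtain L0 where L0: "0 \<le> L0" "\<And>c v. c \<in> {p} \<Longrightarrow> norm (frechet_derivative (\<lambda>p. y (0, p)) (at c) v) \<le> L0 * norm v"
    by (rule compact_derivative_bound[OF y0 cp(1,2)]) blast
  obtain \<rho>1 where \<rho>1: "0 < \<rho>1" "\<And>c v. c \<in> ?C \<Longrightarrow> norm v < \<rho>1 \<Longrightarrow>
    c + v \<in> D \<and> norm (F (c + v) - F c - frechet_derivative F (at c) v) \<le> 1 * norm v"
    by (rule uniform_linear_approximation[OF F open_D(1) C zero_less_one]) blast
  obtain \<rho>2 where \<rho>2: "0 < \<rho>2" "\<And>c v. c \<in> {p} \<Longrightarrow> norm v < \<rho>2 \<Longrightarrow>
    c + v \<in> P \<and> norm (y (0, c + v) - y (0, c) - frechet_derivative (\<lambda>p. y (0, p)) (at c) v) \<le> 1 * norm v"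
    by (rule uniform_linear_approximation[OF y0 opens(1) cp(1,2) zero_less_one]) blast
  \<comment> \<open>The Lipschitz constant that \<open>difference_estimate\<close> yields from 1 +
    L0 for the initial values and 1 + L for the parameter dependence of F; the summands 1 are the
    tolerances of the two linear approximations.\<close>
  define A where "A = 2 * ((1 + L0) + \<epsilon> * (1 + L))"
  have A: "0 \<le> A" using L L0 pos by (simp add: A_def)
  have growth: "norm (y (s, p + h) - y (s, p)) \<le> A * norm h"
    if h: "norm h < min \<rho>1 \<rho>2" and s: "s \<in> {-\<delta>..\<delta>}" for h s
  proof -
    have "norm (y (s, p + h) - y (s, p)) \<le> 2 * (norm (y (0, p + h) - y (0, p)) + \<epsilon> * ((1 + L) * norm h))"
    proof (rule difference_estimate[OF _ \<delta>(2) p _ _ _ s])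
      show "p + h \<in> P" using \<rho>2(2)[OF cp(3), of h] h by auto
      fix s assume s: "s \<in> {-\<delta>..\<delta>}"
      let ?c = "(s, p, y (s, p))"
      have "norm (F (?c + (0, h, 0)) - F ?c - frechet_derivative F (at ?c) (0, h, 0)) \<le> 1 * norm (0::real, h, 0::'e)"
        using \<rho>1(2)[of ?c "(0, h, 0)"] h s by (auto simp: norm_Pair)
      moreover have "norm (frechet_derivative F (at ?c) (0, h, 0)) \<le> L * norm h"
        using L(2)[of ?c "(0, h, 0)"] s by (auto simp: norm_Pair)
      ultimately show "norm (F (s, p + h, y (s, p)) - F (s, p, y (s, p))) \<le> (1 + L) * norm h"
        using norm_triangle_sub[of "F (s, p + h, y (s, p)) - F (s, p, y (s, p))" "frechet_derivative F (at ?c) (0, h, 0)"]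
        by (simp add: norm_Pair algebra_simps)
    qed (use \<delta> L in auto)
    also have "norm (y (0, p + h) - y (0, p)) \<le> (1 + L0) * norm h"
      using \<rho>2(2)[OF cp(3), of h] h L0(2)[OF cp(3), of h] norm_triangle_sub[of "y (0, p + h) - y (0, p)" "frechet_derivative (\<lambda>p. y (0, p)) (at p) h"]
      by (simp add: algebra_simps)
    finally show ?thesis by (simp add: A_def algebra_simps)
  qed
  show ?thesis
    unfolding has_derivative_at_alt
  proof (intro conjI allI impI)
    show "bounded_linear (\<lambda>u. z u (t, p))" using lin linear_conv_bounded_linear by blast
    fix e :: real assume e: "0 < e"
    \<comment> \<open>Makes 2 (1 + \<epsilon> (1 + A)) \<eta> equal to e, the factor collected at
      the end.\<close>
    define \<eta> where "\<eta> = e / (2 * (1 + \<epsilon> * (1 + A)))"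
    have N: "0 < 1 + \<epsilon> * (1 + A)" using pos A by (simp add: add_pos_nonneg)
    have \<eta>: "0 < \<eta>" using e N by (simp add: \<eta>_def)
    obtain \<sigma>1 where \<sigma>1: "0 < \<sigma>1" "\<And>c v. c \<in> ?C \<Longrightarrow> norm v < \<sigma>1 \<Longrightarrow>
      c + v \<in> D \<and> norm (F (c + v) - F c - frechet_derivative F (at c) v) \<le> \<eta> * norm v"
      by (rule uniform_linear_approximation[OF F open_D(1) C \<eta>]) blast
    obtain \<sigma>2 where \<sigma>2: "0 < \<sigma>2" "\<And>c v. c \<in> {p} \<Longrightarrow> norm v < \<sigma>2 \<Longrightarrow>
      c + v \<in> P \<and> norm (y (0, c + v) - y (0, c) - frechet_derivative (\<lambda>p. y (0, p)) (at c) v) \<le> \<eta> * norm v"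
      by (rule uniform_linear_approximation[OF y0 opens(1) cp(1,2) \<eta>]) blast
    define d where "d = min (min \<rho>1 \<rho>2) (min (\<sigma>1 / (1 + A)) \<sigma>2)"
    show "\<exists>d>0. \<forall>q. norm (q - p) < d \<longrightarrow> norm (y (t, q) - y (t, p) - z (q - p) (t, p)) \<le> e * norm (q - p)"
    proof (intro exI conjI allI impI)
      show "0 < d" using \<rho>1 \<rho>2 \<sigma>1 \<sigma>2 A by (simp add: d_def add_pos_nonneg)
      fix q assume "norm (q - p) < d"
      define h where "h = q - p"
      have h: "norm h < min \<rho>1 \<rho>2" "norm h < \<sigma>1 / (1 + A)" "norm h < \<sigma>2"
        using \<open>norm (q - p) < d\<close> by (auto simp: h_def d_def)
      have q: "q = p + h" by (simp add: h_def)
      have qP: "q \<in> P" using \<sigma>2(2)[OF cp(3) h(3)] q by simp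
      define r where "r s = y (s, q) - y (s, p) - z h (s, p)" for s
      define B where "B = \<eta> * ((1 + A) * norm h)"
      have "norm (r t) \<le> 2 * (norm (r 0) + \<delta> * B)"
      proof (rule short_time_estimate[of 0 \<delta> r "\<lambda>s. F (s, q, y (s, q)) - F (s, p, y (s, p)) - G h (s, p, z h (s, p))" K B t])
        fix s assume "s \<in> {0 - \<delta>..0 + \<delta>}"
        then have s: "s \<in> {-\<delta>..\<delta>}" by simp
        show "(r has_vector_derivative F (s, q, y (s, q)) - F (s, p, y (s, p)) - G h (s, p, z h (s, p))) (at s within {0 - \<delta>..0 + \<delta>})"
          unfolding r_def[abs_def] using z[OF s p, of h]
          by (intro has_vector_derivative_diff has_vector_derivative_at_within[OF ode] sI[OF s] p qP) simp
        let ?c = "(s, p, y (s, p))" and ?\<Delta> = "y (s, q) - y (s, p)"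
        have "norm (0::real, h, ?\<Delta>) \<le> norm h + norm ?\<Delta>"
          using norm_Pair_le[of 0 "(h, ?\<Delta>)"] norm_Pair_le[of h ?\<Delta>] by (simp add: norm_Pair)
        also have "\<dots> \<le> (1 + A) * norm h" using growth[OF h(1) s] q by (simp add: algebra_simps)
        finally have nv: "norm (0::real, h, ?\<Delta>) \<le> (1 + A) * norm h" .
        also have "\<dots> < \<sigma>1" using h(2) A by (simp add: pos_less_divide_eq mult.commute)
        finally have "norm (F (?c + (0, h, ?\<Delta>)) - F ?c - frechet_derivative F (at ?c) (0, h, ?\<Delta>)) \<le> \<eta> * norm (0::real, h, ?\<Delta>)"
          using \<sigma>1(2)[of ?c "(0, h, ?\<Delta>)"] s by blast
        also have "\<dots> \<le> B" unfolding B_def using nv \<eta> by (intro mult_left_mono) auto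
        finally have 1: "norm (F (s, q, y (s, q)) - F ?c - frechet_derivative F (at ?c) (0, h, ?\<Delta>)) \<le> B"
          by (simp add: q)
        have 2: "norm (G h (s, p, ?\<Delta>) - G h (s, p, z h (s, p))) \<le> K * norm (r s)"
          using G_diff[OF F sI[OF s] p, of h ?\<Delta> "z h (s, p)"] by (simp add: r_def)
        have "F (s, q, y (s, q)) - F ?c - G h (s, p, z h (s, p))
          = (G h (s, p, ?\<Delta>) - G h (s, p, z h (s, p))) + (F (s, q, y (s, q)) - F ?c - frechet_derivative F (at ?c) (0, h, ?\<Delta>))"
          by simp
        then show "norm (F (s, q, y (s, q)) - F ?c - G h (s, p, z h (s, p))) \<le> K * norm (r s) + B"
          using norm_triangle_mono[OF 2 1] by (simp only:)
      qed (use \<delta> \<delta>K t pos \<eta> A in \<open>auto simp: B_def\<close>)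
      also have "norm (r 0) \<le> \<eta> * norm h"
        using \<sigma>2(2)[OF cp(3) h(3)] z0[OF p, of h] by (simp add: r_def q)
      also have "\<delta> * B \<le> \<epsilon> * B" using \<delta> \<eta> A by (intro mult_right_mono) (auto simp: B_def)
      also have "2 * (\<eta> * norm h + \<epsilon> * B) = (2 * (1 + \<epsilon> * (1 + A)) * \<eta>) * norm h"
        by (simp add: B_def algebra_simps)
      also have "2 * (1 + \<epsilon> * (1 + A)) * \<eta> = e" unfolding \<eta>_def using N by simp
      finally show "norm (y (t, q) - y (t, p) - z (q - p) (t, p)) \<le> e * norm (q - p)"
        by (simp add: r_def h_def)
    qed
  qed
qed

end

text \<open>The derivative \<open>z\<close> of \<open>y\<close> in the direction \<open>u\<close> of the parameter solves \<open>z' = G u (t, p, z)\<close>, which is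
  an equation of the same kind with values in the same space; hence the induction on \<open>k\<close>.\<close>

theorem ode_Ck_dependence:
  fixes F :: "real \<times> 'p::euclidean_space \<times> 'e::euclidean_space \<Rightarrow> 'e"
  assumes "ode_family \<epsilon> K P Y F y" "Ck_on k ({-\<epsilon><..<\<epsilon>} \<times> P \<times> Y) F" "Ck_on k P (\<lambda>p. y (0, p))"
  shows "Ck_on k ({-\<epsilon><..<\<epsilon>} \<times> P) y"
  using assms
\<comment> \<open>The interval, Y, F and y are generalised: the hypothesis is used both for y itself
  and for z, with G on a shorter interval and Y = UNIV.\<close>
proof (induction k arbitrary: \<epsilon> Y F y)
  case 0
  then show ?case using ode_family.continuous_dependence by auto
next
  case (Suc k)
  interpret ode_family \<epsilon> K P Y F y by (rule Suc.prems(1))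
  note F = Suc.prems(2) and y0 = Suc.prems(3)
  have F1: "Ck_on (Suc 0) D F" and y01: "Ck_on (Suc 0) P (\<lambda>p. y (0, p))"
    using Ck_on_le[OF F] Ck_on_le[OF y0] by blast+
  have y_k: "Ck_on k (I \<times> P) y"
    using Suc.IH[OF Suc.prems(1) Ck_on_Suc_imp[OF F] Ck_on_Suc_imp[OF y0]] .
  have oU: "open (I \<times> P \<times> (UNIV :: 'e set))" using opens by (auto intro!: open_Times)
  have bl: "bounded_linear (\<lambda>x :: real \<times> 'p \<times> 'e. fst x)" "bounded_linear (\<lambda>x :: real \<times> 'p \<times> 'e. fst (snd x))"
      "bounded_linear (\<lambda>x :: real \<times> 'p \<times> 'e. snd (snd x))"
    by (intro bounded_linear_intros)+
  have G_k: "Ck_on k (I \<times> P \<times> UNIV) (G u)" for u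
  proof -
    have yc: "Ck_on k (I \<times> P \<times> (UNIV :: 'e set)) (\<lambda>x. y (fst x, fst (snd x)))"
      by (rule Ck_on_compose[OF oU open_D(2) y_k Ck_on_Pair[OF oU Ck_on_bounded_linear Ck_on_bounded_linear]])
        (auto intro: bl)
    have c: "Ck_on k (I \<times> P \<times> (UNIV :: 'e set)) (\<lambda>x. (fst x, fst (snd x), y (fst x, fst (snd x))))"
      by (intro Ck_on_Pair oU Ck_on_bounded_linear bl yc)
    have "Ck_on k (I \<times> P \<times> UNIV) (\<lambda>x. frechet_derivative F (at (fst x, fst (snd x), y (fst x, fst (snd x)))) (0, u, snd (snd x)))"
    proof (rule Ck_on_linear_family[OF oU, where V = "\<lambda>x. (0, u, snd (snd x))"
          and A = "\<lambda>x. frechet_derivative F (at (fst x, fst (snd x), y (fst x, fst (snd x))))"])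
      show "Ck_on k (I \<times> P \<times> (UNIV :: 'e set)) (\<lambda>x. frechet_derivative F (at (fst x, fst (snd x), y (fst x, fst (snd x)))) v)" for v
        by (rule Ck_on_compose[OF oU open_D(1) Ck_on_SucD(2)[OF F] c]) (use mem in auto)
      show "linear (frechet_derivative F (at (fst x, fst (snd x), y (fst x, fst (snd x)))))"
        if "x \<in> I \<times> P \<times> UNIV" for x
        by (rule linear_frechet_derivative_Ck[OF F]) (use that mem in auto)
      show "Ck_on k (I \<times> P \<times> (UNIV :: 'e set)) (\<lambda>x. (0::real, u, snd (snd x)))"
        by (rule Ck_on_Pair[OF oU Ck_on_const Ck_on_Pair[OF oU Ck_on_const Ck_on_bounded_linear[OF bl(3)]]])
    qed
    then show ?thesis by (simp add: case_prod_unfold)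
  qed
  show ?case
  proof (rule Ck_on_local)
    fix x assume x: "x \<in> I \<times> P"
    \<comment> \<open>The variational equation is solved on closed intervals, so \<epsilon> is
      shrunk to some \<delta> above the absolute value of the time considered.\<close>
    define \<delta> where "\<delta> = (\<bar>fst x\<bar> + \<epsilon>) / 2"
    have \<delta>: "0 < \<delta>" "\<delta> < \<epsilon>" "\<bar>fst x\<bar> < \<delta>" using x pos by (auto simp: \<delta>_def)
    have \<delta>K: "\<delta> * K \<le> 1/4" using \<delta> pos mult_right_mono[of \<delta> \<epsilon> K] by simp
    have sI: "s \<in> I" if "s \<in> {-\<delta>..\<delta>}" for s using \<delta> that by auto
    let ?J = "{-\<delta><..<\<delta>}"
    have "\<exists>zz. zz 0 = frechet_derivative (\<lambda>p. y (0, p)) (at p) u \<and> (\<forall>t\<in>{-\<delta>..\<delta>}.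
        (zz has_vector_derivative G u (t, p, zz t)) (at t within {-\<delta>..\<delta>}))" if p: "p \<in> P" for u p
    proof -
      have "continuous_on ({-\<delta>..\<delta>} \<times> UNIV) (\<lambda>x. G u (fst x, p, snd x))"
        by (rule continuous_on_compose2[OF Ck_on_imp_continuous_on[OF G_k]])
          (use p sI in \<open>auto intro!: continuous_intros\<close>)
      then have "continuous_on ({-\<delta>..\<delta>} \<times> UNIV) (\<lambda>(t, z). G u (t, p, z))" by (simp add: case_prod_unfold)
      then obtain w where "w 0 = frechet_derivative (\<lambda>p. y (0, p)) (at p) u"
        "\<And>t. t \<in> {-\<delta>..\<delta>} \<Longrightarrow> (w has_vector_derivative G u (t, p, w t)) (at t within {-\<delta>..\<delta>})"
        by (rule picard_short_time[of \<delta> _ K]) (use G_diff[OF F1 sI p] \<delta> \<delta>K pos in auto)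
      then show ?thesis by (intro exI[of _ w]) simp
    qed
    then have ex: "\<exists>zz. p \<in> P \<longrightarrow> zz 0 = frechet_derivative (\<lambda>p. y (0, p)) (at p) u \<and> (\<forall>t\<in>{-\<delta>..\<delta>}.
        (zz has_vector_derivative G u (t, p, zz t)) (at t within {-\<delta>..\<delta>}))" for u p by blast
    define zz where "zz u p = (SOME w. p \<in> P \<longrightarrow> w 0 = frechet_derivative (\<lambda>p. y (0, p)) (at p) u \<and>
      (\<forall>t\<in>{-\<delta>..\<delta>}. (w has_vector_derivative G u (t, p, w t)) (at t within {-\<delta>..\<delta>})))" for u p
    have zz: "zz u p 0 = frechet_derivative (\<lambda>p. y (0, p)) (at p) u"
      "\<And>t. t \<in> {-\<delta>..\<delta>} \<Longrightarrow> (zz u p has_vector_derivative G u (t, p, zz u p t)) (at t within {-\<delta>..\<delta>})"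
      if "p \<in> P" for u p
      using someI_ex[OF ex[of p u], folded zz_def] that by blast+
    define z where "z u x = zz u (snd x) (fst x)" for u x
    have z0: "z u (0, p) = frechet_derivative (\<lambda>p. y (0, p)) (at p) u" if "p \<in> P" for u p
      using zz(1)[OF that] by (simp add: z_def)
    have z: "((\<lambda>s. z u (s, p)) has_vector_derivative G u (t, p, z u (t, p))) (at t within {-\<delta>..\<delta>})"
      if "t \<in> {-\<delta>..\<delta>}" "p \<in> P" for u t p
      using zz(2)[OF that(2,1)] by (simp add: z_def)
    have zfam: "ode_family \<delta> K P UNIV (G u) (z u)" for u
    proof
      fix t p assume t: "t \<in> ?J" and p: "p \<in> P"
      have t': "t \<in> {-\<delta>..\<delta>}" using t by auto
      show "norm (G u (t, p, y1) - G u (t, p, y2)) \<le> K * norm (y1 - y2)" for y1 y2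
        by (rule G_diff[OF F1 sI[OF t'] p])
      have "((\<lambda>s. z u (s, p)) has_vector_derivative G u (t, p, z u (t, p))) (at t within ?J)"
        by (rule has_vector_derivative_within_subset[OF z[OF t' p]]) auto
      then show "((\<lambda>s. z u (s, p)) has_vector_derivative G u (t, p, z u (t, p))) (at t)"
        using at_within_open[OF t] by simp
    qed (use \<delta> \<delta>K pos opens in auto)
    have z_k: "Ck_on k (?J \<times> P) (z u)" for u
    proof (rule Suc.IH[OF zfam])
      show "Ck_on k (?J \<times> P \<times> UNIV) (G u)"
        by (rule Ck_on_subset[OF G_k]) (use \<delta> in auto)
      show "Ck_on k P (\<lambda>p. z u (0, p))"
        by (rule Ck_on_cong[OF opens(1) z0[symmetric] Ck_on_SucD(2)[OF y0]])
    qed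
    have oT: "open (?J \<times> P)" using opens by (auto intro!: open_Times)
    have sub: "?J \<times> P \<subseteq> I \<times> P" using \<delta> by auto
    have "Ck_on (Suc k) (?J \<times> P) y"
    proof (rule Ck_on_SucI[OF oT])
      fix x' assume x': "x' \<in> ?J \<times> P"
      obtain t p where tp: "x' = (t, p)" by (cases x')
      have t: "t \<in> ?J" "t \<in> {-\<delta>..\<delta>}" and p: "p \<in> P" using x' tp by auto
      obtain r where r: "0 < r" "ball p r \<subseteq> P" using opens p open_contains_ball by blast
      define fy where "fy t p = Blinfun (\<lambda>u. z u (t, p))" for t p
      have pd: "((\<lambda>p. y (t, p)) has_derivative (\<lambda>u. z u (t, p))) (at p)" if "t \<in> ?J" "p \<in> P" for t p
        by (rule parameter_derivative[OF F1 y01 \<delta>(1,2) z0 z]) (use that in auto)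
      have app: "blinfun_apply (fy t p) = (\<lambda>u. z u (t, p))" if "t \<in> ?J" "p \<in> P" for t p
        unfolding fy_def using has_derivative_bounded_linear[OF pd[OF that]] by (rule bounded_linear_Blinfun_apply)
      have cont: "continuous_on (?J \<times> P) (\<lambda>(t, p). fy t p)"
      proof (rule continuous_on_blinfun_componentwise)
        fix b :: 'p
        show "continuous_on (?J \<times> P) (\<lambda>x. blinfun_apply (case x of (t, p) \<Rightarrow> fy t p) b)"
          by (rule continuous_on_cong[THEN iffD1, OF refl _ Ck_on_imp_continuous_on[OF z_k[of b]]]) (auto simp: app)
      qed
      \<comment> \<open>Both partial derivatives exist and the one in p is continuous, which yields
        the total derivative.\<close>
      have "((\<lambda>(t, p). y (t, p)) has_derivative (\<lambda>(\<tau>, h). \<tau> *\<^sub>R F (t, p, y (t, p)) + fy t p h))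
          (at (t, p) within ?J \<times> ball p r)"
      proof (rule has_derivative_partialsI)
        show "((\<lambda>t. y (t, p)) has_derivative (\<lambda>\<tau>. \<tau> *\<^sub>R F (t, p, y (t, p)))) (at t within ?J)"
          using ode[OF sI[OF t(2)] p] by (auto simp: has_vector_derivative_def intro: has_derivative_at_withinI)
        show "((\<lambda>p. y (t', p)) has_derivative blinfun_apply (fy t' p')) (at p' within ball p r)"
          if "t' \<in> ?J" "p' \<in> ball p r" for t' p'
          proof (rule has_derivative_at_withinI)
          have "p' \<in> P" using that r by blast
          then show "((\<lambda>p. y (t', p)) has_derivative blinfun_apply (fy t' p')) (at p')"
            using pd[OF that(1)] app[OF that(1)] by simp
        qed
        show "continuous (at (t, p) within ?J \<times> ball p r) (\<lambda>(t, p). fy t p)"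
        proof -
          have "continuous_on (?J \<times> ball p r) (\<lambda>(t, p). fy t p)"
            by (rule continuous_on_subset[OF cont]) (use r in blast)
          moreover have "(t, p) \<in> ?J \<times> ball p r" using t r by simp
          ultimately show ?thesis unfolding continuous_on_eq_continuous_within by blast
        qed
      qed (use r in auto)
      moreover have "at (t, p) within ?J \<times> ball p r = at (t, p)"
        by (rule at_within_open) (use t r in \<open>auto intro!: open_Times\<close>)
      ultimately have "(y has_derivative (\<lambda>v. fst v *\<^sub>R F (t, p, y (t, p)) + z (snd v) (t, p))) (at (t, p))"
        using app[OF t(1) p] by (simp add: case_prod_unfold)
      then show "(y has_derivative (\<lambda>v. fst v *\<^sub>R F (fst x', snd x', y x') + z (snd v) x')) (at x')"
        by (simp add: tp)
    next
      fix v :: "real \<times> 'p"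
      have yk: "Ck_on k (?J \<times> P) y" using y_k sub by (rule Ck_on_subset)
      show "Ck_on k (?J \<times> P) (\<lambda>x'. fst v *\<^sub>R F (fst x', snd x', y x') + z (snd v) x')"
      proof (intro Ck_on_add Ck_on_scaleR oT z_k Ck_on_const)
        show "Ck_on k (?J \<times> P) (\<lambda>x'. F (fst x', snd x', y x'))"
          by (rule Ck_on_compose[OF oT open_D(1) Ck_on_Suc_imp[OF F]],
              intro Ck_on_Pair oT yk Ck_on_bounded_linear bounded_linear_intros)
            (use sub mem in auto)
      qed
    qed
    then show "\<exists>T. open T \<and> x \<in> T \<and> Ck_on (Suc k) T y"
      using oT x \<delta> by (intro exI[of _ "?J \<times> P"]) auto
  qed
qed

section \<open>Local flows and uniqueness of integral curves\<close>

lemma smooth_on_lipschitz_cball: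
  fixes X :: "'e::euclidean_space \<Rightarrow> 'f::real_normed_vector"
  assumes "open U" "smooth_on U X" "cball x0 r \<subseteq> U"
  obtains K where "0 \<le> K" "\<And>x y. x \<in> cball x0 r \<Longrightarrow> y \<in> cball x0 r \<Longrightarrow> norm (X x - X y) \<le> K * norm (x - y)"
proof -
  obtain L where L: "0 \<le> L" "\<And>c v. c \<in> cball x0 r \<Longrightarrow> norm (frechet_derivative X (at c) v) \<le> L * norm v"
    using compact_derivative_bound[OF smooth_on_imp_Ck_on[OF assms(2)] compact_cball assms(3)] by blast
  have "norm (X x - X y) \<le> L * norm (x - y)" if "x \<in> cball x0 r" "y \<in> cball x0 r" for x y
  proof (rule differentiable_bound[OF convex_cball _ _ that])
    fix z assume z: "z \<in> cball x0 r"
    show "(X has_derivative frechet_derivative X (at z)) (at z within cball x0 r)"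
      using smooth_on_has_derivative[OF assms(2)] z assms(3) by (blast intro: has_derivative_at_withinI)
    show "onorm (frechet_derivative X (at z)) \<le> L" using L z by (intro onorm_le) (simp add: mult.commute)
  qed
  then show thesis using L(1) that by blast
qed

text \<open>X is given near x0 only. Composed with the nearest-point projection onto a closed ball
  it becomes globally Lipschitz, and curves starting in the half ball stay in the ball, where the
  projection is the identity.\<close>

theorem local_flow_exists:
  fixes X :: "'e::euclidean_space \<Rightarrow> 'e"
  assumes U: "open U" "x0 \<in> U" and X: "smooth_on U X"
  obtains \<epsilon> V y where "0 < \<epsilon>" "open V" "x0 \<in> V" "V \<subseteq> U" "smooth_on ({-\<epsilon><..<\<epsilon>} \<times> V) y"
    "\<And>x. x \<in> V \<Longrightarrow> y (0, x) = x"
    "\<And>t x. t \<in> {-\<epsilon><..<\<epsilon>} \<Longrightarrow> x \<in> V \<Longrightarrow> y (t, x) \<in> U"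
    "\<And>t x. t \<in> {-\<epsilon><..<\<epsilon>} \<Longrightarrow> x \<in> V \<Longrightarrow> ((\<lambda>s. y (s, x)) has_vector_derivative X (y (t, x))) (at t)"
proof -
  obtain r where r: "0 < r" "cball x0 r \<subseteq> U" using U open_contains_cball by blast
  obtain K where K: "0 \<le> K" "\<And>x y. x \<in> cball x0 r \<Longrightarrow> y \<in> cball x0 r \<Longrightarrow> norm (X x - X y) \<le> K * norm (x - y)"
    using smooth_on_lipschitz_cball[OF U(1) X r(2)] by blast
  have "continuous_on (cball x0 r) X"
    using smooth_on_imp_continuous_on[OF X] r(2) by (rule continuous_on_subset)
  then have "bounded (X ` cball x0 r)" by (intro compact_imp_bounded compact_continuous_image) auto
  then obtain B where B: "0 < B" "\<And>x. x \<in> cball x0 r \<Longrightarrow> norm (X x) \<le> B" by (auto simp: bounded_pos)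
  \<comment> \<open>The first bound is for Picard iteration, the second for confinement: in time
    \<epsilon> a curve moves by at most 2 \<epsilon> B \<le> r/4.\<close>
  define \<epsilon> where "\<epsilon> = min (1 / (4 * (K + 1))) (r / (8 * B))"
  have \<epsilon>: "0 < \<epsilon>" using K B r by (simp add: \<epsilon>_def)
  have "\<epsilon> * K \<le> 1 / (4 * (K + 1)) * K" using K by (intro mult_right_mono) (auto simp: \<epsilon>_def)
  also have "\<dots> \<le> 1/4" using K by (simp add: field_simps)
  finally have \<epsilon>K: "\<epsilon> * K \<le> 1/4" .
  have \<epsilon>B: "\<epsilon> * B \<le> r / 8"
  proof -
    have "\<epsilon> * B \<le> r / (8 * B) * B" using B by (intro mult_right_mono) (auto simp: \<epsilon>_def)
    then show ?thesis using B by simp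
  qed
  define pr where "pr = closest_point (cball x0 r)"
  have pr: "pr x \<in> cball x0 r" for x unfolding pr_def using r by (intro closest_point_in_set) auto
  have pr_id: "pr x = x" if "x \<in> cball x0 r" for x using that by (simp add: pr_def closest_point_self)
  have pr_lip: "norm (pr x - pr y) \<le> norm (x - y)" for x y
    using closest_point_lipschitz[of "cball x0 r" x y] r by (simp add: pr_def dist_norm)
  have Xpr: "norm (X (pr x) - X (pr y)) \<le> K * norm (x - y)" for x y
    using K(2)[OF pr pr, of x y] mult_left_mono[OF pr_lip[of x y] K(1)] by simp
  have "continuous_on UNIV (\<lambda>x. X (pr x))"
  proof (rule continuous_on_compose2[OF \<open>continuous_on (cball x0 r) X\<close>])
    show "continuous_on UNIV pr" unfolding pr_def using r by (intro continuous_on_closest_point) auto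
  qed (use pr in auto)
  then have cont: "continuous_on ({-\<epsilon>..\<epsilon>} \<times> UNIV) (\<lambda>(t, y). X (pr y))"
    unfolding case_prod_unfold by (rule continuous_on_compose2) (auto intro!: continuous_intros)
  have "\<exists>y. y 0 = x \<and> (\<forall>t\<in>{-\<epsilon>..\<epsilon>}. (y has_vector_derivative X (pr (y t))) (at t within {-\<epsilon>..\<epsilon>}))" for x
  proof -
    obtain w where "w 0 = x"
      "\<And>t. t \<in> {-\<epsilon>..\<epsilon>} \<Longrightarrow> (w has_vector_derivative X (pr (w t))) (at t within {-\<epsilon>..\<epsilon>})"
      by (rule picard_short_time[OF cont, of K x]) (use Xpr \<epsilon> K \<epsilon>K in auto)
    then show ?thesis by blast
  qed
  then obtain y where y: "\<And>x. y x 0 = x"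
    "\<And>x t. t \<in> {-\<epsilon>..\<epsilon>} \<Longrightarrow> (y x has_vector_derivative X (pr (y x t))) (at t within {-\<epsilon>..\<epsilon>})" by metis
  define V where "V = ball x0 (r / 2)"
  have near: "y x t \<in> ball x0 r" if "x \<in> V" "t \<in> {-\<epsilon>..\<epsilon>}" for x t
  proof -
    have "norm (y x t - x) \<le> 2 * (norm (y x 0 - x) + \<epsilon> * B)"
      by (rule short_time_estimate[of 0 \<epsilon> "\<lambda>t. y x t - x" "\<lambda>t. X (pr (y x t))" 0])
        (use that \<epsilon> B pr y in \<open>auto intro!: derivative_eq_intros\<close>)
    also have "\<dots> < r / 2" using \<epsilon>B r by (simp add: y(1))
    finally have "dist (y x t) x < r / 2" by (simp add: dist_norm)
    moreover have "dist x0 x < r / 2" using that by (simp add: V_def)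
    ultimately show ?thesis using dist_triangle_half_l[of x0 x r "y x t"] by (simp add: dist_commute)
  qed
  have ode: "((\<lambda>s. y x s) has_vector_derivative X (y x t)) (at t)" if "t \<in> {-\<epsilon><..<\<epsilon>}" "x \<in> V" for t x
  proof -
    have t: "t \<in> {-\<epsilon>..\<epsilon>}" using that by auto
    have "(y x has_vector_derivative X (pr (y x t))) (at t within {-\<epsilon><..<\<epsilon>})"
      by (rule has_vector_derivative_within_subset[OF y(2)[OF t]]) auto
    moreover have "pr (y x t) = y x t" using near[OF that(2) t] by (intro pr_id) auto
    ultimately show ?thesis using at_within_open[OF that(1)] by simp
  qed
  \<comment> \<open>The starting point plays the part of the parameter; the right-hand side depends
    on neither t nor p.\<close>
  have fam: "ode_family \<epsilon> K V (ball x0 r) (\<lambda>x. X (snd (snd x))) (\<lambda>x. y (snd x) (fst x))"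
  proof
    fix t p y1 y2 assume "y1 \<in> ball x0 r" "y2 \<in> ball x0 r"
    then show "norm (X (snd (snd (t, p, y1))) - X (snd (snd (t, p, y2)))) \<le> K * norm (y1 - y2)"
      using K(2) by auto
  qed (use \<epsilon> K \<epsilon>K near ode in \<open>auto simp: V_def\<close>)
  have sm: "smooth_on ({-\<epsilon><..<\<epsilon>} \<times> V) (\<lambda>x. y (snd x) (fst x))"
    unfolding smooth_on_def
  proof
    fix k
    have op: "open ({-\<epsilon><..<\<epsilon>} \<times> V \<times> ball x0 r)" by (auto simp: V_def intro!: open_Times)
    show "Ck_on k ({-\<epsilon><..<\<epsilon>} \<times> V) (\<lambda>x. y (snd x) (fst x))"
    proof (rule ode_Ck_dependence[OF fam])
      show "Ck_on k ({-\<epsilon><..<\<epsilon>} \<times> V \<times> ball x0 r) (\<lambda>x. X (snd (snd x)))"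
        by (rule Ck_on_compose[OF op U(1) smooth_on_imp_Ck_on[OF X] Ck_on_bounded_linear])
          (use r in \<open>auto intro!: bounded_linear_intros\<close>)
      show "Ck_on k V (\<lambda>p. y (snd (0, p)) (fst (0, p)))" by (simp add: y(1) Ck_on_bounded_linear)
    qed
  qed
  show thesis
  proof (rule that[OF \<epsilon> _ _ _ sm])
    show "open V" "x0 \<in> V" "V \<subseteq> U" using r by (auto simp: V_def subset_iff)
    show "y (snd (t, x)) (fst (t, x)) \<in> U" if "t \<in> {-\<epsilon><..<\<epsilon>}" "x \<in> V" for t x
      using near[OF that(2), of t] that(1) r by auto
  qed (use y ode in auto)
qed

text \<open>The common factor \<mu> allows reparametrised integral curves to be compared. Both
  curves stay in a ball where X is Lipschitz, and their difference starts at 0.\<close>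

theorem local_curve_uniqueness:
  fixes X :: "'e::euclidean_space \<Rightarrow> 'e"
  assumes U: "open U" and X: "smooth_on U X" and d: "0 < d"
    and \<mu>: "continuous_on {a - d..a + d} \<mu>"
    and c1: "\<And>t. t \<in> {a - d..a + d} \<Longrightarrow> (c1 has_vector_derivative \<mu> t *\<^sub>R X (c1 t)) (at t)"
    and c2: "\<And>t. t \<in> {a - d..a + d} \<Longrightarrow> (c2 has_vector_derivative \<mu> t *\<^sub>R X (c2 t)) (at t)"
    and eq: "c1 a = c2 a" "c1 a \<in> U"
  obtains \<delta> where "0 < \<delta>" "\<And>t. \<bar>t - a\<bar> < \<delta> \<Longrightarrow> c1 t = c2 t"
proof -
  obtain r where r: "0 < r" "cball (c1 a) r \<subseteq> U" using U eq open_contains_cball by blast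
  obtain K where K: "0 \<le> K" "\<And>x y. x \<in> cball (c1 a) r \<Longrightarrow> y \<in> cball (c1 a) r \<Longrightarrow> norm (X x - X y) \<le> K * norm (x - y)"
    using smooth_on_lipschitz_cball[OF U(1) X r(2)] by blast
  have "bounded (\<mu> ` {a - d..a + d})" using \<mu> by (intro compact_imp_bounded compact_continuous_image) auto
  then obtain B where B: "0 < B" "\<And>t. t \<in> {a - d..a + d} \<Longrightarrow> \<bar>\<mu> t\<bar> \<le> B" by (auto simp: bounded_pos)
  have "isCont c1 a" "isCont c2 a" using c1[of a] c2[of a] d has_vector_derivative_continuous by auto
  then obtain d1 d2 where d1: "0 < d1" "\<And>t. dist t a < d1 \<Longrightarrow> dist (c1 t) (c1 a) < r"
    and d2: "0 < d2" "\<And>t. dist t a < d2 \<Longrightarrow> dist (c2 t) (c2 a) < r"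
    unfolding continuous_at_eps_delta using r(1) by metis
  \<comment> \<open>The first three entries keep the curves within their domain and the ball, the
    last gives \<delta> B K \<le> 1/2.\<close>
  define \<delta> where "\<delta> = Min {d, d1 / 2, d2 / 2, 1 / (2 * (B * K + 1))}"
  have BK: "0 \<le> B * K" using B K by simp
  have \<delta>: "0 < \<delta>" "\<delta> \<le> d" "\<delta> < d1" "\<delta> < d2" "\<delta> \<le> 1 / (2 * (B * K + 1))"
    using d d1 d2 BK by (auto simp: \<delta>_def)
  have "\<delta> * (B * K) \<le> 1 / (2 * (B * K + 1)) * (B * K)" using \<delta> BK by (intro mult_right_mono) auto
  also have "\<dots> \<le> 1/2" using BK by (simp add: field_simps)
  finally have \<delta>K: "\<delta> * (B * K) \<le> 1/2" .
  show thesis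
  proof (rule that[OF \<delta>(1)])
    fix t assume t: "\<bar>t - a\<bar> < \<delta>"
    have "norm (c1 t - c2 t) \<le> 2 * (norm (c1 a - c2 a) + \<delta> * 0)"
    proof (rule short_time_estimate[of a \<delta> "\<lambda>t. c1 t - c2 t" "\<lambda>t. \<mu> t *\<^sub>R X (c1 t) - \<mu> t *\<^sub>R X (c2 t)" "B * K"])
      fix s assume s: "s \<in> {a - \<delta>..a + \<delta>}"
      then have sd: "s \<in> {a - d..a + d}" using \<delta>(2) by auto
      show "((\<lambda>t. c1 t - c2 t) has_vector_derivative \<mu> s *\<^sub>R X (c1 s) - \<mu> s *\<^sub>R X (c2 s)) (at s within {a - \<delta>..a + \<delta>})"
        by (intro has_vector_derivative_diff has_vector_derivative_at_within[OF c1] has_vector_derivative_at_within[OF c2] sd)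
      have "dist s a < d1" "dist s a < d2" using s \<delta> by (auto simp: dist_real_def)
      then have "norm (X (c1 s) - X (c2 s)) \<le> K * norm (c1 s - c2 s)"
        using d1(2)[of s] d2(2)[of s] eq by (intro K(2)) (auto simp: dist_commute)
      then have "\<bar>\<mu> s\<bar> * norm (X (c1 s) - X (c2 s)) \<le> B * (K * norm (c1 s - c2 s))"
        using B(2)[OF sd] K B by (intro mult_mono) auto
      then show "norm (\<mu> s *\<^sub>R X (c1 s) - \<mu> s *\<^sub>R X (c2 s)) \<le> B * K * norm (c1 s - c2 s) + 0"
        by (simp add: scaleR_diff_right[symmetric] mult.assoc)
    qed (use t \<delta> \<delta>K BK in auto)
    then show "c1 t = c2 t" using eq by simp
  qed
qed

section \<open>Periods of additive functions on singular 1-simplices\<close>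

text \<open>A group of rank 0 has no independent singleton, so a nonzero multiple of the class of c
  vanishes. The rest translates powers in the homology group into integer multiples of the
  chain.\<close>

lemma torsion_cycle:
  assumes b: "betti_number 1 X = 0" and c: "singular_relcycle 1 X {} c"
  obtains n :: int where "n \<noteq> 0" "singular_relboundary 1 X {} (frag_cmul n c)"
proof -
  let ?R = "homologous_rel_set 1 X {} c"
  define H where "H = homology_group (int 1) X"
  interpret H: comm_group H unfolding H_def by (rule abelian_relative_homology_group)
  have R: "?R \<in> carrier H" unfolding H_def carrier_relative_homology_group using c by blast
  have "\<not> int_independent H {?R}"
  proof
    assume "int_independent H {?R}"
    then have "enat (card {?R}) \<le> abelian_rank H"
      unfolding abelian_rank_def by (intro SUP_upper) auto
    then show False using b by (simp add: betti_number_def H_def zero_enat_def)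
  qed
  then obtain k :: "_ \<Rightarrow> int" where k: "finprod H (\<lambda>b. b [^]\<^bsub>H\<^esub> k b) {?R} = \<one>\<^bsub>H\<^esub>" "k ?R \<noteq> 0"
    using R unfolding int_independent_def by auto
  have "finprod H (\<lambda>b. b [^]\<^bsub>H\<^esub> k b) {?R} = ?R [^]\<^bsub>H\<^esub> k ?R"
    using H.finprod_insert[of "{}" ?R "\<lambda>b. b [^]\<^bsub>H\<^esub> k b"] H.int_pow_closed[OF R] by simp
  then have one: "?R [^]\<^bsub>H\<^esub> k ?R = singular_relboundary_set 1 X {}"
    using k(1) one_relative_homology_group[of 1 X "{}"] by (simp add: H_def)
  let ?G = "relcycle_group 1 X {}" and ?B = "singular_relboundary_set 1 X {}"
  interpret N: normal ?B ?G by (rule normal_subgroup_singular_relboundary_relcycle)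
  have cG: "c \<in> carrier ?G" using c by simp
  have H: "H = ?G Mod ?B" unfolding H_def by (rule nontrivial_relative_homology_group)
  have Rc: "?B #>\<^bsub>?G\<^esub> a = homologous_rel_set 1 X {} a" for a
    by (simp add: right_coset_singular_relboundary)
  \<comment> \<open>Powers are computed in the cycle group, a subgroup of the free abelian chain
    group, and only then passed to the quotient.\<close>
  have "c [^]\<^bsub>?G\<^esub> k ?R = c [^]\<^bsub>chain_group 1 X\<^esub> k ?R"
    using cG unfolding relcycle_group_def by (intro group.int_pow_subgroup_generated) auto
  also have "\<dots> = frag_cmul (k ?R) c"
    using c unfolding chain_group_def by (intro int_pow_free_Abelian_group) (auto simp: singular_cycle singular_chain_def)
  finally have pow: "c [^]\<^bsub>?G\<^esub> k ?R = frag_cmul (k ?R) c" .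
  have "homologous_rel_set 1 X {} (frag_cmul (k ?R) c) = ?R [^]\<^bsub>H\<^esub> k ?R"
    using N.FactGroup_int_pow[OF cG, of "k ?R"] unfolding H Rc pow by (rule sym)
  then have "homologous_rel_set 1 X {} (frag_cmul (k ?R) c) = ?B" unfolding one .
  then have "singular_relboundary 1 X {} (frag_cmul (k ?R) c)"
    by (simp only: homologous_rel_set_eq_relboundary)
  then show thesis using that k(2) by blast
qed

section \<open>Pairing of real cochains with integral chains\<close>

definition chain_eval :: "('b \<Rightarrow> real) \<Rightarrow> ('b \<Rightarrow>\<^sub>0 int) \<Rightarrow> real" where
  "chain_eval f c = (\<Sum>s\<in>Poly_Mapping.keys c. of_int (Poly_Mapping.lookup c s) * f s)"

lemma chain_eval_superset:
  assumes "finite S" "Poly_Mapping.keys c \<subseteq> S"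
  shows "chain_eval f c = (\<Sum>s\<in>S. of_int (Poly_Mapping.lookup c s) * f s)"
  unfolding chain_eval_def by (rule sum.mono_neutral_left) (use assms in \<open>auto simp: in_keys_iff\<close>)

lemma chain_eval_add: "chain_eval f (a + b) = chain_eval f a + chain_eval f b"
proof -
  let ?S = "Poly_Mapping.keys a \<union> Poly_Mapping.keys b"
  have "chain_eval f (a + b) = (\<Sum>s\<in>?S. of_int (Poly_Mapping.lookup (a + b) s) * f s)"
    using Poly_Mapping.keys_add[of a b] by (rule chain_eval_superset[rotated]) simp
  also have "\<dots> = chain_eval f a + chain_eval f b"
    by (simp add: chain_eval_superset[of ?S] lookup_add algebra_simps sum.distrib)
  finally show ?thesis .
qed

lemma chain_eval_0 [simp]: "chain_eval f 0 = 0"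
  by (simp add: chain_eval_def)

lemma chain_eval_frag_of [simp]: "chain_eval f (frag_of s) = f s"
  by (simp add: chain_eval_def keys_frag_of)

lemma chain_eval_cmul: "chain_eval f (frag_cmul k c) = of_int k * chain_eval f c"
proof -
  have "chain_eval f (frag_cmul k c) = (\<Sum>s\<in>Poly_Mapping.keys c. of_int (Poly_Mapping.lookup (frag_cmul k c) s) * f s)"
    by (rule chain_eval_superset) (auto dest: subsetD[OF keys_cmul])
  then show ?thesis by (simp add: chain_eval_def sum_distrib_left algebra_simps)
qed

lemma chain_eval_diff: "chain_eval f (a - b) = chain_eval f a - chain_eval f b"
  using chain_eval_add[of f a "- b"] chain_eval_cmul[of f "-1" b] by simp

text \<open>The hypothesis on f is the cocycle condition; the pairing is additive, so single
  simplices suffice.\<close>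

lemma chain_eval_boundary:
  assumes f: "\<And>s. singular_simplex 2 X s \<Longrightarrow>
      f (singular_face 2 0 s) - f (singular_face 2 1 s) + f (singular_face 2 2 s) = 0"
    and d: "singular_chain 2 X d"
  shows "chain_eval f (chain_boundary 2 d) = 0"
  using d[unfolded singular_chain_def]
proof (induction d rule: frag_induction)
  case (one s)
  have "chain_boundary 2 (frag_of s) = frag_of (singular_face 2 0 s) - frag_of (singular_face 2 1 s)
      + frag_of (singular_face 2 2 s)"
    by (simp add: chain_boundary_of numeral_2_eq_2)
  then show ?case using f[of s] one by (simp add: chain_eval_add chain_eval_diff)
qed (auto simp: chain_boundary_diff chain_eval_diff)

text \<open>Some n c with n \<noteq> 0 is a boundary, and n f(c) = 0 in the reals forces f(c) =
  0.\<close>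

lemma chain_eval_cycle:
  assumes "betti_number 1 X = 0" "singular_relcycle 1 X {} c"
    and f: "\<And>s. singular_simplex 2 X s \<Longrightarrow>
      f (singular_face 2 0 s) - f (singular_face 2 1 s) + f (singular_face 2 2 s) = 0"
  shows "chain_eval f c = 0"
proof -
  obtain n :: int where n: "n \<noteq> 0" "singular_relboundary 1 X {} (frag_cmul n c)"
    using torsion_cycle[OF assms(1,2)] .
  then obtain d where "singular_chain 2 X d" "chain_boundary 2 d = frag_cmul n c"
    by (auto simp: singular_boundary numeral_2_eq_2)
  then have "of_int n * chain_eval f c = 0"
    using chain_eval_boundary[OF f, of X d] by (simp add: chain_eval_cmul)
  then show ?thesis using n by simp
qed

section \<open>Locally defined potentials\<close>

text \<open>A closed 1-form, seen only through its local primitives \<open>h p\<close>.\<close>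

locale local_potential =
  fixes X :: "'a topology" and U :: "'a \<Rightarrow> 'a set" and h :: "'a \<Rightarrow> 'a \<Rightarrow> real"
  assumes open_U: "\<And>p. p \<in> topspace X \<Longrightarrow> openin X (U p)"
    and mem_U: "\<And>p. p \<in> topspace X \<Longrightarrow> p \<in> U p"
    and compat: "\<And>p q x. p \<in> topspace X \<Longrightarrow> q \<in> topspace X \<Longrightarrow> x \<in> U p \<Longrightarrow> x \<in> U q \<Longrightarrow>
      \<exists>W. openin X W \<and> x \<in> W \<and> W \<subseteq> U p \<inter> U q \<and> (\<forall>z\<in>W. h p z - h p x = h q z - h q x)"
begin

section \<open>Primitives along continuous maps\<close>

text \<open>Stands for a primitive of the form pulled back by \<sigma>: since \<sigma> is only
  continuous, increments of F are compared with increments of the local potentials instead.\<close>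

definition primitive_along :: "'k::metric_space set \<Rightarrow> ('k \<Rightarrow> 'a) \<Rightarrow> ('k \<Rightarrow> real) \<Rightarrow> bool" where
  "primitive_along K \<sigma> F \<longleftrightarrow> (\<forall>x\<in>K. \<exists>p\<in>topspace X. \<exists>V. open V \<and> x \<in> V \<and>
     (\<forall>z\<in>V \<inter> K. \<sigma> z \<in> U p \<and> F z - F x = h p (\<sigma> z) - h p (\<sigma> x)))"

text \<open>By compatibility of the potentials, the one used near x may be prescribed.\<close>

lemma primitive_along_at:
  assumes F: "primitive_along K \<sigma> F" and \<sigma>: "continuous_map (top_of_set K) X \<sigma>"
    and x: "x \<in> K" and p: "p \<in> topspace X" "\<sigma> x \<in> U p"
  obtains V where "open V" "x \<in> V" "\<And>z. z \<in> V \<inter> K \<Longrightarrow> \<sigma> z \<in> U p \<and> F z - F x = h p (\<sigma> z) - h p (\<sigma> x)"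
proof -
  obtain q V where q: "q \<in> topspace X" and V: "open V" "x \<in> V"
    "\<And>z. z \<in> V \<inter> K \<Longrightarrow> \<sigma> z \<in> U q \<and> F z - F x = h q (\<sigma> z) - h q (\<sigma> x)"
    using F x unfolding primitive_along_def by metis
  obtain W where W: "openin X W" "\<sigma> x \<in> W" "W \<subseteq> U p \<inter> U q"
    "\<forall>z\<in>W. h p z - h p (\<sigma> x) = h q z - h q (\<sigma> x)"
    using compat[OF p(1) q p(2)] V x by blast
  have "openin (top_of_set K) {z \<in> K. \<sigma> z \<in> W}"
    using openin_continuous_map_preimage[OF \<sigma> W(1)] by simp
  then obtain T where T: "open T" "{z \<in> K. \<sigma> z \<in> W} = K \<inter> T" by (auto simp: openin_open)
  show thesis
  proof (rule that[of "V \<inter> T"])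
    fix z assume z: "z \<in> V \<inter> T \<inter> K"
    then have "\<sigma> z \<in> W" using T by blast
    then show "\<sigma> z \<in> U p \<and> F z - F x = h p (\<sigma> z) - h p (\<sigma> x)" using W V(3)[of z] z by auto
  qed (use V T W x in auto)
qed

lemma primitive_along_subset: "primitive_along K \<sigma> F \<Longrightarrow> K' \<subseteq> K \<Longrightarrow> primitive_along K' \<sigma> F"
  unfolding primitive_along_def by (rule ballI, drule bspec, erule subsetD, assumption) blast

lemma primitive_along_compose:
  assumes F: "primitive_along K \<sigma> F" and q: "continuous_on K' q" "q ` K' \<subseteq> K"
  shows "primitive_along K' (\<lambda>x. \<sigma> (q x)) (\<lambda>x. F (q x))"
  unfolding primitive_along_def
proof
  fix x assume x: "x \<in> K'"
  then obtain p V where p: "p \<in> topspace X" and V: "open V" "q x \<in> V"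
    "\<And>z. z \<in> V \<inter> K \<Longrightarrow> \<sigma> z \<in> U p \<and> F z - F (q x) = h p (\<sigma> z) - h p (\<sigma> (q x))"
    using F q(2) unfolding primitive_along_def by (metis image_subset_iff)
  obtain T where T: "open T" "T \<inter> K' = q -` V \<inter> K'"
    using q(1) V(1) unfolding continuous_on_open_invariant by metis
  show "\<exists>p\<in>topspace X. \<exists>V. open V \<and> x \<in> V \<and>
     (\<forall>z\<in>V \<inter> K'. \<sigma> (q z) \<in> U p \<and> F (q z) - F (q x) = h p (\<sigma> (q z)) - h p (\<sigma> (q x)))"
    using p T V x q(2) by (intro bexI[of _ p] exI[of _ T]) auto
qed

text \<open>The difference of two primitives is locally constant on a connected set.\<close>

lemma primitive_along_unique:
  assumes "primitive_along K \<sigma> F" "primitive_along K \<sigma> G" and \<sigma>: "continuous_map (top_of_set K) X \<sigma>"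
    and K: "connected K" "x \<in> K" "y \<in> K"
  shows "F y - F x = G y - G x"
proof -
  have "(\<lambda>x. F x - G x) x = (\<lambda>x. F x - G x) y"
  proof (rule connected_local_const[OF K], rule ballI)
    fix z assume z: "z \<in> K"
    then have sz: "\<sigma> z \<in> topspace X" using \<sigma> by (simp add: continuous_map_def Pi_iff)
    obtain V1 where V1: "open V1" "z \<in> V1" "\<And>w. w \<in> V1 \<inter> K \<Longrightarrow> \<sigma> w \<in> U (\<sigma> z) \<and> F w - F z = h (\<sigma> z) (\<sigma> w) - h (\<sigma> z) (\<sigma> z)"
      by (rule primitive_along_at[OF assms(1) \<sigma> z sz mem_U[OF sz]]) blast
    obtain V2 where V2: "open V2" "z \<in> V2" "\<And>w. w \<in> V2 \<inter> K \<Longrightarrow> \<sigma> w \<in> U (\<sigma> z) \<and> G w - G z = h (\<sigma> z) (\<sigma> w) - h (\<sigma> z) (\<sigma> z)"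
      by (rule primitive_along_at[OF assms(2) \<sigma> z sz mem_U[OF sz]]) blast
    show "eventually (\<lambda>w. F z - G z = F w - G w) (at z within K)"
      unfolding eventually_at_topological
      by (intro exI[of _ "V1 \<inter> V2"]) (use V1 V2 in force)
  qed
  then show ?thesis by simp
qed

text \<open>On the connected overlap the two primitives differ by a constant, which is absorbed into
  the second one; closedness keeps points outside one piece away from it.\<close>

lemma primitive_along_glue:
  assumes F1: "primitive_along K1 \<sigma> F1" and F2: "primitive_along K2 \<sigma> F2"
    and K: "closed K1" "closed K2" "connected (K1 \<inter> K2)"
    and \<sigma>: "continuous_map (top_of_set (K1 \<union> K2)) X \<sigma>"
  shows "\<exists>F. primitive_along (K1 \<union> K2) \<sigma> F"
proof -
  have sub: "continuous_map (top_of_set L) X \<sigma>" if "L \<subseteq> K1 \<union> K2" for L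
    using continuous_map_from_subtopology[OF \<sigma>, of L] that
    by (simp add: subtopology_subtopology inf.absorb2)
  obtain c where c: "\<And>x. x \<in> K1 \<inter> K2 \<Longrightarrow> F1 x = F2 x + c"
  proof (cases "K1 \<inter> K2 = {}")
    case True
    then show thesis using that[of 0] by auto
  next
    case False
    then obtain a where a: "a \<in> K1 \<inter> K2" by auto
    show thesis
    proof (rule that[of "F1 a - F2 a"])
      fix x assume x: "x \<in> K1 \<inter> K2"
      have "F1 x - F1 a = F2 x - F2 a"
        by (rule primitive_along_unique[OF primitive_along_subset[OF F1] primitive_along_subset[OF F2] sub K(3) a x])
          auto
      then show "F1 x = F2 x + (F1 a - F2 a)" by simp
    qed
  qed
  define F where "F x = (if x \<in> K1 then F1 x else F2 x + c)" for x
  have FK1: "F x = F1 x" if "x \<in> K1" for x using that by (simp add: F_def)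
  have FK2: "F x = F2 x + c" if "x \<in> K2" for x using that c by (simp add: F_def)
  have "primitive_along (K1 \<union> K2) \<sigma> F"
    unfolding primitive_along_def
  proof
    fix x assume x: "x \<in> K1 \<union> K2"
    let ?p = "\<sigma> x"
    have p: "?p \<in> topspace X" using x \<sigma> by (simp add: continuous_map_def Pi_iff)
    obtain V1 where V1: "open V1" "x \<in> V1" "\<And>z. z \<in> V1 \<inter> K1 \<Longrightarrow> \<sigma> z \<in> U ?p \<and> F z - F x = h ?p (\<sigma> z) - h ?p (\<sigma> x)"
    proof (cases "x \<in> K1")
      case True
      show thesis
        by (rule primitive_along_at[OF F1 sub True p mem_U[OF p]]) (use that True FK1 in auto)
    next
      case False
      then show thesis using that[of "- K1"] K(1) by (auto simp: open_Compl)
    qed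
    obtain V2 where V2: "open V2" "x \<in> V2" "\<And>z. z \<in> V2 \<inter> K2 \<Longrightarrow> \<sigma> z \<in> U ?p \<and> F z - F x = h ?p (\<sigma> z) - h ?p (\<sigma> x)"
    proof (cases "x \<in> K2")
      case True
      show thesis
        by (rule primitive_along_at[OF F2 sub True p mem_U[OF p]]) (use that True FK2 in auto)
    next
      case False
      then show thesis using that[of "- K2"] K(2) by (auto simp: open_Compl)
    qed
    show "\<exists>p\<in>topspace X. \<exists>V. open V \<and> x \<in> V \<and>
     (\<forall>z\<in>V \<inter> (K1 \<union> K2). \<sigma> z \<in> U p \<and> F z - F x = h p (\<sigma> z) - h p (\<sigma> x))"
      using p V1 V2 by (intro bexI[of _ ?p] exI[of _ "V1 \<inter> V2"]) auto
  qed
  then show ?thesis by blast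
qed

text \<open>Bisection in two stages. Around each s a thin strip is treated by bisecting in t, then
  strips are joined by bisecting in s; the overlaps are convex, hence connected.\<close>

lemma primitive_on_square:
  fixes \<sigma> :: "real \<times> real \<Rightarrow> 'a"
  assumes \<sigma>: "continuous_map (top_of_set ({0..1} \<times> {0..1})) X \<sigma>"
  shows "\<exists>F. primitive_along ({0..1} \<times> {0..1}) \<sigma> F"
proof -
  let ?I = "{0..1::real}"
  let ?S = "\<lambda>a b. {a..b} \<inter> ?I"
  have sub: "continuous_map (top_of_set L) X \<sigma>" if "L \<subseteq> ?I \<times> ?I" for L
    using continuous_map_from_subtopology[OF \<sigma>, of L] that
    by (simp add: subtopology_subtopology inf.absorb2)
  have glue: "\<exists>F. primitive_along K \<sigma> F"
    if "primitive_along K1 \<sigma> F1" "primitive_along K2 \<sigma> F2" "closed K1" "closed K2" "convex (K1 \<inter> K2)"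
      "K = K1 \<union> K2" "K \<subseteq> ?I \<times> ?I" for K K1 K2 F1 F2
    using primitive_along_glue[OF that(1-4) convex_connected[OF that(5)]] sub[OF that(7)] that(6) by blast
  have split: "?S a c = ?S a b \<union> ?S b c" "?S a b \<inter> ?S b c = ?S b b" if "a \<le> b" "b \<le> c" for a b c :: real
    using that by auto
  \<comment> \<open>The width \<delta> may shrink at each joining, which is harmless because it is
    quantified inside the property that is bisected.\<close>
  have strip: "\<exists>\<delta>>0. \<exists>F. primitive_along (?S (s - \<delta>) (s + \<delta>) \<times> ?S 0 1) \<sigma> F" if s: "s \<in> ?I" for s
  proof (rule Bolzano[of 0 1 "\<lambda>c d. \<exists>\<delta>>0. \<exists>F. primitive_along (?S (s - \<delta>) (s + \<delta>) \<times> ?S c d) \<sigma> F"])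
    fix a b c :: real assume "\<exists>\<delta>>0. \<exists>F. primitive_along (?S (s - \<delta>) (s + \<delta>) \<times> ?S a b) \<sigma> F"
      "\<exists>\<delta>>0. \<exists>F. primitive_along (?S (s - \<delta>) (s + \<delta>) \<times> ?S b c) \<sigma> F" and abc: "a \<le> b" "b \<le> c"
    then obtain \<delta>1 F1 \<delta>2 F2 where \<delta>: "\<delta>1 > 0" "\<delta>2 > 0"
      and F: "primitive_along (?S (s - \<delta>1) (s + \<delta>1) \<times> ?S a b) \<sigma> F1"
        "primitive_along (?S (s - \<delta>2) (s + \<delta>2) \<times> ?S b c) \<sigma> F2" by auto
    let ?\<delta> = "min \<delta>1 \<delta>2"
    have "\<exists>F. primitive_along (?S (s - ?\<delta>) (s + ?\<delta>) \<times> ?S a c) \<sigma> F"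
    proof (rule glue[OF primitive_along_subset[OF F(1)] primitive_along_subset[OF F(2)]])
      show "?S (s - ?\<delta>) (s + ?\<delta>) \<times> ?S a b \<subseteq> ?S (s - \<delta>1) (s + \<delta>1) \<times> ?S a b"
        "?S (s - ?\<delta>) (s + ?\<delta>) \<times> ?S b c \<subseteq> ?S (s - \<delta>2) (s + \<delta>2) \<times> ?S b c" by auto
      show "convex (?S (s - ?\<delta>) (s + ?\<delta>) \<times> ?S a b \<inter> ?S (s - ?\<delta>) (s + ?\<delta>) \<times> ?S b c)"
        unfolding Times_Int_Times split(2)[OF abc]
        by (intro convex_Times convex_Int) auto
      show "?S (s - ?\<delta>) (s + ?\<delta>) \<times> ?S a c = ?S (s - ?\<delta>) (s + ?\<delta>) \<times> ?S a b \<union> ?S (s - ?\<delta>) (s + ?\<delta>) \<times> ?S b c"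
        unfolding split(1)[OF abc] by blast
    qed (auto intro!: closed_Times closed_Int)
    then show "\<exists>\<delta>>0. \<exists>F. primitive_along (?S (s - \<delta>) (s + \<delta>) \<times> ?S a c) \<sigma> F"
      using \<delta> by (intro exI[of _ ?\<delta>]) auto
  next
    fix t :: real assume "0 \<le> t" "t \<le> 1"
    then have st: "(s, t) \<in> ?I \<times> ?I" using s by auto
    let ?p = "\<sigma> (s, t)"
    have p: "?p \<in> topspace X" using st \<sigma> by (simp add: continuous_map_def Pi_iff)
    have "openin (top_of_set (?I \<times> ?I)) {z \<in> ?I \<times> ?I. \<sigma> z \<in> U ?p}"
      using openin_continuous_map_preimage[OF \<sigma> open_U[OF p]] by simp
    then obtain T where T: "open T" "{z \<in> ?I \<times> ?I. \<sigma> z \<in> U ?p} = (?I \<times> ?I) \<inter> T" by (auto simp: openin_open)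
    have "(s, t) \<in> T" using T(2) st mem_U[OF p] by blast
    then obtain r where r: "r > 0" "ball (s, t) r \<subseteq> T" using T(1) open_contains_ball by blast
    have small: "(s', t') \<in> T" if "\<bar>s' - s\<bar> < r / 2" "\<bar>t' - t\<bar> < r / 2" for s' t'
    proof -
      have "dist (s, t) (s', t') \<le> \<bar>s' - s\<bar> + \<bar>t' - t\<bar>"
        unfolding dist_Pair_Pair dist_real_def by (rule order_trans[OF sqrt_sum_squares_le_sum_abs]) auto
      then show ?thesis using r that by auto
    qed
    \<comment> \<open>A rectangle of half-width r/4 and height below r/2 is mapped into one set
      \<open>U ?p\<close>, where the potential \<open>h ?p\<close> itself supplies a
      primitive.\<close>
    show "\<exists>d>0. \<forall>a b. a \<le> t \<and> t \<le> b \<and> b - a < d \<longrightarrow>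
      (\<exists>\<delta>>0. \<exists>F. primitive_along (?S (s - \<delta>) (s + \<delta>) \<times> ?S a b) \<sigma> F)"
    proof (rule exI[of _ "r / 2"], intro conjI allI impI)
      fix a b assume ab: "a \<le> t \<and> t \<le> b \<and> b - a < r / 2"
      have "\<sigma> z \<in> U ?p" if "z \<in> ?S (s - r / 4) (s + r / 4) \<times> ?S a b" for z
      proof -
        have "s - r / 4 \<le> fst z" "fst z \<le> s + r / 4" "a \<le> snd z" "snd z \<le> b" using that by auto
        then have "\<bar>fst z - s\<bar> < r / 2" "\<bar>snd z - t\<bar> < r / 2" using ab r(1) by linarith+
        then have "z \<in> T" using small[of "fst z" "snd z"] by simp
        moreover have "z \<in> ?I \<times> ?I" using that by auto
        ultimately show ?thesis using T(2) by blast
      qed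
      then have "primitive_along (?S (s - r / 4) (s + r / 4) \<times> ?S a b) \<sigma> (\<lambda>z. h ?p (\<sigma> z))"
        unfolding primitive_along_def using p by (intro ballI bexI[of _ ?p] exI[of _ UNIV]) auto
      then show "\<exists>\<delta>>0. \<exists>F. primitive_along (?S (s - \<delta>) (s + \<delta>) \<times> ?S a b) \<sigma> F"
        using r by (intro exI[of _ "r / 4"]) auto
    qed (use r in auto)
  qed simp
  have "\<exists>F. primitive_along (?S 0 1 \<times> ?I) \<sigma> F"
  proof (rule Bolzano[of 0 1 "\<lambda>a b. \<exists>F. primitive_along (?S a b \<times> ?I) \<sigma> F"])
    fix a b c :: real assume "\<exists>F. primitive_along (?S a b \<times> ?I) \<sigma> F" "\<exists>F. primitive_along (?S b c \<times> ?I) \<sigma> F"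
      and abc: "a \<le> b" "b \<le> c"
    then obtain F1 F2 where F: "primitive_along (?S a b \<times> ?I) \<sigma> F1" "primitive_along (?S b c \<times> ?I) \<sigma> F2" by auto
    show "\<exists>F. primitive_along (?S a c \<times> ?I) \<sigma> F"
    proof (rule glue[OF F])
      show "convex (?S a b \<times> ?I \<inter> ?S b c \<times> ?I)"
        unfolding Times_Int_Times split(2)[OF abc] by (intro convex_Times convex_Int) auto
      show "?S a c \<times> ?I = ?S a b \<times> ?I \<union> ?S b c \<times> ?I" unfolding split(1)[OF abc] by blast
    qed (auto intro!: closed_Times closed_Int)
  next
    fix s :: real assume "0 \<le> s" "s \<le> 1"
    then obtain \<delta> F where \<delta>: "\<delta> > 0" "primitive_along (?S (s - \<delta>) (s + \<delta>) \<times> ?S 0 1) \<sigma> F"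
      using strip[of s] by auto
    show "\<exists>d>0. \<forall>a b. a \<le> s \<and> s \<le> b \<and> b - a < d \<longrightarrow> (\<exists>F. primitive_along (?S a b \<times> ?I) \<sigma> F)"
    proof (intro exI[of _ \<delta>] conjI allI impI)
      fix a b assume "a \<le> s \<and> s \<le> b \<and> b - a < \<delta>"
      then have "primitive_along (?S a b \<times> ?I) \<sigma> F"
        by (intro primitive_along_subset[OF \<delta>(2)]) auto
      then show "\<exists>F. primitive_along (?S a b \<times> ?I) \<sigma> F" by blast
    qed (use \<delta> in auto)
  qed simp
  then show ?thesis by simp
qed

section \<open>Path integrals as a cocycle on singular 1-simplices\<close>

text \<open>The choice of primitive is immaterial, since increments of primitives along a path are
  unique.\<close>

definition path_integral :: "(real \<Rightarrow> 'a) \<Rightarrow> real" where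
  "path_integral c = (let F = SOME F. primitive_along {0..1} c F in F 1 - F 0)"

lemma path_integral_eq:
  assumes c: "pathin X c" and F: "primitive_along {0..1} c F"
  shows "path_integral c = F 1 - F 0"
proof -
  have "primitive_along {0..1} c (SOME F. primitive_along {0..1} c F)" using F by (rule someI[where P = "primitive_along {0..1} c"])
  from primitive_along_unique[OF this F c[unfolded pathin_def], of 0 1] show ?thesis
    by (simp add: path_integral_def)
qed

lemma primitive_along_cong:
  assumes "primitive_along K \<sigma> F" "\<And>x. x \<in> K \<Longrightarrow> \<sigma> x = \<sigma>' x"
  shows "primitive_along K \<sigma>' F"
  using assms unfolding primitive_along_def by (metis (no_types, lifting) IntD2)

lemma path_integral_cong:
  assumes "\<And>t. t \<in> {0..1} \<Longrightarrow> c t = c' t"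
  shows "path_integral c = path_integral c'"
proof -
  have "primitive_along {0..1} c F \<longleftrightarrow> primitive_along {0..1} c' F" for F
    using primitive_along_cong[of "{0..1}" c F c'] primitive_along_cong[of "{0..1}" c' F c] assms by auto
  then show ?thesis by (simp add: path_integral_def)
qed

text \<open>The parametrisation runs from vertex 0 to vertex 1 in barycentric coordinates, so face 1
  is the start and face 0 the end.\<close>

definition edge :: "((nat \<Rightarrow> real) \<Rightarrow> 'a) \<Rightarrow> real \<Rightarrow> 'a" where
  "edge f s = f (\<lambda>i. if i = 0 then 1 - s else if i = 1 then s else 0)"

text \<open>\<open>restrict\<close> is there because singular simplices are extensional functions on
  the standard simplex.\<close>

definition simplex_of_path :: "(real \<Rightarrow> 'a) \<Rightarrow> (nat \<Rightarrow> real) \<Rightarrow> 'a" where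
  "simplex_of_path c = restrict (\<lambda>x. c (x 1)) (standard_simplex 1)"

lemma standard_simplex_1: "(\<lambda>i. if i = 0 then 1 - s else if i = 1 then s else 0) \<in> standard_simplex 1"
  if "s \<in> {0..1}" for s :: real
  using that by (auto simp: standard_simplex_def)

lemma edge_simplex_of_path: "s \<in> {0..1} \<Longrightarrow> edge (simplex_of_path c) s = c s"
  using standard_simplex_1[of s] by (simp add: edge_def simplex_of_path_def)

lemma singular_simplex_of_path:
  assumes "pathin X c" shows "singular_simplex 1 X (simplex_of_path c)"
proof -
  let ?S = "subtopology (powertop_real UNIV) (standard_simplex 1)"
  have "continuous_map ?S (top_of_set {0..1}) (\<lambda>x. x 1)"
    by (auto simp: continuous_map_in_subtopology standard_simplex_def
        intro!: continuous_map_from_subtopology continuous_map_product_projection)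
  then have "continuous_map ?S X (c \<circ> (\<lambda>x. x 1))"
    using assms unfolding pathin_def by (rule continuous_map_compose)
  then have "continuous_map ?S X (simplex_of_path c)"
    by (rule continuous_map_eq) (auto simp: simplex_of_path_def topspace_subtopology)
  then show ?thesis unfolding singular_simplex_def by (simp add: simplex_of_path_def)
qed

text \<open>The map \<open>q\<close> of the proof collapses one edge of the square to a vertex of the triangle.\<close>

lemma path_integral_2simplex:
  assumes f: "singular_simplex 2 X f"
  shows "path_integral (edge (singular_face 2 0 f)) - path_integral (edge (singular_face 2 1 f))
    + path_integral (edge (singular_face 2 2 f)) = 0"
proof -
  \<comment> \<open>The side s = 0 goes to vertex 0; the sides s = 1, t = 1 and t = 0 parametrise
    the faces 0, 1 and 2.\<close>
  define q :: "real \<times> real \<Rightarrow> nat \<Rightarrow> real" where "q = (\<lambda>(s, t) i. if i = 0 then 1 - s else if i = 1 then s * (1 - t)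
    else if i = 2 then s * t else 0)"
  let ?Q = "{0..1::real} \<times> {0..1::real}"
  have q: "q z \<in> standard_simplex 2" if "z \<in> ?Q" for z
  proof -
    obtain s t where z: "z = (s, t)" by (cases z)
    have st: "0 \<le> s" "s \<le> 1" "0 \<le> t" "t \<le> 1" using that z by auto
    have "s * (1 - t) \<le> 1" "s * t \<le> 1" using st by (auto intro: mult_le_one)
    then have "0 \<le> q z i \<and> q z i \<le> 1" for i using st by (simp add: z q_def)
    moreover have "(\<Sum>i\<le>2. q z i) = 1" by (simp add: z q_def numeral_2_eq_2 algebra_simps)
    ultimately show ?thesis by (simp add: standard_simplex_def z q_def)
  qed
  have "continuous_map (top_of_set ?Q) (powertop_real UNIV) q"
    unfolding continuous_map_componentwise_UNIV
  proof
    fix i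
    show "continuous_map (top_of_set ?Q) euclideanreal (\<lambda>z. q z i)"
      unfolding q_def case_prod_unfold by (cases "i = 0"; cases "i = 1"; cases "i = 2") (auto intro!: continuous_intros)
  qed
  then have "continuous_map (top_of_set ?Q) (subtopology (powertop_real UNIV) (standard_simplex 2)) q"
    using q by (simp add: continuous_map_in_subtopology image_subset_iff)
  then have \<sigma>: "continuous_map (top_of_set ?Q) X (\<lambda>z. f (q z))"
    using continuous_map_compose[of "top_of_set ?Q" _ q X f] f by (simp add: singular_simplex_def o_def)
  obtain F where F: "primitive_along ?Q (\<lambda>z. f (q z)) F" using primitive_on_square[OF \<sigma>] by blast
  have path_eq: "path_integral c = F e - F b"
    if r: "continuous_on {0..1} \<rho>" "\<rho> ` {0..1} \<subseteq> ?Q" and be: "\<rho> 0 = b" "\<rho> 1 = e"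
      and c: "\<And>s. s \<in> {0..1} \<Longrightarrow> c s = f (q (\<rho> s))" for c b e and \<rho> :: "real \<Rightarrow> real \<times> real"
  proof -
    have p: "pathin X (\<lambda>s. f (q (\<rho> s)))"
      unfolding pathin_def
      using continuous_map_compose[OF _ \<sigma>, of "top_of_set {0..1}" \<rho>] r by (auto simp: o_def image_subset_iff)
    have "path_integral c = path_integral (\<lambda>s. f (q (\<rho> s)))" by (rule path_integral_cong) (rule c)
    also have "\<dots> = F (\<rho> 1) - F (\<rho> 0)"
      by (rule path_integral_eq[OF p primitive_along_compose[OF F r]])
    finally show ?thesis by (simp add: be)
  qed
  have face: "edge (singular_face 2 k f) s = f (simplical_face k (\<lambda>i. if i = 0 then 1 - s else if i = 1 then s else 0))"
    if "s \<in> {0..1}" for k s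
    using standard_simplex_1[OF that] by (simp add: edge_def singular_face_def)
  have 0: "path_integral (edge (singular_face 2 0 f)) = F (1, 1) - F (1, 0)"
    by (rule path_eq[of "\<lambda>s. (1, s)"])
      (auto intro!: continuous_intros arg_cong[where f = f] simp: face q_def simplical_face_def fun_eq_iff)
  have 1: "path_integral (edge (singular_face 2 1 f)) = F (1, 1) - F (0, 1)"
    by (rule path_eq[of "\<lambda>s. (s, 1)"])
      (auto intro!: continuous_intros arg_cong[where f = f] simp: face q_def simplical_face_def fun_eq_iff)
  have 2: "path_integral (edge (singular_face 2 2 f)) = F (1, 0) - F (0, 0)"
    by (rule path_eq[of "\<lambda>s. (s, 0)"])
      (auto intro!: continuous_intros arg_cong[where f = f] simp: face q_def simplical_face_def fun_eq_iff)
  \<comment> \<open>The collapsed side is a constant path. Its integral is computed a second time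
    from a constant path in the square and so is 0.\<close>
  have "path_integral (\<lambda>s. f (q (0, 0))) = F (0, 1) - F (0, 0)"
    by (rule path_eq[of "\<lambda>s. (0, s)"])
      (auto intro!: continuous_intros arg_cong[where f = f] simp: q_def fun_eq_iff)
  moreover have "path_integral (\<lambda>s. f (q (0, 0))) = F (0, 0) - F (0, 0)"
    by (rule path_eq[of "\<lambda>s. (0, 0)"]) (auto intro!: continuous_intros)
  ultimately show ?thesis using 0 1 2 by simp
qed

text \<open>The chain c1 + c2 - c3 is a cycle, and path integrals over edges form a cocycle by
  \<open>path_integral_2simplex\<close>.\<close>

lemma path_integral_triangle:
  assumes b: "betti_number 1 X = 0"
    and c: "pathin X c1" "pathin X c2" "pathin X c3"
    and ends: "c1 0 = c3 0" "c1 1 = c2 0" "c2 1 = c3 1"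
  shows "path_integral c3 = path_integral c1 + path_integral c2"
proof -
  let ?s = "\<lambda>c. frag_of (simplex_of_path c)"
  let ?pt = "\<lambda>a. frag_of (restrict (\<lambda>_. a) (standard_simplex 0))"
  have face: "singular_face 1 0 (simplex_of_path c) = restrict (\<lambda>_. c 1) (standard_simplex 0)"
      "singular_face 1 1 (simplex_of_path c) = restrict (\<lambda>_. c 0) (standard_simplex 0)" for c
    by (auto simp: fun_eq_iff singular_face_def simplex_of_path_def simplical_face_def standard_simplex_def
        restrict_def)
  have bd: "chain_boundary 1 (?s c) = ?pt (c 1) - ?pt (c 0)" for c
    using face[of c] by (simp add: chain_boundary_of)
  let ?z = "?s c1 + ?s c2 - ?s c3"
  have "chain_boundary 1 ?z = 0"
    using ends by (simp add: chain_boundary_add chain_boundary_diff bd del: One_nat_def)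
  moreover have "singular_chain 1 X ?z"
    using c by (intro singular_chain_diff singular_chain_add) (simp_all add: singular_chain_of singular_simplex_of_path del: One_nat_def)
  ultimately have "singular_relcycle 1 X {} ?z" by (simp add: singular_cycle)
  then have "chain_eval (\<lambda>s. path_integral (edge s)) ?z = 0"
    by (rule chain_eval_cycle[OF b]) (rule path_integral_2simplex)
  moreover have "path_integral (edge (simplex_of_path c)) = path_integral c" for c
    by (rule path_integral_cong) (rule edge_simplex_of_path)
  ultimately show ?thesis by (simp add: chain_eval_add chain_eval_diff)
qed

text \<open>H p is the integral along a chosen path to p from a base point of its path component.
  The triangle formed by two chosen paths and c shows that increments do not depend on the
  choices.\<close>

theorem global_potential:
  assumes b: "betti_number 1 X = 0"
  obtains H where "\<And>p c. p \<in> topspace X \<Longrightarrow> pathin X c \<Longrightarrow> c ` {0..1} \<subseteq> U p \<Longrightarrow>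
    H (c 1) - H (c 0) = h p (c 1) - h p (c 0)"
proof -
  define base where "base p = (SOME b. path_component_of X b p)" for p
  define H where "H p = path_integral (SOME c. pathin X c \<and> c 0 = base p \<and> c 1 = p)" for p
  have pathH: "\<exists>c. pathin X c \<and> c 0 = base p \<and> c 1 = p \<and> H p = path_integral c" if "p \<in> topspace X" for p
  proof -
    have "path_component_of X p p" using that by (simp add: path_component_of_refl)
    then have "path_component_of X (base p) p" unfolding base_def by (rule someI)
    then have "\<exists>c. pathin X c \<and> c 0 = base p \<and> c 1 = p" by (simp add: path_component_of_def)
    from someI_ex[OF this] show ?thesis unfolding H_def by blast
  qed
  show thesis
  proof (rule that)
    fix p c assume p: "p \<in> topspace X" and c: "pathin X c" "c ` {0..1} \<subseteq> U p"
    have in_top: "c 0 \<in> topspace X" "c 1 \<in> topspace X"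
      using c(1) by (auto simp: pathin_def continuous_map_def Pi_iff)
    have "path_component_of X (c 0) (c 1)" using c(1) by (auto simp: path_component_of_def)
    \<comment> \<open>Both ends of c satisfy the same path component predicate, so
      \<open>SOME\<close> picks the same base point for them.\<close>
    then have "path_component_of X b (c 0) \<longleftrightarrow> path_component_of X b (c 1)" for b
      by (meson path_component_of_sym path_component_of_trans)
    then have base: "base (c 0) = base (c 1)" by (simp add: base_def)
    obtain c1 where c1: "pathin X c1" "c1 0 = base (c 0)" "c1 1 = c 0" "H (c 0) = path_integral c1"
      using pathH[OF in_top(1)] by blast
    obtain c3 where c3: "pathin X c3" "c3 0 = base (c 1)" "c3 1 = c 1" "H (c 1) = path_integral c3"
      using pathH[OF in_top(2)] by blast
    have "H (c 1) = H (c 0) + path_integral c"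
      unfolding c1(4) c3(4) by (rule path_integral_triangle[OF b c1(1) c(1) c3(1)]) (simp_all add: c1 c3 base)
    moreover have "primitive_along {0..1} c (\<lambda>s. h p (c s))"
      unfolding primitive_along_def using p c(2) by (intro ballI bexI[of _ p] exI[of _ UNIV]) auto
    then have "path_integral c = h p (c 1) - h p (c 0)" by (rule path_integral_eq[OF c(1)])
    ultimately show "H (c 1) - H (c 0) = h p (c 1) - h p (c 0)" by simp
  qed
qed

end

section \<open>Smooth maps, forms and vector fields in charts\<close>

locale smooth_mfd =
  fixes M :: "('a, 'i, 'e::euclidean_space) atlas_space"
  assumes mfd: "smooth_manifold M"
begin

abbreviation "X \<equiv> mspace M"
abbreviation "I \<equiv> index_set M"
abbreviation "emb i \<equiv> inv_into (cdom M i) (chart M i)"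

section \<open>Charts and local representations of maps\<close>

lemma open_cimg: "i \<in> I \<Longrightarrow> open (cimg M i)"
  and openin_cdom: "i \<in> I \<Longrightarrow> openin X (cdom M i)"
  and homeo: "i \<in> I \<Longrightarrow> homeomorphic_map (subtopology X (cdom M i)) (top_of_set (cimg M i)) (chart M i)"
  and cover: "p \<in> topspace X \<Longrightarrow> \<exists>i\<in>I. p \<in> cdom M i"
  and Hausdorff: "Hausdorff_space X"
  and transition_smooth: "i \<in> I \<Longrightarrow> j \<in> I \<Longrightarrow>
    smooth_on (chart M i ` (cdom M i \<inter> cdom M j)) (local_rep M id i j)"
  using mfd unfolding smooth_manifold_def by auto

lemma cdom_subset: "i \<in> I \<Longrightarrow> cdom M i \<subseteq> topspace X"
  using openin_cdom openin_subset by blast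

lemma inj_chart: "i \<in> I \<Longrightarrow> inj_on (chart M i) (cdom M i)"
  using homeo[of i] cdom_subset[of i]
  by (auto dest!: homeomorphic_imp_injective_map simp: topspace_subtopology Int_absorb1)

lemma chart_in: "p \<in> cdom M i \<Longrightarrow> chart M i p \<in> cimg M i"
  by (simp add: cimg_def)

lemma emb_in: "x \<in> cimg M i \<Longrightarrow> emb i x \<in> cdom M i"
  unfolding cimg_def by (rule inv_into_into)

lemma chart_emb [simp]: "x \<in> cimg M i \<Longrightarrow> chart M i (emb i x) = x"
  unfolding cimg_def by (rule f_inv_into_f)

lemma emb_chart [simp]: "i \<in> I \<Longrightarrow> p \<in> cdom M i \<Longrightarrow> emb i (chart M i p) = p"
  using inj_chart by (rule inv_into_f_f)

lemma emb_in_topspace: "i \<in> I \<Longrightarrow> x \<in> cimg M i \<Longrightarrow> emb i x \<in> topspace X"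
  using emb_in cdom_subset by blast

lemma continuous_emb: 
  assumes i: "i \<in> I" shows "continuous_map (top_of_set (cimg M i)) X (emb i)"
proof -
  let ?S = "subtopology X (cdom M i)"
  obtain g where g: "continuous_map (top_of_set (cimg M i)) ?S g"
    "\<And>x. x \<in> topspace ?S \<Longrightarrow> g (chart M i x) = x"
    using homeo[OF i] unfolding homeomorphic_map_maps homeomorphic_maps_def by blast
  have "g x = emb i x" if "x \<in> cimg M i" for x
    using g(2)[of "emb i x"] emb_in[OF that] chart_emb[OF that] cdom_subset[OF i]
    by (auto simp: topspace_subtopology)
  then have "continuous_map (top_of_set (cimg M i)) ?S (emb i)"
    using g(1) by (rule continuous_map_eq[rotated]) auto
  then show ?thesis by (simp add: continuous_map_in_subtopology)
qed

lemma openin_emb_image: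
  assumes i: "i \<in> I" and V: "open V" "V \<subseteq> cimg M i"
  shows "openin X (emb i ` V)"
proof -
  have "openin (subtopology X (cdom M i)) {p \<in> topspace (subtopology X (cdom M i)). chart M i p \<in> V}"
    using homeomorphic_imp_continuous_map[OF homeo[OF i]] V
    by (intro openin_continuous_map_preimage[of _ "top_of_set (cimg M i)"]) (auto simp: openin_open_eq open_cimg[OF i])
  moreover have "{p \<in> topspace (subtopology X (cdom M i)). chart M i p \<in> V} = emb i ` V"
    using V cdom_subset[OF i] emb_in i by (force simp: topspace_subtopology image_iff)
  ultimately have "openin (subtopology X (cdom M i)) (emb i ` V)" by simp
  then show ?thesis using openin_cdom[OF i] openin_trans_full by blast
qed

lemma open_chart_image:
  assumes i: "i \<in> I" and W: "openin X W" "W \<subseteq> cdom M i"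
  shows "open (chart M i ` W)"
proof -
  have "openin (subtopology X (cdom M i)) W"
    using W by (metis inf.absorb1 openin_subtopology_Int)
  then have "openin (top_of_set (cimg M i)) (chart M i ` W)"
    using homeomorphic_imp_open_map[OF homeo[OF i]] by (simp add: open_map_def)
  then show ?thesis using open_cimg[OF i] by (simp add: openin_open_eq)
qed

lemma local_rep_apply: "local_rep M f i j x = chart M j (f (emb i x))"
  by (simp add: local_rep_def)

text \<open>The coordinates at which \<open>local_rep M f i j\<close> is meaningful; elsewhere
  \<open>inv_into\<close> or the target chart is applied outside its domain.\<close>

definition "rdom f i j = chart M i ` {p \<in> cdom M i. f p \<in> cdom M j}"

lemma open_rdom:
  assumes f: "continuous_map X X f" and i: "i \<in> I" "j \<in> I" shows "open (rdom f i j)"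
proof -
  have "openin X {p \<in> topspace X. f p \<in> cdom M j}"
    by (rule openin_continuous_map_preimage[OF f openin_cdom[OF i(2)]])
  then have "openin X ({p \<in> topspace X. f p \<in> cdom M j} \<inter> cdom M i)" using openin_cdom[OF i(1)] by blast
  moreover have "{p \<in> topspace X. f p \<in> cdom M j} \<inter> cdom M i = {p \<in> cdom M i. f p \<in> cdom M j}"
    using cdom_subset[OF i(1)] by auto
  ultimately show ?thesis unfolding rdom_def by (intro open_chart_image[OF i(1)]) auto
qed

lemma rdom_iff: "i \<in> I \<Longrightarrow> x \<in> rdom f i j \<longleftrightarrow> x \<in> cimg M i \<and> f (emb i x) \<in> cdom M j"
  unfolding rdom_def using emb_in by (force simp: cimg_def image_iff)

lemma smooth_local_rep:
  assumes "smooth_self_map M f" "i \<in> I" "j \<in> I"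
  shows "open (rdom f i j)" "smooth_on (rdom f i j) (local_rep M f i j)"
  using assms open_rdom unfolding smooth_self_map_def rdom_def by auto

lemma smooth_self_map_maps: "smooth_self_map M f \<Longrightarrow> p \<in> topspace X \<Longrightarrow> f p \<in> topspace X"
  unfolding smooth_self_map_def by (auto simp: continuous_map_def)

lemma smooth_self_map_id: "smooth_self_map M id"
  unfolding smooth_self_map_def
proof (intro conjI ballI)
  show "smooth_on (chart M i ` {p \<in> cdom M i. id p \<in> cdom M j}) (local_rep M id i j)"
    if "i \<in> I" "j \<in> I" for i j
    using transition_smooth[OF that] by (simp add: Int_def)
qed simp

text \<open>Near each point one pair of charts suffices: continuity follows from the local
  representation, and any other pair differs by transition maps.\<close>

lemma smooth_self_mapI:
  assumes "\<And>p. p \<in> topspace X \<Longrightarrow> \<exists>i\<in>I. \<exists>j\<in>I. \<exists>W. p \<in> cdom M i \<and> open W \<and> chart M i p \<in> W \<and> W \<subseteq> cimg M i \<and>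
    (\<forall>x\<in>W. f (emb i x) \<in> cdom M j) \<and> smooth_on W (local_rep M f i j)"
  shows "smooth_self_map M f"
proof -
  have cont: "continuous_map X X f"
  proof -
    have "openin X {p \<in> topspace X. f p \<in> T}" if T: "openin X T" for T
    proof (subst openin_subopen, safe)
      fix p assume p: "p \<in> topspace X" "f p \<in> T"
      obtain i j W where i: "i \<in> I" "j \<in> I" and pi: "p \<in> cdom M i" and W: "open W" "chart M i p \<in> W" "W \<subseteq> cimg M i"
        and fW: "\<And>x. x \<in> W \<Longrightarrow> f (emb i x) \<in> cdom M j" and sm: "smooth_on W (local_rep M f i j)"
        using assms[OF p(1)] by blast
      let ?T = "chart M j ` (T \<inter> cdom M j)"
      have oT: "open ?T" by (rule open_chart_image[OF i(2)]) (use T openin_cdom[OF i(2)] in auto)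
      define W' where "W' = local_rep M f i j -` ?T \<inter> W"
      have W': "open W'"
        using smooth_on_imp_continuous_on[OF sm] oT W(1) unfolding W'_def
        by (simp add: continuous_on_open_vimage)
      have pW': "chart M i p \<in> W'"
        using W fW[OF W(2)] i pi p(2) by (auto simp: W'_def local_rep_apply)
      have in_T: "f (emb i x) \<in> T" if "x \<in> W'" for x
      proof -
        obtain q where q: "q \<in> T" "q \<in> cdom M j" "chart M j (f (emb i x)) = chart M j q"
          using \<open>x \<in> W'\<close> by (auto simp: W'_def local_rep_apply)
        moreover have "f (emb i x) \<in> cdom M j" using fW \<open>x \<in> W'\<close> by (simp add: W'_def)
        ultimately show ?thesis using inj_onD[OF inj_chart[OF i(2)]] by metis
      qed
      have W's: "W' \<subseteq> cimg M i" using W(3) by (auto simp: W'_def)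
      show "\<exists>U. openin X U \<and> p \<in> U \<and> U \<subseteq> {p \<in> topspace X. f p \<in> T}"
      proof (intro exI[of _ "emb i ` W'"] conjI)
        show "openin X (emb i ` W')" by (rule openin_emb_image[OF i(1) W' W's])
        show "p \<in> emb i ` W'" using pW' i(1) pi by (metis emb_chart image_eqI)
        show "emb i ` W' \<subseteq> {p \<in> topspace X. f p \<in> T}" using in_T W's emb_in_topspace[OF i(1)] by auto
      qed
    qed
    moreover have "f p \<in> topspace X" if p: "p \<in> topspace X" for p
      using assms[OF p] cdom_subset by (metis emb_chart subsetD)
    ultimately show ?thesis by (simp add: continuous_map_def Pi_iff)
  qed
  show ?thesis
    unfolding smooth_self_map_def rdom_def[symmetric]
  proof (intro conjI ballI cont)
    fix k l assume k: "k \<in> I" "l \<in> I"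
    show "smooth_on (rdom f k l) (local_rep M f k l)"
    proof (rule smooth_on_local)
      fix x assume x: "x \<in> rdom f k l"
      let ?p = "emb k x"
      have xk: "x \<in> cimg M k" "f ?p \<in> cdom M l" using x rdom_iff[OF k(1)] by auto
      have p: "?p \<in> topspace X" by (rule emb_in_topspace[OF k(1) xk(1)])
      obtain i j W where i: "i \<in> I" "j \<in> I" and pi: "?p \<in> cdom M i" and W: "open W" "chart M i ?p \<in> W" "W \<subseteq> cimg M i"
        and fW: "\<And>x. x \<in> W \<Longrightarrow> f (emb i x) \<in> cdom M j" and sm: "smooth_on W (local_rep M f i j)"
        using assms[OF p] by blast
      \<comment> \<open>In the charts k and l, f is factored as the transition from k to i, the
        given representation from i to j, and the transition from j to l.\<close>
      note t1 = smooth_local_rep[OF smooth_self_map_id k(1) i(1)]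
      note t2 = smooth_local_rep[OF smooth_self_map_id i(2) k(2)]
      define T1 where "T1 = local_rep M id k i -` W \<inter> rdom id k i"
      have T1: "open T1" unfolding T1_def
        using smooth_on_imp_continuous_on[OF t1(2)] t1(1) W(1) by (simp add: continuous_on_open_vimage)
      define T where "T = T1 \<inter> rdom f k l"
      have T: "open T" using T1 open_rdom[OF cont k] by (auto simp: T_def)
      have T1W: "local_rep M id k i ` T \<subseteq> W" by (auto simp: T_def T1_def)
      have Ti: "emb i (local_rep M id k i y) = emb k y" if "y \<in> T" for y
        using that rdom_iff[OF k(1)] i(1) by (auto simp: T_def T1_def local_rep_apply)
      have s1: "smooth_on T (\<lambda>y. local_rep M f i j (local_rep M id k i y))"
        by (rule smooth_on_compose[OF T W(1) sm smooth_on_subset[OF t1(2)] T1W]) (auto simp: T_def T1_def)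
      have s2: "smooth_on T (\<lambda>y. local_rep M id j l (local_rep M f i j (local_rep M id k i y)))"
      proof (rule smooth_on_compose[OF T t2(1,2) s1], safe)
        fix y assume y: "y \<in> T"
        then have W': "local_rep M id k i y \<in> W" using T1W by blast
        have "f (emb k y) \<in> cdom M l" using y rdom_iff[OF k(1)] by (auto simp: T_def)
        then show "local_rep M f i j (local_rep M id k i y) \<in> rdom id j l"
          using fW[OF W'] Ti[OF y] i(2) by (auto simp: rdom_iff local_rep_apply chart_in)
      qed
      have "smooth_on T (local_rep M f k l)"
      proof (rule smooth_on_cong[OF T _ s2])
        fix y assume y: "y \<in> T"
        then have W': "local_rep M id k i y \<in> W" using T1W by blast
        show "local_rep M id j l (local_rep M f i j (local_rep M id k i y)) = local_rep M f k l y"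
          using fW[OF W'] Ti[OF y] i(2) by (simp add: local_rep_apply)
      qed
      moreover have "x \<in> T"
        using x xk W(2) pi emb_chart[OF i(1) pi] k(1) by (auto simp: T_def T1_def local_rep_apply rdom_iff)
      ultimately show "\<exists>T. open T \<and> x \<in> T \<and> smooth_on T (local_rep M f k l)" using T by blast
    qed
  qed
qed

section \<open>Tangent maps and pullbacks\<close>

lemma in_chartsD:
  assumes "in_charts M f i j p"
  shows "i \<in> I" "j \<in> I" "p \<in> cdom M i" "f p \<in> cdom M j" "p \<in> topspace X" "chart M i p \<in> cimg M i"
    "chart M j (f p) \<in> cimg M j"
  using assms cdom_subset chart_in unfolding in_charts_def by auto

lemma chart_in_rdom: "in_charts M f i j p \<Longrightarrow> chart M i p \<in> rdom f i j"
  using in_chartsD by (simp add: rdom_iff)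

lemma ex_in_charts:
  assumes "smooth_self_map M f" "p \<in> topspace X" shows "\<exists>i j. in_charts M f i j p"
  using cover[OF assms(2)] cover[OF smooth_self_map_maps[OF assms]] by (auto simp: in_charts_def)

lemma local_rep_has_derivative:
  assumes "smooth_self_map M f" "in_charts M f i j p"
  shows "(local_rep M f i j has_derivative tangent_map M f i j p) (at (chart M i p))"
  unfolding tangent_map_def
  using smooth_local_rep(2)[OF assms(1)] in_chartsD[OF assms(2)] chart_in_rdom[OF assms(2)]
  by (auto intro: smooth_on_has_derivative)

lemma linear_tangent_map:
  "smooth_self_map M f \<Longrightarrow> in_charts M f i j p \<Longrightarrow> linear (tangent_map M f i j p)"
  using local_rep_has_derivative has_derivative_linear by blast

lemma tangent_map_unique:
  assumes "open W" "chart M i p \<in> W" "\<And>x. x \<in> W \<Longrightarrow> local_rep M f i j x = g x"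
    "(g has_derivative D) (at (chart M i p))"
  shows "tangent_map M f i j p = D"
proof -
  have "(local_rep M f i j has_derivative D) (at (chart M i p))"
    by (rule has_derivative_transform_within_open[OF assms(4,1,2)]) (simp add: assms(3))
  then show ?thesis unfolding tangent_map_def by (metis frechet_derivative_at)
qed

lemma tangent_map_compose:
  assumes f: "smooth_self_map M f" and g: "smooth_self_map M g"
    and ij: "in_charts M f i j p" and jk: "in_charts M g j k (f p)"
  shows "tangent_map M (\<lambda>p. g (f p)) i k p v = tangent_map M g j k (f p) (tangent_map M f i j p v)"
proof -
  note i = in_chartsD[OF ij]
  have x: "local_rep M f i j (chart M i p) = chart M j (f p)" using i by (simp add: local_rep_apply)
  have "tangent_map M (\<lambda>p. g (f p)) i k p = (\<lambda>v. tangent_map M g j k (f p) (tangent_map M f i j p v))"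
  proof (rule tangent_map_unique)
    show "open (rdom f i j)" by (rule smooth_local_rep(1)[OF f i(1,2)])
    show "chart M i p \<in> rdom f i j" by (rule chart_in_rdom[OF ij])
    show "local_rep M (\<lambda>p. g (f p)) i k x = local_rep M g j k (local_rep M f i j x)" if "x \<in> rdom f i j" for x
      using that i by (simp add: rdom_iff local_rep_apply)
    show "((\<lambda>x. local_rep M g j k (local_rep M f i j x)) has_derivative
        (\<lambda>v. tangent_map M g j k (f p) (tangent_map M f i j p v))) (at (chart M i p))"
      by (rule has_derivative_chain[OF local_rep_has_derivative[OF g jk] x local_rep_has_derivative[OF f ij]])
  qed
  then show ?thesis by simp
qed

lemma tangent_map_id: "i \<in> I \<Longrightarrow> p \<in> cdom M i \<Longrightarrow> tangent_map M id i i p = (\<lambda>v. v)"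
  by (rule tangent_map_unique[OF open_cimg chart_in, of i]) (auto simp: local_rep_apply)

lemma transition_inverse:
  assumes "in_charts M id i j p"
  shows "tangent_map M id j i p (tangent_map M id i j p v) = v"
    "in_charts M id j i p"
proof -
  show ji: "in_charts M id j i p" using assms by (auto simp: in_charts_def)
  have "tangent_map M (\<lambda>p. id (id p)) i i p v = v"
    using tangent_map_id[of i p] in_chartsD[OF assms] by (simp add: id_def)
  then show "tangent_map M id j i p (tangent_map M id i j p v) = v"
    using tangent_map_compose[OF smooth_self_map_id smooth_self_map_id assms, of i v] ji by (simp add: id_def)
qed

lemma tangent_map_transition:
  assumes f: "smooth_self_map M f" and ij: "in_charts M f i j p" and kl: "in_charts M f k l p"
  shows "tangent_map M f k l p v =
    tangent_map M id j l (f p) (tangent_map M f i j p (tangent_map M id k i p v))"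
proof -
  have ki: "in_charts M id k i p" and jl: "in_charts M id j l (f p)"
    using ij kl by (auto simp: in_charts_def)
  have il: "in_charts M f i l p" using ij kl by (auto simp: in_charts_def)
  have "tangent_map M f k l p v = tangent_map M f i l p (tangent_map M id k i p v)"
    using tangent_map_compose[OF smooth_self_map_id f ki, of l v] il by simp
  also have "tangent_map M f i l p w = tangent_map M id j l (f p) (tangent_map M f i j p w)" for w
    using tangent_map_compose[OF f smooth_self_map_id ij, of l w] jl by simp
  finally show ?thesis .
qed

text \<open>Both forms transform correctly between charts, so at each point a single pair of charts
  may be used.\<close>

lemma pulls_back_formI:
  assumes f: "smooth_self_map M f" and \<alpha>: "pulls_back_form M id \<alpha> \<alpha>" and \<beta>: "pulls_back_form M id \<beta> \<beta>"
    and loc: "\<And>p. p \<in> topspace X \<Longrightarrow> \<exists>i j. in_charts M f i j p \<and>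
      (\<forall>v. \<alpha> j (chart M j (f p)) (tangent_map M f i j p v) = \<beta> i (chart M i p) v)"
  shows "pulls_back_form M f \<alpha> \<beta>"
  unfolding pulls_back_form_def
proof (intro allI impI)
  fix k l p v assume kl: "in_charts M f k l p"
  obtain i j where ij: "in_charts M f i j p"
    and eq: "\<And>v. \<alpha> j (chart M j (f p)) (tangent_map M f i j p v) = \<beta> i (chart M i p) v"
    using loc[OF in_chartsD(5)[OF kl]] by blast
  have ki: "in_charts M id k i p" and jl: "in_charts M id j l (f p)"
    using ij kl by (auto simp: in_charts_def)
  show "\<alpha> l (chart M l (f p)) (tangent_map M f k l p v) = \<beta> k (chart M k p) v"
    unfolding tangent_map_transition[OF f ij kl]
    using \<alpha>[unfolded pulls_back_form_def, rule_format, OF jl] \<beta>[unfolded pulls_back_form_def, rule_format, OF ki] eq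
    by simp
qed

lemma pulls_back_bilinearI:
  assumes f: "smooth_self_map M f" and \<alpha>: "pulls_back_bilinear M id \<alpha> \<alpha>" and \<beta>: "pulls_back_bilinear M id \<beta> \<beta>"
    and loc: "\<And>p. p \<in> topspace X \<Longrightarrow> \<exists>i j. in_charts M f i j p \<and>
      (\<forall>v w. \<alpha> j (chart M j (f p)) (tangent_map M f i j p v) (tangent_map M f i j p w) = \<beta> i (chart M i p) v w)"
  shows "pulls_back_bilinear M f \<alpha> \<beta>"
  unfolding pulls_back_bilinear_def
proof (intro allI impI)
  fix k l p v w assume kl: "in_charts M f k l p"
  obtain i j where ij: "in_charts M f i j p"
    and eq: "\<And>v w. \<alpha> j (chart M j (f p)) (tangent_map M f i j p v) (tangent_map M f i j p w) = \<beta> i (chart M i p) v w"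
    using loc[OF in_chartsD(5)[OF kl]] by blast
  have ki: "in_charts M id k i p" and jl: "in_charts M id j l (f p)"
    using ij kl by (auto simp: in_charts_def)
  show "\<alpha> l (chart M l (f p)) (tangent_map M f k l p v) (tangent_map M f k l p w) = \<beta> k (chart M k p) v w"
    unfolding tangent_map_transition[OF f ij kl]
    using \<alpha>[unfolded pulls_back_bilinear_def, rule_format, OF jl] \<beta>[unfolded pulls_back_bilinear_def, rule_format, OF ki] eq
    by simp
qed

section \<open>Smooth functions and their differentials\<close>

definition smooth_fun :: "('a \<Rightarrow> real) \<Rightarrow> bool" where
  "smooth_fun s \<longleftrightarrow> (\<forall>i\<in>I. smooth_on (cimg M i) (\<lambda>x. s (emb i x)))"

definition dfun :: "('a \<Rightarrow> real) \<Rightarrow> ('i, 'e) one_form" where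
  "dfun s i x = frechet_derivative (\<lambda>x. s (emb i x)) (at x)"

lemma smooth_fun_has_derivative:
  "smooth_fun s \<Longrightarrow> i \<in> I \<Longrightarrow> x \<in> cimg M i \<Longrightarrow> ((\<lambda>x. s (emb i x)) has_derivative dfun s i x) (at x)"
  unfolding smooth_fun_def dfun_def by (blast intro: smooth_on_has_derivative)

lemma smooth_fun_compose:
  assumes s: "smooth_fun s" and f: "smooth_self_map M f"
  shows "smooth_fun (\<lambda>p. s (f p))"
  unfolding smooth_fun_def
proof (rule ballI, rule smooth_on_local)
  fix i x assume i: "i \<in> I" and x: "x \<in> cimg M i"
  obtain j where j: "j \<in> I" "f (emb i x) \<in> cdom M j"
    using cover[OF smooth_self_map_maps[OF f emb_in_topspace[OF i x]]] by blast
  note sf = smooth_local_rep[OF f i j(1)]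
  have "smooth_on (rdom f i j) (\<lambda>x. s (emb j (local_rep M f i j x)))"
    using s j by (intro smooth_on_compose[OF sf(1) open_cimg[OF j(1)] _ sf(2), of "\<lambda>x. s (emb j x)"])
      (auto simp: smooth_fun_def rdom_iff[OF i] local_rep_apply chart_in)
  then have "smooth_on (rdom f i j) (\<lambda>x. s (f (emb i x)))"
    by (rule smooth_on_cong[OF sf(1), rotated]) (use i j in \<open>simp add: rdom_iff local_rep_apply\<close>)
  then show "\<exists>T. open T \<and> x \<in> T \<and> smooth_on T (\<lambda>x. s (f (emb i x)))"
    using sf(1) i x j by (intro exI[of _ "rdom f i j"]) (simp add: rdom_iff)
qed

lemma dfun_compose:
  assumes s: "smooth_fun s" and f: "smooth_self_map M f" and ij: "in_charts M f i j p"
  shows "dfun (\<lambda>p. s (f p)) i (chart M i p) v = dfun s j (chart M j (f p)) (tangent_map M f i j p v)"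
proof -
  note i = in_chartsD[OF ij]
  have x: "local_rep M f i j (chart M i p) = chart M j (f p)" using i by (simp add: local_rep_apply)
  have "((\<lambda>x. s (emb j (local_rep M f i j x))) has_derivative
      (\<lambda>v. dfun s j (chart M j (f p)) (tangent_map M f i j p v))) (at (chart M i p))"
    by (rule has_derivative_chain[OF smooth_fun_has_derivative[OF s i(2,7)] x local_rep_has_derivative[OF f ij]])
  then have "((\<lambda>x. s (f (emb i x))) has_derivative
      (\<lambda>v. dfun s j (chart M j (f p)) (tangent_map M f i j p v))) (at (chart M i p))"
    by (rule has_derivative_transform_within_open[OF _ smooth_local_rep(1)[OF f i(1,2)] chart_in_rdom[OF ij]])
      (use i in \<open>simp add: rdom_iff local_rep_apply\<close>)
  from frechet_derivative_at[OF this] show ?thesis unfolding dfun_def by metis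
qed

lemma pulls_back_dfun: "smooth_fun s \<Longrightarrow> pulls_back_form M id (dfun s) (dfun s)"
  unfolding pulls_back_form_def using dfun_compose[OF _ smooth_self_map_id, of s] by simp

lemma smooth_fun_cmul: "smooth_fun s \<Longrightarrow> smooth_fun (\<lambda>p. c * s p)"
  unfolding smooth_fun_def by (auto intro: smooth_on_mult smooth_on_const open_cimg)

lemma dfun_cmul:
  assumes "smooth_fun s" "i \<in> I" "x \<in> cimg M i" shows "dfun (\<lambda>p. c * s p) i x v = c * dfun s i x v"
proof -
  have "((\<lambda>x. c * s (emb i x)) has_derivative (\<lambda>v. c * dfun s i x v)) (at x)"
    by (rule has_derivative_mult_right[OF smooth_fun_has_derivative[OF assms]])
  from frechet_derivative_at[OF this] show ?thesis unfolding dfun_def by metis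
qed

lemma bounded_smooth_fun:
  assumes "smooth_fun s" "compact_space X"
  obtains B where "0 < B" "\<And>p. p \<in> topspace X \<Longrightarrow> \<bar>s p\<bar> < B"
proof -
  have "continuous_map X euclideanreal s"
  proof -
    have "openin X {p \<in> topspace X. s p \<in> T}" if T: "open T" for T
    proof (subst openin_subopen, safe)
      fix p assume p: "p \<in> topspace X" "s p \<in> T"
      obtain i where i: "i \<in> I" "p \<in> cdom M i" using cover[OF p(1)] by blast
      define W where "W = (\<lambda>x. s (emb i x)) -` T \<inter> cimg M i"
      have "continuous_on (cimg M i) (\<lambda>x. s (emb i x))"
        using assms(1) i by (auto simp: smooth_fun_def intro: smooth_on_imp_continuous_on)
      then have W: "open W" "W \<subseteq> cimg M i" unfolding W_def
        using T open_cimg[OF i(1)] by (auto simp: continuous_on_open_vimage)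
      have "p \<in> emb i ` W" using i p by (intro image_eqI[of _ _ "chart M i p"]) (auto simp: W_def chart_in)
      then show "\<exists>U. openin X U \<and> p \<in> U \<and> U \<subseteq> {p \<in> topspace X. s p \<in> T}"
        using openin_emb_image[OF i(1) W] emb_in_topspace[OF i(1)]
        by (intro exI[of _ "emb i ` W"]) (auto simp: W_def)
    qed
    then show ?thesis by (simp add: continuous_map_def)
  qed
  then have "compactin euclideanreal (s ` topspace X)"
    using assms(2) unfolding compact_space_def by (rule image_compactin[rotated])
  then have "bounded (s ` topspace X)" by (simp add: compact_imp_bounded)
  then obtain B where B: "B > 0" "\<And>p. p \<in> topspace X \<Longrightarrow> \<bar>s p\<bar> \<le> B" by (auto simp: bounded_pos)
  show thesis
  \<comment> \<open>One is added because the bound has to be strict.\<close>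
  proof (rule that[of "B + 1"])
    show "\<bar>s p\<bar> < B + 1" if "p \<in> topspace X" for p using B(2)[OF that] by linarith
  qed (use B(1) in simp)
qed

end

section \<open>Flows of vector fields\<close>

context smooth_mfd
begin

definition vector_field :: "('i \<Rightarrow> 'e \<Rightarrow> 'e) \<Rightarrow> bool" where
  "vector_field \<xi> \<longleftrightarrow> (\<forall>i\<in>I. smooth_on (cimg M i) (\<xi> i)) \<and>
     (\<forall>i j p. in_charts M id i j p \<longrightarrow> tangent_map M id i j p (\<xi> i (chart M i p)) = \<xi> j (chart M j p))"

text \<open>The speed \<mu> varies because a map preserving leaves sends integral curves to integral
  curves with changed time. The derivative is two-sided and is demanded in every chart around the
  point.\<close>

definition flows :: "('i \<Rightarrow> 'e \<Rightarrow> 'e) \<Rightarrow> real set \<Rightarrow> (real \<Rightarrow> real) \<Rightarrow> (real \<Rightarrow> 'a) \<Rightarrow> bool" where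
  "flows \<xi> J \<mu> c \<longleftrightarrow> continuous_map (top_of_set J) X c \<and> (\<forall>t\<in>J. \<forall>i\<in>I. c t \<in> cdom M i \<longrightarrow>
     ((\<lambda>s. chart M i (c s)) has_vector_derivative \<mu> t *\<^sub>R \<xi> i (chart M i (c t))) (at t))"

lemma curve_preimage_open:
  assumes c: "continuous_map (top_of_set J) X c" and J: "open J" and i: "i \<in> I"
  shows "open {s \<in> J. c s \<in> cdom M i}"
proof -
  have "openin (top_of_set J) {s \<in> J. c s \<in> cdom M i}"
    using openin_continuous_map_preimage[OF c openin_cdom[OF i]] by simp
  then show ?thesis using J openin_open_eq by auto
qed

lemma curve_derivative_transfer:
  assumes c: "continuous_map (top_of_set J) X c" and J: "open J" "t \<in> J"
    and f: "smooth_self_map M f" and ij: "in_charts M f i j (c t)"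
    and d: "((\<lambda>s. chart M i (c s)) has_vector_derivative v) (at t)"
  shows "((\<lambda>s. chart M j (f (c s))) has_vector_derivative tangent_map M f i j (c t) v) (at t)"
proof -
  note i = in_chartsD[OF ij]
  have "((\<lambda>s. local_rep M f i j (chart M i (c s))) has_derivative
      (\<lambda>h. tangent_map M f i j (c t) (h *\<^sub>R v))) (at t)"
    by (rule has_derivative_chain[OF local_rep_has_derivative[OF f ij] refl d[unfolded has_vector_derivative_def]])
  then have "((\<lambda>s. local_rep M f i j (chart M i (c s))) has_vector_derivative tangent_map M f i j (c t) v) (at t)"
    unfolding has_vector_derivative_def by (simp add: linear_scale[OF linear_tangent_map[OF f ij]])
  then show ?thesis
    by (rule has_vector_derivative_transform_within_open[OF _ curve_preimage_open[OF c J(1) i(1)]])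
      (use J i in \<open>auto simp: local_rep_apply\<close>)
qed

text \<open>Transition maps carry \<xi> to itself, so one chart at each time suffices.\<close>

lemma flowsI:
  assumes \<xi>: "vector_field \<xi>" and c: "continuous_map (top_of_set J) X c" and J: "open J"
    and d: "\<And>t. t \<in> J \<Longrightarrow> \<exists>i\<in>I. c t \<in> cdom M i \<and>
      ((\<lambda>s. chart M i (c s)) has_vector_derivative \<mu> t *\<^sub>R \<xi> i (chart M i (c t))) (at t)"
  shows "flows \<xi> J \<mu> c"
  unfolding flows_def
proof (intro conjI ballI impI c)
  fix t j assume t: "t \<in> J" and j: "j \<in> I" "c t \<in> cdom M j"
  obtain i where i: "i \<in> I" "c t \<in> cdom M i"
    "((\<lambda>s. chart M i (c s)) has_vector_derivative \<mu> t *\<^sub>R \<xi> i (chart M i (c t))) (at t)"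
    using d[OF t] by blast
  have ij: "in_charts M id i j (c t)" using i j by (simp add: in_charts_def)
  have "tangent_map M id i j (c t) (\<mu> t *\<^sub>R \<xi> i (chart M i (c t))) = \<mu> t *\<^sub>R \<xi> j (chart M j (c t))"
    using \<xi> ij unfolding vector_field_def
    by (simp add: linear_scale[OF linear_tangent_map[OF smooth_self_map_id ij]])
  then show "((\<lambda>s. chart M j (c s)) has_vector_derivative \<mu> t *\<^sub>R \<xi> j (chart M j (c t))) (at t)"
    using curve_derivative_transfer[OF c J t smooth_self_map_id ij i(3)] by simp
qed

text \<open>Needed for \<open>long_flow\<close>, whose orbits are recognised as integral curves only
  near each time separately.\<close>

lemma flows_local:
  assumes \<xi>: "vector_field \<xi>" and J: "open J"
    and loc: "\<And>t. t \<in> J \<Longrightarrow> \<exists>J' c'. open J' \<and> t \<in> J' \<and> J' \<subseteq> J \<and> flows \<xi> J' \<mu> c' \<and> (\<forall>s\<in>J'. c s = c' s)"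
  shows "flows \<xi> J \<mu> c"
proof (rule flowsI[OF \<xi> _ J])
  show "continuous_map (top_of_set J) X c"
  proof -
    have "openin (top_of_set J) {s \<in> J. c s \<in> T}" if T: "openin X T" for T
    proof (subst openin_subopen, safe)
      fix t assume t: "t \<in> J" "c t \<in> T"
      obtain J' c' where J': "open J'" "t \<in> J'" "J' \<subseteq> J" "flows \<xi> J' \<mu> c'" "\<And>s. s \<in> J' \<Longrightarrow> c s = c' s"
        using loc[OF t(1)] by blast
      have "openin (top_of_set J') {s \<in> J'. c' s \<in> T}"
        using openin_continuous_map_preimage[of "top_of_set J'" X c' T] J'(4) T by (simp add: flows_def)
      then have "open {s \<in> J'. c' s \<in> T}" using J'(1) openin_open_eq by blast
      then show "\<exists>U. openin (top_of_set J) U \<and> t \<in> U \<and> U \<subseteq> {s \<in> J. c s \<in> T}"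
        using J' t J by (intro exI[of _ "{s \<in> J'. c' s \<in> T}"]) (auto simp: openin_open_eq)
    qed
    moreover have "c t \<in> topspace X" if "t \<in> J" for t
      using loc[OF that] unfolding flows_def continuous_map_def by (force simp: Pi_iff)
    ultimately show ?thesis by (simp add: continuous_map_def Pi_iff)
  qed
next
  fix t assume t: "t \<in> J"
  obtain J' c' where J': "open J'" "t \<in> J'" "J' \<subseteq> J" "flows \<xi> J' \<mu> c'" "\<And>s. s \<in> J' \<Longrightarrow> c s = c' s"
    using loc[OF t] by blast
  have "c' t \<in> topspace X" using J'(2,4) by (auto simp: flows_def continuous_map_def Pi_iff)
  then obtain i where i: "i \<in> I" "c' t \<in> cdom M i" using cover by blast
  have "((\<lambda>s. chart M i (c s)) has_vector_derivative \<mu> t *\<^sub>R \<xi> i (chart M i (c' t))) (at t)"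
    by (rule has_vector_derivative_transform_within_open[OF _ J'(1,2)])
      (use J' i in \<open>auto simp: flows_def\<close>)
  then show "\<exists>i\<in>I. c t \<in> cdom M i \<and>
      ((\<lambda>s. chart M i (c s)) has_vector_derivative \<mu> t *\<^sub>R \<xi> i (chart M i (c t))) (at t)"
    using i J' by auto
qed

lemma flows_subset: "flows \<xi> J \<mu> c \<Longrightarrow> J' \<subseteq> J \<Longrightarrow> flows \<xi> J' \<mu> c"
  unfolding flows_def using continuous_map_from_subtopology[of "top_of_set J" X c J']
  by (auto simp: subtopology_subtopology inf.absorb2)

lemma flows_topspace: "flows \<xi> J \<mu> c \<Longrightarrow> t \<in> J \<Longrightarrow> c t \<in> topspace X"
  by (auto simp: flows_def continuous_map_def Pi_iff)

lemma flows_reparam: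
  assumes c: "flows \<xi> J \<mu> c" and \<theta>: "\<And>t. t \<in> J' \<Longrightarrow> \<theta> t \<in> J"
    "\<And>t. t \<in> J' \<Longrightarrow> (\<theta> has_real_derivative \<theta>' t) (at t)"
  shows "flows \<xi> J' (\<lambda>t. \<theta>' t * \<mu> (\<theta> t)) (\<lambda>t. c (\<theta> t))"
  unfolding flows_def
proof (intro conjI ballI impI)
  have "continuous_on J' \<theta>"
    using \<theta>(2) by (intro continuous_at_imp_continuous_on) (auto intro: DERIV_isCont)
  then have "continuous_map (top_of_set J') (top_of_set J) \<theta>" using \<theta>(1) by auto
  then show "continuous_map (top_of_set J') X (\<lambda>t. c (\<theta> t))"
    using continuous_map_compose[of _ _ \<theta> X c] c unfolding flows_def o_def by blast
  fix t i assume t: "t \<in> J'" and i: "i \<in> I" "c (\<theta> t) \<in> cdom M i"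
  have "((\<lambda>s. chart M i (c s)) has_vector_derivative \<mu> (\<theta> t) *\<^sub>R \<xi> i (chart M i (c (\<theta> t)))) (at (\<theta> t))"
    using c \<theta>(1)[OF t] i by (simp add: flows_def)
  from vector_diff_chain_at[OF \<theta>(2)[OF t, unfolded has_real_derivative_iff_has_vector_derivative] this]
  show "((\<lambda>s. chart M i (c (\<theta> s))) has_vector_derivative (\<theta>' t * \<mu> (\<theta> t)) *\<^sub>R \<xi> i (chart M i (c (\<theta> t)))) (at t)"
    by (simp add: o_def)
qed

lemma flows_shift:
  assumes "flows \<xi> J (\<lambda>_. 1) c" "\<And>t. t \<in> J' \<Longrightarrow> t + a \<in> J"
  shows "flows \<xi> J' (\<lambda>_. 1) (\<lambda>t. c (t + a))"
proof -
  have "((\<lambda>t. t + a) has_real_derivative 1) (at t)" for t by (auto intro!: derivative_eq_intros)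
  from flows_reparam[OF assms(1), of J' "\<lambda>t. t + a" "\<lambda>_. 1", OF assms(2) this] show ?thesis by simp
qed

text \<open>The set of agreement is closed because the manifold is Hausdorff and open by
  \<open>local_curve_uniqueness\<close> in a chart; J is connected.\<close>

theorem flows_unique:
  assumes \<xi>: "vector_field \<xi>" and b: "flows \<xi> J \<mu> b" and c: "flows \<xi> J \<mu> c"
    and J: "open J" "connected J" and \<mu>: "continuous_on J \<mu>"
    and t0: "t0 \<in> J" "b t0 = c t0" and t: "t \<in> J"
  shows "b t = c t"
proof -
  have cb: "continuous_map (top_of_set J) X b" and cc: "continuous_map (top_of_set J) X c"
    using b c by (auto simp: flows_def)
  let ?A = "{t \<in> J. b t = c t}"
  have "closedin (top_of_set J) {x \<in> topspace (top_of_set J). b x = c x}"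
    by (rule closedin_continuous_maps_eq[OF Hausdorff cb cc])
  then have cl: "closedin (top_of_set J) ?A" by simp
  have "openin (top_of_set J) ?A"
  proof (subst openin_subopen, safe)
    fix t assume t: "t \<in> J" "b t = c t"
    have "b t \<in> topspace X" using cb t by (auto simp: continuous_map_def Pi_iff)
    then obtain i where i: "i \<in> I" "b t \<in> cdom M i" using cover by blast
    define N where "N = {s \<in> J. b s \<in> cdom M i} \<inter> {s \<in> J. c s \<in> cdom M i}"
    have N: "open N" "t \<in> N" unfolding N_def
      using curve_preimage_open[OF cb J(1) i(1)] curve_preimage_open[OF cc J(1) i(1)] t i by auto
    then obtain d where d: "0 < d" "cball t d \<subseteq> N" using open_contains_cball by blast
    have sub: "{t - d..t + d} \<subseteq> N" using d(2) by (simp add: cball_eq_atLeastAtMost)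
    have sm: "smooth_on (cimg M i) (\<xi> i)" using \<xi> i by (simp add: vector_field_def)
    obtain \<delta> where \<delta>: "0 < \<delta>" "\<And>s. \<bar>s - t\<bar> < \<delta> \<Longrightarrow> chart M i (b s) = chart M i (c s)"
    proof (rule local_curve_uniqueness[OF open_cimg[OF i(1)] sm d(1)])
      show "continuous_on {t - d..t + d} \<mu>" using \<mu> sub by (auto intro: continuous_on_subset simp: N_def)
      show "((\<lambda>s. chart M i (b s)) has_vector_derivative \<mu> s *\<^sub>R \<xi> i (chart M i (b s))) (at s)"
        "((\<lambda>s. chart M i (c s)) has_vector_derivative \<mu> s *\<^sub>R \<xi> i (chart M i (c s))) (at s)"
        if "s \<in> {t - d..t + d}" for s
        using b c i subsetD[OF sub that] by (auto simp: flows_def N_def)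
      show "chart M i (b t) = chart M i (c t)" "chart M i (b t) \<in> cimg M i" using t i by (auto simp: chart_in)
    qed blast
    define T where "T = {t - min \<delta> d<..<t + min \<delta> d}"
    have "b s = c s \<and> s \<in> J" if "s \<in> T" for s
    proof -
      have "s \<in> {t - d..t + d}" "\<bar>s - t\<bar> < \<delta>" using that by (auto simp: T_def)
      then have "s \<in> N" "chart M i (b s) = chart M i (c s)" using sub \<delta>(2) by auto
      then show ?thesis using inj_onD[OF inj_chart[OF i(1)]] by (auto simp: N_def)
    qed
    then show "\<exists>U. openin (top_of_set J) U \<and> t \<in> U \<and> U \<subseteq> ?A"
      using \<delta> d J(1) by (intro exI[of _ T]) (auto simp: T_def openin_open_eq)
  qed
  then have "?A = {} \<or> ?A = J" using J(2) cl unfolding connected_clopen by blast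
  then show ?thesis using t0 t by blast
qed

lemma flows_box:
  assumes \<xi>: "vector_field \<xi>" and i: "i \<in> I" and J: "open J"
    and y: "\<And>t. t \<in> J \<Longrightarrow> y t \<in> cimg M i" "\<And>t. t \<in> J \<Longrightarrow> (y has_vector_derivative \<xi> i (y t)) (at t)"
  shows "flows \<xi> J (\<lambda>_. 1) (\<lambda>t. emb i (y t))"
proof (rule flowsI[OF \<xi> _ J])
  have "continuous_on J y"
    using y(2) by (intro continuous_at_imp_continuous_on) (auto intro: has_vector_derivative_continuous)
  then have "continuous_map (top_of_set J) (top_of_set (cimg M i)) y" using y(1) by auto
  then show "continuous_map (top_of_set J) X (\<lambda>t. emb i (y t))"
    using continuous_map_compose[OF _ continuous_emb[OF i], of _ y] by (simp add: o_def)
  fix t assume t: "t \<in> J"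
  have "((\<lambda>s. chart M i (emb i (y s))) has_vector_derivative \<xi> i (y t)) (at t)"
    by (rule has_vector_derivative_transform_within_open[OF y(2)[OF t] J t]) (simp add: y(1))
  then show "\<exists>i'\<in>I. emb i (y t) \<in> cdom M i' \<and>
      ((\<lambda>s. chart M i' (emb i (y s))) has_vector_derivative 1 *\<^sub>R \<xi> i' (chart M i' (emb i (y t)))) (at t)"
    using i y(1)[OF t] emb_in by (intro bexI[of _ i]) auto
qed

section \<open>Flows with a uniform duration on a compact manifold\<close>

text \<open>The map y is \<phi> in the chart i, near p and for all times below \<epsilon>; it
  records the joint smoothness in time and point.\<close>

definition flow_box :: "('i \<Rightarrow> 'e \<Rightarrow> 'e) \<Rightarrow> real \<Rightarrow> (real \<Rightarrow> 'a \<Rightarrow> 'a) \<Rightarrow> 'a \<Rightarrow> 'i \<Rightarrow> 'e set \<Rightarrow> (real \<times> 'e \<Rightarrow> 'e) \<Rightarrow> bool" where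
  "flow_box \<xi> \<epsilon> \<phi> p i V y \<longleftrightarrow> i \<in> I \<and> open V \<and> V \<subseteq> cimg M i \<and> p \<in> cdom M i \<and> chart M i p \<in> V \<and>
     smooth_on ({-\<epsilon><..<\<epsilon>} \<times> V) y \<and>
     (\<forall>x\<in>V. y (0, x) = x) \<and>
     (\<forall>t\<in>{-\<epsilon><..<\<epsilon>}. \<forall>x\<in>V. y (t, x) \<in> cimg M i \<and> \<phi> t (emb i x) = emb i (y (t, x)) \<and>
        ((\<lambda>s. y (s, x)) has_vector_derivative \<xi> i (y (t, x))) (at t))"

text \<open>Outside \<open>topspace X\<close>, \<open>\<phi> t\<close> is the identity, so that its group law holds on the whole type.\<close>

definition local_flow :: "('i \<Rightarrow> 'e \<Rightarrow> 'e) \<Rightarrow> real \<Rightarrow> (real \<Rightarrow> 'a \<Rightarrow> 'a) \<Rightarrow> bool" where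
  "local_flow \<xi> \<epsilon> \<phi> \<longleftrightarrow> 0 < \<epsilon> \<and> (\<forall>p\<in>topspace X. \<exists>i V y. flow_box \<xi> \<epsilon> \<phi> p i V y) \<and>
     (\<forall>p\<in>topspace X. \<phi> 0 p = p \<and> flows \<xi> {-\<epsilon><..<\<epsilon>} (\<lambda>_. 1) (\<lambda>t. \<phi> t p)) \<and>
     (\<forall>t p. p \<notin> topspace X \<longrightarrow> \<phi> t p = p)"

text \<open>Finitely many flow boxes cover the manifold, and \<epsilon> is at most the duration of
  each. Uniqueness of integral curves makes \<phi>, defined through one chosen box at each point,
  agree with every box.\<close>

theorem local_flow_exists_compact:
  assumes \<xi>: "vector_field \<xi>" and cpt: "compact_space X"
  obtains \<epsilon> \<phi> where "local_flow \<xi> \<epsilon> \<phi>"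
proof -
  define box where "box p i \<epsilon> V y \<longleftrightarrow> i \<in> I \<and> 0 < \<epsilon> \<and> open V \<and> V \<subseteq> cimg M i \<and> p \<in> emb i ` V \<and>
     smooth_on ({-\<epsilon><..<\<epsilon>} \<times> V) y \<and> (\<forall>x\<in>V. y (0, x) = x) \<and>
     (\<forall>t\<in>{-\<epsilon><..<\<epsilon>}. \<forall>x\<in>V. y (t, x) \<in> cimg M i \<and>
        ((\<lambda>s. y (s, x)) has_vector_derivative \<xi> i (y (t, x))) (at t))" for p i \<epsilon> V and y :: "real \<times> 'e \<Rightarrow> 'e"
  have "\<exists>i \<epsilon> V y. box p i \<epsilon> V y" if p: "p \<in> topspace X" for p
  proof -
    obtain i where i: "i \<in> I" "p \<in> cdom M i" using cover[OF p] by blast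
    have sm: "smooth_on (cimg M i) (\<xi> i)" using \<xi> i by (simp add: vector_field_def)
    obtain \<epsilon> V y where "0 < \<epsilon>" "open V" "chart M i p \<in> V" "V \<subseteq> cimg M i" "smooth_on ({-\<epsilon><..<\<epsilon>} \<times> V) y"
      "\<And>x. x \<in> V \<Longrightarrow> y (0, x) = x" "\<And>t x. t \<in> {-\<epsilon><..<\<epsilon>} \<Longrightarrow> x \<in> V \<Longrightarrow> y (t, x) \<in> cimg M i"
      "\<And>t x. t \<in> {-\<epsilon><..<\<epsilon>} \<Longrightarrow> x \<in> V \<Longrightarrow> ((\<lambda>s. y (s, x)) has_vector_derivative \<xi> i (y (t, x))) (at t)"
      by (rule local_flow_exists[OF open_cimg[OF i(1)] chart_in[OF i(2)] sm]) blast
    moreover have "p \<in> emb i ` V" using emb_chart[OF i] \<open>chart M i p \<in> V\<close> by (metis image_eqI)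
    ultimately show ?thesis unfolding box_def using i
      by (intro exI[of _ i] exI[of _ \<epsilon>] exI[of _ V] exI[of _ y]) simp
  qed
  then obtain ii ee VV yy where bx: "\<And>p. p \<in> topspace X \<Longrightarrow> box p (ii p) (ee p) (VV p) (yy p)" by metis
  define N where "N p = emb (ii p) ` VV p" for p
  have N: "openin X (N p)" "p \<in> N p" if "p \<in> topspace X" for p
    using bx[OF that] openin_emb_image unfolding box_def N_def by auto
  have "compactin X (topspace X)" using cpt by (simp add: compact_space_def)
  then obtain \<F> where F: "finite \<F>" "\<F> \<subseteq> N ` topspace X" "topspace X \<subseteq> \<Union>\<F>"
    using compactinD[of X "topspace X" "N ` topspace X"] N by blast
  obtain S where "S \<subseteq> topspace X" "finite S" "\<F> = N ` S" using finite_subset_image[OF F(1,2)] by blast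
  then have S: "finite S" "S \<subseteq> topspace X" "topspace X \<subseteq> (\<Union>p\<in>S. N p)" using F(3) by auto
  \<comment> \<open>Inserting 1 keeps the minimum defined when the cover is empty.\<close>
  define \<epsilon> where "\<epsilon> = Min (insert 1 (ee ` S))"
  have \<epsilon>: "0 < \<epsilon>" "\<And>k. k \<in> S \<Longrightarrow> \<epsilon> \<le> ee k"
    using S bx unfolding \<epsilon>_def box_def by (auto simp: subset_iff)
  define kk where "kk p = (SOME k. k \<in> S \<and> p \<in> N k)" for p
  have kk: "kk p \<in> S" "p \<in> N (kk p)" if "p \<in> topspace X" for p
    using someI_ex[of "\<lambda>k. k \<in> S \<and> p \<in> N k"] S(3) that unfolding kk_def by blast+
  let ?J = "{-\<epsilon><..<\<epsilon>}"
  have sub: "?J \<subseteq> {-ee k<..<ee k}" if "k \<in> S" for k using \<epsilon>(2)[OF that] by auto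
  have curve: "flows \<xi> ?J (\<lambda>_. 1) (\<lambda>t. emb (ii k) (yy k (t, x)))" if k: "k \<in> S" and x: "x \<in> VV k" for k x
  proof (rule flows_box[OF \<xi>])
    have b: "box k (ii k) (ee k) (VV k) (yy k)" using bx k S by auto
    then show "ii k \<in> I" by (simp add: box_def)
    show "yy k (t, x) \<in> cimg M (ii k)" "((\<lambda>t. yy k (t, x)) has_vector_derivative \<xi> (ii k) (yy k (t, x))) (at t)"
      if "t \<in> ?J" for t
      using b subsetD[OF sub[OF k] that] x unfolding box_def by blast+
  qed simp
  define \<phi> where "\<phi> t p = (if p \<in> topspace X then emb (ii (kk p)) (yy (kk p) (t, chart M (ii (kk p)) p)) else p)" for t p
  have chart_V: "chart M (ii k) p \<in> VV k" "emb (ii k) (chart M (ii k) p) = p" if "k \<in> S" "p \<in> N k" for k p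
    using bx[of k] that S by (auto simp: N_def box_def subset_iff)
  have \<phi>0: "\<phi> 0 p = p" if "p \<in> topspace X" for p
    using kk[OF that] chart_V[of "kk p" p] bx[of "kk p"] S that by (auto simp: \<phi>_def box_def)
  have \<phi>f: "flows \<xi> ?J (\<lambda>_. 1) (\<lambda>t. \<phi> t p)" if "p \<in> topspace X" for p
    using curve[OF kk(1)[OF that] chart_V(1)[OF kk[OF that]]] that by (simp add: \<phi>_def)
  have \<phi>_eq: "\<phi> t (emb (ii k) x) = emb (ii k) (yy k (t, x))" if k: "k \<in> S" and x: "x \<in> VV k" and t: "t \<in> ?J" for k x t
  proof -
    have p: "emb (ii k) x \<in> topspace X"
      using bx[of k] k x S emb_in_topspace by (auto simp: box_def subset_iff)
    show ?thesis
      by (rule flows_unique[OF \<xi> \<phi>f[OF p] curve[OF k x], of 0])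
        (use \<epsilon> \<phi>0[OF p] bx[of k] k S x t in \<open>auto simp: box_def subset_iff\<close>)
  qed
  have "flow_box \<xi> \<epsilon> \<phi> p (ii (kk p)) (VV (kk p)) (yy (kk p))" if p: "p \<in> topspace X" for p
  proof -
    note k = kk[OF p]
    have b: "box (kk p) (ii (kk p)) (ee (kk p)) (VV (kk p)) (yy (kk p))" using bx k S by auto
    have "p \<in> cdom M (ii (kk p))" using chart_V[OF k] emb_in b by (metis box_def subsetD)
    moreover have "smooth_on (?J \<times> VV (kk p)) (yy (kk p))"
      using b sub[OF k(1)] by (auto simp: box_def intro: smooth_on_subset)
    ultimately show ?thesis
      unfolding flow_box_def using b chart_V(1)[OF k] \<phi>_eq[OF k(1)] sub[OF k(1)] by (auto simp: box_def)
  qed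
  then have "local_flow \<xi> \<epsilon> \<phi>"
    unfolding local_flow_def using \<epsilon> \<phi>0 \<phi>f by (auto simp: \<phi>_def) 
  then show thesis by (rule that)
qed

lemma local_flow_topspace:
  assumes "local_flow \<xi> \<epsilon> \<phi>" "p \<in> topspace X" "\<bar>t\<bar> < \<epsilon>" shows "\<phi> t p \<in> topspace X"
proof -
  have "flows \<xi> {-\<epsilon><..<\<epsilon>} (\<lambda>_. 1) (\<lambda>t. \<phi> t p)" using assms by (simp add: local_flow_def)
  then show ?thesis by (rule flows_topspace) (use assms(3) in auto)
qed

text \<open>Both sides are integral curves in s that start at \<phi> t p.\<close>

lemma local_flow_add:
  assumes \<xi>: "vector_field \<xi>" and \<phi>: "local_flow \<xi> \<epsilon> \<phi>" and st: "\<bar>s\<bar> < \<epsilon>" "\<bar>t\<bar> < \<epsilon>" "\<bar>s + t\<bar> < \<epsilon>"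
  shows "\<phi> s (\<phi> t p) = \<phi> (s + t) p"
proof (cases "p \<in> topspace X")
  case True
  note q = local_flow_topspace[OF \<phi> True st(2)]
  \<comment> \<open>The times s for which s and s + t both lie in (-\<epsilon>, \<epsilon>): an
    interval containing 0.\<close>
  define J where "J = {max (-\<epsilon>) (-\<epsilon> - t)<..<min \<epsilon> (\<epsilon> - t)}"
  have 1: "flows \<xi> J (\<lambda>_. 1) (\<lambda>s. \<phi> s (\<phi> t p))"
    by (rule flows_subset[of _ "{-\<epsilon><..<\<epsilon>}"]) (use \<phi> q in \<open>auto simp: local_flow_def J_def\<close>)
  have "flows \<xi> {-\<epsilon><..<\<epsilon>} (\<lambda>_. 1) (\<lambda>t. \<phi> t p)" using \<phi> True by (simp add: local_flow_def)
  then have 2: "flows \<xi> J (\<lambda>_. 1) (\<lambda>s. \<phi> (s + t) p)" by (rule flows_shift) (auto simp: J_def)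
  show ?thesis
    by (rule flows_unique[OF \<xi> 1 2, of 0]) (use st \<phi> q in \<open>auto simp: J_def local_flow_def\<close>)
next
  case False
  then show ?thesis using \<phi> by (simp add: local_flow_def)
qed

lemma local_flow_funpow:
  assumes \<xi>: "vector_field \<xi>" and \<phi>: "local_flow \<xi> \<epsilon> \<phi>" and t: "\<bar>real n * t\<bar> < \<epsilon>" and n: "\<bar>t\<bar> < \<epsilon>"
  shows "(\<phi> t ^^ n) p = \<phi> (real n * t) p"
  using t
proof (induction n)
  case 0
  then show ?case using \<phi> by (cases "p \<in> topspace X") (auto simp: local_flow_def)
next
  case (Suc m)
  have "\<bar>real m * t\<bar> \<le> \<bar>real (Suc m) * t\<bar>" by (simp add: abs_mult mult_right_mono)
  then have m: "\<bar>real m * t\<bar> < \<epsilon>" using Suc.prems by simp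
  have e: "t + real m * t = real (Suc m) * t" by (simp add: algebra_simps)
  show ?case using local_flow_add[OF \<xi> \<phi> n m, of p] Suc.IH[OF m] Suc.prems unfolding e by simp
qed

lemma funpow_commute_compose:
  assumes "\<And>x. f (g x) = g (f x)" shows "((\<lambda>x. f (g x)) ^^ n) x = (f ^^ n) ((g ^^ n) x)"
proof -
  have c: "g ((f ^^ m) y) = (f ^^ m) (g y)" for m y by (induction m) (simp_all add: assms[symmetric])
  show ?thesis by (induction n) (simp_all add: c)
qed

section \<open>Extension of a flow by iteration\<close>

text \<open>Each of the n steps has length t/n, so times up to n \<epsilon> are reached; by the
  group law of \<phi> the iterate is the exact flow, not an approximation.\<close>

definition long_flow :: "(real \<Rightarrow> 'a \<Rightarrow> 'a) \<Rightarrow> nat \<Rightarrow> real \<Rightarrow> 'a \<Rightarrow> 'a" where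
  "long_flow \<phi> n t = \<phi> (t / real n) ^^ n"

context
  fixes \<xi> \<epsilon> \<phi> n
  assumes \<xi>: "vector_field \<xi>" and \<phi>: "local_flow \<xi> \<epsilon> \<phi>" and n: "0 < (n :: nat)"
begin

lemma long_flow_topspace:
  assumes "p \<in> topspace X" "\<bar>t\<bar> < real n * \<epsilon>" shows "long_flow \<phi> n t p \<in> topspace X"
proof -
  have "\<bar>t / real n\<bar> < \<epsilon>" using assms(2) n by (simp add: divide_less_eq mult.commute)
  then have "(\<phi> (t / real n) ^^ k) p \<in> topspace X" for k
    by (induction k) (auto simp: assms local_flow_topspace[OF \<phi>])
  then show ?thesis by (simp add: long_flow_def)
qed

lemma long_flow_0: "long_flow \<phi> n 0 p = p"
proof -
  have "\<phi> 0 p = p" for p using \<phi> by (cases "p \<in> topspace X") (auto simp: local_flow_def)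
  then have "(\<phi> 0 ^^ k) p = p" for k by (induction k) auto
  then show ?thesis by (simp add: long_flow_def)
qed

text \<open>The steps t/n and -t/n are mutually inverse and thus commute, so the two iterates
  combine into an iterate of the identity.\<close>

lemma long_flow_inverse:
  assumes "\<bar>t\<bar> < real n * \<epsilon>" shows "long_flow \<phi> n t (long_flow \<phi> n (- t) p) = p"
proof -
  have s: "\<bar>t / real n\<bar> < \<epsilon>" using assms n by (simp add: divide_less_eq mult.commute)
  have \<epsilon>: "0 < \<epsilon>" using \<phi> by (simp add: local_flow_def)
  have 1: "\<phi> (t / real n) (\<phi> (- t / real n) q) = q" for q
    using local_flow_add[OF \<xi> \<phi>, of "t / real n" "- t / real n" q] s \<epsilon> \<phi>
    by (cases "q \<in> topspace X") (auto simp: local_flow_def)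
  have 2: "\<phi> (- t / real n) (\<phi> (t / real n) q) = q" for q
    using local_flow_add[OF \<xi> \<phi>, of "- t / real n" "t / real n" q] s \<epsilon> \<phi>
    by (cases "q \<in> topspace X") (auto simp: local_flow_def)
  have "(\<phi> (t / real n) ^^ n) ((\<phi> (- t / real n) ^^ n) p) = ((\<lambda>x. \<phi> (t / real n) (\<phi> (- t / real n) x)) ^^ n) p"
    by (rule funpow_commute_compose[symmetric]) (simp only: 1 2)
  also have "(\<lambda>x. \<phi> (t / real n) (\<phi> (- t / real n) x)) = id" unfolding 1 by (simp add: id_def)
  also have "(id ^^ n) p = p" by simp
  finally show ?thesis by (simp add: long_flow_def)
qed

text \<open>Near t0 each step t/n splits into (t - t0)/n and t0/n. The two kinds of steps commute,
  and those of the first kind add up to \<phi> (t - t0), applied to the point reached at t0.\<close>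

lemma long_flow_flows:
  assumes p: "p \<in> topspace X"
  shows "flows \<xi> {- (real n * \<epsilon>)<..<real n * \<epsilon>} (\<lambda>_. 1) (\<lambda>t. long_flow \<phi> n t p)"
proof (rule flows_local[OF \<xi>])
  let ?T = "real n * \<epsilon>"
  have \<epsilon>: "0 < \<epsilon>" using \<phi> by (simp add: local_flow_def)
  fix t0 assume t0: "t0 \<in> {- ?T<..<?T}"
  define q where "q = long_flow \<phi> n t0 p"
  have q: "q \<in> topspace X" unfolding q_def by (rule long_flow_topspace[OF p]) (use t0 in auto)
  define J where "J = {max (- ?T) (t0 - \<epsilon> / 2)<..<min ?T (t0 + \<epsilon> / 2)} \<inter> {t. \<bar>t / real n\<bar> < \<epsilon>}"
  have J: "J = {max (- ?T) (t0 - \<epsilon> / 2)<..<min ?T (t0 + \<epsilon> / 2)}"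
    unfolding J_def using n by (auto simp: divide_less_eq less_divide_eq mult.commute abs_less_iff)
  have "flows \<xi> {-\<epsilon><..<\<epsilon>} (\<lambda>_. 1) (\<lambda>t. \<phi> t q)" using \<phi> q by (simp add: local_flow_def)
  then have "flows \<xi> J (\<lambda>_. 1) (\<lambda>t. \<phi> (t + - t0) q)" by (rule flows_shift) (use \<epsilon> in \<open>auto simp: J\<close>)
  then have c': "flows \<xi> J (\<lambda>_. 1) (\<lambda>t. \<phi> (t - t0) q)" by simp
  have "long_flow \<phi> n t p = \<phi> (t - t0) q" if t: "t \<in> J" for t
  proof -
    let ?a = "(t - t0) / real n" and ?b = "t0 / real n"
    have d: "\<bar>t - t0\<bar> < \<epsilon>" using t \<epsilon> by (auto simp: J)
    have "\<bar>?a\<bar> \<le> \<bar>t - t0\<bar>" using n by (simp add: divide_le_eq mult_le_cancel_left1)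
    then have a: "\<bar>?a\<bar> < \<epsilon>" using d by simp
    have b: "\<bar>?b\<bar> < \<epsilon>" using t0 n by (auto simp: divide_less_eq less_divide_eq mult.commute abs_less_iff)
    have ab: "?a + ?b = t / real n" by (simp add: diff_divide_distrib)
    have abs: "\<bar>?a + ?b\<bar> < \<epsilon>" unfolding ab using t by (simp add: J_def)
    have e: "\<phi> ?a (\<phi> ?b x) = \<phi> (t / real n) x" "\<phi> ?b (\<phi> ?a x) = \<phi> (t / real n) x" for x
      using local_flow_add[OF \<xi> \<phi> a b abs, of x] local_flow_add[OF \<xi> \<phi> b a, of x] abs ab
      by (simp_all add: add.commute)
    have "long_flow \<phi> n t p = ((\<lambda>x. \<phi> ?a (\<phi> ?b x)) ^^ n) p" by (simp add: long_flow_def e)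
    also have "\<dots> = (\<phi> ?a ^^ n) q" unfolding q_def long_flow_def
      by (rule funpow_commute_compose) (simp add: e)
    also have "\<dots> = \<phi> (t - t0) q" using local_flow_funpow[OF \<xi> \<phi> _ a, of n q] n d by simp
    finally show ?thesis .
  qed
  then show "\<exists>J' c'. open J' \<and> t0 \<in> J' \<and> J' \<subseteq> {- ?T<..<?T} \<and> flows \<xi> J' (\<lambda>_. 1) c' \<and>
      (\<forall>s\<in>J'. long_flow \<phi> n s p = c' s)"
    using c' t0 \<epsilon> by (intro exI[of _ J] exI[of _ "\<lambda>t. \<phi> (t - t0) q"]) (auto simp: J)
qed simp

end

end

section \<open>Lie derivatives and pullbacks along flows\<close>

text \<open>The time derivative of the spatial derivative is the spatial derivative of X(y), by
  symmetry of second derivatives of the jointly smooth map y.\<close>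

lemma flow_variation:
  fixes X :: "'e::euclidean_space \<Rightarrow> 'e" and y :: "real \<times> 'e \<Rightarrow> 'e"
  assumes V: "open V" and U: "open U" and X: "smooth_on U X" and y: "smooth_on ({-\<epsilon><..<\<epsilon>} \<times> V) y"
    and yU: "\<And>t x. t \<in> {-\<epsilon><..<\<epsilon>} \<Longrightarrow> x \<in> V \<Longrightarrow> y (t, x) \<in> U"
    and ode: "\<And>t x. t \<in> {-\<epsilon><..<\<epsilon>} \<Longrightarrow> x \<in> V \<Longrightarrow> ((\<lambda>s. y (s, x)) has_vector_derivative X (y (t, x))) (at t)"
    and t: "t \<in> {-\<epsilon><..<\<epsilon>}" and x: "x \<in> V"
  shows "frechet_derivative y (at (t, x)) (1, 0) = X (y (t, x))"
    "((\<lambda>s. frechet_derivative y (at (s, x)) (0, v)) has_vector_derivative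
      frechet_derivative X (at (y (t, x))) (frechet_derivative y (at (t, x)) (0, v))) (at t)"
proof -
  let ?S = "{-\<epsilon><..<\<epsilon>} \<times> V"
  have S: "open ?S" using V by (auto intro: open_Times)
  note Dy = smooth_on_has_derivative[OF y]
  have line: "((\<lambda>s. f (s, x)) has_vector_derivative D (1, 0)) (at t)"
    if f: "(f has_derivative D) (at (t, x))" for f :: "real \<times> 'e \<Rightarrow> 'e" and D t x
  proof -
    have "((\<lambda>s. f (s, x)) has_derivative (\<lambda>h. D (h, 0))) (at t)"
      by (rule has_derivative_chain[OF f]) (auto intro!: derivative_eq_intros)
    moreover have "(\<lambda>h. D (h, 0)) = (\<lambda>h. h *\<^sub>R D (1, 0))"
    proof
      fix h
      have "D (h *\<^sub>R (1, 0)) = h *\<^sub>R D (1, 0)" by (rule linear_scale[OF has_derivative_linear[OF f]])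
      then show "D (h, 0) = h *\<^sub>R D (1, 0)" by simp
    qed
    ultimately show ?thesis by (simp only: has_vector_derivative_def)
  qed
  have time: "frechet_derivative y (at z) (1, 0) = X (y z)" if z: "z \<in> ?S" for z
  proof -
    obtain t x where tx: "z = (t, x)" by (cases z)
    show ?thesis
      using vector_derivative_unique_at[OF line[OF Dy[OF z, unfolded tx]] ode[of t x]] z tx by auto
  qed
  show "frechet_derivative y (at (t, x)) (1, 0) = X (y (t, x))" using time[of "(t, x)"] t x by simp
  have tx: "(t, x) \<in> ?S" using t x by simp
  let ?A = "\<lambda>z. frechet_derivative y (at z) (0, v)"
  have "((\<lambda>s. ?A (s, x)) has_vector_derivative frechet_derivative ?A (at (t, x)) (1, 0)) (at t)"
    by (rule line[OF smooth_on_has_derivative[OF smooth_on_frechet_derivative[OF y] tx]])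
  also have "frechet_derivative ?A (at (t, x)) (1, 0)
      = frechet_derivative (\<lambda>z. frechet_derivative y (at z) (1, 0)) (at (t, x)) (0, v)"
    by (rule symmetric_second_derivative[OF S y tx])
  also have "frechet_derivative (\<lambda>z. frechet_derivative y (at z) (1, 0)) (at (t, x))
      = frechet_derivative (\<lambda>z. X (y z)) (at (t, x))"
    by (rule frechet_derivative_cong_open[OF S tx time])
  also have "frechet_derivative (\<lambda>z. X (y z)) (at (t, x))
      = (\<lambda>h. frechet_derivative X (at (y (t, x))) (frechet_derivative y (at (t, x)) h))"
    by (rule frechet_derivative_at[symmetric], rule has_derivative_chain[OF smooth_on_has_derivative[OF X yU[OF t x]] refl Dy[OF tx]])
  finally show "((\<lambda>s. ?A (s, x)) has_vector_derivative
      frechet_derivative X (at (y (t, x))) (frechet_derivative y (at (t, x)) (0, v))) (at t)" .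
qed

text \<open>The time derivative of the tensor on transported vectors is its Lie derivative at the
  moving point, which vanishes; at time 0 the transport is the identity.\<close>

lemma flow_preserves:
  fixes X :: "'e::euclidean_space \<Rightarrow> 'e" and y :: "real \<times> 'e \<Rightarrow> 'e"
  assumes V: "open V" and U: "open U" and X: "smooth_on U X" and y: "smooth_on ({-\<epsilon><..<\<epsilon>} \<times> V) y"
    and yU: "\<And>t x. t \<in> {-\<epsilon><..<\<epsilon>} \<Longrightarrow> x \<in> V \<Longrightarrow> y (t, x) \<in> U"
    and ode: "\<And>t x. t \<in> {-\<epsilon><..<\<epsilon>} \<Longrightarrow> x \<in> V \<Longrightarrow> ((\<lambda>s. y (s, x)) has_vector_derivative X (y (t, x))) (at t)"
    and y0: "\<And>x. x \<in> V \<Longrightarrow> y (0, x) = x"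
    and t: "t \<in> {-\<epsilon><..<\<epsilon>}" and x: "x \<in> V"
  shows flow_preserves_form: "\<And>\<alpha> :: 'e \<Rightarrow> 'e \<Rightarrow> real. \<lbrakk>\<And>x. x \<in> U \<Longrightarrow> linear (\<alpha> x); \<And>v. smooth_on U (\<lambda>x. \<alpha> x v);
      \<And>x v. x \<in> U \<Longrightarrow> frechet_derivative (\<lambda>y. \<alpha> y v) (at x) (X x) + \<alpha> x (frechet_derivative X (at x) v) = 0\<rbrakk>
      \<Longrightarrow> \<alpha> (y (t, x)) (frechet_derivative y (at (t, x)) (0, v)) = \<alpha> x v"
    and flow_preserves_bilinear: "\<And>B :: 'e \<Rightarrow> 'e \<Rightarrow> 'e \<Rightarrow> real. \<lbrakk>\<And>x. x \<in> U \<Longrightarrow> bilinear (B x); \<And>v w. smooth_on U (\<lambda>x. B x v w);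
      \<And>x v w. x \<in> U \<Longrightarrow> frechet_derivative (\<lambda>y. B y v w) (at x) (X x) + B x (frechet_derivative X (at x) v) w
        + B x v (frechet_derivative X (at x) w) = 0\<rbrakk>
      \<Longrightarrow> B (y (t, x)) (frechet_derivative y (at (t, x)) (0, v)) (frechet_derivative y (at (t, x)) (0, w)) = B x v w"
proof -
  let ?J = "{-\<epsilon><..<\<epsilon>}"
  let ?z = "\<lambda>v s. frechet_derivative y (at (s, x)) (0, v)"
  have z0: "?z v 0 = v" for v
  proof -
    have 0: "(0, x) \<in> ?J \<times> V" using t x by auto
    have "((\<lambda>x. y (0, x)) has_derivative (\<lambda>h. frechet_derivative y (at (0, x)) (0, h))) (at x)"
      by (rule has_derivative_chain[OF smooth_on_has_derivative[OF y 0]]) (auto intro!: derivative_eq_intros)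
    then have "((\<lambda>x. x) has_derivative (\<lambda>h. frechet_derivative y (at (0, x)) (0, h))) (at x)"
      by (rule has_derivative_transform_within_open[OF _ V x]) (simp add: y0)
    from has_derivative_unique[OF this has_derivative_ident] show ?thesis by metis
  qed
  have zd: "(?z v has_derivative (\<lambda>h. h *\<^sub>R frechet_derivative X (at (y (s, x))) (?z v s))) (at s)"
    if "s \<in> ?J" for s v
    using flow_variation(2)[OF V U X y yU ode that x] by (simp add: has_vector_derivative_def)
  have yd: "((\<lambda>s. f (y (s, x))) has_derivative (\<lambda>h. h *\<^sub>R frechet_derivative f (at (y (s, x))) (X (y (s, x))))) (at s)"
    if f: "smooth_on U f" and s: "s \<in> ?J" for f :: "'e \<Rightarrow> real" and s
  proof -
    note D = smooth_on_has_derivative[OF f yU[OF s x]]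
    have "((\<lambda>s. f (y (s, x))) has_derivative (\<lambda>h. frechet_derivative f (at (y (s, x))) (h *\<^sub>R X (y (s, x))))) (at s)"
      by (rule has_derivative_chain[OF D refl ode[OF s x, unfolded has_vector_derivative_def]])
    then show ?thesis by (simp add: linear_scale[OF has_derivative_linear[OF D]])
  qed
  have const: "f t = f 0" if "\<And>s. s \<in> ?J \<Longrightarrow> (f has_derivative (\<lambda>h. 0)) (at s)" for f :: "real \<Rightarrow> real"
    by (rule has_derivative_zero_unique[of ?J]) (use that t in \<open>auto intro: has_derivative_at_withinI\<close>)
  {
    fix \<alpha> :: "'e \<Rightarrow> 'e \<Rightarrow> real"
    assume lin: "\<And>x. x \<in> U \<Longrightarrow> linear (\<alpha> x)" and sm: "\<And>v. smooth_on U (\<lambda>x. \<alpha> x v)"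
      and L: "\<And>x v. x \<in> U \<Longrightarrow> frechet_derivative (\<lambda>y. \<alpha> y v) (at x) (X x) + \<alpha> x (frechet_derivative X (at x) v) = 0"
    have "(\<lambda>s. \<alpha> (y (s, x)) (?z v s)) t = (\<lambda>s. \<alpha> (y (s, x)) (?z v s)) 0"
    proof (rule const)
      fix s assume s: "s \<in> ?J"
      note ys = yU[OF s x]
      have "((\<lambda>s. \<alpha> (y (s, x)) (?z v s)) has_derivative
        (\<lambda>h. h *\<^sub>R frechet_derivative (\<lambda>y. \<alpha> y (?z v s)) (at (y (s, x))) (X (y (s, x)))
          + \<alpha> (y (s, x)) (h *\<^sub>R frechet_derivative X (at (y (s, x))) (?z v s)))) (at s)"
        by (rule has_derivative_linear_family[of ?J s "\<lambda>s. \<alpha> (y (s, x))", OF open_greaterThanLessThan s lin[OF yU[OF _ x]] yd[OF sm s] zd[OF s]])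
      also have "(\<lambda>h. h *\<^sub>R frechet_derivative (\<lambda>y. \<alpha> y (?z v s)) (at (y (s, x))) (X (y (s, x)))
          + \<alpha> (y (s, x)) (h *\<^sub>R frechet_derivative X (at (y (s, x))) (?z v s))) = (\<lambda>h. 0)"
        using L[OF ys, of "?z v s"] by (simp add: linear_scale[OF lin[OF ys]] distrib_left[symmetric])
      finally show "((\<lambda>s. \<alpha> (y (s, x)) (?z v s)) has_derivative (\<lambda>h. 0)) (at s)" .
    qed
    then show "\<alpha> (y (t, x)) (?z v t) = \<alpha> x v" by (simp add: z0 y0[OF x])
  next
    fix B :: "'e \<Rightarrow> 'e \<Rightarrow> 'e \<Rightarrow> real"
    assume lin: "\<And>x. x \<in> U \<Longrightarrow> bilinear (B x)" and sm: "\<And>v w. smooth_on U (\<lambda>x. B x v w)"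
      and L: "\<And>x v w. x \<in> U \<Longrightarrow> frechet_derivative (\<lambda>y. B y v w) (at x) (X x) + B x (frechet_derivative X (at x) v) w
        + B x v (frechet_derivative X (at x) w) = 0"
    have l1: "linear (\<lambda>v. B x v w)" and l2: "linear (B x v)" if "x \<in> U" for x v w
      using lin[OF that] by (auto simp: bilinear_def)
    have "(\<lambda>s. B (y (s, x)) (?z v s) (?z w s)) t = (\<lambda>s. B (y (s, x)) (?z v s) (?z w s)) 0"
    proof (rule const)
      fix s assume s: "s \<in> ?J"
      note ys = yU[OF s x]
      have 1: "((\<lambda>s. B (y (s, x)) u (?z w s)) has_derivative
        (\<lambda>h. h *\<^sub>R frechet_derivative (\<lambda>y. B y u (?z w s)) (at (y (s, x))) (X (y (s, x)))
          + B (y (s, x)) u (h *\<^sub>R frechet_derivative X (at (y (s, x))) (?z w s)))) (at s)" for u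
        by (rule has_derivative_linear_family[of ?J s "\<lambda>s. B (y (s, x)) u", OF open_greaterThanLessThan s l2[OF yU[OF _ x]] yd[OF sm s] zd[OF s]])
      have "((\<lambda>s. B (y (s, x)) (?z v s) (?z w s)) has_derivative
        (\<lambda>h. (h *\<^sub>R frechet_derivative (\<lambda>y. B y (?z v s) (?z w s)) (at (y (s, x))) (X (y (s, x)))
          + B (y (s, x)) (?z v s) (h *\<^sub>R frechet_derivative X (at (y (s, x))) (?z w s)))
          + B (y (s, x)) (h *\<^sub>R frechet_derivative X (at (y (s, x))) (?z v s)) (?z w s))) (at s)"
        by (rule has_derivative_linear_family[of ?J s "\<lambda>s u. B (y (s, x)) u (?z w s)", OF open_greaterThanLessThan s l1[OF yU[OF _ x]] 1 zd[OF s]])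
      also have "(\<lambda>h. (h *\<^sub>R frechet_derivative (\<lambda>y. B y (?z v s) (?z w s)) (at (y (s, x))) (X (y (s, x)))
          + B (y (s, x)) (?z v s) (h *\<^sub>R frechet_derivative X (at (y (s, x))) (?z w s)))
          + B (y (s, x)) (h *\<^sub>R frechet_derivative X (at (y (s, x))) (?z v s)) (?z w s)) = (\<lambda>h. 0)"
      proof
        fix h
        have "h * (frechet_derivative (\<lambda>y. B y (?z v s) (?z w s)) (at (y (s, x))) (X (y (s, x)))
            + B (y (s, x)) (frechet_derivative X (at (y (s, x))) (?z v s)) (?z w s)
            + B (y (s, x)) (?z v s) (frechet_derivative X (at (y (s, x))) (?z w s))) = 0"
          using L[OF ys, of "?z v s" "?z w s"] by simp
        then show "(h *\<^sub>R frechet_derivative (\<lambda>y. B y (?z v s) (?z w s)) (at (y (s, x))) (X (y (s, x)))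
          + B (y (s, x)) (?z v s) (h *\<^sub>R frechet_derivative X (at (y (s, x))) (?z w s)))
          + B (y (s, x)) (h *\<^sub>R frechet_derivative X (at (y (s, x))) (?z v s)) (?z w s) = 0"
          by (simp add: linear_scale[OF l1[OF ys]] linear_scale[OF l2[OF ys]] algebra_simps)
      qed
      finally show "((\<lambda>s. B (y (s, x)) (?z v s) (?z w s)) has_derivative (\<lambda>h. 0)) (at s)" .
    qed
    then show "B (y (t, x)) (?z v t) (?z w t) = B x v w" by (simp add: z0 y0[OF x])
  }
qed

context smooth_mfd
begin

text \<open>The Lie derivative along \<xi> is tested on constant coordinate fields v, whose bracket
  [\<xi>, v] is -D\<xi>(v).\<close>

definition lie_form :: "('i \<Rightarrow> 'e \<Rightarrow> 'e) \<Rightarrow> ('i, 'e) one_form \<Rightarrow> bool" where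
  "lie_form \<xi> \<alpha> \<longleftrightarrow> (\<forall>i\<in>I. \<forall>x\<in>cimg M i. \<forall>v.
     frechet_derivative (\<lambda>y. \<alpha> i y v) (at x) (\<xi> i x) + \<alpha> i x (frechet_derivative (\<xi> i) (at x) v) = 0)"

definition lie_bilinear :: "('i \<Rightarrow> 'e \<Rightarrow> 'e) \<Rightarrow> ('i, 'e) bilinear_field \<Rightarrow> bool" where
  "lie_bilinear \<xi> B \<longleftrightarrow> (\<forall>i\<in>I. \<forall>x\<in>cimg M i. \<forall>v w.
     frechet_derivative (\<lambda>y. B i y v w) (at x) (\<xi> i x) + B i x (frechet_derivative (\<xi> i) (at x) v) w
       + B i x v (frechet_derivative (\<xi> i) (at x) w) = 0)"

lemma smooth_one_formD:
  assumes "smooth_one_form M \<alpha>"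
  shows "\<And>i x. i \<in> I \<Longrightarrow> x \<in> cimg M i \<Longrightarrow> linear (\<alpha> i x)"
    "\<And>i v. i \<in> I \<Longrightarrow> smooth_on (cimg M i) (\<lambda>x. \<alpha> i x v)" "pulls_back_form M id \<alpha> \<alpha>"
  using assms by (auto simp: smooth_one_form_def)

lemma smooth_bilinear_fieldD:
  assumes "smooth_bilinear_field M B"
  shows "\<And>i x. i \<in> I \<Longrightarrow> x \<in> cimg M i \<Longrightarrow> bilinear (B i x)"
    "\<And>i v w. i \<in> I \<Longrightarrow> smooth_on (cimg M i) (\<lambda>x. B i x v w)" "pulls_back_bilinear M id B B"
  using assms by (auto simp: smooth_bilinear_field_def)

text \<open>In a flow box G is y(s, g), so its differential is ds times \<xi> plus A after dg, where
  A is the spatial derivative of the flow at the fixed time s p. A preserves every tensor with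
  vanishing Lie derivative.\<close>

lemma flow_shift:
  assumes \<xi>: "vector_field \<xi>" and \<phi>: "local_flow \<xi> \<epsilon> \<phi>" and g: "smooth_self_map M g"
    and s: "smooth_fun s" and sb: "\<forall>p\<in>topspace X. \<bar>s p\<bar> < \<epsilon>"
  defines "G \<equiv> \<lambda>p. \<phi> (s p) (g p)"
  shows flow_shift_smooth: "smooth_self_map M G"
    and flow_shift_tangent: "p \<in> topspace X \<Longrightarrow> \<exists>i j A. in_charts M g i j p \<and> in_charts M G i j p \<and>
      (\<forall>v. tangent_map M G i j p v = dfun s i (chart M i p) v *\<^sub>R \<xi> j (chart M j (G p)) + A (tangent_map M g i j p v)) \<and>
      (\<forall>\<alpha>. smooth_one_form M \<alpha> \<and> lie_form \<xi> \<alpha> \<longrightarrow> (\<forall>v. \<alpha> j (chart M j (G p)) (A v) = \<alpha> j (chart M j (g p)) v)) \<and>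
      (\<forall>B. smooth_bilinear_field M B \<and> lie_bilinear \<xi> B \<longrightarrow>
        (\<forall>v w. B j (chart M j (G p)) (A v) (A w) = B j (chart M j (g p)) v w))"
proof -
  let ?J = "{-\<epsilon><..<\<epsilon>}"
  have main: "\<exists>i j W V y. in_charts M g i j p \<and> flow_box \<xi> \<epsilon> \<phi> (g p) j V y \<and> open W \<and> W \<subseteq> cimg M i \<and> chart M i p \<in> W \<and>
      (\<forall>x\<in>W. G (emb i x) \<in> cdom M j \<and> local_rep M g i j x \<in> V \<and>
        local_rep M G i j x = y (s (emb i x), local_rep M g i j x)) \<and>
      smooth_on W (local_rep M G i j)" if p: "p \<in> topspace X" for p
  proof -
    have q: "g p \<in> topspace X" by (rule smooth_self_map_maps[OF g p])
    obtain j V y where fb: "flow_box \<xi> \<epsilon> \<phi> (g p) j V y" using \<phi> q by (auto simp: local_flow_def)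
    then have j: "j \<in> I" "open V" "V \<subseteq> cimg M j" "g p \<in> cdom M j" "chart M j (g p) \<in> V"
      and y: "smooth_on (?J \<times> V) y" "\<And>t x. t \<in> ?J \<Longrightarrow> x \<in> V \<Longrightarrow> y (t, x) \<in> cimg M j"
        "\<And>t x. t \<in> ?J \<Longrightarrow> x \<in> V \<Longrightarrow> \<phi> t (emb j x) = emb j (y (t, x))"
      by (auto simp: flow_box_def)
    obtain i where i: "i \<in> I" "p \<in> cdom M i" using cover[OF p] by blast
    have ij: "in_charts M g i j p" using i j by (simp add: in_charts_def)
    note gs = smooth_local_rep[OF g i(1) j(1)]
    define W where "W = local_rep M g i j -` V \<inter> rdom g i j"
    have W: "open W" unfolding W_def
      using smooth_on_imp_continuous_on[OF gs(2)] gs(1) j(2) by (simp add: continuous_on_open_vimage)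
    have Wi: "W \<subseteq> cimg M i" using rdom_iff[OF i(1)] by (auto simp: W_def)
    have pW: "chart M i p \<in> W" using chart_in_rdom[OF ij] j i by (simp add: W_def local_rep_apply)
    have onW: "s (emb i x) \<in> ?J" "local_rep M g i j x \<in> V" "g (emb i x) = emb j (local_rep M g i j x)" if "x \<in> W" for x
    proof -
      have "emb i x \<in> topspace X" using that Wi emb_in_topspace[OF i(1)] by blast
      with sb show "s (emb i x) \<in> ?J" by (auto simp: abs_less_iff)
    qed (use that j(1) rdom_iff[OF i(1)] in \<open>auto simp: W_def local_rep_apply\<close>)
    have rep: "G (emb i x) = emb j (y (s (emb i x), local_rep M g i j x))" if "x \<in> W" for x
      using y(3)[OF onW(1,2)[OF that]] onW(3)[OF that] by (simp add: G_def)
    have rep': "local_rep M G i j x = y (s (emb i x), local_rep M g i j x)" if "x \<in> W" for x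
      using rep[OF that] y(2)[OF onW(1,2)[OF that]] by (simp add: local_rep_apply)
    have "smooth_on W (\<lambda>x. y (s (emb i x), local_rep M g i j x))"
    proof (rule smooth_on_compose[OF W _ y(1) smooth_on_Pair[OF W]])
      show "open (?J \<times> V)" using j(2) by (auto intro: open_Times)
      show "smooth_on W (\<lambda>x. s (emb i x))" using s i(1) Wi by (auto simp: smooth_fun_def intro: smooth_on_subset)
      show "smooth_on W (local_rep M g i j)" using gs(2) by (rule smooth_on_subset) (auto simp: W_def)
    qed (use onW in auto)
    then have "smooth_on W (local_rep M G i j)" by (rule smooth_on_cong[OF W, rotated]) (simp add: rep')
    moreover have "G (emb i x) \<in> cdom M j" if "x \<in> W" for x
      using rep[OF that] emb_in[OF y(2)[OF onW(1,2)[OF that]]] by simp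
    ultimately show ?thesis using ij fb W Wi pW rep' onW(2) by blast
  qed
  show G: "smooth_self_map M G"
  proof (rule smooth_self_mapI)
    fix p assume p: "p \<in> topspace X"
    from main[OF p] show "\<exists>i\<in>I. \<exists>j\<in>I. \<exists>W. p \<in> cdom M i \<and> open W \<and> chart M i p \<in> W \<and> W \<subseteq> cimg M i \<and>
      (\<forall>x\<in>W. G (emb i x) \<in> cdom M j) \<and> smooth_on W (local_rep M G i j)"
      unfolding in_charts_def by blast
  qed
  assume p: "p \<in> topspace X"
  obtain i j W V y where ij: "in_charts M g i j p" and fb: "flow_box \<xi> \<epsilon> \<phi> (g p) j V y"
    and W: "open W" "W \<subseteq> cimg M i" "chart M i p \<in> W" and
    onW: "\<And>x. x \<in> W \<Longrightarrow> G (emb i x) \<in> cdom M j" "\<And>x. x \<in> W \<Longrightarrow> local_rep M g i j x \<in> V"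
      "\<And>x. x \<in> W \<Longrightarrow> local_rep M G i j x = y (s (emb i x), local_rep M g i j x)"
    using main[OF p] by metis
  note i = in_chartsD[OF ij]
  have V: "open V" "V \<subseteq> cimg M j" and y: "smooth_on (?J \<times> V) y"
    and yj: "\<And>t x. t \<in> ?J \<Longrightarrow> x \<in> V \<Longrightarrow> y (t, x) \<in> cimg M j"
    and ode: "\<And>t x. t \<in> ?J \<Longrightarrow> x \<in> V \<Longrightarrow> ((\<lambda>s. y (s, x)) has_vector_derivative \<xi> j (y (t, x))) (at t)"
    and y0: "\<And>x. x \<in> V \<Longrightarrow> y (0, x) = x"
    using fb by (auto simp: flow_box_def)
  have \<xi>j: "smooth_on (cimg M j) (\<xi> j)" using \<xi> i by (simp add: vector_field_def)
  let ?x = "chart M j (g p)"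
  have lr: "local_rep M g i j (chart M i p) = ?x" using i by (simp add: local_rep_apply)
  have x: "?x \<in> V" using onW(2)[OF W(3)] lr by simp
  have sp: "s p \<in> ?J" using sb p by (auto simp: abs_less_iff)
  have Gp: "G p \<in> cdom M j" using onW(1)[OF W(3)] i by simp
  have Gij: "in_charts M G i j p" using i Gp by (simp add: in_charts_def)
  have yG: "y (s p, ?x) = chart M j (G p)" using onW(3)[OF W(3)] lr i by (simp add: local_rep_apply)
  define A where "A v = frechet_derivative y (at (s p, ?x)) (0, v)" for v
  have Dy: "(y has_derivative frechet_derivative y (at (s p, ?x))) (at (s p, ?x))"
    using smooth_on_has_derivative[OF y] sp x by simp
  have "tangent_map M G i j p = (\<lambda>v. frechet_derivative y (at (s p, ?x)) (dfun s i (chart M i p) v, tangent_map M g i j p v))"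
  proof (rule tangent_map_unique[OF W(1,3) onW(3)])
    show "((\<lambda>x. y (s (emb i x), local_rep M g i j x)) has_derivative
      (\<lambda>v. frechet_derivative y (at (s p, ?x)) (dfun s i (chart M i p) v, tangent_map M g i j p v))) (at (chart M i p))"
      by (rule has_derivative_chain[OF Dy _ has_derivative_Pair[OF smooth_fun_has_derivative[OF s i(1) i(6)]
            local_rep_has_derivative[OF g ij]]]) (use i lr in simp)
  qed
  \<comment> \<open>The pair (a, v) is split into its time and space parts; the time derivative of y
    is \<xi>.\<close>
  moreover have "frechet_derivative y (at (s p, ?x)) (a, v) = a *\<^sub>R \<xi> j (chart M j (G p)) + A v" for a v
  proof -
    have "frechet_derivative y (at (s p, ?x)) (a *\<^sub>R (1, 0) + (0, v))
        = a *\<^sub>R frechet_derivative y (at (s p, ?x)) (1, 0) + A v"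
      unfolding A_def using has_derivative_linear[OF Dy] by (simp only: linear_add linear_scale)
    then show ?thesis
      using flow_variation(1)[OF V(1) open_cimg[OF i(2)] \<xi>j y yj ode sp x] yG by simp
  qed
  ultimately have T: "tangent_map M G i j p v = dfun s i (chart M i p) v *\<^sub>R \<xi> j (chart M j (G p)) + A (tangent_map M g i j p v)" for v
    by simp
  note pf = flow_preserves_form[OF V(1) open_cimg[OF i(2)] \<xi>j y yj ode y0 sp x, unfolded yG A_def[symmetric]]
  note pb = flow_preserves_bilinear[OF V(1) open_cimg[OF i(2)] \<xi>j y yj ode y0 sp x, unfolded yG A_def[symmetric]]
  have inv1: "\<alpha> j (chart M j (G p)) (A v) = \<alpha> j ?x v" if "smooth_one_form M \<alpha>" "lie_form \<xi> \<alpha>" for \<alpha> v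
    by (rule pf[of "\<alpha> j"]) (use that smooth_one_formD[OF that(1)] i in \<open>auto simp: lie_form_def\<close>)
  have inv2: "B j (chart M j (G p)) (A v) (A w) = B j ?x v w" if "smooth_bilinear_field M B" "lie_bilinear \<xi> B" for B v w
    by (rule pb[of "B j"]) (use that smooth_bilinear_fieldD[OF that(1)] i in \<open>auto simp: lie_bilinear_def\<close>)
  show "\<exists>i j A. in_charts M g i j p \<and> in_charts M G i j p \<and>
      (\<forall>v. tangent_map M G i j p v = dfun s i (chart M i p) v *\<^sub>R \<xi> j (chart M j (G p)) + A (tangent_map M g i j p v)) \<and>
      (\<forall>\<alpha>. smooth_one_form M \<alpha> \<and> lie_form \<xi> \<alpha> \<longrightarrow> (\<forall>v. \<alpha> j (chart M j (G p)) (A v) = \<alpha> j (chart M j (g p)) v)) \<and>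
      (\<forall>B. smooth_bilinear_field M B \<and> lie_bilinear \<xi> B \<longrightarrow>
        (\<forall>v w. B j (chart M j (G p)) (A v) (A w) = B j (chart M j (g p)) v w))"
    using ij Gij T inv1 inv2 by (intro exI[of _ i] exI[of _ j] exI[of _ A]) blast
qed

text \<open>Moving points along \<open>\<xi>\<close> by the time \<open>u\<close> changes the pullback of \<open>\<alpha>\<close> by \<open>du\<close> and leaves that
  of \<open>B\<close> alone.\<close>

definition reeb_pair :: "('i \<Rightarrow> 'e \<Rightarrow> 'e) \<Rightarrow> ('i, 'e) one_form \<Rightarrow> ('i, 'e) bilinear_field \<Rightarrow> bool" where
  "reeb_pair \<xi> \<alpha> B \<longleftrightarrow> vector_field \<xi> \<and> smooth_one_form M \<alpha> \<and> lie_form \<xi> \<alpha> \<and>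
     smooth_bilinear_field M B \<and> lie_bilinear \<xi> B \<and>
     (\<forall>i\<in>I. \<forall>x\<in>cimg M i. \<alpha> i x (\<xi> i x) = 1 \<and> (\<forall>v. B i x (\<xi> i x) v = 0 \<and> B i x v (\<xi> i x) = 0))"

text \<open>In the differential of the shifted map the summand along \<xi> contributes ds to the
  pullback of \<alpha>, as \<alpha>(\<xi>) = 1, and nothing to that of B, as B annihilates
  \<xi>.\<close>

lemma flow_shift_pullback:
  assumes R: "reeb_pair \<xi> \<alpha> B" and \<phi>: "local_flow \<xi> \<epsilon> \<phi>" and g: "smooth_self_map M g"
    and s: "smooth_fun s" and sb: "\<forall>p\<in>topspace X. \<bar>s p\<bar> < \<epsilon>"
    and \<beta>: "pulls_back_form M id \<beta> \<beta>" "pulls_back_form M g \<alpha> \<beta>"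
    and C: "pulls_back_bilinear M id C C" "pulls_back_bilinear M g B C"
  shows "pulls_back_form M (\<lambda>p. \<phi> (s p) (g p)) \<alpha> (\<lambda>i x v. \<beta> i x v + dfun s i x v)"
    "pulls_back_bilinear M (\<lambda>p. \<phi> (s p) (g p)) B C"
proof -
  let ?G = "\<lambda>p. \<phi> (s p) (g p)"
  have \<xi>: "vector_field \<xi>" and \<alpha>: "smooth_one_form M \<alpha>" "lie_form \<xi> \<alpha>" and B: "smooth_bilinear_field M B" "lie_bilinear \<xi> B"
    and n: "\<And>i x. i \<in> I \<Longrightarrow> x \<in> cimg M i \<Longrightarrow> \<alpha> i x (\<xi> i x) = 1"
      "\<And>i x v. i \<in> I \<Longrightarrow> x \<in> cimg M i \<Longrightarrow> B i x (\<xi> i x) v = 0"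
      "\<And>i x v. i \<in> I \<Longrightarrow> x \<in> cimg M i \<Longrightarrow> B i x v (\<xi> i x) = 0"
    using R by (auto simp: reeb_pair_def)
  note G = flow_shift_smooth[OF \<xi> \<phi> g s sb] and T = flow_shift_tangent[OF \<xi> \<phi> g s sb]
  show "pulls_back_form M ?G \<alpha> (\<lambda>i x v. \<beta> i x v + dfun s i x v)"
  proof (rule pulls_back_formI[OF G smooth_one_formD(3)[OF \<alpha>(1)]])
    show "pulls_back_form M id (\<lambda>i x v. \<beta> i x v + dfun s i x v) (\<lambda>i x v. \<beta> i x v + dfun s i x v)"
      using \<beta>(1) pulls_back_dfun[OF s] by (simp add: pulls_back_form_def)
    fix p assume p: "p \<in> topspace X"
    obtain i j A where ij: "in_charts M g i j p" "in_charts M ?G i j p"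
      and t: "\<And>v. tangent_map M ?G i j p v = dfun s i (chart M i p) v *\<^sub>R \<xi> j (chart M j (?G p)) + A (tangent_map M g i j p v)"
      and a: "\<And>v. \<alpha> j (chart M j (?G p)) (A v) = \<alpha> j (chart M j (g p)) v"
      using T[OF p] \<alpha> by blast
    note i = in_chartsD[OF ij(2)]
    have l: "linear (\<alpha> j (chart M j (?G p)))" by (rule smooth_one_formD(1)[OF \<alpha>(1) i(2,7)])
    have "\<alpha> j (chart M j (?G p)) (tangent_map M ?G i j p v) = \<beta> i (chart M i p) v + dfun s i (chart M i p) v" for v
      using \<beta>(2) ij(1) unfolding t pulls_back_form_def
      by (simp add: linear_add[OF l] linear_scale[OF l] a n(1)[OF i(2,7)])
    then show "\<exists>i j. in_charts M ?G i j p \<and> (\<forall>v. \<alpha> j (chart M j (?G p)) (tangent_map M ?G i j p v)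
        = \<beta> i (chart M i p) v + dfun s i (chart M i p) v)" using ij(2) by blast
  qed
  show "pulls_back_bilinear M ?G B C"
  proof (rule pulls_back_bilinearI[OF G smooth_bilinear_fieldD(3)[OF B(1)] C(1)])
    fix p assume p: "p \<in> topspace X"
    obtain i j A where ij: "in_charts M g i j p" "in_charts M ?G i j p"
      and t: "\<And>v. tangent_map M ?G i j p v = dfun s i (chart M i p) v *\<^sub>R \<xi> j (chart M j (?G p)) + A (tangent_map M g i j p v)"
      and a: "\<And>v w. B j (chart M j (?G p)) (A v) (A w) = B j (chart M j (g p)) v w"
      using T[OF p] B by blast
    note i = in_chartsD[OF ij(2)]
    have bl: "bilinear (B j (chart M j (?G p)))" by (rule smooth_bilinear_fieldD(1)[OF B(1) i(2,7)])
    have "B j (chart M j (?G p)) (tangent_map M ?G i j p v) (tangent_map M ?G i j p w) = C i (chart M i p) v w" for v w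
      using C(2) ij(1) unfolding t pulls_back_bilinear_def
      by (simp add: bilinear_ladd[OF bl] bilinear_radd[OF bl] bilinear_lmul[OF bl] bilinear_rmul[OF bl]
          a n(2,3)[OF i(2,7)])
    then show "\<exists>i j. in_charts M ?G i j p \<and> (\<forall>v w. B j (chart M j (?G p)) (tangent_map M ?G i j p v)
        (tangent_map M ?G i j p w) = C i (chart M i p) v w)" using ij(2) by blast
  qed
qed

theorem long_flow_pullback:
  assumes R: "reeb_pair \<xi> \<alpha> B" and \<phi>: "local_flow \<xi> \<epsilon> \<phi>" and n: "0 < n" and g: "smooth_self_map M g"
    and u: "smooth_fun u" and ub: "\<And>p. p \<in> topspace X \<Longrightarrow> \<bar>u p\<bar> < real n * \<epsilon>"
    and \<beta>: "pulls_back_form M id \<beta> \<beta>" "pulls_back_form M g \<alpha> \<beta>"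
    and C: "pulls_back_bilinear M id C C" "pulls_back_bilinear M g B C"
  shows "smooth_self_map M (\<lambda>p. long_flow \<phi> n (u p) (g p))"
    "pulls_back_form M (\<lambda>p. long_flow \<phi> n (u p) (g p)) \<alpha> (\<lambda>i x v. \<beta> i x v + dfun u i x v)"
    "pulls_back_bilinear M (\<lambda>p. long_flow \<phi> n (u p) (g p)) B C"
proof -
  define s where "s = (\<lambda>p. (1 / real n) * u p)"
  have s: "smooth_fun s" unfolding s_def by (rule smooth_fun_cmul[OF u])
  have sb: "\<forall>p\<in>topspace X. \<bar>s p\<bar> < \<epsilon>"
    using ub n by (auto simp: s_def divide_less_eq mult.commute)
  have ds: "dfun s i x v = dfun u i x v / real n" if "i \<in> I" "x \<in> cimg M i" for i x v
    using dfun_cmul[OF u that, of "1 / real n" v] unfolding s_def by simp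
  have \<xi>: "vector_field \<xi>" using R by (simp add: reeb_pair_def)
  \<comment> \<open>The time s p is taken at the original point p in every step, so each step is a
    shift of the map \<open>G k\<close> by the same function s.\<close>
  define G where "G k p = (\<phi> (s p) ^^ k) (g p)" for k p
  have step: "G (Suc k) = (\<lambda>p. \<phi> (s p) (G k p))" for k by (simp add: G_def fun_eq_iff)
  have all: "smooth_self_map M (G k) \<and> pulls_back_form M (G k) \<alpha> (\<lambda>i x v. \<beta> i x v + real k * dfun s i x v) \<and>
      pulls_back_bilinear M (G k) B C" for k
  proof (induction k)
    case 0
    then show ?case using g \<beta>(2) C(2) by (simp add: G_def)
  next
    case (Suc k)
    have "pulls_back_form M id (\<lambda>i x v. \<beta> i x v + real k * dfun s i x v) (\<lambda>i x v. \<beta> i x v + real k * dfun s i x v)"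
      using \<beta>(1) pulls_back_dfun[OF s] by (simp add: pulls_back_form_def)
    note F = flow_shift_pullback[OF R \<phi> _ s sb this _ C(1), of "G k"]
    have e: "(\<lambda>i x v. \<beta> i x v + real (Suc k) * dfun s i x v) = (\<lambda>i x v. \<beta> i x v + real k * dfun s i x v + dfun s i x v)"
      by (simp add: algebra_simps)
    show ?case unfolding step e using F flow_shift_smooth[OF \<xi> \<phi> _ s sb, of "G k"] Suc.IH by blast
  qed
  have Gn: "G n = (\<lambda>p. long_flow \<phi> n (u p) (g p))" by (simp add: fun_eq_iff G_def long_flow_def s_def)
  note main = all[of n, unfolded Gn]
  show "smooth_self_map M (\<lambda>p. long_flow \<phi> n (u p) (g p))"
    "pulls_back_bilinear M (\<lambda>p. long_flow \<phi> n (u p) (g p)) B C" using main by blast+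
  show "pulls_back_form M (\<lambda>p. long_flow \<phi> n (u p) (g p)) \<alpha> (\<lambda>i x v. \<beta> i x v + dfun u i x v)"
    using main ds n in_chartsD(1,6) unfolding pulls_back_form_def by simp
qed

section \<open>Comparison of times along a leaf\<close>

text \<open>The derivative of k along \<xi> as a function on the manifold; the choice of chart is
  immaterial by \<open>lie_fun_eq\<close>.\<close>

definition lie_fun :: "('i \<Rightarrow> 'e \<Rightarrow> 'e) \<Rightarrow> ('a \<Rightarrow> real) \<Rightarrow> 'a \<Rightarrow> real" where
  "lie_fun \<xi> k q = (let j = SOME j. j \<in> I \<and> q \<in> cdom M j in dfun k j (chart M j q) (\<xi> j (chart M j q)))"

lemma lie_fun_eq:
  assumes \<xi>: "vector_field \<xi>" and k: "smooth_fun k" and j: "j \<in> I" "q \<in> cdom M j"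
  shows "lie_fun \<xi> k q = dfun k j (chart M j q) (\<xi> j (chart M j q))"
proof -
  define i where "i = (SOME j. j \<in> I \<and> q \<in> cdom M j)"
  have "i \<in> I \<and> q \<in> cdom M i" unfolding i_def by (rule someI_ex) (use j in blast)
  then have ij: "in_charts M id i j q" using j by (simp add: in_charts_def)
  have "dfun k j (chart M j (id q)) (tangent_map M id i j q (\<xi> i (chart M i q))) = dfun k i (chart M i q) (\<xi> i (chart M i q))"
    using pulls_back_dfun[OF k] ij unfolding pulls_back_form_def by blast
  then show ?thesis using \<xi> ij unfolding vector_field_def lie_fun_def i_def[symmetric] by simp
qed

text \<open>Continuity is recorded because \<open>flows_unique\<close> asks for continuous
  speeds.\<close>

lemma flows_fun_derivative:
  assumes \<xi>: "vector_field \<xi>" and k: "smooth_fun k" and c: "flows \<xi> J \<mu> c" and J: "open J" "t \<in> J"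
  shows "((\<lambda>s. k (c s)) has_real_derivative \<mu> t * lie_fun \<xi> k (c t)) (at t)"
    "isCont (\<lambda>s. lie_fun \<xi> k (c s)) t"
proof -
  have cc: "continuous_map (top_of_set J) X c" using c by (simp add: flows_def)
  obtain j where j: "j \<in> I" "c t \<in> cdom M j" using cover[OF flows_topspace[OF c J(2)]] by blast
  let ?N = "{s \<in> J. c s \<in> cdom M j}"
  have N: "open ?N" "t \<in> ?N" using curve_preimage_open[OF cc J(1) j(1)] J j by auto
  have d: "((\<lambda>s. chart M j (c s)) has_vector_derivative \<mu> t *\<^sub>R \<xi> j (chart M j (c t))) (at t)"
    using c J(2) j by (simp add: flows_def)
  note Dk = smooth_fun_has_derivative[OF k j(1) chart_in[OF j(2)]]
  have "((\<lambda>s. k (emb j (chart M j (c s)))) has_derivative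
      (\<lambda>h. dfun k j (chart M j (c t)) (h *\<^sub>R \<mu> t *\<^sub>R \<xi> j (chart M j (c t))))) (at t)"
    by (rule has_derivative_chain[OF Dk refl d[unfolded has_vector_derivative_def]])
  then have "((\<lambda>s. k (c s)) has_derivative
      (\<lambda>h. dfun k j (chart M j (c t)) (h *\<^sub>R \<mu> t *\<^sub>R \<xi> j (chart M j (c t))))) (at t)"
    by (rule has_derivative_transform_within_open[OF _ N]) (use j in auto)
  moreover have "(\<lambda>h. dfun k j (chart M j (c t)) (h *\<^sub>R \<mu> t *\<^sub>R \<xi> j (chart M j (c t)))) = (*) (\<mu> t * lie_fun \<xi> k (c t))"
    unfolding lie_fun_eq[OF \<xi> k j] by (auto simp: linear_scale[OF has_derivative_linear[OF Dk]])
  ultimately show "((\<lambda>s. k (c s)) has_real_derivative \<mu> t * lie_fun \<xi> k (c t)) (at t)"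
    by (simp add: has_field_derivative_def)
  have "smooth_on (cimg M j) (\<lambda>x. dfun k j x (\<xi> j x))"
    unfolding dfun_def using k \<xi> j(1) open_cimg[OF j(1)]
    by (intro smooth_on_frechet_derivative_field) (auto simp: smooth_fun_def vector_field_def)
  then have "isCont (\<lambda>x. dfun k j x (\<xi> j x)) (chart M j (c t))"
    using smooth_on_imp_continuous_on open_cimg[OF j(1)] chart_in[OF j(2)] continuous_on_eq_continuous_at by blast
  then have c1: "isCont (\<lambda>s. dfun k j (chart M j (c s)) (\<xi> j (chart M j (c s)))) t"
    by (rule isCont_o2[OF has_vector_derivative_continuous[OF d]])
  have ev: "eventually (\<lambda>s. lie_fun \<xi> k (c s) = dfun k j (chart M j (c s)) (\<xi> j (chart M j (c s)))) (nhds t)"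
    unfolding eventually_nhds using N lie_fun_eq[OF \<xi> k j(1)] by blast
  show "isCont (\<lambda>s. lie_fun \<xi> k (c s)) t" unfolding isCont_cong[OF ev] by (rule c1)
qed

text \<open>Along a leaf, elapsed time for \<open>\<alpha>\<^sub>1\<close> and \<open>H\<^sup>* \<alpha>\<^sub>1 = \<alpha>\<^sub>2 - dk\<close> differ by the increment of \<open>k\<close>.\<close>

theorem long_flow_adjust_inverse:
  assumes R1: "reeb_pair \<xi>1 \<alpha>1 B1" and R2: "reeb_pair \<xi>2 \<alpha>2 B2"
    and \<phi>1: "local_flow \<xi>1 \<epsilon>1 \<phi>1" and \<phi>2: "local_flow \<xi>2 \<epsilon>2 \<phi>2" and n: "0 < n"
    and H: "smooth_self_map M H" and FH: "\<And>p. p \<in> topspace X \<Longrightarrow> F p \<in> topspace X \<and> H (F p) = p"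
    and h: "smooth_fun h" and K: "\<And>p. p \<in> topspace X \<Longrightarrow> \<bar>h p\<bar> < K" "3 * K \<le> real n * \<epsilon>1" "3 * K \<le> real n * \<epsilon>2"
    and pull: "pulls_back_form M H \<alpha>1 (\<lambda>i x v. \<alpha>2 i x v - dfun (\<lambda>q. h (H q)) i x v)"
    and leaf: "\<And>i j q. in_charts M H i j q \<Longrightarrow> \<exists>c. tangent_map M H i j q (\<xi>2 i (chart M i q)) = c *\<^sub>R \<xi>1 j (chart M j (H q))"
    and p: "p \<in> topspace X" and q: "q = long_flow \<phi>2 n (- h p) (F p)"
  shows "long_flow \<phi>1 n (h (H q)) (H q) = p"
proof -
  define k where "k q = h (H q)" for q
  have k: "smooth_fun k" unfolding k_def by (rule smooth_fun_compose[OF h H])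
  have \<xi>1: "vector_field \<xi>1" and \<xi>2: "vector_field \<xi>2" using R1 R2 by (auto simp: reeb_pair_def)
  have K0: "0 < K" using K(1)[OF p] by simp
  have \<epsilon>1: "0 < \<epsilon>1" using \<phi>1 by (simp add: local_flow_def)
  let ?J = "{-K<..<K}"
  \<comment> \<open>The curve runs backwards along the flow of \<xi>2 from F p and reaches q at time
    h p.\<close>
  define c where "c t = long_flow \<phi>2 n (- t) (F p)" for t
  have "flows \<xi>2 {- (real n * \<epsilon>2)<..<real n * \<epsilon>2} (\<lambda>_. 1) (\<lambda>t. long_flow \<phi>2 n t (F p))"
    by (rule long_flow_flows[OF \<xi>2 \<phi>2 n]) (use FH p in blast)
  moreover have "((\<lambda>t. - t) has_real_derivative - 1) (at t)" for t :: real
    by (auto intro!: derivative_eq_intros)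
  moreover have "- t \<in> {- (real n * \<epsilon>2)<..<real n * \<epsilon>2}" if "t \<in> ?J" for t using that K K0 by auto
  ultimately have c: "flows \<xi>2 ?J (\<lambda>_. - 1) c"
    using flows_reparam[of \<xi>2 "{- (real n * \<epsilon>2)<..<real n * \<epsilon>2}" "\<lambda>_. 1" _ ?J "\<lambda>t. - t" "\<lambda>_. - 1"]
    by (simp add: c_def[abs_def])
  have cX: "c t \<in> topspace X" if "t \<in> ?J" for t using flows_topspace[OF c that] .
  have c0: "c 0 = F p" using long_flow_0[OF \<xi>2 \<phi>2 n] by (simp add: c_def)
  \<comment> \<open>By \<open>pull\<close>, \<alpha>1 takes the value 1 minus the derivative of k
    along \<xi>2 on the image of \<xi>2 under H; as H preserves leaves, this image is \<kappa>
    \<xi>1.\<close>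
  define \<kappa> where "\<kappa> t = 1 - lie_fun \<xi>2 k (c t)" for t
  have b: "flows \<xi>1 ?J (\<lambda>t. - \<kappa> t) (\<lambda>t. H (c t))"
  proof (rule flowsI[OF \<xi>1])
    have cc: "continuous_map (top_of_set ?J) X c" using c by (simp add: flows_def)
    then show "continuous_map (top_of_set ?J) X (\<lambda>t. H (c t))"
      using continuous_map_compose[of _ _ c X H] H unfolding smooth_self_map_def o_def by blast
    fix t assume t: "t \<in> ?J"
    obtain i j where ij: "in_charts M H i j (c t)" using ex_in_charts[OF H cX[OF t]] by blast
    note i = in_chartsD[OF ij]
    obtain a where a: "tangent_map M H i j (c t) (\<xi>2 i (chart M i (c t))) = a *\<^sub>R \<xi>1 j (chart M j (H (c t)))"
      using leaf[OF ij] by blast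
    have "a = \<alpha>1 j (chart M j (H (c t))) (a *\<^sub>R \<xi>1 j (chart M j (H (c t))))"
      using R1 i(2,7) smooth_one_formD(1)[of \<alpha>1 j "chart M j (H (c t))"] by (simp add: reeb_pair_def linear_scale)
    also have "\<dots> = \<alpha>2 i (chart M i (c t)) (\<xi>2 i (chart M i (c t))) - dfun k i (chart M i (c t)) (\<xi>2 i (chart M i (c t)))"
      using pull ij unfolding pulls_back_form_def a[symmetric] k_def[abs_def] by blast
    also have "\<dots> = \<kappa> t" using R2 i(1,6) lie_fun_eq[OF \<xi>2 k i(1,3)] by (simp add: reeb_pair_def \<kappa>_def)
    finally have a_eq: "a = \<kappa> t" .
    have "((\<lambda>s. chart M i (c s)) has_vector_derivative (- 1) *\<^sub>R \<xi>2 i (chart M i (c t))) (at t)"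
      using c t i(1,3) by (simp add: flows_def)
    from curve_derivative_transfer[OF cc _ t H ij this]
    have "((\<lambda>s. chart M j (H (c s))) has_vector_derivative (- \<kappa> t) *\<^sub>R \<xi>1 j (chart M j (H (c t)))) (at t)"
      unfolding linear_scale[OF linear_tangent_map[OF H ij]] a a_eq by simp
    then show "\<exists>j\<in>I. H (c t) \<in> cdom M j \<and>
      ((\<lambda>s. chart M j (H (c s))) has_vector_derivative (- \<kappa> t) *\<^sub>R \<xi>1 j (chart M j (H (c t)))) (at t)"
      using i by blast
  qed simp
  \<comment> \<open>A primitive of \<kappa>, normalised by \<Lambda> 0 = 0; the sign of the term in
    k is right because c runs backwards. At time h p it equals k q.\<close>
  define \<Lambda> where "\<Lambda> t = t + k (c t) - h p" for t
  have \<Lambda>0: "\<Lambda> 0 = 0" using FH p by (simp add: \<Lambda>_def c0 k_def)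
  have d\<Lambda>: "((\<lambda>t. - \<Lambda> t) has_real_derivative - \<kappa> t) (at t)" if "t \<in> ?J" for t
    unfolding \<Lambda>_def \<kappa>_def
    by (rule derivative_eq_intros flows_fun_derivative(1)[OF \<xi>2 k c _ that] refl | simp)+
  \<comment> \<open>Three terms, each below K in absolute value: the origin of the factor 3 in the
    bounds on K.\<close>
  have \<Lambda>b: "- \<Lambda> t \<in> {- (real n * \<epsilon>1)<..<real n * \<epsilon>1}" if "t \<in> ?J" for t
  proof -
    have "\<bar>k (c t)\<bar> < K" unfolding k_def by (rule K(1)[OF smooth_self_map_maps[OF H cX[OF that]]])
    then show ?thesis using that K(1)[OF p] K(2) by (auto simp: \<Lambda>_def)
  qed
  from flows_reparam[OF long_flow_flows[OF \<xi>1 \<phi>1 n p], of ?J "\<lambda>t. - \<Lambda> t" "\<lambda>t. - \<kappa> t", OF \<Lambda>b d\<Lambda>]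
  have b2: "flows \<xi>1 ?J (\<lambda>t. - \<kappa> t) (\<lambda>t. long_flow \<phi>1 n (- \<Lambda> t) p)" by simp
  have "continuous_on ?J (\<lambda>t. - \<kappa> t)"
  proof (rule continuous_at_imp_continuous_on, rule ballI)
    fix t assume t: "t \<in> ?J"
    have "isCont (\<lambda>s. lie_fun \<xi>2 k (c s)) t" by (rule flows_fun_derivative(2)[OF \<xi>2 k c _ t]) simp
    then show "isCont (\<lambda>t. - \<kappa> t) t" unfolding \<kappa>_def by (intro continuous_intros)
  qed
  \<comment> \<open>H after c and the orbit of p with time -\<Lambda> have the same speed and the
    same starting point p.\<close>
  then have "H (c (h p)) = long_flow \<phi>1 n (- \<Lambda> (h p)) p"
    by (rule flows_unique[OF \<xi>1 b b2, of 0, rotated 2])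
      (use K(1)[OF p] K0 FH p \<Lambda>0 long_flow_0[OF \<xi>1 \<phi>1 n] in \<open>auto simp: c0\<close>)
  moreover have "\<Lambda> (h p) = k q" by (simp add: \<Lambda>_def c_def q)
  moreover have "c (h p) = q" by (simp add: c_def q)
  ultimately have "H q = long_flow \<phi>1 n (- k q) p" by simp
  moreover have "\<bar>k q\<bar> < real n * \<epsilon>1"
  proof -
    have "q \<in> topspace X" using cX[of "h p"] K(1)[OF p] \<open>c (h p) = q\<close> by (auto simp: abs_less_iff)
    then have "\<bar>k q\<bar> < K" unfolding k_def by (intro K(1) smooth_self_map_maps[OF H])
    then show ?thesis using K(2) K0 by simp
  qed
  ultimately show ?thesis using long_flow_inverse[OF \<xi>1 \<phi>1 n, of "k q" p] by (simp add: k_def)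
qed

section \<open>Closed 1-forms are exact if the first Betti number vanishes\<close>

lemma pathin_emb_segment:
  assumes i: "i \<in> I" and B: "convex B" "B \<subseteq> cimg M i" and xy: "x \<in> B" "y \<in> B"
  shows "pathin X (\<lambda>t. emb i (x + t *\<^sub>R (y - x)))" "t \<in> {0..1} \<Longrightarrow> x + t *\<^sub>R (y - x) \<in> B"
proof -
  show seg: "x + t *\<^sub>R (y - x) \<in> B" if "t \<in> {0..1}" for t
    using convexD_alt[OF B(1) xy, of t] that by (simp add: algebra_simps)
  have "continuous_map (top_of_set {0..1}) (top_of_set (cimg M i)) (\<lambda>t. x + t *\<^sub>R (y - x))"
    using seg B(2) by (auto intro!: continuous_intros)
  from continuous_map_compose[OF this continuous_emb[OF i]]
  show "pathin X (\<lambda>t. emb i (x + t *\<^sub>R (y - x)))" unfolding pathin_def o_def .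
qed

text \<open>Primitives on coordinate balls form local potentials; the resulting global potential has
  differential \<gamma> and hence is smooth.\<close>

theorem closed_one_form_exact:
  assumes betti: "betti_number 1 X = 0" and \<gamma>: "smooth_one_form M \<gamma>"
    and closed: "\<And>i x v w. i \<in> I \<Longrightarrow> x \<in> cimg M i \<Longrightarrow>
      frechet_derivative (\<lambda>y. \<gamma> i y w) (at x) v = frechet_derivative (\<lambda>y. \<gamma> i y v) (at x) w"
  obtains h where "smooth_fun h" "\<And>i x. i \<in> I \<Longrightarrow> x \<in> cimg M i \<Longrightarrow> dfun h i x = \<gamma> i x"
proof -
  define Q where "Q p i r \<eta> \<longleftrightarrow> i \<in> I \<and> p \<in> cdom M i \<and> 0 < r \<and> ball (chart M i p) r \<subseteq> cimg M i \<and>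
      (\<forall>x\<in>ball (chart M i p) r. (\<eta> has_derivative \<gamma> i x) (at x))" for p i r \<eta>
  have "\<exists>i r \<eta>. Q p i r \<eta>" if p: "p \<in> topspace X" for p
  proof -
    obtain i where i: "i \<in> I" "p \<in> cdom M i" using cover[OF p] by blast
    obtain r where r: "0 < r" "ball (chart M i p) r \<subseteq> cimg M i"
      using open_cimg[OF i(1)] chart_in[OF i(2)] open_contains_ball by blast
    obtain \<eta> where "\<And>x. x \<in> ball (chart M i p) r \<Longrightarrow> (\<eta> has_derivative \<gamma> i x) (at x)"
    proof (rule poincare_lemma_ball[of "chart M i p" r "\<gamma> i"])
      show "smooth_on (ball (chart M i p) r) (\<lambda>x. \<gamma> i x v)" for v
        using smooth_one_formD(2)[OF \<gamma> i(1)] r(2) by (rule smooth_on_subset)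
    qed (use smooth_one_formD(1)[OF \<gamma> i(1)] closed[OF i(1)] r(2) in \<open>blast+\<close>)
    then show ?thesis unfolding Q_def using i r by (intro exI[of _ i] exI[of _ r] exI[of _ \<eta>]) simp
  qed
  then obtain ii r \<eta> where loc: "\<And>p. p \<in> topspace X \<Longrightarrow> Q p (ii p) (r p) (\<eta> p)" by metis
  define B where "B p = ball (chart M (ii p) p) (r p)" for p
  define U where "U p = emb (ii p) ` B p" for p
  define hh where "hh p q = \<eta> p (chart M (ii p) q)" for p q
  have ii: "ii p \<in> I" "p \<in> cdom M (ii p)" and B: "open (B p)" "convex (B p)" "B p \<subseteq> cimg M (ii p)" "chart M (ii p) p \<in> B p"
    and \<eta>: "\<And>x. x \<in> B p \<Longrightarrow> (\<eta> p has_derivative \<gamma> (ii p) x) (at x)" if "p \<in> topspace X" for p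
    using loc[OF that] by (auto simp: B_def Q_def)
  have oU: "openin X (U p)" and pU: "p \<in> U p" if p: "p \<in> topspace X" for p
    unfolding U_def using openin_emb_image[OF ii(1)[OF p] B(1,3)[OF p]] emb_chart[OF ii[OF p]] B(4)[OF p]
    by (simp, metis image_eqI)
  have Ud: "x \<in> cdom M (ii p)" "chart M (ii p) x \<in> B p" if "p \<in> topspace X" "x \<in> U p" for p x
    using that B(3)[OF that(1)] emb_in by (auto simp: U_def)
  interpret local_potential X U hh
  proof
    fix p q x assume p: "p \<in> topspace X" and q: "q \<in> topspace X" and x: "x \<in> U p" "x \<in> U q"
    let ?i = "ii p" and ?j = "ii q"
    note i = ii[OF p] and j = ii[OF q]
    let ?\<tau> = "local_rep M id ?i ?j"
    note ts = smooth_local_rep[OF smooth_self_map_id i(1) j(1)]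
    define T where "T = ?\<tau> -` B q \<inter> (rdom id ?i ?j) \<inter> B p"
    have "open (?\<tau> -` B q \<inter> rdom id ?i ?j)"
      using smooth_on_imp_continuous_on[OF ts(2)] ts(1) B(1)[OF q] by (simp add: continuous_on_open_vimage)
    then have T: "open T" using B(1)[OF p] by (auto simp: T_def)
    have xT: "chart M ?i x \<in> T"
      using Ud[OF p x(1)] Ud[OF q x(2)] i(1) by (auto simp: T_def rdom_iff local_rep_apply chart_in)
    obtain \<rho> where \<rho>: "0 < \<rho>" "ball (chart M ?i x) \<rho> \<subseteq> T" using T xT open_contains_ball by blast
    let ?N = "ball (chart M ?i x) \<rho>"
    \<comment> \<open>Two local primitives, read in one chart, differ by a function with zero
      derivative on a ball.\<close>
    define D where "D y = \<eta> p y - \<eta> q (?\<tau> y)" for y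
    have D0: "(D has_derivative (\<lambda>h. 0)) (at y within ?N)" if y: "y \<in> ?N" for y
    proof -
      have yT: "y \<in> B p" "?\<tau> y \<in> B q" "y \<in> rdom id ?i ?j" using y \<rho>(2) by (auto simp: T_def)
      then have ij: "in_charts M id ?i ?j (emb ?i y)" and cy: "chart M ?i (emb ?i y) = y"
        using i j by (auto simp: in_charts_def rdom_iff emb_in)
      have "(?\<tau> has_derivative tangent_map M id ?i ?j (emb ?i y)) (at y)"
        using local_rep_has_derivative[OF smooth_self_map_id ij] cy by simp
      from has_derivative_chain[OF \<eta>[OF q yT(2)] refl this]
      have "(D has_derivative (\<lambda>h. \<gamma> ?i y h - \<gamma> ?j (?\<tau> y) (tangent_map M id ?i ?j (emb ?i y) h))) (at y)"
        unfolding D_def by (rule has_derivative_diff[OF \<eta>[OF p yT(1)]])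
      moreover have "\<gamma> ?j (?\<tau> y) (tangent_map M id ?i ?j (emb ?i y) h) = \<gamma> ?i y h" for h
        using smooth_one_formD(3)[OF \<gamma>] ij cy by (simp add: pulls_back_form_def local_rep_apply)
      ultimately show ?thesis by (simp add: has_derivative_at_withinI)
    qed
    show "\<exists>W. openin X W \<and> x \<in> W \<and> W \<subseteq> U p \<inter> U q \<and> (\<forall>z\<in>W. hh p z - hh p x = hh q z - hh q x)"
    proof (intro exI[of _ "emb ?i ` ?N"] conjI ballI)
      have NT: "?N \<subseteq> cimg M ?i" using \<rho>(2) B(3)[OF p] by (auto simp: T_def)
      show "openin X (emb ?i ` ?N)" by (rule openin_emb_image[OF i(1) open_ball NT])
      have xe: "emb ?i (chart M ?i x) = x" using Ud[OF p x(1)] i by simp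
      then show "x \<in> emb ?i ` ?N" using \<rho>(1) by (metis centre_in_ball image_eqI)
      have val: "emb ?i y \<in> U p \<and> emb ?i y \<in> U q \<and> hh p (emb ?i y) - hh q (emb ?i y) = D y" if "y \<in> ?N" for y
      proof -
        have yT: "y \<in> B p" "?\<tau> y \<in> B q" "y \<in> rdom id ?i ?j" using that \<rho>(2) by (auto simp: T_def)
        have "emb ?j (?\<tau> y) = emb ?i y" using yT(3) i j by (simp add: rdom_iff local_rep_apply)
        then have "emb ?i y \<in> U q" using yT(2) unfolding U_def by (metis image_eqI)
        moreover have "emb ?i y \<in> U p" using yT(1) by (auto simp: U_def)
        ultimately show ?thesis using NT that by (auto simp: hh_def D_def local_rep_apply subset_iff)
      qed
      then show "emb ?i ` ?N \<subseteq> U p \<inter> U q" by auto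
      fix z assume "z \<in> emb ?i ` ?N"
      then obtain y where y: "y \<in> ?N" "z = emb ?i y" by auto
      have "D y = D (chart M ?i x)"
        by (rule has_derivative_zero_unique[OF convex_ball D0 y(1)]) (use \<rho> in auto)
      then show "hh p z - hh p x = hh q z - hh q x"
        using val[OF y(1)] val[of "chart M ?i x"] y(2) \<rho>(1) xe by simp
    qed
  qed (use oU pU in auto)
  obtain H where H: "\<And>p c. p \<in> topspace X \<Longrightarrow> pathin X c \<Longrightarrow> c ` {0..1} \<subseteq> U p \<Longrightarrow>
    H (c 1) - H (c 0) = hh p (c 1) - hh p (c 0)" using global_potential[OF betti] by blast
  have main: "((\<lambda>x. H (emb j x)) has_derivative \<gamma> j x) (at x)" if j: "j \<in> I" and x: "x \<in> cimg M j" for j x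
  proof -
    let ?p = "emb j x"
    have p: "?p \<in> topspace X" by (rule emb_in_topspace[OF j x])
    let ?i = "ii ?p"
    note i = ii[OF p]
    let ?x0 = "chart M ?i ?p"
    \<comment> \<open>Inside a coordinate ball the straight segment from the centre is an admissible
      path, so H is the local primitive up to a constant.\<close>
    have "H (emb ?i y) = \<eta> ?p y + (H ?p - \<eta> ?p ?x0)" if y: "y \<in> B ?p" for y
    proof -
      let ?c = "\<lambda>t. emb ?i (?x0 + t *\<^sub>R (y - ?x0))"
      have "H (?c 1) - H (?c 0) = hh ?p (?c 1) - hh ?p (?c 0)"
      proof (rule H[OF p pathin_emb_segment(1)[OF i(1) B(2,3,4)[OF p] y]])
        show "?c ` {0..1} \<subseteq> U ?p"
          using pathin_emb_segment(2)[OF i(1) B(2,3,4)[OF p] y] by (auto simp: U_def simp del: atLeastAtMost_iff)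
      qed
      then show ?thesis using y B(3,4)[OF p] i by (auto simp: hh_def subset_iff)
    qed
    note Heq = this
    have "((\<lambda>y. \<eta> ?p y + (H ?p - \<eta> ?p ?x0)) has_derivative \<gamma> ?i ?x0) (at ?x0)"
      using has_derivative_add[OF \<eta>[OF p B(4)[OF p]] has_derivative_const] by simp
    then have Hi: "((\<lambda>y. H (emb ?i y)) has_derivative \<gamma> ?i ?x0) (at ?x0)"
      by (rule has_derivative_transform_within_open[OF _ B(1,4)[OF p]]) (simp add: Heq)
    \<comment> \<open>The derivative at the centre, known in the chart of the ball, is carried to
      the chart j by the transition map.\<close>
    have ji: "in_charts M id j ?i ?p" using j i emb_in[OF x] by (simp add: in_charts_def)
    have "(local_rep M id j ?i has_derivative tangent_map M id j ?i ?p) (at x)"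
      using local_rep_has_derivative[OF smooth_self_map_id ji] x by simp
    from has_derivative_chain[OF Hi _ this]
    have "((\<lambda>y. H (emb ?i (local_rep M id j ?i y))) has_derivative (\<lambda>h. \<gamma> ?i ?x0 (tangent_map M id j ?i ?p h))) (at x)"
      by (simp add: local_rep_apply)
    moreover have "(\<lambda>h. \<gamma> ?i ?x0 (tangent_map M id j ?i ?p h)) = \<gamma> j x"
      using smooth_one_formD(3)[OF \<gamma>] ji x by (auto simp: pulls_back_form_def)
    ultimately have "((\<lambda>y. H (emb ?i (local_rep M id j ?i y))) has_derivative \<gamma> j x) (at x)" by simp
    then show ?thesis
    proof (rule has_derivative_transform_within_open)
      show "open (rdom id j ?i)" by (rule smooth_local_rep(1)[OF smooth_self_map_id j i(1)])
      show "x \<in> rdom id j ?i" using x j i by (simp add: rdom_iff)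
    qed (use j i in \<open>simp add: rdom_iff local_rep_apply\<close>)
  qed
  show thesis
  proof (rule that)
    show "smooth_fun H" unfolding smooth_fun_def
      using smooth_onI_derivative[OF open_cimg main smooth_one_formD(2)[OF \<gamma>]] by blast
    show "dfun H i x = \<gamma> i x" if "i \<in> I" "x \<in> cimg M i" for i x
      unfolding dfun_def using frechet_derivative_at[OF main[OF that]] by simp
  qed
qed

end

section \<open>Sasakian metrics\<close>

locale sasakian = smooth_mfd M
  for M :: "('a, 'i, 'e::euclidean_space) atlas_space" +
  fixes g :: "('i, 'e) bilinear_field" and \<alpha> :: "('i, 'e) one_form"
  assumes sas: "sasakian_metric M g \<alpha>"
begin

lemma g_bilinear: "i \<in> I \<Longrightarrow> x \<in> cimg M i \<Longrightarrow> bilinear (g i x)"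
  and g_sym: "i \<in> I \<Longrightarrow> x \<in> cimg M i \<Longrightarrow> g i x v w = g i x w v"
  and g_pos: "i \<in> I \<Longrightarrow> x \<in> cimg M i \<Longrightarrow> v \<noteq> 0 \<Longrightarrow> g i x v v > 0"
  and g_smooth_field: "smooth_bilinear_field M g"
  and \<alpha>_form: "smooth_one_form M \<alpha>"
  using sas unfolding sasakian_metric_def riemannian_metric_def contact_form_def smooth_bilinear_field_def by auto

lemma \<alpha>_linear: "i \<in> I \<Longrightarrow> x \<in> cimg M i \<Longrightarrow> linear (\<alpha> i x)"
  and \<alpha>_smooth: "i \<in> I \<Longrightarrow> smooth_on (cimg M i) (\<lambda>x. \<alpha> i x v)"
  using smooth_one_formD[OF \<alpha>_form] by auto

lemma g_nondegenerate:
  assumes "i \<in> I" "x \<in> cimg M i" "\<And>u. g i x u v = g i x u w" shows "v = w"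
proof (rule ccontr)
  assume "v \<noteq> w"
  then have "g i x (v - w) (v - w) > 0" using g_pos[OF assms(1,2)] by simp
  then show False using assms(3)[of "v - w"] bilinear_rsub[OF g_bilinear[OF assms(1,2)], of "v - w" v w] by simp
qed

lemma \<alpha>_has_derivative:
  "i \<in> I \<Longrightarrow> x \<in> cimg M i \<Longrightarrow> ((\<lambda>y. \<alpha> i y v) has_derivative frechet_derivative (\<lambda>y. \<alpha> i y v) (at x)) (at x)"
  by (rule smooth_on_has_derivative[OF \<alpha>_smooth])

section \<open>The complex structure of the cone in terms of the base\<close>

lemma cimg_cone: "cimg (cone M) i = cimg M i \<times> {0<..}"
  by (force simp: cimg_def cone_def)

lemma cone_mem: "x \<in> cimg M i \<Longrightarrow> 0 < r \<Longrightarrow> (x, r) \<in> cimg (cone M) i"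
  by (simp add: cimg_cone)

lemma index_cone [simp]: "index_set (cone M) = I"
  by (simp add: cone_def)

text \<open>The factor 1/2 in \<open>ext_d\<close> cancels the 2 in d(r^2) = 2 r dr.\<close>

lemma cone_ext_d:
  assumes i: "i \<in> I" "x \<in> cimg M i"
  shows "ext_d (cone_form \<alpha>) i (x, r) (v, s) (w, t) = r * (s * \<alpha> i x w - t * \<alpha> i x v) + r\<^sup>2 * ext_d \<alpha> i x v w"
proof -
  have "frechet_derivative (\<lambda>y. cone_form \<alpha> i y (w, t)) (at (x, r)) (v, s)
      = 2 * r * s * \<alpha> i x w + r\<^sup>2 * frechet_derivative (\<lambda>y. \<alpha> i y w) (at x) v" for v s w t
  proof -
    have "((\<lambda>y. \<alpha> i (fst y) w) has_derivative (\<lambda>h. frechet_derivative (\<lambda>y. \<alpha> i y w) (at x) (fst h))) (at (x, r))"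
      by (rule has_derivative_chain[OF \<alpha>_has_derivative[OF i]]) (auto intro!: derivative_eq_intros)
    then have "((\<lambda>y. (snd y)\<^sup>2 * \<alpha> i (fst y) w) has_derivative
        (\<lambda>h. 2 * r * snd h * \<alpha> i x w + r\<^sup>2 * frechet_derivative (\<lambda>y. \<alpha> i y w) (at x) (fst h))) (at (x, r))"
      by (auto intro!: derivative_eq_intros simp: algebra_simps)
    moreover have "(\<lambda>y. cone_form \<alpha> i y (w, t)) = (\<lambda>y. (snd y)\<^sup>2 * \<alpha> i (fst y) w)"
      by (simp add: cone_form_def case_prod_unfold)
    ultimately show ?thesis using frechet_derivative_at by (metis (no_types, lifting) fst_conv snd_conv)
  qed
  then show ?thesis unfolding ext_d_def by (simp add: field_simps)
qed

definition "J = (SOME J. integrable_complex_structure (cone M) J \<and> (\<forall>i\<in>I. \<forall>x\<in>cimg (cone M) i. \<forall>v w.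
   ext_d (cone_form \<alpha>) i x v w = cone_metric g i x v (J i x w)))"

lemma J: "integrable_complex_structure (cone M) J"
  "i \<in> I \<Longrightarrow> c \<in> cimg (cone M) i \<Longrightarrow> ext_d (cone_form \<alpha>) i c a b = cone_metric g i c a (J i c b)"
proof -
  have "\<exists>J. integrable_complex_structure (cone M) J \<and> (\<forall>i\<in>I. \<forall>x\<in>cimg (cone M) i. \<forall>v w.
   ext_d (cone_form \<alpha>) i x v w = cone_metric g i x v (J i x w))"
    using sas unfolding sasakian_metric_def kaehler_metric_with_form_def by auto
  from someI_ex[OF this, folded J_def]
  show "integrable_complex_structure (cone M) J"
    "i \<in> I \<Longrightarrow> c \<in> cimg (cone M) i \<Longrightarrow> ext_d (cone_form \<alpha>) i c a b = cone_metric g i c a (J i c b)" by blast+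
qed

lemma J_smooth: "i \<in> I \<Longrightarrow> smooth_on (cimg M i \<times> {0<..}) (\<lambda>c. J i c b)"
  using J(1) unfolding integrable_complex_structure_def smooth_endo_field_def cimg_cone index_cone by blast

lemma J_linear: "i \<in> I \<Longrightarrow> x \<in> cimg M i \<Longrightarrow> 0 < r \<Longrightarrow> linear (J i (x, r))"
  using J(1) cone_mem[of x i r] unfolding integrable_complex_structure_def smooth_endo_field_def index_cone by blast

lemma J_square: "i \<in> I \<Longrightarrow> x \<in> cimg M i \<Longrightarrow> 0 < r \<Longrightarrow> J i (x, r) (J i (x, r) b) = - b"
  using J(1) cone_mem[of x i r] unfolding integrable_complex_structure_def index_cone by blast

lemma J_form:
  assumes i: "i \<in> I" "x \<in> cimg M i" "0 < r"
  shows "r * (s * \<alpha> i x w - t * \<alpha> i x v) + r\<^sup>2 * ext_d \<alpha> i x v w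
    = r\<^sup>2 * g i x v (fst (J i (x, r) (w, t))) + s * snd (J i (x, r) (w, t))"
  using J(2)[OF i(1) cone_mem[OF i(2,3)], of "(v, s)" "(w, t)"]
  by (simp add: cone_ext_d[OF i(1,2)] cone_metric_def case_prod_unfold)

text \<open>On the cone, \<open>J (r \<partial>\<^sub>r) = - \<xi>\<close> and \<open>J v = (T v, r \<alpha>(v) \<partial>\<^sub>r)\<close> with \<open>T\<close> independent of \<open>r\<close>.\<close>

definition "T i x v = fst (J i (x, 1) (v, 0))"
definition "\<xi> i x = - fst (J i (x, 1) (0, 1))"

lemma g_T: "i \<in> I \<Longrightarrow> x \<in> cimg M i \<Longrightarrow> g i x v (T i x w) = ext_d \<alpha> i x v w"
  using J_form[of i x 1 0 w 0 v] by (simp add: T_def)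

text \<open>Comes from pairing a horizontal vector with the radial one at r = 1. So \<xi> first
  appears as the metric dual of \<alpha>; that it is the Reeb field is seen in
  \<open>reeb_field_eq\<close>.\<close>

lemma g_\<xi>:
  assumes i: "i \<in> I" "x \<in> cimg M i" shows "g i x v (\<xi> i x) = \<alpha> i x v"
proof -
  note b = g_bilinear[OF i]
  have "T i x 0 = 0" using linear_0[OF J_linear[OF i, of 1]] by (simp add: T_def zero_prod_def)
  then have "ext_d \<alpha> i x v 0 = 0" using g_T[OF i, of v 0] bilinear_rzero[OF b] by simp
  then show ?thesis
    using J_form[OF i, of 1 0 0 1 v] linear_0[OF \<alpha>_linear[OF i]] by (simp add: \<xi>_def bilinear_rneg[OF b])
qed

text \<open>The radial component is read off by pairing with the radial vector, the horizontal one
  from nondegeneracy of g.\<close>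

lemma J_eq:
  assumes i: "i \<in> I" "x \<in> cimg M i" "0 < r"
  shows "J i (x, r) (v, s) = (T i x v - (s / r) *\<^sub>R \<xi> i x, r * \<alpha> i x v)"
proof -
  note b = g_bilinear[OF i(1,2)]
  have 1: "snd (J i (x, r) (v, s)) = r * \<alpha> i x v"
    using J_form[OF i, of 1 v s 0] linear_0[OF \<alpha>_linear[OF i(1,2)]] g_T[OF i(1,2), of 0 v] bilinear_lzero[OF b]
    by simp
  have "g i x u (fst (J i (x, r) (v, s))) = g i x u (T i x v - (s / r) *\<^sub>R \<xi> i x)" for u
  proof -
    have "r\<^sup>2 * g i x u (fst (J i (x, r) (v, s))) = r\<^sup>2 * g i x u (T i x v - (s / r) *\<^sub>R \<xi> i x)"
      using J_form[OF i, of 0 v s u] i(3)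
      by (simp add: bilinear_rsub[OF b] bilinear_rmul[OF b] g_T[OF i(1,2)] g_\<xi>[OF i(1,2)] power2_eq_square algebra_simps)
    then show ?thesis using i(3) by simp
  qed
  then have "fst (J i (x, r) (v, s)) = T i x v - (s / r) *\<^sub>R \<xi> i x" by (rule g_nondegenerate[OF i(1,2)])
  then show ?thesis using 1 by (simp add: prod_eq_iff)
qed

context
  fixes i x assumes i: "i \<in> I" "x \<in> cimg M i"
begin

lemma T_linear: "linear (T i x)"
proof -
  have "linear (\<lambda>v. fst (J i (x, 1) (v, 0)))"
    using J_linear[OF i, of 1]
    by (intro linear_compose[unfolded o_def, OF _ linear_fst] linear_compose[unfolded o_def, of "\<lambda>v. (v, 0)" "J i (x, 1)"])
      (auto simp: linear_iff)
  then show ?thesis by (simp add: T_def[abs_def])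
qed

text \<open>These are the two components of J^2 = -1 on the radial vector, which J sends to
  -\<xi>.\<close>

lemma T_\<xi>: "T i x (\<xi> i x) = 0" and \<alpha>_\<xi>: "\<alpha> i x (\<xi> i x) = 1"
proof -
  have "J i (x, 1) (J i (x, 1) (0, 1)) = (0, - 1)" using J_square[OF i, of 1 "(0, 1)"] by simp
  moreover have "J i (x, 1) (0, 1) = (- \<xi> i x, 0)"
    using J_eq[OF i, of 1 0 1] linear_0[OF T_linear] linear_0[OF \<alpha>_linear[OF i]] by simp
  ultimately have "(- T i x (\<xi> i x), - \<alpha> i x (\<xi> i x)) = (0, - 1)"
    using J_eq[OF i, of 1 "- \<xi> i x" 0] linear_neg[OF T_linear] linear_neg[OF \<alpha>_linear[OF i]] by simp
  then show "T i x (\<xi> i x) = 0" "\<alpha> i x (\<xi> i x) = 1" by auto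
qed

text \<open>The components of J^2 = -1 on a horizontal vector. Hence T is a complex structure on the
  kernel of \<alpha>.\<close>

lemma T_square: "T i x (T i x v) = \<alpha> i x v *\<^sub>R \<xi> i x - v" and \<alpha>_T: "\<alpha> i x (T i x v) = 0"
proof -
  have "J i (x, 1) (T i x v, \<alpha> i x v) = (- v, 0)"
    using J_square[OF i, of 1 "(v, 0)"] J_eq[OF i, of 1 v 0] by simp
  then have *: "T i x (T i x v) - \<alpha> i x v *\<^sub>R \<xi> i x = - v" "\<alpha> i x (T i x v) = 0"
    using J_eq[OF i, of 1 "T i x v" "\<alpha> i x v"] by auto
  show "\<alpha> i x (T i x v) = 0" by (rule *)
  show "T i x (T i x v) = \<alpha> i x v *\<^sub>R \<xi> i x - v" using *(1) by (simp add: algebra_simps)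
qed

lemma ext_d_antisym: "ext_d \<alpha> i x v w = - ext_d \<alpha> i x w v"
  by (simp add: ext_d_def field_simps)

lemma ext_d_\<xi>: "ext_d \<alpha> i x v (\<xi> i x) = 0" "ext_d \<alpha> i x (\<xi> i x) v = 0"
  using g_T[OF i, of v "\<xi> i x"] T_\<xi> bilinear_rzero[OF g_bilinear[OF i]] ext_d_antisym[of "\<xi> i x" v] by auto

text \<open>If d\<alpha>(\<zeta>, .) vanishes, then T \<zeta> = 0 because g represents d\<alpha>
  through T, and the formula for T^2 leaves \<zeta> = \<alpha>(\<zeta>) \<xi>.\<close>

lemma reeb_field_eq: "reeb_field \<alpha> i x = \<xi> i x"
  unfolding reeb_field_def
proof (rule the_equality)
  fix \<zeta> assume \<zeta>: "\<alpha> i x \<zeta> = 1 \<and> (\<forall>v. ext_d \<alpha> i x \<zeta> v = 0)"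
  have "g i x u (T i x \<zeta>) = g i x u 0" for u
    using g_T[OF i, of u \<zeta>] ext_d_antisym[of u \<zeta>] \<zeta> bilinear_rzero[OF g_bilinear[OF i]] by simp
  then have "T i x \<zeta> = 0" by (rule g_nondegenerate[OF i])
  then show "\<zeta> = \<xi> i x" using T_square[of \<zeta>] linear_0[OF T_linear] \<zeta> by simp
qed (simp add: \<alpha>_\<xi> ext_d_\<xi>)

end

definition "\<nu> i x v w = g i x v w - \<alpha> i x v * \<alpha> i x w"

lemma \<nu>_bilinear: "i \<in> I \<Longrightarrow> x \<in> cimg M i \<Longrightarrow> bilinear (\<nu> i x)"
  using g_bilinear[of i x] \<alpha>_linear[of i x]
  by (auto simp: bilinear_def \<nu>_def linear_iff algebra_simps)

lemma \<nu>_\<xi>: "i \<in> I \<Longrightarrow> x \<in> cimg M i \<Longrightarrow> \<nu> i x v (\<xi> i x) = 0"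
  "i \<in> I \<Longrightarrow> x \<in> cimg M i \<Longrightarrow> \<nu> i x (\<xi> i x) v = 0"
  using g_\<xi>[of i x v] \<alpha>_\<xi>[of i x] g_sym[of i x v "\<xi> i x"] by (auto simp: \<nu>_def)

lemma \<nu>_T: "i \<in> I \<Longrightarrow> x \<in> cimg M i \<Longrightarrow> \<nu> i x v (T i x w) = ext_d \<alpha> i x v w"
  using g_T[of i x v w] \<alpha>_T[of i x w] by (simp add: \<nu>_def)

text \<open>Writes \<nu> through d\<alpha> and T, the two objects whose Lie derivatives along \<xi>
  are accessible.\<close>

lemma ext_d_T: "i \<in> I \<Longrightarrow> x \<in> cimg M i \<Longrightarrow> ext_d \<alpha> i x v (T i x w) = - \<nu> i x v w"
  using g_T[of i x v "T i x w"] T_square[of i x w] g_\<xi>[of i x v]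
  by (simp add: \<nu>_def bilinear_rsub[OF g_bilinear] bilinear_rmul[OF g_bilinear] mult.commute)

text \<open>If all \<nu>(v, z) vanish, then z and \<alpha>(z) \<xi> have the same g-products with
  every vector.\<close>

lemma \<nu>_nondegenerate:
  assumes i: "i \<in> I" "x \<in> cimg M i" and z: "\<And>v. \<nu> i x v z = 0" shows "z = \<alpha> i x z *\<^sub>R \<xi> i x"
proof (rule g_nondegenerate[OF i])
  show "g i x u z = g i x u (\<alpha> i x z *\<^sub>R \<xi> i x)" for u
    using z[of u] by (simp add: \<nu>_def bilinear_rmul[OF g_bilinear[OF i]] g_\<xi>[OF i] mult.commute)
qed

lemma at_one_smooth:
  assumes i: "i \<in> I" shows "smooth_on (cimg M i) (\<lambda>x. J i (x, 1) b)"
proof (rule smooth_on_compose[OF open_cimg[OF i] _ J_smooth[OF i]])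
  show "open (cimg M i \<times> {0::real<..})" using open_cimg[OF i] by (intro open_Times) auto
  show "smooth_on (cimg M i) (\<lambda>x. (x, 1))"
    by (intro smooth_on_Pair open_cimg[OF i] smooth_on_ident smooth_on_const)
qed auto

lemma T_smooth: "i \<in> I \<Longrightarrow> smooth_on (cimg M i) (\<lambda>x. T i x v)"
  unfolding T_def by (rule smooth_on_linear_compose[OF bounded_linear_fst open_cimg at_one_smooth])

lemma \<xi>_smooth: "i \<in> I \<Longrightarrow> smooth_on (cimg M i) (\<xi> i)"
  unfolding \<xi>_def[abs_def]
  by (rule smooth_on_minus[OF open_cimg smooth_on_linear_compose[OF bounded_linear_fst open_cimg at_one_smooth]])

lemma \<nu>_smooth: "i \<in> I \<Longrightarrow> smooth_on (cimg M i) (\<lambda>x. \<nu> i x v w)"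
  unfolding \<nu>_def using smooth_bilinear_fieldD(2)[OF g_smooth_field]
  by (intro smooth_on_diff smooth_on_mult open_cimg \<alpha>_smooth) auto

lemma ext_d_smooth: "i \<in> I \<Longrightarrow> smooth_on (cimg M i) (\<lambda>x. ext_d \<alpha> i x v w)"
  unfolding ext_d_def divide_inverse
  by (intro smooth_on_mult smooth_on_diff smooth_on_const smooth_on_frechet_derivative open_cimg \<alpha>_smooth)

lemma \<nu>_field: "smooth_bilinear_field M \<nu>"
  unfolding smooth_bilinear_field_def
proof (intro conjI ballI allI)
  show "pulls_back_bilinear M id \<nu> \<nu>"
    using smooth_bilinear_fieldD(3)[OF g_smooth_field] smooth_one_formD(3)[OF \<alpha>_form]
    by (simp add: pulls_back_bilinear_def pulls_back_form_def \<nu>_def)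
qed (auto intro: \<nu>_bilinear \<nu>_smooth)

section \<open>The Reeb field and the tensors it preserves\<close>

text \<open>\<xi> is the g-dual of \<alpha>, and both g and \<alpha> transform as tensors.\<close>

lemma vector_field_\<xi>: "vector_field \<xi>"
  unfolding vector_field_def
proof (intro conjI ballI allI impI \<xi>_smooth)
  fix i j p assume ij: "in_charts M id i j p"
  note ii = in_chartsD[OF ij]
  have i: "i \<in> I" "chart M i p \<in> cimg M i" and j: "j \<in> I" "chart M j p \<in> cimg M j" using ii by auto
  let ?D = "tangent_map M id i j p"
  have "g j (chart M j p) u (?D (\<xi> i (chart M i p))) = g j (chart M j p) u (\<xi> j (chart M j p))" for u
  proof -
    define v where "v = tangent_map M id j i p u"
    have u: "u = ?D v" using transition_inverse(1)[OF transition_inverse(2)[OF ij]] by (simp add: v_def)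
    have "g j (chart M j p) (?D v) (?D (\<xi> i (chart M i p))) = g i (chart M i p) v (\<xi> i (chart M i p))"
      using smooth_bilinear_fieldD(3)[OF g_smooth_field] ij by (simp add: pulls_back_bilinear_def)
    also have "\<dots> = \<alpha> j (chart M j p) (?D v)"
      using g_\<xi>[OF i] smooth_one_formD(3)[OF \<alpha>_form] ij by (simp add: pulls_back_form_def)
    finally show ?thesis using g_\<xi>[OF j] u by simp
  qed
  then show "?D (\<xi> i (chart M i p)) = \<xi> j (chart M j p)" by (rule g_nondegenerate[OF j])
qed

text \<open>\<open>d (d \<alpha>) = 0\<close> and \<open>\<iota>\<^sub>\<xi> d\<alpha> = 0\<close> give \<open>L\<^sub>\<xi> d\<alpha> = 0\<close>.\<close>

lemma lie_derivatives:
  assumes i: "i \<in> I" "x \<in> cimg M i"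
  shows lie_\<alpha>: "frechet_derivative (\<lambda>y. \<alpha> i y v) (at x) (\<xi> i x) + \<alpha> i x (frechet_derivative (\<xi> i) (at x) v) = 0"
    and lie_ext_d: "frechet_derivative (\<lambda>y. ext_d \<alpha> i y v w) (at x) (\<xi> i x)
      + ext_d \<alpha> i x (frechet_derivative (\<xi> i) (at x) v) w + ext_d \<alpha> i x v (frechet_derivative (\<xi> i) (at x) w) = 0"
proof -
  note o = open_cimg[OF i(1)]
  note D\<xi> = smooth_on_has_derivative[OF \<xi>_smooth[OF i(1)] i(2)]
  \<comment> \<open>Differentiating \<alpha>(\<xi>) = 1 exchanges the derivative of \<alpha> for
    that of \<xi>; together with d\<alpha>(\<xi>, v) = 0 this gives the first claim.\<close>
  have 1: "((\<lambda>y. \<alpha> i y (\<xi> i y)) has_derivative (\<lambda>h. frechet_derivative (\<lambda>y. \<alpha> i y (\<xi> i x)) (at x) h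
      + \<alpha> i x (frechet_derivative (\<xi> i) (at x) h))) (at x)"
    by (rule has_derivative_linear_family[OF o i(2) \<alpha>_linear[OF i(1)] \<alpha>_has_derivative[OF i] D\<xi>])
  have 2: "((\<lambda>y. \<alpha> i y (\<xi> i y)) has_derivative (\<lambda>h. 0)) (at x)"
    by (rule has_derivative_transform_within_open[OF has_derivative_const o i(2)]) (simp add: \<alpha>_\<xi>[OF i(1)])
  have "frechet_derivative (\<lambda>y. \<alpha> i y (\<xi> i x)) (at x) v + \<alpha> i x (frechet_derivative (\<xi> i) (at x) v) = 0"
    by (rule fun_cong[OF has_derivative_unique[OF 1 2]])
  then show "frechet_derivative (\<lambda>y. \<alpha> i y v) (at x) (\<xi> i x) + \<alpha> i x (frechet_derivative (\<xi> i) (at x) v) = 0"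
    using ext_d_\<xi>(2)[OF i, of v] by (simp add: ext_d_def)
  let ?B = "\<lambda>v w y. ext_d \<alpha> i y v w"
  have lin: "linear (\<lambda>v. ext_d \<alpha> i y v w)" if "y \<in> cimg M i" for y w
    using g_bilinear[OF i(1) that]
    by (intro linearI) (simp_all add: g_T[OF i(1) that, symmetric] bilinear_ladd bilinear_lmul)
  have DB: "(?B v w has_derivative frechet_derivative (?B v w) (at x)) (at x)" for v w
    by (rule smooth_on_has_derivative[OF ext_d_smooth[OF i(1)] i(2)])
  \<comment> \<open>The same device, applied to d\<alpha>(\<xi>, w) = 0.\<close>
  have 1: "frechet_derivative (?B (\<xi> i x) w) (at x) v = - ext_d \<alpha> i x (frechet_derivative (\<xi> i) (at x) v) w" for v w
  proof -
    have 1: "((\<lambda>y. ext_d \<alpha> i y (\<xi> i y) w) has_derivative (\<lambda>h. frechet_derivative (?B (\<xi> i x) w) (at x) h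
        + ext_d \<alpha> i x (frechet_derivative (\<xi> i) (at x) h) w)) (at x)"
      by (rule has_derivative_linear_family[of "cimg M i" x "\<lambda>y v. ext_d \<alpha> i y v w", OF o i(2) lin DB D\<xi>])
    have 2: "((\<lambda>y. ext_d \<alpha> i y (\<xi> i y) w) has_derivative (\<lambda>h. 0)) (at x)"
      by (rule has_derivative_transform_within_open[OF has_derivative_const o i(2)]) (simp add: ext_d_\<xi>(2)[OF i(1)])
    have "frechet_derivative (?B (\<xi> i x) w) (at x) v + ext_d \<alpha> i x (frechet_derivative (\<xi> i) (at x) v) w = 0"
      by (rule fun_cong[OF has_derivative_unique[OF 1 2]])
    then show ?thesis by simp
  qed
  \<comment> \<open>Expands derivatives of d\<alpha> into second derivatives of \<alpha>, whose
    symmetry makes the cyclic sum vanish.\<close>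
  have dd: "frechet_derivative (?B v w) (at x) u =
      (frechet_derivative (\<lambda>y. frechet_derivative (\<lambda>z. \<alpha> i z w) (at y) v) (at x) u
      - frechet_derivative (\<lambda>y. frechet_derivative (\<lambda>z. \<alpha> i z v) (at y) w) (at x) u) / 2" for u v w
  proof -
    note s = smooth_on_has_derivative[OF smooth_on_frechet_derivative[OF \<alpha>_smooth[OF i(1)]] i(2)]
    have "(?B v w has_derivative (\<lambda>u. (frechet_derivative (\<lambda>y. frechet_derivative (\<lambda>z. \<alpha> i z w) (at y) v) (at x) u
      - frechet_derivative (\<lambda>y. frechet_derivative (\<lambda>z. \<alpha> i z v) (at y) w) (at x) u) * (1/2))) (at x)"
      unfolding ext_d_def divide_inverse
      using has_derivative_mult_left[OF has_derivative_diff[OF s[of w v] s[of v w]], of "1/2"] by simp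
    from fun_cong[OF frechet_derivative_at[OF this], of u] show ?thesis by simp
  qed
  have sym: "frechet_derivative (\<lambda>y. frechet_derivative (\<lambda>z. \<alpha> i z w) (at y) v) (at x) u
      = frechet_derivative (\<lambda>y. frechet_derivative (\<lambda>z. \<alpha> i z w) (at y) u) (at x) v" for u v w
    by (rule symmetric_second_derivative[OF o \<alpha>_smooth[OF i(1)] i(2)])
  have "frechet_derivative (?B v w) (at x) (\<xi> i x) + frechet_derivative (?B w (\<xi> i x)) (at x) v
      + frechet_derivative (?B (\<xi> i x) v) (at x) w = 0"
    unfolding dd using sym[of w v "\<xi> i x"] sym[of v w "\<xi> i x"] sym[of "\<xi> i x" v w] by (simp add: field_simps)
  moreover have "frechet_derivative (?B w (\<xi> i x)) (at x) v = - frechet_derivative (?B (\<xi> i x) w) (at x) v"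
    unfolding dd by (simp add: field_simps)
  ultimately show "frechet_derivative (\<lambda>y. ext_d \<alpha> i y v w) (at x) (\<xi> i x)
      + ext_d \<alpha> i x (frechet_derivative (\<xi> i) (at x) v) w + ext_d \<alpha> i x v (frechet_derivative (\<xi> i) (at x) w) = 0"
    using 1[of w v] 1[of v w] ext_d_antisym[OF i, of v "frechet_derivative (\<xi> i) (at x) w"] by simp
qed

text \<open>The Euler field \<open>r \<partial>\<^sub>r\<close> preserves the complex structure of the cone, hence so does its image
  \<open>- \<xi>\<close> under it: this is the vanishing of the Nijenhuis tensor on \<open>r \<partial>\<^sub>r\<close> and \<open>w\<close>.\<close>

lemma lie_T:
  assumes i: "i \<in> I" "x \<in> cimg M i"
  shows "frechet_derivative (\<lambda>y. T i y w) (at x) (\<xi> i x)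
    = frechet_derivative (\<xi> i) (at x) (T i x w) - T i x (frechet_derivative (\<xi> i) (at x) w)"
proof -
  let ?W = "cimg M i \<times> {0::real<..}" and ?c = "(x, 1::real)"
  \<comment> \<open>X is the Euler field and Y the constant horizontal field w; the identity is
    evaluated at r = 1.\<close>
  let ?X = "\<lambda>y :: 'e \<times> real. (0 :: 'e, snd y)" and ?Y = "\<lambda>y :: 'e \<times> real. (w, 0 :: real)"
  have W: "open ?W" "?c \<in> ?W" using open_cimg[OF i(1)] i(2) by (auto intro: open_Times)
  have DX: "(?X has_derivative (\<lambda>h. (0, snd h))) (at ?c)" by (auto intro!: derivative_eq_intros)
  have DY: "(?Y has_derivative (\<lambda>h. (0, 0))) (at ?c)" unfolding zero_prod_def[symmetric] by simp
  have f: "((\<lambda>y. f (fst y)) has_derivative (\<lambda>h. frechet_derivative f (at x) (fst h))) (at ?c)"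
    if "smooth_on (cimg M i) f" for f :: "'e \<Rightarrow> 'z::real_normed_vector"
    by (rule has_derivative_chain[OF smooth_on_has_derivative[OF that i(2)]]) (auto intro!: derivative_eq_intros)
  have "((\<lambda>y. (- \<xi> i (fst y), 0 :: real)) has_derivative (\<lambda>h. (- frechet_derivative (\<xi> i) (at x) (fst h), 0))) (at ?c)"
    by (intro has_derivative_Pair has_derivative_minus f \<xi>_smooth i has_derivative_const)
  \<comment> \<open>J maps (0, r) to (-\<xi>, 0), which does not depend on r, so only the derivative
    of \<xi> remains.\<close>
  then have DJX: "((\<lambda>y. J i y (?X y)) has_derivative (\<lambda>h. (- frechet_derivative (\<xi> i) (at x) (fst h), 0))) (at ?c)"
    by (rule has_derivative_transform_within_open[OF _ W])
      (use i linear_0[OF T_linear] linear_0[OF \<alpha>_linear] in \<open>auto simp: J_eq\<close>)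
  have "((\<lambda>y. (T i (fst y) w, snd y * \<alpha> i (fst y) w)) has_derivative
      (\<lambda>h. (frechet_derivative (\<lambda>y. T i y w) (at x) (fst h),
        1 * frechet_derivative (\<lambda>y. \<alpha> i y w) (at x) (fst h) + snd h * \<alpha> i x w))) (at ?c)"
    using has_derivative_mult[OF has_derivative_snd[OF has_derivative_ident] f[OF \<alpha>_smooth[OF i(1), of w]]]
    by (intro has_derivative_Pair f T_smooth i) simp
  then have DJY: "((\<lambda>y. J i y (?Y y)) has_derivative
      (\<lambda>h. (frechet_derivative (\<lambda>y. T i y w) (at x) (fst h),
        1 * frechet_derivative (\<lambda>y. \<alpha> i y w) (at x) (fst h) + snd h * \<alpha> i x w))) (at ?c)"
    by (rule has_derivative_transform_within_open[OF _ W]) (use i in \<open>auto simp: J_eq\<close>)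
  note fd = frechet_derivative_at[OF DX, symmetric] frechet_derivative_at[OF DY, symmetric]
    frechet_derivative_at[OF DJX, symmetric] frechet_derivative_at[OF DJY, symmetric]
  have "smooth_on ?W ?X" "smooth_on ?W ?Y"
    using smooth_on_Pair[OF W(1) smooth_on_const smooth_on_bounded_linear[OF bounded_linear_snd]]
    by (auto intro: smooth_on_const)
  then have "lie_bracket (\<lambda>y. J i y (?X y)) (\<lambda>y. J i y (?Y y)) ?c
      - J i ?c (lie_bracket (\<lambda>y. J i y (?X y)) ?Y ?c)
      - J i ?c (lie_bracket ?X (\<lambda>y. J i y (?Y y)) ?c) - lie_bracket ?X ?Y ?c = 0"
    using J(1) W i unfolding integrable_complex_structure_def cimg_cone index_cone by blast
  moreover have "J i ?c (?X ?c) = (- \<xi> i x, 0)" "J i ?c (?Y ?c) = (T i x w, \<alpha> i x w)"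
    using J_eq[OF i, of 1] linear_0[OF T_linear[OF i]] linear_0[OF \<alpha>_linear[OF i]] by auto
  moreover note DT = smooth_on_linear_frechet_derivative[OF T_smooth[OF i(1)] i(2), of w]
    and D\<alpha> = smooth_on_linear_frechet_derivative[OF \<alpha>_smooth[OF i(1)] i(2), of w]
  moreover have "frechet_derivative (\<lambda>y. T i y w) (at x) 0 = 0" "frechet_derivative (\<lambda>y. \<alpha> i y w) (at x) 0 = 0"
    using linear_0[OF DT] linear_0[OF D\<alpha>] by auto
  \<comment> \<open>The horizontal component of the Nijenhuis identity carries the Lie derivative of
    T.\<close>
  ultimately have "fst ((frechet_derivative (\<lambda>y. T i y w) (at x) (- \<xi> i x) + frechet_derivative (\<xi> i) (at x) (T i x w), 0::real)
      - J i ?c (frechet_derivative (\<xi> i) (at x) w, 0) - J i ?c 0) = 0"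
    unfolding lie_bracket_def fd by (simp add: prod_eq_iff)
  then show ?thesis
    using J_eq[OF i, of 1 "frechet_derivative (\<xi> i) (at x) w" 0] linear_0[OF J_linear[OF i, of 1]]
      linear_neg[OF DT]
    by (simp add: algebra_simps)
qed

text \<open>\<nu>(v, w) = -d\<alpha>(v, T w) is built from two tensors that \<xi> preserves; the
  product rule combines \<open>lie_ext_d\<close> with \<open>lie_T\<close>.\<close>

lemma lie_\<nu>:
  assumes i: "i \<in> I" "x \<in> cimg M i"
  shows "frechet_derivative (\<lambda>y. \<nu> i y v w) (at x) (\<xi> i x) + \<nu> i x (frechet_derivative (\<xi> i) (at x) v) w
    + \<nu> i x v (frechet_derivative (\<xi> i) (at x) w) = 0"
proof -
  note o = open_cimg[OF i(1)]
  have lin: "linear (ext_d \<alpha> i y v)" if "y \<in> cimg M i" for y v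
  proof -
    have "linear (\<lambda>w. - ext_d \<alpha> i y w v)"
      using g_bilinear[OF i(1) that]
      by (intro linearI) (simp_all add: g_T[OF i(1) that, symmetric] bilinear_ladd bilinear_lmul)
    moreover have "(\<lambda>w. - ext_d \<alpha> i y w v) = ext_d \<alpha> i y v"
      by (rule ext) (rule ext_d_antisym[OF i(1) that, symmetric])
    ultimately show ?thesis by simp
  qed
  have "((\<lambda>y. ext_d \<alpha> i y v (T i y w)) has_derivative (\<lambda>h. frechet_derivative (\<lambda>y. ext_d \<alpha> i y v (T i x w)) (at x) h
      + ext_d \<alpha> i x v (frechet_derivative (\<lambda>y. T i y w) (at x) h))) (at x)"
    by (rule has_derivative_linear_family[of "cimg M i" x "\<lambda>y. ext_d \<alpha> i y v", OF o i(2) lin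
          smooth_on_has_derivative[OF ext_d_smooth[OF i(1)] i(2)] smooth_on_has_derivative[OF T_smooth[OF i(1)] i(2)]])
  from has_derivative_minus[OF this]
  have "((\<lambda>y. \<nu> i y v w) has_derivative (\<lambda>h. - (frechet_derivative (\<lambda>y. ext_d \<alpha> i y v (T i x w)) (at x) h
      + ext_d \<alpha> i x v (frechet_derivative (\<lambda>y. T i y w) (at x) h)))) (at x)"
    by (rule has_derivative_transform_within_open[OF _ o i(2)]) (simp add: ext_d_T[OF i(1)])
  from frechet_derivative_at[OF this, symmetric]
  have "frechet_derivative (\<lambda>y. \<nu> i y v w) (at x) (\<xi> i x) = - (frechet_derivative (\<lambda>y. ext_d \<alpha> i y v (T i x w)) (at x) (\<xi> i x)
      + ext_d \<alpha> i x v (frechet_derivative (\<lambda>y. T i y w) (at x) (\<xi> i x)))" by simp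
  then show ?thesis
    using lie_ext_d[OF i, of v "T i x w"] ext_d_T[OF i] linear_diff[OF lin[OF i(2)]] by (simp add: lie_T[OF i])
qed

theorem reeb_pair_sasakian: "reeb_pair \<xi> \<alpha> \<nu>"
  unfolding reeb_pair_def lie_form_def lie_bilinear_def
  using vector_field_\<xi> \<alpha>_form \<nu>_field lie_\<alpha> lie_\<nu> \<alpha>_\<xi> \<nu>_\<xi> by auto

end

section \<open>Cosets and the underlying flow\<close>

lemma mem_coset_of: "u \<in> coset_of L v \<longleftrightarrow> u - v \<in> L"
  unfolding coset_of_def by (auto simp: image_iff) (metis add_diff_cancel_left' diff_add_cancel add.commute)

lemma coset_of_eq_iff:
  assumes "subspace L" shows "coset_of L v = coset_of L w \<longleftrightarrow> v - w \<in> L"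
proof
  assume "coset_of L v = coset_of L w"
  then show "v - w \<in> L" using mem_coset_of[of v L v] mem_coset_of[of v L w] subspace_0[OF assms] by simp
next
  assume vw: "v - w \<in> L"
  have "u - v \<in> L \<longleftrightarrow> u - w \<in> L" for u
    using subspace_add[OF assms vw, of "u - v"] subspace_diff[OF assms _ vw, of "u - w"] by (auto simp: algebra_simps)
  then show "coset_of L v = coset_of L w" by (auto simp: mem_coset_of)
qed

lemma image_coset_of: "linear D \<Longrightarrow> D ` coset_of L v = coset_of (D ` L) (D v)"
  unfolding coset_of_def image_image by (simp add: linear_add)

context sasakian
begin

abbreviation "L i x \<equiv> span {\<xi> i x}"

context
  fixes i x assumes i: "i \<in> I" "x \<in> cimg M i"
begin

lemma reeb_line_eq: "reeb_line \<alpha> i x = L i x"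
  unfolding reeb_line_def reeb_field_eq[OF i] ..

lemma horizontal_lift_coset: "horizontal_lift \<alpha> i x (coset_of (L i x) v) = v - \<alpha> i x v *\<^sub>R \<xi> i x"
  unfolding horizontal_lift_def
proof (rule the_equality)
  note l = \<alpha>_linear[OF i]
  show "v - \<alpha> i x v *\<^sub>R \<xi> i x \<in> coset_of (L i x) v \<and> \<alpha> i x (v - \<alpha> i x v *\<^sub>R \<xi> i x) = 0"
    by (auto simp: mem_coset_of linear_diff[OF l] linear_scale[OF l] \<alpha>_\<xi>[OF i] intro: span_neg span_scale span_base)
  fix u assume u: "u \<in> coset_of (L i x) v \<and> \<alpha> i x u = 0"
  then obtain c where c: "u - v = c *\<^sub>R \<xi> i x" by (auto simp: mem_coset_of span_singleton)
  then have "\<alpha> i x (u - v) = c" by (simp add: linear_scale[OF l] \<alpha>_\<xi>[OF i])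
  then have "c = - \<alpha> i x v" using u by (simp add: linear_diff[OF l])
  then show "u = v - \<alpha> i x v *\<^sub>R \<xi> i x" using c by (simp add: algebra_simps)
qed

text \<open>Removing the \<xi>-parts of v and w from g subtracts exactly \<alpha>(v) \<alpha>(w), as
  g(\<xi>, v) = \<alpha>(v) and g(\<xi>, \<xi>) = 1.\<close>

lemma induced_metric_coset: "induced_metric g \<alpha> i x (coset_of (L i x) v) (coset_of (L i x) w) = \<nu> i x v w"
  unfolding induced_metric_def horizontal_lift_coset
  using g_\<xi>[OF i] g_sym[OF i, of "\<xi> i x"] \<alpha>_\<xi>[OF i]
  by (simp add: linear_diff[OF \<alpha>_linear[OF i]] linear_scale[OF \<alpha>_linear[OF i]] bilinear_lsub[OF g_bilinear[OF i]] bilinear_rsub[OF g_bilinear[OF i]]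
      bilinear_lmul[OF g_bilinear[OF i]] bilinear_rmul[OF g_bilinear[OF i]] \<nu>_def)

text \<open>T satisfies the defining relation of the transverse complex structure, and two solutions
  differ by a vector in the kernel of \<nu>, that is, along \<xi>.\<close>

lemma trans_J_coset: "trans_J (underlying_flow g \<alpha>) i x (coset_of (L i x) w) = coset_of (L i x) (T i x w)"
  unfolding underlying_flow_def transverse_flow.simps reeb_line_eq
proof (rule the_equality)
  show "coset_of (L i x) (T i x w) \<in> range (coset_of (L i x)) \<and>
    (\<forall>v. \<forall>w'\<in>coset_of (L i x) w. ext_d \<alpha> i x v w' = induced_metric g \<alpha> i x (coset_of (L i x) v) (coset_of (L i x) (T i x w)))"
  proof (intro conjI allI ballI rangeI)
    fix v w' assume "w' \<in> coset_of (L i x) w"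
    then obtain c where "w' = w + c *\<^sub>R \<xi> i x" by (auto simp: mem_coset_of span_singleton) (metis diff_add_cancel add.commute)
    then have "ext_d \<alpha> i x v w' = ext_d \<alpha> i x v w"
      using g_T[OF i, of v] linear_add[OF T_linear[OF i]] linear_scale[OF T_linear[OF i]] T_\<xi>[OF i] by (metis add.right_neutral scaleR_zero_right)
    then show "ext_d \<alpha> i x v w' = induced_metric g \<alpha> i x (coset_of (L i x) v) (coset_of (L i x) (T i x w))"
      by (simp add: induced_metric_coset \<nu>_T[OF i])
  qed
  fix R assume R: "R \<in> range (coset_of (L i x)) \<and>
    (\<forall>v. \<forall>w'\<in>coset_of (L i x) w. ext_d \<alpha> i x v w' = induced_metric g \<alpha> i x (coset_of (L i x) v) R)"
  then obtain u where u: "R = coset_of (L i x) u" by auto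
  have "w \<in> coset_of (L i x) w" by (simp add: mem_coset_of span_zero)
  then have "\<nu> i x v u = \<nu> i x v (T i x w)" for v
    using R by (auto simp: u induced_metric_coset \<nu>_T[OF i])
  then have "\<nu> i x v (u - T i x w) = 0" for v by (simp add: bilinear_rsub[OF \<nu>_bilinear[OF i]])
  then have "u - T i x w = \<alpha> i x (u - T i x w) *\<^sub>R \<xi> i x" by (rule \<nu>_nondegenerate[OF i])
  then have "u - T i x w \<in> L i x" by (metis span_scale span_base singletonI)
  then show "R = coset_of (L i x) (T i x w)" by (simp add: u coset_of_eq_iff)
qed

end

end

section \<open>Two Sasakian metrics with isomorphic flows\<close>

lemma (in smooth_mfd) tangent_map_inverse:
  assumes F: "smooth_self_map M F" and H: "smooth_self_map M H" and HF: "\<And>p. p \<in> topspace X \<Longrightarrow> H (F p) = p"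
    and ij: "in_charts M F i j p"
  shows "in_charts M H j i (F p)" "tangent_map M H j i (F p) (tangent_map M F i j p v) = v"
proof -
  note i = in_chartsD[OF ij]
  show ji: "in_charts M H j i (F p)" using i HF[OF i(5)] by (simp add: in_charts_def)
  have "tangent_map M (\<lambda>p. H (F p)) i i p = (\<lambda>v. v)"
    by (rule tangent_map_unique[OF open_cimg[OF i(1)] i(6), where g = "\<lambda>x. x"])
      (auto simp: local_rep_apply HF emb_in_topspace[OF i(1)])
  then show "tangent_map M H j i (F p) (tangent_map M F i j p v) = v"
    using tangent_map_compose[OF F H ij ji, of v] by simp
qed

locale sasakian_pair = smooth_mfd M + S1: sasakian M g1 \<alpha>1 + S2: sasakian M g2 \<alpha>2
  for M :: "('a, 'i, 'e::euclidean_space) atlas_space" and g1 \<alpha>1 g2 \<alpha>2 +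
  fixes F H
  assumes F: "smooth_self_map M F" and H: "smooth_self_map M H"
    and HF: "\<And>p. p \<in> topspace X \<Longrightarrow> H (F p) = p" and FH: "\<And>p. p \<in> topspace X \<Longrightarrow> F (H p) = p"
    and carries: "carries_flow M F (underlying_flow g1 \<alpha>1) (underlying_flow g2 \<alpha>2)"
begin

context
  fixes i j p assumes ij: "in_charts M F i j p"
begin

text \<open>For the last claim, d\<alpha>(v, w) = \<nu>(v, T w) reduces it to the metric and the
  complex structure. With D the tangent map, T D w for the second metric and D T w for the first
  agree only modulo the second Reeb field, which the second \<nu> annihilates.\<close>

lemma tangent_F:
  defines "D \<equiv> tangent_map M F i j p" and "x \<equiv> chart M i p" and "y \<equiv> chart M j (F p)"
  shows tangent_F_line: "D ` S1.L i x = S2.L j y"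
    and tangent_F_\<nu>: "S2.\<nu> j y (D v) (D w) = S1.\<nu> i x v w"
    and tangent_F_ext_d: "ext_d \<alpha>2 j y (D v) (D w) = ext_d \<alpha>1 i x v w"
proof -
  note ii = in_chartsD[OF ij]
  have i: "i \<in> I" "x \<in> cimg M i" and j: "j \<in> I" "y \<in> cimg M j" using ii by (auto simp: x_def y_def)
  have Dl: "linear D" unfolding D_def by (rule linear_tangent_map[OF F ij])
  have tl: "tangent_line (underlying_flow g1 \<alpha>1) i x = S1.L i x" "tangent_line (underlying_flow g2 \<alpha>2) j y = S2.L j y"
    unfolding underlying_flow_def transverse_flow.simps S1.reeb_line_eq[OF i] S2.reeb_line_eq[OF j] by auto
  have C: "D ` S1.L i x = S2.L j y \<and>
    (\<forall>Q\<in>range (coset_of (S1.L i x)). trans_J (underlying_flow g2 \<alpha>2) j y (D ` Q) = D ` trans_J (underlying_flow g1 \<alpha>1) i x Q) \<and>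
    (\<forall>Q\<in>range (coset_of (S1.L i x)). \<forall>R\<in>range (coset_of (S1.L i x)).
       trans_metric (underlying_flow g2 \<alpha>2) j y (D ` Q) (D ` R) = trans_metric (underlying_flow g1 \<alpha>1) i x Q R)"
    using carries[unfolded carries_flow_def Let_def, rule_format, OF ij]
    unfolding normal_space_def D_def[symmetric] x_def[symmetric] y_def[symmetric] tl .
  show line: "D ` S1.L i x = S2.L j y" using C by blast
  have co: "D ` coset_of (S1.L i x) v = coset_of (S2.L j y) (D v)" for v
    unfolding image_coset_of[OF Dl] line ..
  have tm: "trans_metric (underlying_flow g \<alpha>) = induced_metric g \<alpha>" for g \<alpha> by (simp add: underlying_flow_def)
  have \<nu>: "S2.\<nu> j y (D v) (D w) = S1.\<nu> i x v w" for v w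
    using C unfolding tm by (metis rangeI co S1.induced_metric_coset[OF i] S2.induced_metric_coset[OF j])
  then show "S2.\<nu> j y (D v) (D w) = S1.\<nu> i x v w" .
  have "coset_of (S2.L j y) (S2.T j y (D w)) = coset_of (S2.L j y) (D (S1.T i x w))"
    using C by (metis rangeI co S1.trans_J_coset[OF i] S2.trans_J_coset[OF j])
  then have "S2.T j y (D w) - D (S1.T i x w) \<in> S2.L j y" by (simp add: coset_of_eq_iff)
  then obtain c where "S2.T j y (D w) - D (S1.T i x w) = c *\<^sub>R S2.\<xi> j y" by (auto simp: span_singleton)
  then have "S2.T j y (D w) = D (S1.T i x w) + c *\<^sub>R S2.\<xi> j y" by (simp add: algebra_simps)
  then have "ext_d \<alpha>2 j y (D v) (D w) = S2.\<nu> j y (D v) (D (S1.T i x w))"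
    using S2.\<nu>_T[OF j, of "D v" "D w"] S2.\<nu>_\<xi>(1)[OF j]
    by (simp add: bilinear_radd[OF S2.\<nu>_bilinear[OF j]] bilinear_rmul[OF S2.\<nu>_bilinear[OF j]])
  then show "ext_d \<alpha>2 j y (D v) (D w) = ext_d \<alpha>1 i x v w" using \<nu> S1.\<nu>_T[OF i] by simp
qed

end

lemma tangent_F_\<xi>:
  assumes ij: "in_charts M F i j p"
  shows "\<exists>c. tangent_map M F i j p (S1.\<xi> i (chart M i p)) = c *\<^sub>R S2.\<xi> j (chart M j (F p))"
proof -
  have "tangent_map M F i j p (S1.\<xi> i (chart M i p)) \<in> S2.L j (chart M j (F p))"
    unfolding tangent_F_line[OF ij, symmetric] by (intro imageI span_base) simp
  then show ?thesis by (auto simp: span_singleton)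
qed

lemma tangent_H_\<xi>:
  assumes ji: "in_charts M H j i q"
  shows "\<exists>c. tangent_map M H j i q (S2.\<xi> j (chart M j q)) = c *\<^sub>R S1.\<xi> i (chart M i (H q))"
proof -
  have FHq: "F (H q) = q" using FH in_chartsD(5)[OF ji] by blast
  then have ij: "in_charts M F i j (H q)" using ji by (simp add: in_charts_def)
  have "S2.\<xi> j (chart M j q) \<in> tangent_map M F i j (H q) ` S1.L i (chart M i (H q))"
    using tangent_F_line[OF ij] FHq by (simp add: span_base)
  then obtain c where "S2.\<xi> j (chart M j q) = tangent_map M F i j (H q) (c *\<^sub>R S1.\<xi> i (chart M i (H q)))"
    by (auto simp: span_singleton)
  then show ?thesis using tangent_map_inverse(2)[OF F H HF ij] FHq by metis
qed

text \<open>The pullback of \<alpha>2 under F, computed in a chosen target chart;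
  \<open>\<beta>_pull\<close> shows that the choice is immaterial.\<close>

definition \<beta> :: "('i, 'e) one_form" where
  "\<beta> i x v = (let j = SOME j. j \<in> I \<and> F (emb i x) \<in> cdom M j in
     \<alpha>2 j (chart M j (F (emb i x))) (tangent_map M F i j (emb i x) v))"

lemma \<beta>_pull: "pulls_back_form M F \<alpha>2 \<beta>"
  unfolding pulls_back_form_def
proof (intro allI impI)
  fix i j p v assume ij: "in_charts M F i j p"
  note ii = in_chartsD[OF ij]
  define k where "k = (SOME j. j \<in> I \<and> F p \<in> cdom M j)"
  have "k \<in> I \<and> F p \<in> cdom M k" unfolding k_def by (rule someI_ex) (use ii in blast)
  then have kj: "in_charts M id k j (F p)" and ik: "in_charts M F i k p" using ii by (auto simp: in_charts_def)
  have "\<beta> i (chart M i p) v = \<alpha>2 k (chart M k (F p)) (tangent_map M F i k p v)"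
    unfolding \<beta>_def k_def using ii by (simp add: Let_def)
  also have "\<dots> = \<alpha>2 j (chart M j (F p)) (tangent_map M id k j (F p) (tangent_map M F i k p v))"
    using smooth_one_formD(3)[OF S2.\<alpha>_form] kj by (simp add: pulls_back_form_def)
  also have "tangent_map M id k j (F p) (tangent_map M F i k p v) = tangent_map M F i j p v"
    using tangent_map_compose[OF F smooth_self_map_id ik, of j v] kj by simp
  finally show "\<alpha>2 j (chart M j (F p)) (tangent_map M F i j p v) = \<beta> i (chart M i p) v" by simp
qed

text \<open>Near x one target chart serves all points, which gives a formula that can be
  differentiated.\<close>

lemma \<beta>_local:
  assumes i: "i \<in> I" "x \<in> cimg M i" and j: "j \<in> I" "F (emb i x) \<in> cdom M j"
  shows "x \<in> rdom F i j" "linear (\<beta> i x)"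
    "\<And>y v. y \<in> rdom F i j \<Longrightarrow> \<beta> i y v = \<alpha>2 j (local_rep M F i j y) (frechet_derivative (local_rep M F i j) (at y) v)"
    "local_rep M F i j ` rdom F i j \<subseteq> cimg M j"
proof -
  show x: "x \<in> rdom F i j" using i j by (simp add: rdom_iff)
  show eq: "\<beta> i y v = \<alpha>2 j (local_rep M F i j y) (frechet_derivative (local_rep M F i j) (at y) v)"
    if "y \<in> rdom F i j" for y v
  proof -
    have "in_charts M F i j (emb i y)" "y \<in> cimg M i" using that i j emb_in by (auto simp: rdom_iff in_charts_def)
    then show ?thesis
      using \<beta>_pull[unfolded pulls_back_form_def, rule_format, of i j "emb i y" v]
      by (simp add: tangent_map_def local_rep_apply)
  qed
  show im: "local_rep M F i j ` rdom F i j \<subseteq> cimg M j"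
    using i j by (auto simp: rdom_iff local_rep_apply chart_in)
  have "linear (\<lambda>v. \<alpha>2 j (local_rep M F i j x) (frechet_derivative (local_rep M F i j) (at x) v))"
    using linear_compose[OF smooth_on_linear_frechet_derivative[OF smooth_local_rep(2)[OF F i(1) j(1)] x]
        S2.\<alpha>_linear[OF j(1), of "local_rep M F i j x"]] im x by (auto simp: o_def)
  moreover have "\<beta> i x = (\<lambda>v. \<alpha>2 j (local_rep M F i j x) (frechet_derivative (local_rep M F i j) (at x) v))"
    using eq[OF x] by (rule ext)
  ultimately show "linear (\<beta> i x)" by simp
qed

lemma \<beta>_form: "smooth_one_form M \<beta>"
  unfolding smooth_one_form_def
proof (intro conjI ballI allI)
  fix i assume i: "i \<in> I"
  have ex: "\<exists>j\<in>I. F (emb i x) \<in> cdom M j" if "x \<in> cimg M i" for x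
    by (rule cover[OF smooth_self_map_maps[OF F emb_in_topspace[OF i that]]])
  show "linear (\<beta> i x)" if "x \<in> cimg M i" for x using ex[OF that] \<beta>_local(2)[OF i that] by blast
  show "smooth_on (cimg M i) (\<lambda>x. \<beta> i x v)" for v
  proof (rule smooth_on_local)
    fix x assume x: "x \<in> cimg M i"
    obtain j where j: "j \<in> I" "F (emb i x) \<in> cdom M j" using ex[OF x] by blast
    note l = \<beta>_local[OF i x j] and s = smooth_local_rep[OF F i j(1)]
    have "smooth_on (rdom F i j) (\<lambda>y. \<alpha>2 j (local_rep M F i j y) (frechet_derivative (local_rep M F i j) (at y) v))"
    proof (rule smooth_on_linear_family[OF s(1), where A = "\<lambda>y. \<alpha>2 j (local_rep M F i j y)"
          and V = "\<lambda>y. frechet_derivative (local_rep M F i j) (at y) v"])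
      show "smooth_on (rdom F i j) (\<lambda>y. \<alpha>2 j (local_rep M F i j y) w)" for w
        by (rule smooth_on_compose[OF s(1) open_cimg[OF j(1)] S2.\<alpha>_smooth[OF j(1)] s(2) l(4)])
      show "linear (\<alpha>2 j (local_rep M F i j y))" if "y \<in> rdom F i j" for y
        by (rule S2.\<alpha>_linear[OF j(1)]) (use l(4) that in blast)
    qed (rule smooth_on_frechet_derivative[OF s(2)])
    then have "smooth_on (rdom F i j) (\<lambda>y. \<beta> i y v)" by (rule smooth_on_cong[OF s(1), rotated]) (simp add: l(3))
    then show "\<exists>T. open T \<and> x \<in> T \<and> smooth_on T (\<lambda>x. \<beta> i x v)" using s(1) l(1) by blast
  qed
next
  show "pulls_back_form M id \<beta> \<beta>"
    unfolding pulls_back_form_def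
  proof (intro allI impI)
    fix i k p v assume ik: "in_charts M id i k p"
    note ii = in_chartsD[OF ik]
    obtain j where j: "j \<in> I" "F p \<in> cdom M j" using cover[OF smooth_self_map_maps[OF F ii(5)]] by blast
    have ij: "in_charts M F i j p" and kj: "in_charts M F k j p" using ii j by (auto simp: in_charts_def)
    have "tangent_map M F i j p v = tangent_map M F k j p (tangent_map M id i k p v)"
      using tangent_map_compose[OF smooth_self_map_id F ik, of j v] kj by simp
    then show "\<beta> k (chart M k (id p)) (tangent_map M id i k p v) = \<beta> i (chart M i p) v"
      using \<beta>_pull[unfolded pulls_back_form_def, rule_format, OF ij, of v]
        \<beta>_pull[unfolded pulls_back_form_def, rule_format, OF kj, of "tangent_map M id i k p v"] by simp
  qed
qed

text \<open>The exterior derivative commutes with pullback: the terms with second derivatives of F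
  are symmetric in v and w and cancel. Then \<open>tangent_F_ext_d\<close> applies.\<close>

lemma ext_d_\<beta>:
  assumes i: "i \<in> I" "x \<in> cimg M i"
  shows "ext_d \<beta> i x v w = ext_d \<alpha>1 i x v w"
proof -
  have p: "emb i x \<in> topspace X" by (rule emb_in_topspace[OF i])
  obtain j where j: "j \<in> I" "F (emb i x) \<in> cdom M j" using cover[OF smooth_self_map_maps[OF F p]] by blast
  note l = \<beta>_local[OF i j] and s = smooth_local_rep[OF F i(1) j(1)]
  let ?f = "local_rep M F i j"
  let ?D = "frechet_derivative ?f (at x)"
  have y: "?f x \<in> cimg M j" using l by blast
  have Df: "(?f has_derivative ?D) (at x)" by (rule smooth_on_has_derivative[OF s(2) l(1)])
  have D\<beta>: "frechet_derivative (\<lambda>y. \<beta> i y w) (at x) v = frechet_derivative (\<lambda>z. \<alpha>2 j z (?D w)) (at (?f x)) (?D v)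
      + \<alpha>2 j (?f x) (frechet_derivative (\<lambda>y. frechet_derivative ?f (at y) w) (at x) v)" for v w
  proof -
    have "((\<lambda>y. \<alpha>2 j (?f y) (frechet_derivative ?f (at y) w)) has_derivative
      (\<lambda>h. frechet_derivative (\<lambda>z. \<alpha>2 j z (?D w)) (at (?f x)) (?D h)
        + \<alpha>2 j (?f x) (frechet_derivative (\<lambda>y. frechet_derivative ?f (at y) w) (at x) h))) (at x)"
    proof (rule has_derivative_linear_family[of "rdom F i j" x "\<lambda>y. \<alpha>2 j (?f y)", OF s(1) l(1)])
      show "linear (\<alpha>2 j (?f y))" if "y \<in> rdom F i j" for y
        by (rule S2.\<alpha>_linear[OF j(1)]) (use l(4) that in blast)
      show "((\<lambda>y. \<alpha>2 j (?f y) u) has_derivative (\<lambda>h. frechet_derivative (\<lambda>z. \<alpha>2 j z u) (at (?f x)) (?D h))) (at x)" for u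
        by (rule has_derivative_chain[OF S2.\<alpha>_has_derivative[OF j(1) y] refl Df])
      show "((\<lambda>y. frechet_derivative ?f (at y) w) has_derivative
          frechet_derivative (\<lambda>y. frechet_derivative ?f (at y) w) (at x)) (at x)"
        by (rule smooth_on_has_derivative[OF smooth_on_frechet_derivative[OF s(2)] l(1)])
    qed
    then have "((\<lambda>y. \<beta> i y w) has_derivative
      (\<lambda>h. frechet_derivative (\<lambda>z. \<alpha>2 j z (?D w)) (at (?f x)) (?D h)
        + \<alpha>2 j (?f x) (frechet_derivative (\<lambda>y. frechet_derivative ?f (at y) w) (at x) h))) (at x)"
      by (rule has_derivative_transform_within_open[OF _ s(1) l(1)]) (simp add: l(3))
    from fun_cong[OF frechet_derivative_at[OF this, symmetric]] show ?thesis .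
  qed
  have ij: "in_charts M F i j (emb i x)" using i j emb_in by (simp add: in_charts_def)
  have "ext_d \<beta> i x v w = ext_d \<alpha>2 j (?f x) (?D v) (?D w)"
    unfolding ext_d_def D\<beta> using symmetric_second_derivative[OF s l(1), of v w] by simp
  also have "\<dots> = ext_d \<alpha>1 i x v w"
    using tangent_F_ext_d[OF ij, of v w] i(2) by (simp add: tangent_map_def local_rep_apply)
  finally show ?thesis .
qed

lemma \<beta>_exact:
  assumes "betti_number 1 X = 0"
  obtains h where "smooth_fun h" "\<And>i x v. i \<in> I \<Longrightarrow> x \<in> cimg M i \<Longrightarrow> \<beta> i x v = \<alpha>1 i x v + dfun h i x v"
proof -
  define \<gamma> where "\<gamma> i x v = \<beta> i x v - \<alpha>1 i x v" for i x v
  note b = smooth_one_formD[OF \<beta>_form]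
  have \<gamma>: "smooth_one_form M \<gamma>"
    unfolding smooth_one_form_def \<gamma>_def
  proof (intro conjI ballI allI)
    fix i assume i: "i \<in> I"
    show "linear (\<lambda>v. \<beta> i x v - \<alpha>1 i x v)" if "x \<in> cimg M i" for x
      by (rule linear_compose_sub[OF b(1)[OF i that] S1.\<alpha>_linear[OF i that]])
    show "smooth_on (cimg M i) (\<lambda>x. \<beta> i x v - \<alpha>1 i x v)" for v
      by (rule smooth_on_diff[OF open_cimg[OF i] b(2)[OF i] S1.\<alpha>_smooth[OF i]])
  next
    show "pulls_back_form M id (\<lambda>i x v. \<beta> i x v - \<alpha>1 i x v) (\<lambda>i x v. \<beta> i x v - \<alpha>1 i x v)"
      using b(3) smooth_one_formD(3)[OF S1.\<alpha>_form] by (simp add: pulls_back_form_def)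
  qed
  have closed: "frechet_derivative (\<lambda>y. \<gamma> i y w) (at x) v = frechet_derivative (\<lambda>y. \<gamma> i y v) (at x) w"
    if i: "i \<in> I" "x \<in> cimg M i" for i x v w
  proof -
    have D: "frechet_derivative (\<lambda>y. \<gamma> i y w) (at x) v
        = frechet_derivative (\<lambda>y. \<beta> i y w) (at x) v - frechet_derivative (\<lambda>y. \<alpha>1 i y w) (at x) v" for v w
      unfolding \<gamma>_def
      using fun_cong[OF frechet_derivative_at[OF has_derivative_diff[OF
          smooth_on_has_derivative[OF b(2)[OF i(1), of w] i(2)] S1.\<alpha>_has_derivative[OF i, of w]]], of v] by simp
    show ?thesis using ext_d_\<beta>[OF i, of v w] unfolding D ext_d_def by simp
  qed
  obtain h where "smooth_fun h" "\<And>i x. i \<in> I \<Longrightarrow> x \<in> cimg M i \<Longrightarrow> dfun h i x = \<gamma> i x"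
    using closed_one_form_exact[OF assms \<gamma> closed] by blast
  then show thesis by (intro that[of h]) (auto simp: \<gamma>_def)
qed

theorem sasakian_isomorphic_if_flow_isomorphic:
  assumes betti: "betti_number 1 X = 0" and cpt: "compact_space X"
  shows "sasakian_isomorphic M g1 \<alpha>1 g2 \<alpha>2"
proof -
  obtain h where h: "smooth_fun h" and \<beta>h: "\<And>i x v. i \<in> I \<Longrightarrow> x \<in> cimg M i \<Longrightarrow> \<beta> i x v = \<alpha>1 i x v + dfun h i x v"
    using \<beta>_exact[OF betti] by blast
  note R1 = S1.reeb_pair_sasakian and R2 = S2.reeb_pair_sasakian
  obtain \<epsilon>1 \<phi>1 where \<phi>1: "local_flow S1.\<xi> \<epsilon>1 \<phi>1" using local_flow_exists_compact[OF S1.vector_field_\<xi> cpt] by blast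
  obtain \<epsilon>2 \<phi>2 where \<phi>2: "local_flow S2.\<xi> \<epsilon>2 \<phi>2" using local_flow_exists_compact[OF S2.vector_field_\<xi> cpt] by blast
  have \<epsilon>: "0 < \<epsilon>1" "0 < \<epsilon>2" using \<phi>1 \<phi>2 by (auto simp: local_flow_def)
  obtain K where K: "0 < K" "\<And>p. p \<in> topspace X \<Longrightarrow> \<bar>h p\<bar> < K" using bounded_smooth_fun[OF h cpt] by blast
  \<comment> \<open>Makes both iterated flows last beyond 3 K, as
    \<open>long_flow_adjust_inverse\<close> demands for each direction of the inverse.\<close>
  obtain n :: nat where n': "3 * K / min \<epsilon>1 \<epsilon>2 < real n" using reals_Archimedean2 by blast
  have "0 < 3 * K / min \<epsilon>1 \<epsilon>2" using K \<epsilon> by simp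
  then have "0 < real n" using n' by linarith
  then have n: "0 < n" by simp
  have "3 * K < real n * min \<epsilon>1 \<epsilon>2" using n' \<epsilon> by (simp add: divide_less_eq)
  also have "\<dots> \<le> real n * \<epsilon>1" by (intro mult_left_mono) auto
  finally have K1: "3 * K \<le> real n * \<epsilon>1" by simp
  have "3 * K < real n * min \<epsilon>1 \<epsilon>2" using n' \<epsilon> by (simp add: divide_less_eq)
  also have "\<dots> \<le> real n * \<epsilon>2" by (intro mult_left_mono) auto
  finally have K2: "3 * K \<le> real n * \<epsilon>2" by simp
  \<comment> \<open>This is h transported by H to the target, so that H pulls \<alpha>1 back to
    \<alpha>2 - dk.\<close>
  define k where "k q = h (H q)" for q
  have k: "smooth_fun k" unfolding k_def by (rule smooth_fun_compose[OF h H])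
  have kK: "\<bar>k q\<bar> < K" if "q \<in> topspace X" for q
    unfolding k_def by (rule K(2)[OF smooth_self_map_maps[OF H that]])
  define f where "f p = long_flow \<phi>2 n (- h p) (F p)" for p
  define f' where "f' q = long_flow \<phi>1 n (k q) (H q)" for q
  note ids = smooth_one_formD(3)[OF \<beta>_form] smooth_one_formD(3)[OF S1.\<alpha>_form] smooth_one_formD(3)[OF S2.\<alpha>_form]
    smooth_bilinear_fieldD(3)[OF S1.\<nu>_field] smooth_bilinear_fieldD(3)[OF S2.\<nu>_field]

  have F\<nu>: "pulls_back_bilinear M F S2.\<nu> S1.\<nu>" using tangent_F_\<nu> by (simp add: pulls_back_bilinear_def)
  have mh: "smooth_fun (\<lambda>p. - h p)" and dmh: "i \<in> I \<Longrightarrow> x \<in> cimg M i \<Longrightarrow> dfun (\<lambda>p. - h p) i x v = - dfun h i x v" for i x v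
    using smooth_fun_cmul[OF h, of "- 1"] dfun_cmul[OF h, of i x "- 1" v] by auto
  have mhK: "\<bar>- h p\<bar> < real n * \<epsilon>2" if "p \<in> topspace X" for p using K(1) K(2)[OF that] K2 by simp
  note f = long_flow_pullback[OF R2 \<phi>2 n F mh mhK ids(1) \<beta>_pull ids(4) F\<nu>, folded f_def]
  \<comment> \<open>The shift by -h cancels the dh in \<beta> = \<alpha>1 + dh.\<close>
  have f\<alpha>: "pulls_back_form M f \<alpha>2 \<alpha>1"
    using f(2) unfolding pulls_back_form_def
    by (auto simp: \<beta>h dmh in_chartsD)

  have TFH: "in_charts M F i j (H q)" "tangent_map M F i j (H q) (tangent_map M H j i q v) = v" "F (H q) = q"
    if ji: "in_charts M H j i q" for i j q v
    using tangent_map_inverse[OF H F FH ji] FH in_chartsD(5)[OF ji] by auto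
  have H\<nu>: "pulls_back_bilinear M H S1.\<nu> S2.\<nu>"
    unfolding pulls_back_bilinear_def
  proof (intro allI impI)
    fix j i q v w assume ji: "in_charts M H j i q"
    show "S1.\<nu> i (chart M i (H q)) (tangent_map M H j i q v) (tangent_map M H j i q w) = S2.\<nu> j (chart M j q) v w"
      using tangent_F_\<nu>[OF TFH(1)[OF ji], of "tangent_map M H j i q v" "tangent_map M H j i q w"] TFH(2,3)[OF ji] by simp
  qed
  have H\<alpha>: "pulls_back_form M H \<alpha>1 (\<lambda>i x v. \<alpha>2 i x v - dfun k i x v)"
    unfolding pulls_back_form_def
  proof (intro allI impI)
    fix j i q v assume ji: "in_charts M H j i q"
    note ij = TFH(1)[OF ji]
    have "\<alpha>2 j (chart M j q) v = \<beta> i (chart M i (H q)) (tangent_map M H j i q v)"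
      using \<beta>_pull[unfolded pulls_back_form_def, rule_format, OF ij, of "tangent_map M H j i q v"] TFH(2,3)[OF ji] by simp
    also have "\<dots> = \<alpha>1 i (chart M i (H q)) (tangent_map M H j i q v) + dfun k j (chart M j q) v"
      using \<beta>h[of i "chart M i (H q)"] in_chartsD[OF ji] dfun_compose[OF h H ji, of v] by (simp add: k_def[abs_def])
    finally show "\<alpha>1 i (chart M i (H q)) (tangent_map M H j i q v) = \<alpha>2 j (chart M j q) v - dfun k j (chart M j q) v" by simp
  qed
  have idk: "pulls_back_form M id (\<lambda>i x v. \<alpha>2 i x v - dfun k i x v) (\<lambda>i x v. \<alpha>2 i x v - dfun k i x v)"
    using ids(3) pulls_back_dfun[OF k] by (simp add: pulls_back_form_def)
  have kK1: "\<bar>k q\<bar> < real n * \<epsilon>1" if "q \<in> topspace X" for q using K(1) kK[OF that] K1 by simp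
  note f' = long_flow_pullback[OF R1 \<phi>1 n H k kK1 idk H\<alpha> ids(5) H\<nu>, folded f'_def]

  have f'f: "f' (f p) = p" if p: "p \<in> topspace X" for p
  proof -
    have "long_flow \<phi>1 n (h (H (f p))) (H (f p)) = p"
    proof (rule long_flow_adjust_inverse[OF R1 R2 \<phi>1 \<phi>2 n H _ h K(2) K1 K2 _ tangent_H_\<xi> p])
      show "F p \<in> topspace X \<and> H (F p) = p" if "p \<in> topspace X" for p
        using that HF smooth_self_map_maps[OF F] by blast
    qed (use H\<alpha> in \<open>simp_all add: k_def[abs_def] f_def\<close>)
    then show ?thesis by (simp add: f'_def k_def)
  qed
  \<comment> \<open>The same lemma with the two metrics exchanged: the potential is now -k, and F
    pulls \<alpha>2 back to \<alpha>1 - d(-k o F), which is the form required there.\<close>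
  have ff': "f (f' q) = q" if q: "q \<in> topspace X" for q
  proof -
    have mk: "smooth_fun (\<lambda>p. - k p)" using smooth_fun_cmul[OF k, of "- 1"] by simp
    have dk: "dfun (\<lambda>p. - k (F p)) i x v = - dfun h i x v" if i: "i \<in> I" "x \<in> cimg M i" for i x v
    proof -
      have "dfun (\<lambda>p. - k (F p)) i x = dfun (\<lambda>p. - h p) i x"
        unfolding dfun_def
        by (rule frechet_derivative_cong_open[OF open_cimg[OF i(1)] i(2)])
          (simp add: k_def HF emb_in_topspace[OF i(1)])
      then show ?thesis using dmh[OF i] by simp
    qed
    have "long_flow \<phi>2 n (- k (F (f' q))) (F (f' q)) = q"
    proof (rule long_flow_adjust_inverse[OF R2 R1 \<phi>2 \<phi>1 n F _ mk _ K2 K1 _ tangent_F_\<xi> q])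
      show "H p \<in> topspace X \<and> F (H p) = p" if "p \<in> topspace X" for p
        using that FH smooth_self_map_maps[OF H] by blast
      show "pulls_back_form M F \<alpha>2 (\<lambda>i x v. \<alpha>1 i x v - dfun (\<lambda>p. - k (F p)) i x v)"
        using \<beta>_pull unfolding pulls_back_form_def by (auto simp: \<beta>h dk in_chartsD)
    qed (use kK in \<open>simp_all add: f'_def\<close>)
    moreover have "f' q \<in> topspace X" by (rule smooth_self_map_maps[OF f'(1) q])
    ultimately show ?thesis by (simp add: f_def k_def HF)
  qed
  have "diffeomorphism M f"
    unfolding diffeomorphism_def using f(1) f'(1) f'f ff' by blast
  \<comment> \<open>g is recovered as \<nu> + \<alpha> \<otimes> \<alpha>, and f pulls back both
    summands correctly.\<close>
  moreover have "pulls_back_bilinear M f g2 g1"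
    using f(3) f\<alpha> unfolding pulls_back_bilinear_def pulls_back_form_def S1.\<nu>_def S2.\<nu>_def by fastforce
  ultimately show ?thesis using f\<alpha> unfolding sasakian_isomorphic_def by blast
qed

end

theorem corollary1p7:
  fixes M :: "('a, 'i, 'e::euclidean_space) atlas_space"
    and g\<^sub>1 g\<^sub>2 :: "('i, 'e) bilinear_field"
    and \<alpha>\<^sub>1 \<alpha>\<^sub>2 :: "('i, 'e) one_form"
  assumes "closed_manifold M"
    and "betti_number 1 (mspace M) = 0"
    and "sasakian_metric M g\<^sub>1 \<alpha>\<^sub>1"
    and "sasakian_metric M g\<^sub>2 \<alpha>\<^sub>2"
    and "flow_isomorphic M (underlying_flow g\<^sub>1 \<alpha>\<^sub>1) (underlying_flow g\<^sub>2 \<alpha>\<^sub>2)"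
  shows "sasakian_isomorphic M g\<^sub>1 \<alpha>\<^sub>1 g\<^sub>2 \<alpha>\<^sub>2"
proof -
  obtain F H where "smooth_self_map M F" "smooth_self_map M H"
    "\<forall>p\<in>topspace (mspace M). H (F p) = p \<and> F (H p) = p"
    "carries_flow M F (underlying_flow g\<^sub>1 \<alpha>\<^sub>1) (underlying_flow g\<^sub>2 \<alpha>\<^sub>2)"
    using assms(5) unfolding flow_isomorphic_def diffeomorphism_def by blast
  then interpret sasakian_pair M g\<^sub>1 \<alpha>\<^sub>1 g\<^sub>2 \<alpha>\<^sub>2 F H
    using assms by unfold_locales (auto simp: closed_manifold_def)
  show ?thesis
    using assms by (intro sasakian_isomorphic_if_flow_isomorphic) (auto simp: closed_manifold_def)
qed

end
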